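(* Let $n,m\ge1$ be integers and let $G=\mathbb{Z}/n\mathbb{Z}\times\mathbb{Z}/m\mathbb{Z}$. Then there exists a metric group structure $\langle\cdot\rangle$ on $G$ and a finite quantum dilogarithm $E\colon G\to\mathbb{C}$ for the metric group $(G,\langle\cdot\rangle)$.
   Context: A metric group is a finite abelian group $G$ together with a function $\langle\cdot\rangle\colon G\to\mathbb{C}^\times$ such that $\langle x\rangle=\langle -x\rangle$ for all $x$ and $\langle x;y\rangle:=\dfrac{\langle x+y\rangle}{\langle x\rangle\langle y\rangle}$ is a non-degenerate bicharacter on $G$. Let $N=|G|$. A finite quantum dilogarithm for a metric group $G$ is a function $E\colon G\to\mathbb{C}$ such that for some non-zero constant $C\in\mathbb{C}^\times$ and all $x,y\in G$, $$\langle x;y\rangle E(x)E(y)=C+\frac1{\sqrt N}\sum_{z\in G}E(y-z)E(z)\langle z\rangle E(x-z),$$ and which, when $|G|\le4$, is in addition required to satisfy $E(0)^2=\sqrt{N}\,E(0)+1$. *)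

theory Defs
  imports "HOL-Algebra.Algebra" Complex_Main
begin

text \<open>
  Groups are written multiplicatively, as in \<^theory>\<open>HOL-Algebra.Group\<close>: the group operation
  \<open>x + y\<close> is \<open>x \<otimes> y\<close>, \<open>-x\<close> is \<open>inv x\<close>, and \<open>x - y\<close> is \<open>x \<otimes> inv y\<close>.
  Functions on a group are only constrained on its carrier.
\<close>

definition bicharacter :: "('a, 'b) monoid_scheme \<Rightarrow> ('a \<Rightarrow> 'a \<Rightarrow> complex) \<Rightarrow> bool" where
  "bicharacter G b \<longleftrightarrow>
     (\<forall>x\<in>carrier G. \<forall>y\<in>carrier G. b x y \<noteq> 0) \<and>
     (\<forall>x\<in>carrier G. \<forall>y\<in>carrier G. \<forall>z\<in>carrier G. b (x \<otimes>\<^bsub>G\<^esub> y) z = b x z * b y z) \<and>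
     (\<forall>x\<in>carrier G. \<forall>y\<in>carrier G. \<forall>z\<in>carrier G. b x (y \<otimes>\<^bsub>G\<^esub> z) = b x y * b x z)"

text \<open>Non-degeneracy is triviality of both the left and the right kernel; for a finite abelian group
  this says that both induced maps to the dual group are isomorphisms.\<close>

definition nondegenerate :: "('a, 'b) monoid_scheme \<Rightarrow> ('a \<Rightarrow> 'a \<Rightarrow> complex) \<Rightarrow> bool" where
  "nondegenerate G b \<longleftrightarrow>
     (\<forall>x\<in>carrier G. (\<forall>y\<in>carrier G. b x y = 1) \<longrightarrow> x = \<one>\<^bsub>G\<^esub>) \<and>
     (\<forall>y\<in>carrier G. (\<forall>x\<in>carrier G. b x y = 1) \<longrightarrow> y = \<one>\<^bsub>G\<^esub>)"

definition polarization ::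
    "('a, 'b) monoid_scheme \<Rightarrow> ('a \<Rightarrow> complex) \<Rightarrow> 'a \<Rightarrow> 'a \<Rightarrow> complex" where
  "polarization G q x y = q (x \<otimes>\<^bsub>G\<^esub> y) / (q x * q y)"

locale metric_group = comm_group G for G (structure) +
  fixes q :: "'a \<Rightarrow> complex"
  assumes finite_carrier: "finite (carrier G)"
    and nonzero: "x \<in> carrier G \<Longrightarrow> q x \<noteq> 0"
    and even: "x \<in> carrier G \<Longrightarrow> q (inv x) = q x"
    and bicharacter_polarization: "bicharacter G (polarization G q)"
    and nondegenerate_polarization: "nondegenerate G (polarization G q)"

text \<open>The normalisation at the neutral element is demanded only for groups of order at most 4.\<close>

definition finite_quantum_dilogarithm ::
    "('a, 'b) monoid_scheme \<Rightarrow> ('a \<Rightarrow> complex) \<Rightarrow> ('a \<Rightarrow> complex) \<Rightarrow> bool" where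
  "finite_quantum_dilogarithm G q E \<longleftrightarrow>
     (\<exists>C. C \<noteq> 0 \<and>
        (\<forall>x\<in>carrier G. \<forall>y\<in>carrier G.
           polarization G q x y * E x * E y =
             C + 1 / complex_of_real (sqrt (real (order G))) *
               (\<Sum>z\<in>carrier G.
                  E (y \<otimes>\<^bsub>G\<^esub> inv\<^bsub>G\<^esub> z) * E z * q z * E (x \<otimes>\<^bsub>G\<^esub> inv\<^bsub>G\<^esub> z)))) \<and>
     (order G \<le> 4 \<longrightarrow>
        (E \<one>\<^bsub>G\<^esub>)\<^sup>2 = complex_of_real (sqrt (real (order G))) * E \<one>\<^bsub>G\<^esub> + 1)"

end

theory Submission
  imports Defs "HOL-Complex_Analysis.Complex_Analysis" "HOL-Real_Asymp.Real_Asymp"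
begin

text \<open>
  Let \<open>p = (m + sqrt (m\<^sup>2 + 4 m / n)) / 2\<close>, so that \<open>n p\<^sup>2 = n m p + m\<close>, and \<open>j = n p + 1\<close>.
  Then \<open>p / j = p - m\<close>, so the two variables \<open>ee z = exp (2 \<pi> i z)\<close> and \<open>W a z = ee ((z - a p) / j)\<close>
  are multiplied by the same number \<open>q\<close> when \<open>z\<close> is shifted by \<open>p\<close>. In the upper half plane
  \<open>Phi a z = psi (W a z) / psi (ee z)\<close>, with \<open>psi u\<close> the formal product of \<open>1 - u q\<^sup>k\<close>, is a
  Faddeev type quantum dilogarithm; an integral representation continues it across the real axis.
  Up to a constant factor the finite quantum dilogarithm at \<open>(a, b)\<close> is the value of \<open>Phi a\<close> at the
  point \<open>b p / m - a / n\<close>, where \<open>W a z = ee z\<close>. Such points are the poles of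
  \<open>W a z / (W a z - ee z)\<close>, a function with period \<open>p\<close>. Multiplying it with the quotient
  \<open>Phi (a + k) (z + \<xi>) Phi (a + l) (z + \<eta>) / Phi a z\<close> and shifting the line of integration by \<open>p\<close>
  therefore gives the sum in the defining equation as a sum of residues. By the functional equations
  what remains is a telescoping sum and an integral of Barnes type. The latter satisfies contiguity
  relations which show that its quotient by the expected product is invariant under the
  incommensurable shifts by 1 and \<open>p\<close>, hence constant; a pinching limit determines the constant.
\<close>

text \<open>The arrow of exact sequences would clash with that of limits.\<close>

no_notation Exact_Sequence.exact_seq_arrow
  (\<open>(\<open>indent=3 notation=\<open>mixfix exact_seq\<close>\<close>_ / \<longlongrightarrow>\<index> _)\<close> [1000, 60])

subsection \<open>Irrational periods\<close>

text \<open>Origin of \<open>j\<close>: its square root is the positive root of X^2 = sqrt (n m) X +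
  1, the equation required of E(0), and it does become the value at 0; then \<open>p\<close> is (j -
  1) / n. Two relations create the finite group. By \<open>n p = j - 1\<close>, raising the index
  \<open>a\<close> by \<open>n\<close> amounts to shifting \<open>z\<close> by 1, so a telescoping
  sum over \<open>a < n\<close> ends in a shift by 1, which an integral absorbs. By
  \<open>n p^2 = m j\<close>, the Gaussian in the reflection formula between \<open>z\<close> and
  \<open>p - z\<close> becomes at the points above the inverse of an exponential in x^2 / n - y^2 /
  m, with linear terms that make it well defined modulo \<open>n\<close> and \<open>m\<close> for
  either parity. Reflection also turns the denominator \<open>Phi a z\<close> into the factor E(z)
  <z> of the defining equation, with the summation variable negated. Identities come from functional
  equations instead: the quotient of two solutions has the incommensurable periods 1 and
  \<open>p\<close>. This argument is used for continuation, for reflection and for the Barnes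
  integral.\<close>

definition Lat :: "real \<Rightarrow> real set" where
  "Lat p = {of_int a * p + of_int b | a b. True}"

lemma Lat_add_iff:
  "x + of_int a * p + of_int b \<in> Lat p \<longleftrightarrow> x \<in> Lat p"
proof
  assume "x + of_int a * p + of_int b \<in> Lat p"
  then obtain c d where "x + of_int a * p + of_int b = of_int c * p + of_int d"
    unfolding Lat_def by blast
  then have "x = of_int (c - a) * p + of_int (d - b)" by (simp add: algebra_simps)
  then show "x \<in> Lat p" unfolding Lat_def by blast
next
  assume "x \<in> Lat p"
  then obtain c d where "x = of_int c * p + of_int d" unfolding Lat_def by blast
  then have "x + of_int a * p + of_int b = of_int (c + a) * p + of_int (d + b)"
    by (simp add: algebra_simps)
  then show "x + of_int a * p + of_int b \<in> Lat p" unfolding Lat_def by blast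
qed

text \<open>By irrationality the points x + k p - h come arbitrarily close to \<open>y\<close>, and
  continuity at \<open>y\<close> gives equality. The shifts are only assumed to the right of
  \<open>x0\<close> and off \<open>Lat p\<close>, the countable set containing the zeros that have
  to be avoided later.\<close>

lemma dense_periods_imp_const:
  fixes H :: "real \<Rightarrow> 'a::metric_space" and p x0 :: real
  assumes irr: "p \<notin> \<rat>" and p: "p > 0"
    and per1: "\<And>x. x > x0 \<Longrightarrow> x \<notin> Lat p \<Longrightarrow> H (x + 1) = H x"
    and perp: "\<And>x. x > x0 \<Longrightarrow> x \<notin> Lat p \<Longrightarrow> H (x + p) = H x"
    and cont: "\<And>x. x > x0 \<Longrightarrow> x \<notin> Lat p \<Longrightarrow> isCont H x"
    and x: "x > x0" "x \<notin> Lat p" and y: "y > x0" "y \<notin> Lat p"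
  shows "H x = H y"
proof -
  have nat1: "H (z + real k) = H z" if "z > x0" "z \<notin> Lat p" for z k
  proof (induction k)
    case (Suc k)
    have "z + real k \<notin> Lat p" using Lat_add_iff[of z 0 p "int k"] that by simp
    then have "H (z + real k + 1) = H (z + real k)" using that by (intro per1) auto
    with Suc show ?case by (simp add: add_ac)
  qed simp
  have natp: "H (z + real k * p) = H z" if "z > x0" "z \<notin> Lat p" for z k
  proof (induction k)
    case (Suc k)
    have "z + real k * p \<notin> Lat p" using Lat_add_iff[of z "int k" p 0] that by simp
    moreover have "z + real k * p > x0" using that p by (smt (verit) mult_nonneg_nonneg of_nat_0_le_iff)
    ultimately have "H (z + real k * p + p) = H (z + real k * p)" by (intro perp) auto
    with Suc show ?case by (simp add: algebra_simps)
  qed simp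
  have up: "H (z + real k * p + real l) = H z" if "z > x0" "z \<notin> Lat p" for z k l
  proof -
    have "z + real k * p \<notin> Lat p" using Lat_add_iff[of z "int k" p 0] that by simp
    moreover have "z + real k * p > x0" using that p by (smt (verit) mult_nonneg_nonneg of_nat_0_le_iff)
    ultimately show ?thesis using nat1 natp that by metis
  qed
  have lat: "H (x + of_int k * p - of_int h) = H x" if "x + of_int k * p - of_int h > x0" for k h
  proof -
    define z where "z = x + of_int k * p - of_int h"
    have z: "z \<notin> Lat p" using Lat_add_iff[of x k p "-h"] x by (simp add: z_def)
    \<comment> \<open>Downward shifts might leave the domain, so \<open>z\<close> and
      \<open>x\<close> are both moved upwards to a common point.\<close>
    have "H z = H (z + real (nat (-k)) * p + real (nat h))"
      using up[of z "nat (-k)" "nat h"] z that by (simp add: z_def)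
    also have "z + real (nat (-k)) * p + real (nat h) = x + real (nat k) * p + real (nat (-h))"
      by (cases "k \<ge> 0"; cases "h \<ge> 0") (auto simp: z_def algebra_simps)
    also have "H \<dots> = H x" using up[of x] x by simp
    finally show ?thesis by (simp add: z_def)
  qed
  have "dist (H x) (H y) \<le> e" if "e > 0" for e
  proof -
    obtain d where d: "d > 0" "\<And>z. dist z y < d \<Longrightarrow> dist (H z) (H y) < e"
      using cont[OF y] \<open>e > 0\<close> unfolding continuous_at_eps_delta by (metis dist_commute)
    obtain h k where hk: "\<bar>of_int k * p - of_int h - (y - x)\<bar> < min d (y - x0)"
      by (rule sequence_of_fractional_parts_is_dense[OF irr, of "min d (y - x0)" "y - x"]) (use d y in auto)
    have "x + of_int k * p - of_int h > x0" using hk by linarith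
    then have "H (x + of_int k * p - of_int h) = H x" by (rule lat)
    moreover have "dist (x + of_int k * p - of_int h) y < d"
      using hk by (auto simp: dist_real_def)
    ultimately show ?thesis using d(2) by fastforce
  qed
  then show ?thesis by (meson dense_ge dist_le_zero_iff)
qed

subsection \<open>The exponential with period one\<close>

definition ee :: "complex \<Rightarrow> complex" where
  "ee z = exp (2 * of_real pi * \<i> * z)"

lemma ee_add: "ee (x + y) = ee x * ee y"
  by (simp add: ee_def exp_add[symmetric] algebra_simps)

lemma ee_diff: "ee (x - y) = ee x / ee y"
  by (simp add: ee_def exp_diff[symmetric] algebra_simps)

lemma ee_minus: "ee (- x) = inverse (ee x)"
  by (simp add: ee_def exp_minus)

lemma ee_0 [simp]: "ee 0 = 1"
  by (simp add: ee_def)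

lemma ee_nonzero [simp]: "ee z \<noteq> 0"
  by (simp add: ee_def)

lemma ee_power: "ee z ^ k = ee (of_nat k * z)"
  by (simp add: ee_def exp_of_nat_mult[symmetric] algebra_simps)

lemma norm_ee: "norm (ee z) = exp (- 2 * pi * Im z)"
  by (simp add: ee_def)

lemma ee_eq_1_iff: "ee z = 1 \<longleftrightarrow> z \<in> \<int>"
proof
  assume "ee z = 1"
  then obtain n :: int where n: "Re (2 * of_real pi * \<i> * z) = 0" "Im (2 * of_real pi * \<i> * z) = of_int (2 * n) * pi"
    unfolding ee_def exp_eq_1 by blast
  then have "z = of_int n" by (simp add: complex_eq_iff)
  then show "z \<in> \<int>" by simp
next
  assume "z \<in> \<int>"
  then obtain n :: int where "z = of_int n" by (elim Ints_cases)
  then show "ee z = 1" unfolding ee_def exp_eq_1 by (auto simp: algebra_simps)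
qed

lemma ee_of_int [simp]: "ee (of_int k) = 1" and ee_of_nat [simp]: "ee (of_nat l) = 1"
  and ee_1 [simp]: "ee 1 = 1"
  by (simp_all add: ee_eq_1_iff)

lemma ee_has_field_derivative:
  "(ee has_field_derivative 2 * of_real pi * \<i> * ee z) (at z within A)"
  unfolding ee_def by (auto intro!: derivative_eq_intros simp: ee_def)

lemma holomorphic_on_ee [holomorphic_intros]:
  "f holomorphic_on A \<Longrightarrow> (\<lambda>z. ee (f z)) holomorphic_on A"
  unfolding ee_def by (intro holomorphic_intros)

lemma continuous_on_ee [continuous_intros]:
  "continuous_on A f \<Longrightarrow> continuous_on A (\<lambda>z. ee (f z))"
  unfolding ee_def by (intro continuous_intros)

lemma tendsto_ee [tendsto_intros]:
  "(f \<longlongrightarrow> l) F \<Longrightarrow> ((\<lambda>z. ee (f z)) \<longlongrightarrow> ee l) F"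
  unfolding ee_def by (intro tendsto_intros)

subsection \<open>Shifting a line of integration\<close>

text \<open>The abscissa of the intersection with the real axis of the line through \<open>z\<close> in direction \<open>\<mu>\<close>.\<close>

definition slope_re :: "complex \<Rightarrow> complex \<Rightarrow> real" where
  "slope_re \<mu> z = Re z - Im z * (Re \<mu> / Im \<mu>)"

lemma slope_re_add: "slope_re \<mu> (z + w) = slope_re \<mu> z + slope_re \<mu> w"
  and slope_re_diff: "slope_re \<mu> (z - w) = slope_re \<mu> z - slope_re \<mu> w"
  and slope_re_of_real [simp]: "slope_re \<mu> (of_real x) = x"
  and slope_re_1 [simp]: "slope_re \<mu> 1 = 1"
  by (auto simp: slope_re_def algebra_simps diff_divide_distrib add_divide_distrib)

lemma slope_re_line [simp]: "Im \<mu> > 0 \<Longrightarrow> slope_re \<mu> (\<mu> * of_real t) = 0"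
  by (simp add: slope_re_def)

lemma open_slope_re: "open {z. a < slope_re \<mu> z \<and> slope_re \<mu> z < b}"
  and convex_slope_re: "convex {z. a < slope_re \<mu> z \<and> slope_re \<mu> z < b}"
proof -
  show "open {z. a < slope_re \<mu> z \<and> slope_re \<mu> z < b}"
    unfolding slope_re_def by (intro open_Collect_conj open_Collect_less continuous_intros)
  have lin: "linear (slope_re \<mu>)"
    by (intro linearI) (auto simp: slope_re_def algebra_simps add_divide_distrib)
  have "{z. a < slope_re \<mu> z \<and> slope_re \<mu> z < b} = slope_re \<mu> -` {a<..<b}" by auto
  also have "convex \<dots>" by (intro convex_linear_vimage lin) auto
  finally show "convex {z. a < slope_re \<mu> z \<and> slope_re \<mu> z < b}" .
qed

text \<open>On the convex strip \<open>F\<close> has a primitive \<open>Q\<close>. The integral of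
  the difference therefore collapses to the increments of \<open>Q\<close> over two horizontal
  segments of length 1, one high up and one far down, where \<open>F\<close> is close to
  \<open>L\<close> and to 0.\<close>

lemma tendsto_strip_difference:
  fixes \<mu> :: complex and F :: "complex \<Rightarrow> complex"
  assumes mu: "Im \<mu> > 0" and eps: "\<epsilon> > 0"
    and hol: "F holomorphic_on {z. -\<epsilon> < slope_re \<mu> z \<and> slope_re \<mu> z < 1 + \<epsilon>}"
    and top: "\<And>e. e > 0 \<Longrightarrow> \<exists>T. \<forall>t\<ge>T. \<forall>x\<in>{0..1}. norm (F (of_real x + \<mu> * of_real t) - L) \<le> e"
    and bot: "\<And>e. e > 0 \<Longrightarrow> \<exists>T. \<forall>t\<le>-T. \<forall>x\<in>{0..1}. norm (F (of_real x + \<mu> * of_real t)) \<le> e"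
  shows "((\<lambda>T. \<mu> * integral {-T..T} (\<lambda>t. F (1 + \<mu> * of_real t) - F (\<mu> * of_real t))) \<longlongrightarrow> L) at_top"
proof -
  define U where "U = {z. -\<epsilon> < slope_re \<mu> z \<and> slope_re \<mu> z < 1 + \<epsilon>}"
  have U: "open U" "convex U" unfolding U_def by (rule open_slope_re, rule convex_slope_re)
  obtain Q where Q: "\<And>x. x \<in> U \<Longrightarrow> (Q has_field_derivative F x) (at x within U)"
  proof (rule holomorphic_convex_primitive'[OF U(2,1) hol[folded U_def]])
    fix g assume g: "\<And>x. x \<in> U \<Longrightarrow> (g has_field_derivative F x) (at x within U)"
    show thesis by (rule that[OF g])
  qed
  have Q: "(Q has_field_derivative F x) (at x)" if "x \<in> U" for x
    using Q[OF that] unfolding at_within_open[OF that U(1)] .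
  have inU: "of_real x + \<mu> * of_real t \<in> U" if "x \<in> {0..1}" for x t
    using that mu eps by (auto simp: U_def slope_re_add)
  have int: "\<mu> * integral {-T..T} (\<lambda>t. F (1 + \<mu> * of_real t) - F (\<mu> * of_real t)) =
     (Q (1 + \<mu> * of_real T) - Q (\<mu> * of_real T)) - (Q (1 + \<mu> * of_real (-T)) - Q (\<mu> * of_real (-T)))"
    if "T \<ge> 0" for T
  proof -
    have "((\<lambda>t. F (1 + \<mu> * of_real t) * \<mu> - F (\<mu> * of_real t) * \<mu>) has_integral
        (Q (1 + \<mu> * of_real T) - Q (\<mu> * of_real T)) - (Q (1 + \<mu> * of_real (-T)) - Q (\<mu> * of_real (-T)))) {-T..T}"
    proof (rule fundamental_theorem_of_calculus)
      fix t assume "t \<in> {-T..T}"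
      have "1 + \<mu> * of_real t \<in> U" "\<mu> * of_real t \<in> U" using inU[of 1 t] inU[of 0 t] by simp_all
      note Q' = Q[OF this(1)] Q[OF this(2)]
      have "((\<lambda>x. 1 + \<mu> * x) has_field_derivative \<mu>) (at (of_real t))"
        "((\<lambda>x. \<mu> * x) has_field_derivative \<mu>) (at (of_real t))"
        by (auto intro!: derivative_eq_intros)
      from DERIV_chain2[OF Q'(1) this(1)] DERIV_chain2[OF Q'(2) this(2)]
      have "((\<lambda>x. Q (1 + \<mu> * x) - Q (\<mu> * x)) has_field_derivative
          F (1 + \<mu> * of_real t) * \<mu> - F (\<mu> * of_real t) * \<mu>) (at (of_real t))"
        by (rule DERIV_diff)
      then show "((\<lambda>t. Q (1 + \<mu> * of_real t) - Q (\<mu> * of_real t)) has_vector_derivative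
        F (1 + \<mu> * of_real t) * \<mu> - F (\<mu> * of_real t) * \<mu>) (at t within {-T..T})"
        by (rule has_vector_derivative_real_field)
    qed (use that in auto)
    then have "((\<lambda>t. \<mu> * (F (1 + \<mu> * of_real t) - F (\<mu> * of_real t))) has_integral
        (Q (1 + \<mu> * of_real T) - Q (\<mu> * of_real T)) - (Q (1 + \<mu> * of_real (-T)) - Q (\<mu> * of_real (-T)))) {-T..T}"
      by (simp only: mult.commute[of _ \<mu>] right_diff_distrib)
    from integral_unique[OF this] show ?thesis by (simp only: integral_mult_right)
  qed
  \<comment> \<open>\<open>Q z - M z\<close> has the small derivative \<open>F z - M\<close> along a
    segment of length 1.\<close>
  have seg: "norm (Q (1 + \<mu> * of_real t) - Q (\<mu> * of_real t) - M) \<le> e"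
    if "\<forall>x\<in>{0..1}. norm (F (of_real x + \<mu> * of_real t) - M) \<le> e" for t M e
  proof -
    have "norm ((Q (1 + \<mu> * of_real t) - M * (1 + \<mu> * of_real t)) - (Q (\<mu> * of_real t) - M * (\<mu> * of_real t))) \<le>
       e * norm ((1 + \<mu> * of_real t) - \<mu> * of_real t)"
    proof (rule field_differentiable_bound[where S = "closed_segment (\<mu> * of_real t) (1 + \<mu> * of_real t)"
          and f' = "\<lambda>z. F z - M"])
      fix z assume "z \<in> closed_segment (\<mu> * of_real t) (1 + \<mu> * of_real t)"
      then obtain x where x: "x \<in> {0..1}" "z = of_real x + \<mu> * of_real t"
        unfolding closed_segment_def by (auto simp: algebra_simps scaleR_conv_of_real)
      then have "z \<in> U" using inU by blast
      have "((\<lambda>z. M * z) has_field_derivative M) (at z)" by (auto intro!: derivative_eq_intros)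
      from has_field_derivative_at_within[OF DERIV_diff[OF Q[OF \<open>z \<in> U\<close>] this]] show "((\<lambda>z. Q z - M * z) has_field_derivative F z - M)
          (at z within closed_segment (\<mu> * of_real t) (1 + \<mu> * of_real t))" .
      show "norm (F z - M) \<le> e" using that x by blast
    qed auto
    then show ?thesis by (simp add: algebra_simps)
  qed
  show ?thesis
  proof (rule tendstoI)
    fix e :: real assume e: "e > 0"
    obtain T1 where T1: "\<forall>t\<ge>T1. \<forall>x\<in>{0..1}. norm (F (of_real x + \<mu> * of_real t) - L) \<le> e / 3"
      using top[of "e/3"] e by auto
    obtain T2 where T2: "\<forall>t\<le>-T2. \<forall>x\<in>{0..1}. norm (F (of_real x + \<mu> * of_real t)) \<le> e / 3"
      using bot[of "e/3"] e by auto
    show "eventually (\<lambda>T. dist (\<mu> * integral {-T..T} (\<lambda>t. F (1 + \<mu> * of_real t) - F (\<mu> * of_real t))) L < e) at_top"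
      using eventually_ge_at_top[of "max 0 (max T1 T2)"]
    proof eventually_elim
      case (elim T)
      have "norm (Q (1 + \<mu> * of_real T) - Q (\<mu> * of_real T) - L) \<le> e / 3"
        using T1 elim by (intro seg) auto
      moreover have "norm (Q (1 + \<mu> * of_real (-T)) - Q (\<mu> * of_real (-T)) - 0) \<le> e / 3"
        by (intro seg) (use T2[rule_format, of "-T"] elim in \<open>auto simp del: of_real_minus\<close>)
      ultimately have "norm ((Q (1 + \<mu> * of_real T) - Q (\<mu> * of_real T) - L) -
         (Q (1 + \<mu> * of_real (-T)) - Q (\<mu> * of_real (-T)) - 0)) \<le> e/3 + e/3"
        by (intro norm_triangle_le_diff) auto
      moreover have "T \<ge> 0" using elim by simp
      moreover have "(a - b) - (c - d) - L = (a - b - L) - (c - d - 0)" for a b c d :: complex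
        by simp
      ultimately show ?case using e unfolding int[OF \<open>T \<ge> 0\<close>] dist_norm
        by (simp only:)
    qed
  qed
qed

lemma ee_quotient_limit: "((\<lambda>w. (w - z) * (2 * of_real pi * \<i> / (ee (w - z) - 1))) \<longlongrightarrow> 1) (at z)"
proof -
  have "((\<lambda>w. (ee (w - z) - ee 0) / (w - z)) \<longlongrightarrow> 2 * of_real pi * \<i>) (at z)"
  proof -
    have "((\<lambda>w. ee (w - z)) has_field_derivative 2 * of_real pi * \<i> * ee (z - z) * (1 - 0)) (at z)"
      by (rule DERIV_chain2[OF ee_has_field_derivative]) (intro derivative_intros)
    then show ?thesis by (simp add: has_field_derivative_iff)
  qed
  then have "((\<lambda>w. 2 * of_real pi * \<i> / ((ee (w - z) - ee 0) / (w - z))) \<longlongrightarrow> 2 * of_real pi * \<i> / (2 * of_real pi * \<i>)) (at z)"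
    by (intro tendsto_divide tendsto_const) auto
  then show ?thesis by (simp add: field_simps)
qed

text \<open>Induction on the poles: subtracting \<open>r z0\<close> times a function
  \<open>h\<close> with a simple pole at \<open>z0\<close> and period 1 removes the pole without
  changing the integrand on the left. As \<open>h\<close> tends to -2 pi i upwards and to 0
  downwards, the limit \<open>L\<close> grows by exactly 2 pi i \<open>r z0\<close>.\<close>

theorem tendsto_strip_residues:
  fixes \<mu> :: complex and F :: "complex \<Rightarrow> complex"
  assumes mu: "Im \<mu> > 0" and eps: "\<epsilon> > 0" and P: "finite P"
    and hol: "F holomorphic_on {z. -\<epsilon> < slope_re \<mu> z \<and> slope_re \<mu> z < 1 + \<epsilon>} - P"
    and sub: "\<And>z. z \<in> P \<Longrightarrow> \<epsilon> < slope_re \<mu> z \<and> slope_re \<mu> z < 1 - \<epsilon>"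
    and res: "\<And>z. z \<in> P \<Longrightarrow> ((\<lambda>w. (w - z) * F w) \<longlongrightarrow> r z) (at z)"
    and top: "\<And>e. e > 0 \<Longrightarrow> \<exists>T. \<forall>t\<ge>T. \<forall>x\<in>{0..1}. norm (F (of_real x + \<mu> * of_real t) - L) \<le> e"
    and bot: "\<And>e. e > 0 \<Longrightarrow> \<exists>T. \<forall>t\<le>-T. \<forall>x\<in>{0..1}. norm (F (of_real x + \<mu> * of_real t)) \<le> e"
  shows "((\<lambda>T. \<mu> * integral {-T..T} (\<lambda>t. F (1 + \<mu> * of_real t) - F (\<mu> * of_real t)))
     \<longlongrightarrow> 2 * of_real pi * \<i> * (\<Sum>z\<in>P. r z) + L) at_top"
  using P hol sub res top bot
proof (induction P arbitrary: F L rule: finite_induct)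
  case empty
  then show ?case using tendsto_strip_difference[OF mu eps, of F L] by simp
next
  case (insert z0 P)
  define U where "U = {z. -\<epsilon> < slope_re \<mu> z \<and> slope_re \<mu> z < 1 + \<epsilon>}"
  define h where "h w = 2 * of_real pi * \<i> / (ee (w - z0) - 1)" for w
  have U: "open U" unfolding U_def by (rule open_slope_re)
  have z0: "\<epsilon> < slope_re \<mu> z0 \<and> slope_re \<mu> z0 < 1 - \<epsilon>" using insert.prems(2) by simp
  have per: "h (1 + w) = h w" for w
    by (simp add: h_def add_diff_eq[symmetric] ee_add)
  have ne: "ee (w - z0) \<noteq> 1" if "w \<in> U - {z0}" for w
  proof
    assume "ee (w - z0) = 1"
    then obtain k :: int where k: "w - z0 = of_int k" unfolding ee_eq_1_iff by (elim Ints_cases)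
    then have "w - z0 = of_real (of_int k)" by simp
    then have "slope_re \<mu> w - slope_re \<mu> z0 = of_int k"
      by (metis slope_re_diff slope_re_of_real)
    moreover have "\<bar>slope_re \<mu> w - slope_re \<mu> z0\<bar> < 1" using that z0 unfolding U_def by auto
    ultimately have "k = 0" by simp
    then show False using k that by simp
  qed
  have hhol: "h holomorphic_on U - {z0}" unfolding h_def
    by (intro holomorphic_intros) (use ne in auto)
  have Fhol: "(\<lambda>w. F w - r z0 * h w) holomorphic_on (U - P) - {z0}"
    by (intro holomorphic_intros holomorphic_on_subset[OF hhol] holomorphic_on_subset[OF insert.prems(1)])
       (auto simp: U_def)
  have z0U: "z0 \<in> U - P" using z0 insert.hyps eps by (auto simp: U_def)
  have opUP: "open (U - P)" using U insert.hyps by (simp add: finite_imp_closed open_Diff)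
  have "((\<lambda>w. (w - z0) * F w - r z0 * ((w - z0) * (2 * of_real pi * \<i> / (ee (w - z0) - 1)))) \<longlongrightarrow> r z0 - r z0 * 1) (at z0)"
    by (intro tendsto_intros ee_quotient_limit insert.prems(3)) simp
  then have "((\<lambda>w. (w - z0) * (F w - r z0 * h w)) \<longlongrightarrow> 0) (at z0)"
    by (simp add: h_def algebra_simps)
  then have "\<exists>g. g holomorphic_on (U - P) \<and> (\<forall>z\<in>(U - P) - {z0}. g z = F z - r z0 * h z)"
    using holomorphic_on_extend_lim[OF Fhol] z0U opUP by (simp add: interior_open)
  then obtain g where g: "g holomorphic_on (U - P)" "\<And>z. z \<in> (U - P) - {z0} \<Longrightarrow> g z = F z - r z0 * h z"
    by blast
  have line: "of_real x + \<mu> * of_real t \<in> U" if "x \<in> {0..1}" for x t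
    using that mu eps by (auto simp: U_def slope_re_add)
  have slope_line: "slope_re \<mu> (of_real x + \<mu> * of_real t) = x" for x t
    using mu by (simp add: slope_re_add)
  have edge: "of_real x + \<mu> * of_real t \<in> (U - P) - {z0}" if "x = 0 \<or> x = 1" for x t
  proof -
    have "of_real x + \<mu> * of_real t \<notin> insert z0 P"
      using insert.prems(2)[of "of_real x + \<mu> * of_real t"] that eps unfolding slope_line by auto
    then show ?thesis using line[of x t] that by auto
  qed
  have away: "\<exists>T. \<forall>t. \<bar>t\<bar> \<ge> T \<longrightarrow> (\<forall>x\<in>{0..1}. of_real x + \<mu> * of_real t \<notin> insert z0 P)"
  proof -
    obtain B where B: "\<And>z. z \<in> Im ` insert z0 P \<Longrightarrow> \<bar>z\<bar> < B"
    proof -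
      have "bounded (Im ` insert z0 P)" using insert.hyps(1) by (intro finite_imp_bounded) auto
      then show ?thesis using that unfolding bounded_pos_less by auto
    qed
    show ?thesis
    proof (intro exI allI impI ballI)
      fix t x :: real assume t: "\<bar>t\<bar> \<ge> B / Im \<mu>"
      have "\<bar>Im (of_real x + \<mu> * of_real t)\<bar> \<ge> B" using t mu by (simp add: abs_mult field_simps)
      then show "of_real x + \<mu> * of_real t \<notin> insert z0 P" using B by (metis imageI linorder_not_le)
    qed
  qed
  then obtain T0 where T0: "\<And>t x. \<bar>t\<bar> \<ge> T0 \<Longrightarrow> x \<in> {0..1} \<Longrightarrow> of_real x + \<mu> * of_real t \<notin> insert z0 P"
    by blast
  have geq: "g (of_real x + \<mu> * of_real t) = F (of_real x + \<mu> * of_real t) - r z0 * h (of_real x + \<mu> * of_real t)"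
    if "\<bar>t\<bar> \<ge> T0" "x \<in> {0..1}" for x t
    using T0[OF that] line[OF that(2), of t] by (intro g(2)) auto
  have Imline: "Im (of_real x + \<mu> * of_real t - z0) = Im \<mu> * t - Im z0" for x t by simp
  have frac: "a * (e / (2 * (a + 1))) \<le> e / 2" if "e > 0" "a \<ge> 0" for a e :: real
    unfolding times_divide_eq_right using that by (subst pos_divide_le_eq) (auto simp: algebra_simps)
  have tend_ee: "((\<lambda>t. exp (- 2 * pi * (Im \<mu> * t - Im z0))) \<longlongrightarrow> 0) at_top"
    using mu by real_asymp
  have tend_ee': "filterlim (\<lambda>t. exp (- 2 * pi * (Im \<mu> * (-t) - Im z0))) at_top at_top"
    using mu by real_asymp
  have htop: "\<exists>T. \<forall>t\<ge>T. \<forall>x\<in>{0..1::real}. norm (h (of_real x + \<mu> * of_real t) + 2 * of_real pi * \<i>) \<le> e" if "e > 0" for e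
  proof -
    have "((\<lambda>t. 2 * pi * exp (- 2 * pi * (Im \<mu> * t - Im z0)) / (1 - exp (- 2 * pi * (Im \<mu> * t - Im z0)))) \<longlongrightarrow> 2 * pi * 0 / (1 - 0)) at_top"
      by (intro tendsto_intros tend_ee) auto
    then have "eventually (\<lambda>t. 2 * pi * exp (- 2 * pi * (Im \<mu> * t - Im z0)) / (1 - exp (- 2 * pi * (Im \<mu> * t - Im z0))) < e) at_top"
      using that by (auto dest!: order_tendstoD(2))
    moreover have "eventually (\<lambda>t. exp (- 2 * pi * (Im \<mu> * t - Im z0)) < 1) at_top"
      using order_tendstoD(2)[OF tend_ee, of 1] by simp
    ultimately have "eventually (\<lambda>t. \<forall>x\<in>{0..1::real}. norm (h (of_real x + \<mu> * of_real t) + 2 * of_real pi * \<i>) \<le> e) at_top"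
    proof eventually_elim
      case (elim t)
      show ?case
      proof
        fix x :: real assume "x \<in> {0..1}"
        define E where "E = ee (of_real x + \<mu> * of_real t - z0)"
        have nE: "norm E = exp (- 2 * pi * (Im \<mu> * t - Im z0))"
          unfolding E_def norm_ee Imline ..
        have E1: "norm (E - 1) \<ge> 1 - norm E" by (metis norm_minus_commute norm_one norm_triangle_ineq2)
        have "E \<noteq> 1" using elim(2) nE by auto
        then have "h (of_real x + \<mu> * of_real t) + 2 * of_real pi * \<i> = 2 * of_real pi * \<i> * E / (E - 1)"
          unfolding h_def E_def by (simp add: field_simps)
        then have "norm (h (of_real x + \<mu> * of_real t) + 2 * of_real pi * \<i>) = 2 * pi * norm E / norm (E - 1)"
          by (simp add: norm_mult norm_divide)
        also have "\<dots> \<le> 2 * pi * norm E / (1 - norm E)"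
          using E1 elim(2) nE by (intro divide_left_mono mult_pos_pos) auto
        also have "\<dots> \<le> e" using elim(1) unfolding nE by simp
        finally show "norm (h (of_real x + \<mu> * of_real t) + 2 * of_real pi * \<i>) \<le> e" .
      qed
    qed
    then show ?thesis unfolding eventually_at_top_linorder by blast
  qed
  have hbot: "\<exists>T. \<forall>t\<le>-T. \<forall>x\<in>{0..1::real}. norm (h (of_real x + \<mu> * of_real t)) \<le> e" if "e > 0" for e
  proof -
    have "eventually (\<lambda>t. exp (- 2 * pi * (Im \<mu> * (-t) - Im z0)) \<ge> 2 * pi / e + 1) at_top"
      using tend_ee' unfolding filterlim_at_top by blast
    then obtain T where T: "\<And>t. t \<ge> T \<Longrightarrow> exp (- 2 * pi * (Im \<mu> * (-t) - Im z0)) \<ge> 2 * pi / e + 1"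
      unfolding eventually_at_top_linorder by blast
    show ?thesis
    proof (intro exI allI impI ballI)
      fix t x :: real assume t: "t \<le> -T" and "x \<in> {0..1}"
      define E where "E = ee (of_real x + \<mu> * of_real t - z0)"
      have nE: "norm E = exp (- 2 * pi * (Im \<mu> * t - Im z0))"
        unfolding E_def norm_ee Imline ..
      have "norm E \<ge> 2 * pi / e + 1" using T[of "-t"] t unfolding nE by simp
      moreover have "norm (E - 1) \<ge> norm E - 1" by (metis norm_one norm_triangle_ineq2)
      ultimately have E1: "norm (E - 1) \<ge> 2 * pi / e" by linarith
      have "norm (h (of_real x + \<mu> * of_real t)) = 2 * pi / norm (E - 1)"
        unfolding h_def E_def by (simp add: norm_mult norm_divide)
      also have "\<dots> \<le> 2 * pi / (2 * pi / e)"
      proof (rule divide_left_mono[OF E1])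
        have "2 * pi / e > 0" using \<open>e > 0\<close> by simp
        with E1 have "norm (E - 1) > 0" by linarith
        then show "0 < norm (E - 1) * (2 * pi / e)" using \<open>2 * pi / e > 0\<close> by (rule mult_pos_pos)
      qed simp
      also have "\<dots> = e" by simp
      finally show "norm (h (of_real x + \<mu> * of_real t)) \<le> e" .
    qed
  qed
  have "((\<lambda>T. \<mu> * integral {-T..T} (\<lambda>t. g (1 + \<mu> * of_real t) - g (\<mu> * of_real t)))
     \<longlongrightarrow> 2 * of_real pi * \<i> * (\<Sum>z\<in>P. r z) + (L + r z0 * (2 * of_real pi * \<i>))) at_top"
  proof (rule insert.IH)
    show "g holomorphic_on {z. - \<epsilon> < slope_re \<mu> z \<and> slope_re \<mu> z < 1 + \<epsilon>} - P"
      using g(1) by (simp add: U_def)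
    show "\<epsilon> < slope_re \<mu> z \<and> slope_re \<mu> z < 1 - \<epsilon>" if "z \<in> P" for z
      using insert.prems(2) that by simp
    show "((\<lambda>w. (w - z) * g w) \<longlongrightarrow> r z) (at z)" if z: "z \<in> P" for z
    proof -
      have zU: "z \<in> U - {z0}" using insert.prems(2)[of z] insert.hyps z eps by (auto simp: U_def)
      have "isCont h z" using hhol zU U
        by (meson continuous_on_eq_continuous_at finite.emptyI finite_imp_closed finite_insert holomorphic_on_imp_continuous_on open_Diff)
      then have "((\<lambda>w. (w - z) * F w - r z0 * ((w - z) * h w)) \<longlongrightarrow> r z - r z0 * ((z - z) * h z)) (at z)"
        using insert.prems(3)[of z] z by (intro tendsto_intros) (auto simp: isCont_def)
      moreover have "eventually (\<lambda>w. w \<in> (U - {z0}) - (P - {z}) - {z}) (at z)"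
      proof -
        have "open ((U - {z0}) - (P - {z}))" using U insert.hyps(1) by (intro open_Diff finite_imp_closed) auto
        then show ?thesis using zU by (auto simp: eventually_at_topological)
      qed
      then have "eventually (\<lambda>w. (w - z) * F w - r z0 * ((w - z) * h w) = (w - z) * g w) (at z)"
        by eventually_elim (auto simp: g(2) algebra_simps)
      ultimately show ?thesis by (simp add: tendsto_cong)
    qed
    show "\<exists>T. \<forall>t\<ge>T. \<forall>x\<in>{0..1}. norm (g (of_real x + \<mu> * of_real t) - (L + r z0 * (2 * of_real pi * \<i>))) \<le> e" if e: "e > 0" for e
    proof -
      obtain T1 where T1: "\<forall>t\<ge>T1. \<forall>x\<in>{0..1}. norm (F (of_real x + \<mu> * of_real t) - L) \<le> e / 2"
        using insert.prems(4)[of "e/2"] e by auto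
      obtain T2 where T2: "\<forall>t\<ge>T2. \<forall>x\<in>{0..1::real}. norm (h (of_real x + \<mu> * of_real t) + 2 * of_real pi * \<i>) \<le> e / (2 * (norm (r z0) + 1))"
        using htop[of "e / (2 * (norm (r z0) + 1))"] e by (auto simp: add_nonneg_pos)
      show ?thesis
      proof (intro exI allI impI ballI)
        fix t x :: real assume t: "t \<ge> max T0 (max T1 T2)" and x: "x \<in> {0..1}"
        define w where "w = of_real x + \<mu> * of_real t"
        have "\<bar>t\<bar> \<ge> T0" using t abs_ge_self[of t] by linarith
        then have gw: "g w = F w - r z0 * h w" using geq[of t x] x by (simp add: w_def)
        have "norm (g w - (L + r z0 * (2 * of_real pi * \<i>))) = norm ((F w - L) - r z0 * (h w + 2 * of_real pi * \<i>))"
          unfolding gw by (simp add: algebra_simps)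
        also have "\<dots> \<le> norm (F w - L) + norm (r z0) * norm (h w + 2 * of_real pi * \<i>)"
          by (metis norm_mult norm_triangle_ineq4)
        also have "\<dots> \<le> e / 2 + norm (r z0) * (e / (2 * (norm (r z0) + 1)))"
          using T1 T2 t x unfolding w_def by (intro add_mono mult_left_mono) auto
        also have "\<dots> \<le> e / 2 + e / 2"
          by (intro add_left_mono frac e norm_ge_zero)
        finally show "norm (g (of_real x + \<mu> * of_real t) - (L + r z0 * (2 * of_real pi * \<i>))) \<le> e"
          by (simp add: w_def)
      qed
    qed
    show "\<exists>T. \<forall>t\<le>-T. \<forall>x\<in>{0..1}. norm (g (of_real x + \<mu> * of_real t)) \<le> e" if e: "e > 0" for e
    proof -
      obtain T1 where T1: "\<forall>t\<le>-T1. \<forall>x\<in>{0..1}. norm (F (of_real x + \<mu> * of_real t)) \<le> e / 2"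
        using insert.prems(5)[of "e/2"] e by auto
      obtain T2 where T2: "\<forall>t\<le>-T2. \<forall>x\<in>{0..1::real}. norm (h (of_real x + \<mu> * of_real t)) \<le> e / (2 * (norm (r z0) + 1))"
        using hbot[of "e / (2 * (norm (r z0) + 1))"] e by (auto simp: add_nonneg_pos)
      show ?thesis
      proof (intro exI allI impI ballI)
        fix t x :: real assume t: "t \<le> - max T0 (max T1 T2)" and x: "x \<in> {0..1}"
        define w where "w = of_real x + \<mu> * of_real t"
        have "norm (g w) = norm (F w - r z0 * h w)"
          using geq[of t x] t x by (simp add: w_def)
        also have "\<dots> \<le> norm (F w) + norm (r z0) * norm (h w)"
          by (metis norm_mult norm_triangle_ineq4)
        also have "\<dots> \<le> e / 2 + norm (r z0) * (e / (2 * (norm (r z0) + 1)))"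
          using T1 T2 t x unfolding w_def by (intro add_mono mult_left_mono) auto
        also have "\<dots> \<le> e / 2 + e / 2"
          by (intro add_left_mono frac e norm_ge_zero)
        finally show "norm (g (of_real x + \<mu> * of_real t)) \<le> e"
          by (simp add: w_def)
      qed
    qed
  qed
  moreover have "g (1 + \<mu> * of_real t) - g (\<mu> * of_real t) = F (1 + \<mu> * of_real t) - F (\<mu> * of_real t)" for t
    using g(2)[OF edge[of 0 t]] g(2)[OF edge[of 1 t]] per[of "\<mu> * of_real t"] by simp
  moreover have "2 * of_real pi * \<i> * (\<Sum>z\<in>P. r z) + (L + r z0 * (2 * of_real pi * \<i>)) =
    2 * of_real pi * \<i> * (\<Sum>z\<in>insert z0 P. r z) + L"
    using insert.hyps by (simp add: algebra_simps)
  ultimately show ?case by simp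
qed

lemma sin_ge_quarter:
  assumes "0 \<le> t" "t \<le> pi / 2"
  shows "sin t \<ge> t / 4"
proof (cases "t \<le> pi / 3")
  case True
  have "sin 0 - 0 / 4 \<le> sin t - t / 4"
  proof (rule DERIV_nonneg_imp_nondecreasing[OF assms(1)])
    fix x assume x: "0 \<le> x" "x \<le> t"
    have "cos (pi / 3) \<le> cos x" using x True pi_gt_zero by (intro cos_monotone_0_pi_le) auto
    then have "cos x - 1 / 4 \<ge> 0" by (simp add: cos_60)
    moreover have "((\<lambda>x. sin x - x / 4) has_real_derivative cos x - 1 / 4) (at x)"
      by (auto intro!: derivative_eq_intros)
    ultimately show "\<exists>y. ((\<lambda>x. sin x - x / 4) has_real_derivative y) (at x) \<and> 0 \<le> y" by blast
  qed
  then show ?thesis by simp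
next
  case False
  have "sin (pi / 6) \<le> sin t" using assms False pi_gt_zero
    by (subst sin_mono_le_eq) auto
  then show ?thesis using assms pi_less_4 by (simp add: sin_30)
qed

text \<open>After reduction to the nearest integer the norm is 2 |sin (pi y)| with |y| at most 1/2,
  where a linear lower bound of the sine suffices.\<close>

lemma norm_ee_minus_1_ge:
  fixes x \<delta> :: real
  assumes "\<And>l :: int. \<delta> \<le> \<bar>x - of_int l\<bar>"
  shows "norm (1 - ee (of_real x)) \<ge> \<delta>"
proof -
  define l where "l = round x"
  define y where "y = x - of_int l"
  have y: "\<bar>y\<bar> \<le> 1 / 2"
    using of_int_round_abs_le[of x] by (simp add: y_def l_def abs_minus_commute)
  have "ee (of_real x) = ee (of_real y + of_int l)" by (simp add: y_def)
  also have "\<dots> = ee (of_real y)" by (simp only: ee_add ee_of_int mult_1_right)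
  also have "\<dots> = exp (\<i> * of_real (2 * pi * y))" by (simp add: ee_def algebra_simps)
  finally have "norm (1 - ee (of_real x)) = 2 * \<bar>sin (pi * y)\<bar>"
    using dist_exp_i_1[of "2 * pi * y"] by (simp add: norm_minus_commute)
  also have "\<bar>sin (pi * y)\<bar> = sin (pi * \<bar>y\<bar>)"
  proof -
    have "sin (pi * \<bar>y\<bar>) \<ge> 0" using y pi_gt_zero mult_left_mono[OF y, of pi] by (intro sin_ge_zero) auto
    then show ?thesis by (cases "y \<ge> 0") auto
  qed
  also have "2 * sin (pi * \<bar>y\<bar>) \<ge> 2 * (pi * \<bar>y\<bar> / 4)"
    using y mult_left_mono[OF y, of pi] by (intro mult_left_mono sin_ge_quarter) auto
  also have "2 * (pi * \<bar>y\<bar> / 4) \<ge> \<bar>y\<bar>" using mult_right_mono[of 2 pi "\<bar>y\<bar>"] pi_gt3 by simp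
  finally show ?thesis using assms[of l] by (simp add: y_def)
qed

subsection \<open>The quadratic irrational and the series\<close>

locale quadratic_unit =
  fixes n m :: nat
  assumes n_pos: "n > 0" and m_pos: "m > 0"
begin

definition p :: real where "p = (m + sqrt (m\<^sup>2 + 4 * m / n)) / 2"
definition j :: real where "j = n * p + 1"

lemma p_gt: "p > m" and p_gt_1: "p > 1" and p_pos: "p > 0"
proof -
  have "sqrt (m\<^sup>2) < sqrt (m\<^sup>2 + 4 * m / n)"
    using n_pos m_pos by (intro real_sqrt_less_mono) auto
  then show "p > m" by (simp add: p_def)
  then show "p > 1" "p > 0" using m_pos by linarith+
qed

lemma p_square: "n * p\<^sup>2 = n * m * p + m"
proof -
  have "(sqrt (m\<^sup>2 + 4 * m / n))\<^sup>2 = m\<^sup>2 + 4 * m / n" by (intro real_sqrt_pow2) auto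
  moreover have "2 * ((x + s) / 2) - x = s" for x s :: real by (simp add: field_simps)
  ultimately have "(2 * p - m)\<^sup>2 = m\<^sup>2 + 4 * m / n" by (simp only: p_def)
  then show ?thesis using n_pos by (simp add: power2_eq_square field_simps)
qed

lemma j_gt_1: "j > 1" and j_pos: "j > 0"
  using p_pos n_pos by (auto simp: j_def add_pos_pos)

lemma np_eq: "n * p = j - 1" by (simp add: j_def)

lemma p_square_j: "n * p\<^sup>2 = m * j" using p_square by (simp add: j_def algebra_simps)

lemma p_div_j: "p / j = p - m"
  using p_square j_pos by (simp add: field_simps j_def power2_eq_square)

text \<open>A rational \<open>p\<close> would make the discriminant N^2 + 4 N, with N = n m, the
  square of an integer; but it lies strictly between (N + 1)^2 and (N + 2)^2.\<close>

lemma p_irrational: "p \<notin> \<rat>"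
proof
  assume "p \<in> \<rat>"
  then obtain a b :: int where ab: "b > 0" "p = of_int a / of_int b"
    by (elim Rats_cases') auto
  define N :: int where "N = int n * int m"
  have N: "N > 0" using n_pos m_pos by (simp add: N_def)
  have pb: "p * real_of_int b = real_of_int a" using ab by simp
  have "real n * (p * real_of_int b)\<^sup>2 = real n * real m * (p * real_of_int b) * real_of_int b + real m * (real_of_int b)\<^sup>2"
    using arg_cong[OF p_square, of "\<lambda>x. x * (real_of_int b)\<^sup>2"] by (simp add: power2_eq_square algebra_simps)
  then have "real n * (real_of_int a)\<^sup>2 = real n * real m * real_of_int a * real_of_int b + real m * (real_of_int b)\<^sup>2"
    unfolding pb .
  then have "real_of_int (n * a\<^sup>2) = real_of_int (n * m * a * b + m * b\<^sup>2)" by simp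
  then have "n * a\<^sup>2 = n * m * a * b + m * b\<^sup>2" by (simp only: of_int_eq_iff)
  then have "4 * n * (n * a\<^sup>2) = 4 * n * (n * m * a * b + m * b\<^sup>2)" by simp
  then have eq: "(2 * n * a - N * b)\<^sup>2 = b\<^sup>2 * (N\<^sup>2 + 4 * N)"
    by (simp add: power2_eq_square algebra_simps N_def)
  then have "b dvd 2 * n * a - N * b" by (metis dvd_triv_left pow_divides_pow_iff zero_less_numeral)
  then obtain y where "2 * n * a - N * b = b * y" by blast
  with eq ab have y: "y\<^sup>2 = N\<^sup>2 + 4 * N" by (simp add: power_mult_distrib)
  have *: "(N + 1)\<^sup>2 < \<bar>y\<bar>\<^sup>2" "\<bar>y\<bar>\<^sup>2 < (N + 2)\<^sup>2"
    using y N by (auto simp: power2_eq_square algebra_simps)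
  have "N + 1 < \<bar>y\<bar>" by (rule power2_less_imp_less[OF *(1)]) simp
  moreover have "\<bar>y\<bar> < N + 2" by (rule power2_less_imp_less[OF *(2)]) (use N in simp)
  ultimately show False by linarith
qed

text \<open>Liouville's argument. The conjugate of \<open>p\<close> is \<open>m - p\<close>, so n (k
  p - l) (k (m - p) - l) is an integer, nonzero by irrationality, while its conjugate factor is
  O(k).\<close>

lemma p_badly_approximable:
  obtains c where "c > 0" "\<And>(k::nat) (l::int). (0::nat) < k \<Longrightarrow> c / k \<le> \<bar>k * p - l\<bar>"
proof -
  \<comment> \<open>When |k p - l| is at most 1, the conjugate factor is at most k (1 + 2 p); the
    remaining case only needs \<open>c \<le> 1\<close>.\<close>
  define c where "c = 1 / (n * (1 + 2 * p))"
  have c: "c > 0" using n_pos p_pos by (simp add: c_def)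
  have "1 * 1 \<le> n * (1 + 2 * p)" using n_pos p_pos by (intro mult_mono) auto
  then have c1: "c \<le> 1" by (simp add: c_def)
  have irr: "k * p \<noteq> of_int l" if "k > 0" for k :: nat and l :: int
  proof
    assume "k * p = of_int l"
    then have "p = of_int l / of_nat k" using that by (simp add: field_simps)
    then show False using p_irrational by auto
  qed
  have "c / k \<le> \<bar>k * p - l\<bar>" if k: "k > 0" for k :: nat and l :: int
  proof (cases "\<bar>k * p - l\<bar> \<le> 1")
    case False
    have "c / k \<le> 1" using c1 k c by (simp add: divide_le_eq)
    then show ?thesis using False by linarith
  next
    case True
    define Z :: int where "Z = n * l\<^sup>2 - n * m * k * l - m * k\<^sup>2"
    have "n * ((k * p - l) * (k * (m - p) - l)) = n * l\<^sup>2 - n * m * k * l - k\<^sup>2 * (n * p\<^sup>2 - n * m * p)"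
      by (simp add: power2_eq_square algebra_simps)
    also have "\<dots> = of_int Z" unfolding p_square Z_def by (simp add: mult.commute)
    finally have Z: "n * ((k * p - l) * (k * (m - p) - l)) = of_int Z" .
    have "k * (m - p) \<noteq> l"
    proof
      assume "k * (m - p) = l"
      then have "k * p = of_int (int k * int m - l)" by (simp add: algebra_simps)
      then show False using irr[OF k] by blast
    qed
    then have "n * ((k * p - l) * (k * (m - p) - l)) \<noteq> 0" using irr[OF k, of l] n_pos by simp
    then have "Z \<noteq> 0" unfolding Z by simp
    then have "1 \<le> \<bar>real_of_int Z\<bar>" by linarith
    also have "\<dots> = n * (\<bar>k * p - l\<bar> * \<bar>k * (m - p) - l\<bar>)" unfolding Z[symmetric] by (simp add: abs_mult)
    also have "\<dots> \<le> n * (\<bar>k * p - l\<bar> * (k * (1 + 2 * p)))"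
    proof (intro mult_left_mono)
      have "k * (m - p) - l = (k * p - l) + k * (m - 2 * p)" by (simp add: algebra_simps)
      then have "\<bar>k * (m - p) - l\<bar> \<le> \<bar>k * p - l\<bar> + \<bar>k * (m - 2 * p)\<bar>" by linarith
      also have "\<bar>k * (m - 2 * p)\<bar> = k * (2 * p - m)" using p_gt k p_pos by (simp add: abs_mult)
      also have "\<bar>k * p - l\<bar> + k * (2 * p - m) \<le> k * 1 + k * (2 * p)"
        using True k by (intro add_mono mult_left_mono) auto
      finally show "\<bar>k * (m - p) - l\<bar> \<le> k * (1 + 2 * p)" by (simp add: algebra_simps)
    qed auto
    finally have "1 \<le> \<bar>k * p - l\<bar> * (k / c)" unfolding c_def by (simp add: algebra_simps)
    then show ?thesis using c k by (simp add: field_simps)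
  qed
  with c show ?thesis by (rule that)
qed

definition q :: complex where "q = ee (of_real p)"

lemma norm_q [simp]: "norm q = 1" by (simp add: q_def norm_ee)

lemma q_nonzero [simp]: "q \<noteq> 0" by (simp add: q_def)

lemma q_alt: "q = ee (of_real (p / j))"
proof -
  have "of_real (p / j) = of_real p - (of_nat m :: complex)" unfolding p_div_j by simp
  then show ?thesis unfolding q_def by (simp only: ee_diff ee_of_nat div_by_1)
qed

text \<open>Minus the logarithm of the formal product has the coefficients (1/k) times the sum of
  q^(i k) over i, evaluated as a geometric series. The constant coefficient is 0, since division by
  zero yields 0.\<close>

definition psi_coeff :: "nat \<Rightarrow> complex" where
  "psi_coeff k = 1 / (of_nat k * (1 - q ^ k))"

definition psi_log :: "complex \<Rightarrow> complex" where
  "psi_log u = suminf (\<lambda>k. psi_coeff k * u ^ k)"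

text \<open>Formally \<open>psi u\<close> is the product of \<open>1 - u q\<^sup>k\<close> over all natural numbers \<open>k\<close>. Since \<open>q\<close>
  lies on the unit circle this product diverges, but \<open>p\<close> is badly approximable, so the series for
  its logarithm converges for \<open>norm u < 1\<close>.\<close>

definition psi :: "complex \<Rightarrow> complex" where
  "psi u = exp (- psi_log u)"

text \<open>Bad approximability bounds |1 - q^k| below by c / k, and the factor k in the denominator
  compensates exactly: the small divisors do no harm.\<close>

lemma psi_coeff_bound: obtains K where "K > 0" "\<And>k. norm (psi_coeff k) \<le> K"
proof -
  obtain c where c: "c > 0" "\<And>(k::nat) (l::int). (0::nat) < k \<Longrightarrow> c / k \<le> \<bar>k * p - l\<bar>"
    using p_badly_approximable by metis
  have "norm (psi_coeff k) \<le> 1 / c" for k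
  proof (cases "k = 0")
    case True
    then show ?thesis using c by (simp add: psi_coeff_def)
  next
    case False
    have "norm (1 - ee (of_real (k * p))) \<ge> c / k"
      using c(2) False by (intro norm_ee_minus_1_ge) auto
    then have *: "norm (1 - q ^ k) \<ge> c / k" by (simp add: q_def ee_power)
    then have "k * norm (1 - q ^ k) \<ge> c" using False by (simp add: field_simps)
    then show ?thesis using c(1) by (simp add: psi_coeff_def norm_divide norm_mult frac_le)
  qed
  then show ?thesis using that[of "1/c"] c by simp
qed

lemma q_power_neq_1: "k > 0 \<Longrightarrow> q ^ k \<noteq> 1"
proof
  assume k: "k > 0" and "q ^ k = 1"
  then have "of_nat k * complex_of_real p \<in> \<int>" by (simp add: q_def ee_power ee_eq_1_iff)
  then obtain l :: int where "of_nat k * complex_of_real p = of_int l" by (elim Ints_cases)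
  then have "k * p = l" by (metis of_real_eq_iff of_real_mult of_real_of_int_eq of_real_of_nat_eq)
  then have "p = of_int l / of_nat k" using k by (simp add: field_simps)
  then show False using p_irrational by auto
qed

lemma psi_log_sums: "norm u < 1 \<Longrightarrow> (\<lambda>k. psi_coeff k * u ^ k) sums psi_log u"
  and psi_log_summable_norm: "norm u < 1 \<Longrightarrow> summable (\<lambda>k. norm (psi_coeff k * u ^ k))"
proof -
  assume u: "norm u < 1"
  obtain K where K: "K > 0" "\<And>k. norm (psi_coeff k) \<le> K" using psi_coeff_bound by metis
  show *: "summable (\<lambda>k. norm (psi_coeff k * u ^ k))"
  proof (rule summable_comparison_test')
    show "summable (\<lambda>k. K * norm u ^ k)" using u by (intro summable_mult summable_geometric) auto
    show "norm (norm (psi_coeff k * u ^ k)) \<le> K * norm u ^ k" for k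
      using K by (auto simp: norm_mult norm_power intro!: mult_right_mono)
  qed
  show "(\<lambda>k. psi_coeff k * u ^ k) sums psi_log u"
    unfolding psi_log_def by (rule summable_sums[OF summable_norm_cancel[OF *]])
qed

lemma psi_log_bound: obtains K where "K > 0" "\<And>u. norm u < 1 \<Longrightarrow> norm (psi_log u) \<le> K * norm u / (1 - norm u)"
proof -
  obtain K where K: "K > 0" "\<And>k. norm (psi_coeff k) \<le> K" using psi_coeff_bound by metis
  have "norm (psi_log u) \<le> K * norm u / (1 - norm u)" if u: "norm u < 1" for u
  proof -
    have "(\<lambda>k. psi_coeff (Suc k) * u ^ Suc k) sums (psi_log u - psi_coeff 0 * u ^ 0)"
      using psi_log_sums[OF u] by (subst sums_Suc_iff) auto
    then have eq: "psi_log u = suminf (\<lambda>k. psi_coeff (Suc k) * u ^ Suc k)"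
      by (simp add: sums_iff psi_coeff_def)
    have s: "(\<lambda>k. (K * norm u) * norm u ^ k) sums ((K * norm u) * (1 / (1 - norm u)))"
      using u by (intro sums_mult geometric_sums) auto
    have "norm (psi_log u) \<le> suminf (\<lambda>k. (K * norm u) * norm u ^ k)"
      unfolding eq
    proof (rule norm_suminf_le)
      show "summable (\<lambda>k. K * norm u * norm u ^ k)" using s by (simp add: sums_iff)
      show "norm (psi_coeff (Suc k) * u ^ Suc k) \<le> K * norm u * norm u ^ k" for k
        using mult_right_mono[OF K(2)[of "Suc k"], of "norm u ^ Suc k"] by (simp add: norm_mult norm_power mult_ac)
    qed
    then show ?thesis using s by (simp add: sums_iff)
  qed
  with K show ?thesis using that by blast
qed

lemma psi_log_holomorphic: "psi_log holomorphic_on ball 0 1"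
  by (rule power_series_holomorphic[of 0 1 psi_coeff]) (use psi_log_sums in auto)

lemma psi_holomorphic [holomorphic_intros]:
  assumes "f holomorphic_on A" "\<And>z. z \<in> A \<Longrightarrow> norm (f z) < 1"
  shows "(\<lambda>z. psi (f z)) holomorphic_on A"
proof -
  have "(psi_log \<circ> f) holomorphic_on A"
    using assms by (intro holomorphic_on_compose_gen[OF _ psi_log_holomorphic]) auto
  then show ?thesis unfolding psi_def comp_def by (intro holomorphic_intros)
qed

lemma psi_nonzero [simp]: "psi u \<noteq> 0" by (simp add: psi_def)

text \<open>The factor \<open>1 - q ^ k\<close> cancels the small divisor in
  \<open>psi_coeff k\<close>, so the logarithms differ by the plain series of ln (1 - u).\<close>

lemma psi_step: assumes u: "norm u < 1" shows "psi u = (1 - u) * psi (q * u)"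
proof -
  have "(\<lambda>k. psi_coeff k * u ^ k - psi_coeff k * (q * u) ^ k) sums (psi_log u - psi_log (q * u))"
    using u by (intro sums_diff psi_log_sums) (auto simp: norm_mult)
  moreover have "psi_coeff k * u ^ k - psi_coeff k * (q * u) ^ k = u ^ k / of_nat k" for k
  proof -
    have "psi_coeff k * u ^ k - psi_coeff k * (q * u) ^ k = (psi_coeff k * (1 - q ^ k)) * u ^ k"
      by (simp add: power_mult_distrib algebra_simps)
    also have "psi_coeff k * (1 - q ^ k) = 1 / of_nat k"
      using q_power_neq_1[of k] by (cases "k = 0") (auto simp: psi_coeff_def)
    finally show ?thesis by simp
  qed
  ultimately have "(\<lambda>k. u ^ k / of_nat k) sums (psi_log u - psi_log (q * u))" by simp
  moreover have "(\<lambda>k. - (- (u ^ k / of_nat k))) sums (- ln (1 - u))"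
    using sums_minus[OF Ln_series'[of "- u"]] u by simp
  ultimately have "psi_log u - psi_log (q * u) = - ln (1 - u)"
    using sums_unique2 by fastforce
  then have "- psi_log u = ln (1 - u) + - psi_log (q * u)" by (simp add: algebra_simps)
  then have "psi u = exp (ln (1 - u)) * psi (q * u)" by (simp only: psi_def exp_add)
  moreover have "1 - u \<noteq> 0" using u by auto
  ultimately show ?thesis by simp
qed

definition W :: "nat \<Rightarrow> complex \<Rightarrow> complex" where
  "W a z = ee ((z - of_real (a * p)) / of_real j)"

lemma W_nonzero [simp]: "W a z \<noteq> 0" by (simp add: W_def)

lemma norm_W: "norm (W a z) = exp (- 2 * pi * (Im z / j))"
  by (simp add: W_def norm_ee)

lemma W_Suc: "W (Suc a) z = W a z / q"
  unfolding W_def q_alt ee_diff[symmetric]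
  by (rule arg_cong[where f = ee]) (use j_pos in \<open>simp add: field_simps\<close>)

lemma W_Suc_shift: "W (Suc a) (z + of_real p) = W a z"
  unfolding W_def by (rule arg_cong[where f = ee]) (simp add: algebra_simps)

lemma W_shift_p: "W a (z + of_real p) = q * W a z"
  using W_Suc[of a "z + of_real p"] by (simp add: W_Suc_shift field_simps)

lemma W_add: "W a (z + x) = W a z * ee (x / of_real j)"
  unfolding W_def ee_add[symmetric]
  by (rule arg_cong[where f = ee]) (simp add: diff_divide_distrib add_divide_distrib)

lemma W_add_index: "W (a + b) (z + x) = W a z * W b x"
  unfolding W_def ee_add[symmetric] by (rule arg_cong[where f = ee]) (use j_pos in \<open>simp add: field_simps\<close>)

text \<open>By \<open>n p = j - 1\<close> the two arguments differ by the full period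
  \<open>j\<close>. This ties the index modulo \<open>n\<close> to the shift by 1.\<close>

lemma W_shift_n: "W (a + n) z = W a (z + 1)"
proof -
  have "of_real (n * p) = of_real j - (1 :: complex)" unfolding np_eq by simp
  then have "(z - of_real ((a + n) * p)) / of_real j = (z + 1 - of_real (a * p)) / of_real j - of_nat 1"
    using j_pos by (simp add: field_simps distrib_right)
  then have "W (a + n) z = W a (z + 1) / ee (of_nat 1)" unfolding W_def
    by (simp only: ee_diff of_nat_add)
  then show ?thesis by (simp only: ee_of_nat div_by_1)
qed

lemma holomorphic_on_W [holomorphic_intros]:
  "f holomorphic_on A \<Longrightarrow> (\<lambda>z. W a (f z)) holomorphic_on A"
  unfolding W_def by (intro holomorphic_intros) (use j_pos in auto)

lemma continuous_on_W [continuous_intros]: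
  "continuous_on A f \<Longrightarrow> continuous_on A (\<lambda>z. W a (f z))"
  unfolding W_def by (intro continuous_intros) (use j_pos in auto)

lemma W_eq_1_iff: "W a z = 1 \<longleftrightarrow> (\<exists>l::int. z = of_real (a * p + l * j))"
proof -
  have "W a z = 1 \<longleftrightarrow> (\<exists>l::int. (z - of_real (a * p)) / of_real j = of_int l)"
    unfolding W_def ee_eq_1_iff by (auto elim: Ints_cases)
  also have "\<dots> \<longleftrightarrow> (\<exists>l::int. z = of_real (a * p + l * j))"
    using j_pos by (intro ex_cong1) (auto simp: field_simps)
  finally show ?thesis .
qed

end

subsection \<open>Integrals of exponentially decaying functions\<close>

lemma integrable_exp_abs:
  assumes "\<delta> > 0"
  shows "integrable lborel (\<lambda>t. K * exp (- \<delta> * \<bar>t\<bar>) :: real)"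
proof -
  define f where "f t = indicator {0..} t *\<^sub>R exp (- \<delta> * t)" for t :: real
  have "(\<lambda>t. exp (- \<delta> * t)) absolutely_integrable_on {0..}"
    using assms by (intro nonnegative_absolutely_integrable_1 integrable_on_exp_minus_to_infinity) auto
  then have "integrable (completion lborel) f"
    by (simp add: f_def[abs_def] set_integrable_def)
  then have f: "integrable lborel f"
    by (subst (asm) integrable_completion) (auto simp: f_def[abs_def])
  have f': "integrable lborel (\<lambda>t. f (0 + (-1) * t))"
    by (rule lborel_integrable_real_affine[OF f]) simp
  have "integrable lborel (\<lambda>t. f t + f (- t))"
    using Bochner_Integration.integrable_add[OF f f'] by simp
  then have "integrable lborel (\<lambda>t. exp (- \<delta> * \<bar>t\<bar>) :: real)"
    by (rule Bochner_Integration.integrable_bound) (auto simp: f_def indicator_def abs_if)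
  then show ?thesis by simp
qed

lemma exp_decay_integrable:
  fixes f :: "real \<Rightarrow> complex"
  assumes "continuous_on UNIV f" "\<delta> > 0" "\<And>t. norm (f t) \<le> K * exp (- \<delta> * \<bar>t\<bar>)"
  shows "integrable lborel f"
proof (rule Bochner_Integration.integrable_bound[OF integrable_exp_abs[OF assms(2), of K]])
  show "f \<in> borel_measurable lborel" using borel_measurable_continuous_onI[OF assms(1)] by simp
  show "AE t in lborel. norm (f t) \<le> norm (K * exp (- \<delta> * \<bar>t\<bar>))"
    using assms(3) by (intro AE_I2) (smt (verit) real_norm_def)
qed

lemma tendsto_integral_lborel:
  fixes f :: "real \<Rightarrow> complex"
  assumes "integrable lborel f"
  shows "((\<lambda>T. integral {-T..T} f) \<longlongrightarrow> (LINT t|lborel. f t)) at_top"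
proof -
  have "((\<lambda>T. LINT t|lborel. indicator {-T..T} t *\<^sub>R f t) \<longlongrightarrow> (LINT t|lborel. f t)) at_top"
  proof (rule integral_dominated_convergence_at_top[where w = "\<lambda>t. norm (f t)"])
    show "AE t in lborel. ((\<lambda>T. indicator {-T..T} t *\<^sub>R f t) \<longlongrightarrow> f t) at_top"
    proof (rule AE_I2)
      fix t :: real
      have "eventually (\<lambda>T. indicator {-T..T} t *\<^sub>R f t = f t) at_top"
        using eventually_ge_at_top[of "\<bar>t\<bar>"] by eventually_elim (auto simp: indicator_def)
      then show "((\<lambda>T. indicator {-T..T} t *\<^sub>R f t) \<longlongrightarrow> f t) at_top"
        by (rule tendsto_eventually)
    qed
    show "eventually (\<lambda>T. AE t in lborel. norm (indicator {-T..T} t *\<^sub>R f t) \<le> norm (f t)) at_top"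
      by (intro always_eventually allI AE_I2) (auto simp: indicator_def)
  qed (use assms in auto)
  moreover have "(LINT t|lborel. indicator {-T..T} t *\<^sub>R f t) = integral {-T..T} f" for T
  proof -
    have "set_integrable lborel {-T..T} f"
      using assms unfolding set_integrable_def by (intro integrable_mult_indicator) auto
    from set_borel_integral_eq_integral(2)[OF this] show ?thesis
      by (simp add: set_lebesgue_integral_def)
  qed
  ultimately show ?thesis by simp
qed

text \<open>The constant bound serves for t < 0 and the exponential one for t >= 0; together they
  determine the strip 0 < Re z < A, with a rate that is uniform at distance
  \<open>\<epsilon>\<close> from its edges.\<close>

lemma laplace_integrable:
  fixes g :: "real \<Rightarrow> complex"
  assumes cont: "continuous_on UNIV g"
    and b0: "\<And>t. norm (g t) \<le> K" and bA: "\<And>t. norm (g t) \<le> K * exp (- 2 * pi * A * t)"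
    and e: "\<epsilon> > 0" "\<epsilon> \<le> Re z" "Re z \<le> A - \<epsilon>"
  shows "norm (exp (2 * of_real pi * z * of_real t) * g t) \<le> K * exp (- (2 * pi * \<epsilon>) * \<bar>t\<bar>)"
    and "integrable lborel (\<lambda>t. exp (2 * of_real pi * z * of_real t) * g t)"
proof -
  have K: "K \<ge> 0" using b0[of 0] norm_ge_zero order_trans by blast
  have *: "norm (exp (2 * of_real pi * z * of_real t) * g t) \<le> K * exp (- (2 * pi * \<epsilon>) * \<bar>t\<bar>)" for t
  proof (cases "t \<ge> 0")
    case True
    have "norm (exp (2 * of_real pi * z * of_real t) * g t) \<le> exp (2 * pi * Re z * t) * (K * exp (- 2 * pi * A * t))"
      unfolding norm_mult by (intro mult_mono bA) (auto simp: algebra_simps)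
    also have "\<dots> = K * exp (- (2 * pi * (A - Re z)) * t)"
      by (simp add: exp_add[symmetric] algebra_simps)
    also have "\<dots> \<le> K * exp (- (2 * pi * \<epsilon>) * \<bar>t\<bar>)"
      using K True e by (intro mult_left_mono) (auto intro!: mult_right_mono mult_left_mono)
    finally show ?thesis .
  next
    case False
    have "norm (exp (2 * of_real pi * z * of_real t) * g t) \<le> exp (2 * pi * Re z * t) * K"
      unfolding norm_mult by (intro mult_mono b0) (auto simp: algebra_simps)
    also have "exp (2 * pi * Re z * t) \<le> exp (- (2 * pi * \<epsilon>) * \<bar>t\<bar>)"
    proof -
      have "Re z * t \<le> \<epsilon> * t" using False e by (intro mult_right_mono_neg) auto
      from mult_left_mono[OF this, of "2 * pi"] show ?thesis using False by (simp add: mult_ac)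
    qed
    then have "exp (2 * pi * Re z * t) * K \<le> K * exp (- (2 * pi * \<epsilon>) * \<bar>t\<bar>)"
      using K by (simp add: mult.commute mult_left_mono)
    finally show ?thesis .
  qed
  then show "norm (exp (2 * of_real pi * z * of_real t) * g t) \<le> K * exp (- (2 * pi * \<epsilon>) * \<bar>t\<bar>)" .
  show "integrable lborel (\<lambda>t. exp (2 * of_real pi * z * of_real t) * g t)"
    by (rule exp_decay_integrable[where \<delta> = "2 * pi * \<epsilon>", OF _ _ *]) (use e in \<open>auto intro!: continuous_intros cont\<close>)
qed

text \<open>Truncated integrals are holomorphic by differentiation under the integral, and on a
  closed disc inside the strip one integrable majorant makes the tails uniformly small.\<close>

lemma laplace_holomorphic:
  fixes g :: "real \<Rightarrow> complex"
  assumes cont: "continuous_on UNIV g"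
    and b0: "\<And>t. norm (g t) \<le> K" and bA: "\<And>t. norm (g t) \<le> K * exp (- 2 * pi * A * t)"
  shows "(\<lambda>z. LINT t|lborel. exp (2 * of_real pi * z * of_real t) * g t) holomorphic_on {z. 0 < Re z \<and> Re z < A}"
proof -
  define S where "S = {z. 0 < Re z \<and> Re z < A}"
  define h where "h z t = exp (2 * of_real pi * z * of_real t) * g t" for z t
  define f where "f k z = integral (cbox (- real k) (real k)) (h z)" for k z
  have S: "open S" unfolding S_def by (intro open_Collect_conj open_Collect_less continuous_intros)
  have cS: "convex S"
  proof -
    have "S = Re -` {0<..<A}" by (auto simp: S_def)
    also have "convex \<dots>" by (intro convex_linear_vimage) (auto simp: linear_iff)
    finally show ?thesis .
  qed
  have g2: "continuous_on B (\<lambda>x. g (snd x))" for B :: "(complex \<times> real) set"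
    by (rule continuous_on_compose2[OF cont]) (auto intro!: continuous_intros)
  have hcont: "continuous_on UNIV (h z)" for z
    unfolding h_def by (intro continuous_intros cont)
  have fhol: "f k holomorphic_on S" for k unfolding f_def
  proof (rule leibniz_rule_holomorphic[OF _ _ _ cS])
    show "((\<lambda>z. h z t) has_field_derivative 2 * of_real pi * of_real t * h z t) (at z within S)" for z t
      unfolding h_def by (auto intro!: derivative_eq_intros)
    show "h z integrable_on cbox (- real k) (real k)" for z
      by (intro integrable_continuous continuous_on_subset[OF hcont]) auto
    show "continuous_on (S \<times> cbox (- real k) (real k)) (\<lambda>(z, t). 2 * of_real pi * of_real t * h z t)"
      unfolding h_def split_beta by (intro continuous_intros g2)
  qed
  have "(\<lambda>z. LINT t|lborel. h z t) holomorphic_on S"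
  proof (rule holomorphic_uniform_sequence[OF S fhol])
    fix z assume z: "z \<in> S"
    \<comment> \<open>Half the distance to the edges: the closed disc of radius
      \<open>\<epsilon>\<close> then still keeps distance \<open>\<epsilon>\<close> from
      them.\<close>
    define \<epsilon> where "\<epsilon> = min (Re z) (A - Re z) / 2"
    have e: "\<epsilon> > 0" using z by (auto simp: \<epsilon>_def S_def)
    define w where "w t = K * exp (- (2 * pi * \<epsilon>) * \<bar>t\<bar>)" for t
    have w: "integrable lborel w" unfolding w_def using e by (intro integrable_exp_abs) auto
    have sub: "\<epsilon> \<le> Re y \<and> Re y \<le> A - \<epsilon>" if "y \<in> cball z \<epsilon>" for y
    proof -
      have "\<bar>Re z - Re y\<bar> \<le> \<epsilon>" using that abs_Re_le_cmod[of "z - y"] by (auto simp: dist_norm)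
      moreover have "2 * \<epsilon> \<le> Re z" "2 * \<epsilon> \<le> A - Re z" by (auto simp: \<epsilon>_def)
      ultimately show ?thesis using e by linarith
    qed
    have bd: "norm (h y t) \<le> w t" "integrable lborel (h y)" if "y \<in> cball z \<epsilon>" for y t
      using laplace_integrable[OF cont b0 bA e, of y] sub[OF that] unfolding h_def w_def by auto
    have wc: "w t \<ge> 0" for t using order_trans[OF norm_ge_zero bd(1)[of z t]] e by simp
    have lim: "(\<lambda>k. LINT t|lborel. indicator (- {- real k..real k}) t *\<^sub>R w t) \<longlonglongrightarrow> (LINT t|(lborel :: real measure). (0 :: real))"
    proof (rule integral_dominated_convergence[where w = w])
      show "AE t in lborel. (\<lambda>k. indicator (- {- real k..real k}) t *\<^sub>R w t) \<longlonglongrightarrow> 0"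
      proof (rule AE_I2)
        fix t :: real
        have "eventually (\<lambda>k. indicator (- {- real k..real k}) t *\<^sub>R w t = 0) sequentially"
          using eventually_ge_at_top[of "nat \<lceil>\<bar>t\<bar>\<rceil>"]
        proof eventually_elim
          case (elim k)
          then have "\<bar>t\<bar> \<le> real k" by linarith
          then show ?case by (auto simp: indicator_def)
        qed
        then show "(\<lambda>k. indicator (- {- real k..real k}) t *\<^sub>R w t) \<longlonglongrightarrow> 0" by (rule tendsto_eventually)
      qed
      show "AE t in lborel. norm (indicator (- {- real k..real k}) t *\<^sub>R w t) \<le> w t" for k
        using wc by (intro AE_I2) (auto simp: indicator_def)
      show "(\<lambda>t. indicator (- {- real k..real k}) t *\<^sub>R w t) \<in> borel_measurable lborel" for k
        using w by (intro borel_measurable_scaleR) (auto intro!: borel_measurable_indicator)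
    qed (use w in auto)
    have diff: "norm (f k y - (LINT t|lborel. h y t)) \<le> (LINT t|lborel. indicator (- {- real k..real k}) t *\<^sub>R w t)"
      if "y \<in> cball z \<epsilon>" for k y
    proof -
      have i1: "integrable lborel (\<lambda>t. indicator {- real k..real k} t *\<^sub>R h y t)"
        and i2: "integrable lborel (\<lambda>t. indicator (- {- real k..real k}) t *\<^sub>R h y t)"
        and i3: "integrable lborel (\<lambda>t. indicator (- {- real k..real k}) t *\<^sub>R w t)"
        by (rule integrable_mult_indicator[OF _ bd(2)[OF that]] integrable_mult_indicator[OF _ w], simp)+
      have si: "set_integrable lborel (cbox (- real k) (real k)) (h y)"
        using i1 unfolding set_integrable_def cbox_interval .
      have "f k y = (LINT t|lborel. indicator {- real k..real k} t *\<^sub>R h y t)"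
        unfolding f_def set_borel_integral_eq_integral(2)[OF si, symmetric] set_lebesgue_integral_def
        by (simp add: cbox_interval)
      then have "(LINT t|lborel. h y t) - f k y = (LINT t|lborel. h y t - indicator {- real k..real k} t *\<^sub>R h y t)"
        using bd(2)[OF that] i1 by simp
      also have "\<dots> = (LINT t|lborel. indicator (- {- real k..real k}) t *\<^sub>R h y t)"
        by (intro Bochner_Integration.integral_cong) (auto simp: indicator_def)
      finally have "norm (f k y - (LINT t|lborel. h y t)) = norm (LINT t|lborel. indicator (- {- real k..real k}) t *\<^sub>R h y t)"
        by (metis norm_minus_commute)
      also have "\<dots> \<le> (LINT t|lborel. indicator (- {- real k..real k}) t *\<^sub>R w t)"
        by (rule order_trans[OF integral_norm_bound], rule Bochner_Integration.integral_mono[OF integrable_norm[OF i2] i3])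
           (use bd(1)[OF that] in \<open>auto simp: indicator_def\<close>)
      finally show ?thesis .
    qed
    have "uniform_limit (cball z \<epsilon>) f (\<lambda>z. LINT t|lborel. h z t) sequentially"
    proof (rule uniform_limitI)
      fix \<eta> :: real assume "\<eta> > 0"
      then have "eventually (\<lambda>k. (LINT t|lborel. indicator (- {- real k..real k}) t *\<^sub>R w t) < \<eta>) sequentially"
        using order_tendstoD(2)[OF lim, of \<eta>] by simp
      then show "\<forall>\<^sub>F k in sequentially. \<forall>y\<in>cball z \<epsilon>. dist (f k y) (LINT t|lborel. h y t) < \<eta>"
        by eventually_elim (auto simp: dist_norm intro: le_less_trans[OF diff])
    qed
    moreover have "cball z \<epsilon> \<subseteq> S" using sub e by (fastforce simp: S_def)
    ultimately show "\<exists>d>0. cball z d \<subseteq> S \<and> uniform_limit (cball z d) f (\<lambda>z. LINT t|lborel. h z t) sequentially"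
      using e by blast
  qed
  then show ?thesis by (simp add: h_def S_def)
qed

subsection \<open>Line integrals of Faddeev type\<close>

text \<open>The squares of the two sides differ by (1 + Re w) / 2 times (1 - r)^2, which is
  nonnegative.\<close>

lemma norm_1_minus_ray:
  fixes w :: complex
  assumes "norm w = 1" "r \<ge> 0"
  shows "norm (1 - of_real r * w) \<ge> norm (1 - w) / 2 * (1 + r)"
proof (rule power2_le_imp_le)
  define a where "a = Re w"
  have ab: "a\<^sup>2 + (Im w)\<^sup>2 = 1" using assms(1) by (simp add: a_def cmod_def)
  have a1: "a \<ge> -1" using abs_Re_le_cmod[of w] assms(1) by (simp add: a_def)
  have "(norm (1 - w) / 2 * (1 + r))\<^sup>2 = ((1 - a)\<^sup>2 + (Im w)\<^sup>2) / 4 * (1 + r)\<^sup>2"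
    by (simp add: power_mult_distrib power_divide cmod_power2 a_def)
  also have "(1 - a)\<^sup>2 + (Im w)\<^sup>2 = 2 - 2 * a" using ab by (simp add: power2_eq_square algebra_simps)
  also have "(2 - 2 * a) / 4 * (1 + r)\<^sup>2 \<le> (2 - 2 * a) / 4 * (1 + r)\<^sup>2 + (1 + a) / 2 * (1 - r)\<^sup>2"
    using a1 by simp
  also have "\<dots> = 1 - 2 * r * a + r\<^sup>2 * (a\<^sup>2 + (Im w)\<^sup>2)"
    unfolding ab by (simp add: power2_eq_square field_simps)
  also have "\<dots> = (norm (1 - of_real r * w))\<^sup>2"
    unfolding cmod_power2 by (simp add: a_def power2_eq_square algebra_simps)
  finally show "(norm (1 - w) / 2 * (1 + r))\<^sup>2 \<le> (norm (1 - of_real r * w))\<^sup>2" .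
qed simp

lemma exp_2pi: "exp (2 * of_real pi * z) = ee (- \<i> * z)"
  by (simp add: ee_def mult.assoc)

text \<open>The condition 0 < a c < 1 puts the line strictly between two adjacent zeros, so the
  constant phase \<open>w\<close> differs from 1.\<close>

lemma norm_1_minus_exp_line:
  fixes a c :: real
  assumes "0 < a * c" "a * c < 1"
  obtains K where "K > 0" "\<And>t. norm (1 - exp (2 * of_real pi * of_real a * (of_real t + \<i> * of_real c))) \<ge> K * (1 + exp (2 * pi * a * t))"
proof -
  define w where "w = ee (of_real (a * c))"
  have "w \<noteq> 1"
  proof
    assume "w = 1"
    then obtain l :: int where "complex_of_real (a * c) = of_int l" unfolding w_def ee_eq_1_iff by (elim Ints_cases)
    then have "a * c = of_int l" by (metis of_real_eq_iff of_real_of_int_eq)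
    then show False using assms by simp
  qed
  have w1: "norm w = 1" by (simp add: w_def norm_ee)
  have "exp (2 * of_real pi * of_real a * (of_real t + \<i> * of_real c)) = of_real (exp (2 * pi * a * t)) * w" for t
    unfolding w_def ee_def exp_of_real[symmetric] exp_add[symmetric]
    by (rule arg_cong[where f = exp]) (simp add: algebra_simps)
  then have "norm (1 - exp (2 * of_real pi * of_real a * (of_real t + \<i> * of_real c))) \<ge> norm (1 - w) / 2 * (1 + exp (2 * pi * a * t))" for t
    using norm_1_minus_ray[OF w1, of "exp (2 * pi * a * t)"] by simp
  then show ?thesis using that[of "norm (1 - w) / 2"] \<open>w \<noteq> 1\<close> by simp
qed

text \<open>Its line integral is a logarithm of \<open>1 - ee z\<close>: for Im z > 0 the residues
  at y = i k, k >= 1, are the terms of the logarithm series.\<close>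

definition H_kernel :: "complex \<Rightarrow> complex" where
  "H_kernel y = 1 / ((1 - exp (2 * of_real pi * y)) * y)"

definition H_int :: "real \<Rightarrow> complex \<Rightarrow> complex" where
  "H_int c z = (LINT t|lborel. exp (2 * of_real pi * z * (of_real t + \<i> * of_real c)) * H_kernel (of_real t + \<i> * of_real c))"

text \<open>The kernel of Faddeev's noncompact dilogarithm with periods 1 and \<open>j\<close>.
  Cancelling either exponential factor leaves an \<open>H_kernel\<close>, which gives the two
  difference equations of \<open>I_int\<close>.\<close>

definition I_kernel :: "real \<Rightarrow> complex \<Rightarrow> complex" where
  "I_kernel j y = 1 / ((1 - exp (2 * of_real pi * y)) * (1 - exp (2 * of_real pi * of_real j * y)) * y)"

definition I_int :: "real \<Rightarrow> real \<Rightarrow> complex \<Rightarrow> complex" where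
  "I_int j c z = (LINT t|lborel. exp (2 * of_real pi * z * (of_real t + \<i> * of_real c)) * I_kernel j (of_real t + \<i> * of_real c))"

lemma norm_line_ge: "norm (of_real t + \<i> * of_real c) \<ge> \<bar>c\<bar>"
  using abs_Im_le_cmod[of "of_real t + \<i> * of_real c"] by simp

lemma H_kernel_bounds:
  assumes "0 < c" "c < 1"
  obtains K where "\<And>t. norm (H_kernel (of_real t + \<i> * of_real c)) \<le> K"
    "\<And>t. norm (H_kernel (of_real t + \<i> * of_real c)) \<le> K * exp (- 2 * pi * 1 * t)"
    "continuous_on UNIV (\<lambda>t. H_kernel (of_real t + \<i> * of_real c))"
proof -
  obtain B where B: "B > 0" "\<And>t. norm (1 - exp (2 * of_real pi * of_real 1 * (of_real t + \<i> * of_real c))) \<ge> B * (1 + exp (2 * pi * 1 * t))"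
    using norm_1_minus_exp_line[of 1 c] assms by auto
  have D: "norm ((1 - exp (2 * of_real pi * (of_real t + \<i> * of_real c))) * (of_real t + \<i> * of_real c)) \<ge> B * c * (1 + exp (2 * pi * t))" for t
  proof -
    have "B * (1 + exp (2 * pi * t)) * c \<le> norm (1 - exp (2 * of_real pi * (of_real t + \<i> * of_real c))) * norm (of_real t + \<i> * of_real c)"
      using B norm_line_ge[of c t] assms by (intro mult_mono) (auto simp: add_nonneg_nonneg)
    then show ?thesis by (simp add: norm_mult mult_ac)
  qed
  have n1: "norm (H_kernel (of_real t + \<i> * of_real c)) \<le> 1 / (B * c) * (1 / (1 + exp (2 * pi * t)))" for t
    using D[of t] B(1) assms unfolding H_kernel_def norm_divide
    by (simp add: frac_le add_pos_pos)
  have n2: "1 / (B * c) * (1 / (1 + exp (2 * pi * t))) \<le> 1 / (B * c)" for t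
    using mult_left_mono[of "1 / (1 + exp (2 * pi * t))" 1 "1 / (B * c)"] B(1) assms
    by (simp add: add_pos_pos)
  have n3: "1 / (B * c) * (1 / (1 + exp (2 * pi * t))) \<le> 1 / (B * c) * exp (- 2 * pi * 1 * t)" for t
    using B(1) assms by (intro mult_left_mono) (auto simp: exp_minus field_simps add_pos_pos)
  have n4: "continuous_on UNIV (\<lambda>t. H_kernel (of_real t + \<i> * of_real c))"
  proof -
    have "(1 - exp (2 * of_real pi * (of_real t + \<i> * of_real c))) * (of_real t + \<i> * of_real c) \<noteq> 0" for t
    proof -
      have "B * c * (1 + exp (2 * pi * t)) > 0" using B assms by (simp add: add_pos_pos)
      with D[of t] show ?thesis by (metis norm_zero linorder_not_le)
    qed
    then show ?thesis unfolding H_kernel_def by (intro continuous_intros) auto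
  qed
  show ?thesis by (rule that[OF order_trans[OF n1 n2] order_trans[OF n1 n3] n4])
qed

lemma I_kernel_bounds:
  assumes "0 < c" "c < 1" "j > 0" "j * c < 1"
  obtains K where "\<And>t. norm (I_kernel j (of_real t + \<i> * of_real c)) \<le> K"
    "\<And>t. norm (I_kernel j (of_real t + \<i> * of_real c)) \<le> K * exp (- 2 * pi * (1 + j) * t)"
    "continuous_on UNIV (\<lambda>t. I_kernel j (of_real t + \<i> * of_real c))"
proof -
  obtain K where K: "\<And>t. norm (H_kernel (of_real t + \<i> * of_real c)) \<le> K"
    "\<And>t. norm (H_kernel (of_real t + \<i> * of_real c)) \<le> K * exp (- 2 * pi * 1 * t)"
    "continuous_on UNIV (\<lambda>t. H_kernel (of_real t + \<i> * of_real c))"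
    using H_kernel_bounds[OF assms(1,2)] by metis
  have K0: "K \<ge> 0" using K(1)[of 0] norm_ge_zero order_trans by blast
  obtain B where B: "B > 0" "\<And>t. norm (1 - exp (2 * of_real pi * of_real j * (of_real t + \<i> * of_real c))) \<ge> B * (1 + exp (2 * pi * j * t))"
    using norm_1_minus_exp_line[of j c] assms by auto
  have pos: "B * (1 + exp (2 * pi * j * t)) > 0" for t using B by (simp add: add_pos_pos)
  have eq: "I_kernel j y = H_kernel y * (1 / (1 - exp (2 * of_real pi * of_real j * y)))" for y
    by (simp add: I_kernel_def H_kernel_def)
  have b: "norm (1 / (1 - exp (2 * of_real pi * of_real j * (of_real t + \<i> * of_real c)))) \<le> 1 / (B * (1 + exp (2 * pi * j * t)))" for t
    unfolding norm_divide norm_one using B(2)[of t] pos[of t] by (intro frac_le) auto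
  have b1: "1 / (B * (1 + exp (2 * pi * j * t))) \<le> 1 / B" for t
    using B(1) by (intro divide_left_mono) (auto simp: add_pos_pos)
  have b2: "1 / (B * (1 + exp (2 * pi * j * t))) \<le> 1 / B * exp (- 2 * pi * j * t)" for t
    using B(1) by (auto simp: exp_minus field_simps add_pos_pos)
  have "norm (I_kernel j (of_real t + \<i> * of_real c)) \<le> K * (1 / B)" for t
    unfolding eq norm_mult using K0 by (intro mult_mono K(1) order_trans[OF b b1]) auto
  moreover have "norm (I_kernel j (of_real t + \<i> * of_real c)) \<le> K * (1 / B) * exp (- 2 * pi * (1 + j) * t)" for t
  proof -
    have "norm (I_kernel j (of_real t + \<i> * of_real c)) \<le> (K * exp (- 2 * pi * 1 * t)) * (1 / B * exp (- 2 * pi * j * t))"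
      unfolding eq norm_mult using K0 by (intro mult_mono K(2) order_trans[OF b b2]) auto
    also have "\<dots> = K * (1 / B) * (exp (- 2 * pi * 1 * t) * exp (- 2 * pi * j * t))" by simp
    also have "exp (- 2 * pi * 1 * t) * exp (- 2 * pi * j * t) = exp (- 2 * pi * (1 + j) * t)"
      unfolding exp_add[symmetric] by (rule arg_cong[where f = exp]) (simp add: algebra_simps)
    finally show ?thesis .
  qed
  moreover have "continuous_on UNIV (\<lambda>t. I_kernel j (of_real t + \<i> * of_real c))"
  proof -
    have "1 - exp (2 * of_real pi * of_real j * (of_real t + \<i> * of_real c)) \<noteq> 0" for t
      using B(2)[of t] pos[of t] by (metis norm_zero linorder_not_le)
    then show ?thesis unfolding eq by (intro continuous_intros K(3)) auto
  qed
  ultimately show ?thesis by (rule that)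
qed

lemma split_line_exp:
  "exp (2 * of_real pi * z * (of_real t + \<i> * of_real c)) * k =
   ee (of_real c * z) * (exp (2 * of_real pi * z * of_real t) * k)"
  unfolding ee_def mult.assoc[symmetric] exp_add[symmetric]
  by (simp add: algebra_simps)

lemma H_int_strip:
  assumes c: "0 < c" "c < 1"
  shows H_int_holomorphic: "H_int c holomorphic_on {z. 0 < Re z \<and> Re z < 1}"
    and H_int_integrable: "0 < Re z \<Longrightarrow> Re z < 1 \<Longrightarrow> integrable lborel
      (\<lambda>t. exp (2 * of_real pi * z * (of_real t + \<i> * of_real c)) * H_kernel (of_real t + \<i> * of_real c))"
proof -
  obtain K where K: "\<And>t. norm (H_kernel (of_real t + \<i> * of_real c)) \<le> K"
    "\<And>t. norm (H_kernel (of_real t + \<i> * of_real c)) \<le> K * exp (- 2 * pi * 1 * t)"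
    "continuous_on UNIV (\<lambda>t. H_kernel (of_real t + \<i> * of_real c))"
    using H_kernel_bounds[OF c] by metis
  show "H_int c holomorphic_on {z. 0 < Re z \<and> Re z < 1}"
    unfolding H_int_def[abs_def] split_line_exp integral_mult_right_zero
    by (intro holomorphic_intros laplace_holomorphic[OF K(3,1,2)])
  show "integrable lborel (\<lambda>t. exp (2 * of_real pi * z * (of_real t + \<i> * of_real c)) * H_kernel (of_real t + \<i> * of_real c))"
    if "0 < Re z" "Re z < 1"
    unfolding split_line_exp
    by (intro integrable_mult_right laplace_integrable(2)[OF K(3,1,2), of "min (Re z) (1 - Re z)"]) (use that in auto)
qed

lemma I_int_strip:
  assumes c: "0 < c" "c < 1" "j > 0" "j * c < 1"
  shows I_int_holomorphic: "I_int j c holomorphic_on {z. 0 < Re z \<and> Re z < 1 + j}"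
    and I_int_integrable: "0 < Re z \<Longrightarrow> Re z < 1 + j \<Longrightarrow> integrable lborel
      (\<lambda>t. exp (2 * of_real pi * z * (of_real t + \<i> * of_real c)) * I_kernel j (of_real t + \<i> * of_real c))"
    and I_int_bound: "0 < x \<Longrightarrow> x < 1 + j \<Longrightarrow> \<exists>M. \<forall>y. norm (I_int j c (Complex x y)) \<le> M * exp (- 2 * pi * c * y)"
proof -
  obtain K where K: "\<And>t. norm (I_kernel j (of_real t + \<i> * of_real c)) \<le> K"
    "\<And>t. norm (I_kernel j (of_real t + \<i> * of_real c)) \<le> K * exp (- 2 * pi * (1 + j) * t)"
    "continuous_on UNIV (\<lambda>t. I_kernel j (of_real t + \<i> * of_real c))"
    using I_kernel_bounds[OF c] by metis
  show "I_int j c holomorphic_on {z. 0 < Re z \<and> Re z < 1 + j}"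
    unfolding I_int_def[abs_def] split_line_exp integral_mult_right_zero
    by (intro holomorphic_intros laplace_holomorphic[OF K(3,1,2)])
  show "integrable lborel (\<lambda>t. exp (2 * of_real pi * z * (of_real t + \<i> * of_real c)) * I_kernel j (of_real t + \<i> * of_real c))"
    if "0 < Re z" "Re z < 1 + j"
    unfolding split_line_exp
    by (intro integrable_mult_right laplace_integrable(2)[OF K(3,1,2), of "min (Re z) (1 + j - Re z)"]) (use that in auto)
  show "\<exists>M. \<forall>y. norm (I_int j c (Complex x y)) \<le> M * exp (- 2 * pi * c * y)" if x: "0 < x" "x < 1 + j"
  proof -
    define M where "M = (LINT t|lborel. norm (exp (2 * of_real pi * of_real x * of_real t) * I_kernel j (of_real t + \<i> * of_real c)))"
    have "norm (I_int j c (Complex x y)) \<le> M * exp (- 2 * pi * c * y)" for y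
    proof -
      have "norm (I_int j c (Complex x y)) = exp (- 2 * pi * c * y) *
          norm (LINT t|lborel. exp (2 * of_real pi * Complex x y * of_real t) * I_kernel j (of_real t + \<i> * of_real c))"
        unfolding I_int_def split_line_exp integral_mult_right_zero norm_mult by (simp add: norm_ee)
      also have "norm (LINT t|lborel. exp (2 * of_real pi * Complex x y * of_real t) * I_kernel j (of_real t + \<i> * of_real c)) \<le>
          (LINT t|lborel. norm (exp (2 * of_real pi * Complex x y * of_real t) * I_kernel j (of_real t + \<i> * of_real c)))"
        by (rule integral_norm_bound)
      also have "\<dots> = M" unfolding M_def norm_mult by simp
      finally show ?thesis by (simp add: mult.commute)
    qed
    then show ?thesis by blast
  qed
qed

definition H_integrand :: "complex \<Rightarrow> complex \<Rightarrow> complex" where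
  "H_integrand z y = exp (2 * of_real pi * z * y) * H_kernel y"

lemma H_int_alt: "H_int c z = (LINT t|lborel. H_integrand z (of_real t + \<i> * of_real c))"
  by (simp add: H_int_def H_integrand_def)

lemma norm_H_integrand:
  "norm (H_integrand z (of_real t + \<i> * of_real c)) =
     exp (2 * pi * (Re z * t - Im z * c)) /
       (norm (1 - exp (2 * of_real pi * (of_real t + \<i> * of_real c))) * norm (of_real t + \<i> * of_real c))"
proof -
  have "Re (2 * of_real pi * z * (of_real t + \<i> * of_real c)) = 2 * pi * (Re z * t - Im z * c)"
    by (simp add: algebra_simps)
  then show ?thesis
    unfolding H_integrand_def H_kernel_def by (simp add: norm_mult norm_divide norm_exp_eq_Re del: norm_exp)
qed

lemma exp_line_shift:
  "exp (2 * of_real pi * (of_real t + \<i> * of_real (c + real k))) = exp (2 * of_real pi * (of_real t + \<i> * of_real c))"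
proof -
  have eq: "- \<i> * (of_real t + \<i> * of_real (c + real k)) = - \<i> * (of_real t + \<i> * of_real c) + of_nat k"
    by (simp add: algebra_simps)
  show ?thesis unfolding exp_2pi eq ee_add by simp
qed

lemma exp_line_neq_1:
  assumes "0 < c" "c < 1"
  shows "exp (2 * of_real pi * (of_real t + \<i> * of_real c)) \<noteq> 1"
proof -
  obtain K where "K > 0" "norm (1 - exp (2 * of_real pi * of_real 1 * (of_real t + \<i> * of_real c))) \<ge> K * (1 + exp (2 * pi * 1 * t))"
    using norm_1_minus_exp_line[of 1 c] assms by auto
  moreover have "K * (1 + exp (2 * pi * 1 * t)) > 0" using \<open>K > 0\<close> by (simp add: add_pos_pos)
  ultimately show ?thesis by auto
qed

text \<open>Raising the line by an integer k leaves the exponential in the kernel unchanged,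
  enlarges |y|, and scales the numerator by exp (-2 pi k Im z). For Im z > 0 the integrals over the
  raised lines thus tend to 0.\<close>

lemma
  assumes c: "0 < c" "c < 1" and z: "0 < Re z" "Re z < 1"
  shows H_integrand_shift_integrable: "integrable lborel (\<lambda>t. H_integrand z (of_real t + \<i> * of_real (c + real k)))"
    and H_int_shift_bound: "norm (H_int (c + real k) z) \<le> exp (- 2 * pi * Im z * k) *
      (LINT t|lborel. norm (H_integrand z (of_real t + \<i> * of_real c)))"
proof -
  define f where "f k t = H_integrand z (of_real t + \<i> * of_real (c + real k))" for k t
  have int0: "integrable lborel (f 0)"
    using H_int_integrable[OF c z] by (simp add: f_def[abs_def] H_integrand_def)
  have b: "norm (f k t) \<le> exp (- 2 * pi * Im z * k) * norm (f 0 t)" for t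
  proof -
    have pos: "norm (of_real t + \<i> * of_real c) > 0" using c norm_line_ge[of c t] by linarith
    have "norm (of_real t + \<i> * of_real c) \<le> norm (of_real t + \<i> * of_real (c + real k))"
      using c by (simp add: cmod_def power_mono add_nonneg_nonneg)
    then have "norm (f k t) \<le> exp (2 * pi * (Re z * t - Im z * (c + real k))) /
       (norm (1 - exp (2 * of_real pi * (of_real t + \<i> * of_real c))) * norm (of_real t + \<i> * of_real c))"
      unfolding f_def norm_H_integrand exp_line_shift using pos exp_line_neq_1[OF c, of t]
      by (intro divide_left_mono mult_left_mono mult_pos_pos) auto
    also have "exp (2 * pi * (Re z * t - Im z * (c + real k))) = exp (- 2 * pi * Im z * k) * exp (2 * pi * (Re z * t - Im z * c))"
      unfolding exp_add[symmetric] by (rule arg_cong[where f = exp]) (simp add: algebra_simps)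
    finally show ?thesis by (simp add: f_def norm_H_integrand)
  qed
  have ne: "1 - exp (2 * of_real pi * (of_real t + \<i> * of_real (c + real k))) \<noteq> 0"
    "of_real t + \<i> * of_real (c + real k) \<noteq> 0" for t
    using exp_line_neq_1[OF c, of t] norm_line_ge[of "c + real k" t] c unfolding exp_line_shift by auto
  have cont: "continuous_on UNIV (f k)"
    unfolding f_def H_integrand_def H_kernel_def using ne by (intro continuous_intros) auto
  show int: "integrable lborel (\<lambda>t. H_integrand z (of_real t + \<i> * of_real (c + real k)))"
    unfolding f_def[symmetric]
  proof (rule Bochner_Integration.integrable_bound)
    show "integrable lborel (\<lambda>t. exp (- 2 * pi * Im z * k) * norm (f 0 t))"
      by (intro integrable_mult_right integrable_norm int0)
    show "f k \<in> borel_measurable lborel" using borel_measurable_continuous_onI[OF cont] by simp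
    show "AE t in lborel. norm (f k t) \<le> norm (exp (- 2 * pi * Im z * k) * norm (f 0 t))"
      using b by (intro AE_I2) (simp add: abs_mult)
  qed
  have "norm (H_int (c + real k) z) \<le> (LINT t|lborel. exp (- 2 * pi * Im z * k) * norm (f 0 t))"
    unfolding H_int_alt f_def[symmetric]
    by (rule order_trans[OF integral_norm_bound], rule Bochner_Integration.integral_mono)
       (use int int0 b in \<open>auto simp: f_def[symmetric] simp del: of_real_add\<close>)
  then show "norm (H_int (c + real k) z) \<le> exp (- 2 * pi * Im z * k) *
      (LINT t|lborel. norm (H_integrand z (of_real t + \<i> * of_real c)))"
    by (simp add: f_def)
qed

lemma H_int_step:
  assumes c: "0 < c" "c < 1" and z: "0 < Re z" "Re z < 1"
  shows "H_int (c + real k) z - H_int (c + real (Suc k)) z = - (ee (of_nat (Suc k) * z) / of_nat (Suc k))"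
proof -
  define b where "b = c + real (Suc k)"
  \<comment> \<open>This substitution turns the horizontal lines at heights \<open>b\<close> and
    \<open>b - 1\<close> into Re \<zeta> = 0 and Re \<zeta> = 1, and the only pole between them, y =
    i (k + 1), into \<zeta> = c.\<close>
  define F where "F \<zeta> = H_integrand z (\<i> * of_real b - \<i> * \<zeta>)" for \<zeta>
  define r where "r = - (ee (of_nat (Suc k) * z) / (2 * of_real pi * of_nat (Suc k)))"
  define \<epsilon> where "\<epsilon> = min c (1 - c) / 2"
  have e: "\<epsilon> > 0" "\<epsilon> < c" "\<epsilon> < 1 - c" using c by (auto simp: \<epsilon>_def min_def)
  have y: "\<i> * of_real b - \<i> * (of_real x + \<i> * of_real t) = of_real t + \<i> * of_real (b - x)" for x t
    by (simp add: algebra_simps)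
  have expy: "exp (2 * of_real pi * (\<i> * of_real b - \<i> * \<zeta>)) = inverse (ee (\<zeta> - of_real c))" for \<zeta>
  proof -
    have "- \<i> * (\<i> * of_real b - \<i> * \<zeta>) = - (\<zeta> - of_real c) + of_nat (Suc k)"
      by (simp add: b_def algebra_simps)
    then show ?thesis unfolding exp_2pi by (simp only: ee_add ee_minus ee_of_nat mult_1_right)
  qed
  have res: "((\<lambda>\<zeta>. (\<zeta> - of_real c) * F \<zeta>) \<longlongrightarrow> r) (at (of_real c))"
  proof -
    have eq: "(\<zeta> - of_real c) * F \<zeta> = ((\<zeta> - of_real c) * (2 * of_real pi * \<i> / (ee (\<zeta> - of_real c) - 1))) *
       (ee (\<zeta> - of_real c) * exp (2 * of_real pi * z * (\<i> * of_real b - \<i> * \<zeta>)) / (2 * of_real pi * \<i> * (\<i> * of_real b - \<i> * \<zeta>)))" for \<zeta>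
    proof -
      define E where "E = ee (\<zeta> - of_real c)"
      have "1 - inverse E = (E - 1) / E" by (simp add: E_def field_simps)
      then show ?thesis unfolding F_def H_integrand_def H_kernel_def expy E_def[symmetric] by simp
    qed
    have "((\<lambda>\<zeta>. (\<zeta> - of_real c) * F \<zeta>) \<longlongrightarrow> 1 *
       (ee (of_real c - of_real c) * exp (2 * of_real pi * z * (\<i> * of_real b - \<i> * of_real c)) / (2 * of_real pi * \<i> * (\<i> * of_real b - \<i> * of_real c)))) (at (of_real c))"
      unfolding eq by (intro tendsto_intros ee_quotient_limit) (simp add: b_def del: of_nat_Suc)
    moreover have "\<i> * of_real b - \<i> * of_real c = \<i> * of_nat (Suc k)" by (simp add: b_def algebra_simps)
    moreover have "exp (2 * of_real pi * z * (\<i> * of_nat (Suc k))) = ee (of_nat (Suc k) * z)"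
      unfolding ee_def by (rule arg_cong[where f = exp]) (simp add: algebra_simps)
    moreover have "2 * of_real pi * \<i> * (\<i> * of_nat (Suc k)) = - (2 * complex_of_real pi * of_nat (Suc k))"
      by (simp add: algebra_simps)
    ultimately show ?thesis by (simp add: r_def del: of_nat_Suc)
  qed
  have hol: "F holomorphic_on {\<zeta>. - \<epsilon> < slope_re \<i> \<zeta> \<and> slope_re \<i> \<zeta> < 1 + \<epsilon>} - {of_real c}"
  proof -
    have "1 - exp (2 * of_real pi * (\<i> * of_real b - \<i> * \<zeta>)) \<noteq> 0 \<and> \<i> * of_real b - \<i> * \<zeta> \<noteq> 0"
      if \<zeta>: "- \<epsilon> < Re \<zeta>" "Re \<zeta> < 1 + \<epsilon>" "\<zeta> \<noteq> of_real c" for \<zeta>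
    proof (rule conjI; rule notI)
      assume "1 - exp (2 * of_real pi * (\<i> * of_real b - \<i> * \<zeta>)) = 0"
      then have "ee (\<zeta> - of_real c) = 1" unfolding expy by simp
      then obtain l :: int where l: "\<zeta> - of_real c = of_int l" unfolding ee_eq_1_iff by (elim Ints_cases)
      then have "Re \<zeta> = c + of_int l" by (metis Re_complex_of_real add.commute diff_add_cancel minus_complex.simps(1) complex_Re_of_int)
      then have "real_of_int l > -1" "real_of_int l < 1" using \<zeta> e by linarith+
      then have "l = 0" by simp
      then show False using l \<zeta> by simp
    next
      assume "\<i> * of_real b - \<i> * \<zeta> = 0"
      then have "\<zeta> = of_real b" by simp
      then show False using \<zeta> e by (simp add: b_def)
    qed
    then show ?thesis unfolding F_def H_integrand_def H_kernel_def
      by (intro holomorphic_intros) (auto simp: slope_re_def)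
  qed
  \<comment> \<open>Bounds the factor exp (-2 pi Im z (b - x)) for all x in [0, 1].\<close>
  define M where "M = exp (2 * pi * (\<bar>Im z\<bar> * (b + 1)))"
  have nF: "norm (F (of_real x + \<i> * of_real t)) \<le> M * exp (2 * pi * Re z * t) / D"
    if "x \<in> {0..1}" "\<bar>t\<bar> \<ge> 1" "D > 0" "D \<le> norm (1 - exp (2 * of_real pi * (of_real t + \<i> * of_real (b - x))))" for x t D
  proof -
    have "1 \<le> norm (of_real t + \<i> * of_real (b - x))"
      using that(2) abs_Re_le_cmod[of "of_real t + \<i> * of_real (b - x)"] by simp
    with that have D: "D * 1 \<le> norm (1 - exp (2 * of_real pi * (of_real t + \<i> * of_real (b - x)))) * norm (of_real t + \<i> * of_real (b - x))"
      by (intro mult_mono) auto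
    have "- (Im z * (b - x)) \<le> \<bar>Im z\<bar> * (b + 1)"
    proof -
      have "- (Im z * (b - x)) \<le> \<bar>Im z\<bar> * \<bar>b - x\<bar>" by (metis abs_mult abs_ge_minus_self)
      also have "\<dots> \<le> \<bar>Im z\<bar> * (b + 1)" using that c by (intro mult_left_mono) (auto simp: b_def)
      finally show ?thesis .
    qed
    from mult_left_mono[OF this, of "2 * pi"]
    have "2 * pi * (Re z * t - Im z * (b - x)) \<le> 2 * pi * (\<bar>Im z\<bar> * (b + 1)) + 2 * pi * Re z * t"
      by (simp add: algebra_simps)
    then have "exp (2 * pi * (Re z * t - Im z * (b - x))) \<le> M * exp (2 * pi * Re z * t)"
      unfolding M_def exp_add[symmetric] by (subst exp_le_cancel_iff)
    then show ?thesis unfolding F_def y norm_H_integrand using D that(3) by (intro frac_le) (auto simp: M_def)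
  qed
  have lim: "((\<lambda>T. \<i> * integral {-T..T} (\<lambda>t. F (1 + \<i> * of_real t) - F (\<i> * of_real t)))
     \<longlongrightarrow> 2 * of_real pi * \<i> * (\<Sum>z\<in>{complex_of_real c}. r) + 0) at_top"
  proof (rule tendsto_strip_residues[where \<epsilon> = \<epsilon>])
    show "F holomorphic_on {z. - \<epsilon> < slope_re \<i> z \<and> slope_re \<i> z < 1 + \<epsilon>} - {of_real c}" by (rule hol)
    show "\<epsilon> < slope_re \<i> \<zeta> \<and> slope_re \<i> \<zeta> < 1 - \<epsilon>" if "\<zeta> \<in> {of_real c}" for \<zeta>
      using that e by simp
    show "((\<lambda>w. (w - \<zeta>) * F w) \<longlongrightarrow> r) (at \<zeta>)" if "\<zeta> \<in> {of_real c}" for \<zeta>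
      using that res by simp
    show "\<exists>T. \<forall>t\<ge>T. \<forall>x\<in>{0..1}. norm (F (of_real x + \<i> * of_real t) - 0) \<le> \<eta>" if "\<eta> > 0" for \<eta>
    proof -
      have "((\<lambda>t. M * exp (2 * pi * Re z * t) / (exp (2 * pi * t) - 1)) \<longlongrightarrow> 0) at_top"
        using z by real_asymp
      then have "eventually (\<lambda>t. M * exp (2 * pi * Re z * t) / (exp (2 * pi * t) - 1) < \<eta>) at_top"
        using that order_tendstoD(2) by blast
      then have "eventually (\<lambda>t. \<forall>x\<in>{0..1}. norm (F (of_real x + \<i> * of_real t) - 0) \<le> \<eta>) at_top"
        using eventually_ge_at_top[of 1]
      proof eventually_elim
        case (elim t)
        show ?case
        proof
          fix x :: real assume x: "x \<in> {0..1}"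
          have "norm (F (of_real x + \<i> * of_real t)) \<le> M * exp (2 * pi * Re z * t) / (exp (2 * pi * t) - 1)"
          proof (rule nF[OF x])
            have "norm (exp (2 * of_real pi * (of_real t + \<i> * of_real (b - x)))) = exp (2 * pi * t)" by simp
            then show "exp (2 * pi * t) - 1 \<le> norm (1 - exp (2 * of_real pi * (of_real t + \<i> * of_real (b - x))))"
              by (metis norm_minus_commute norm_one norm_triangle_ineq2)
          qed (use elim in auto)
          then show "norm (F (of_real x + \<i> * of_real t) - 0) \<le> \<eta>" using elim by simp
        qed
      qed
      then show ?thesis unfolding eventually_at_top_linorder by blast
    qed
    show "\<exists>T. \<forall>t\<le>-T. \<forall>x\<in>{0..1}. norm (F (of_real x + \<i> * of_real t)) \<le> \<eta>" if "\<eta> > 0" for \<eta>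
    proof -
      have "((\<lambda>t. M * exp (2 * pi * Re z * (- t)) / (1 - exp (2 * pi * (- t)))) \<longlongrightarrow> 0) at_top"
        using z by real_asymp
      then have "eventually (\<lambda>t. M * exp (2 * pi * Re z * (- t)) / (1 - exp (2 * pi * (- t))) < \<eta>) at_top"
        using that order_tendstoD(2) by blast
      then have "eventually (\<lambda>t. M * exp (2 * pi * Re z * (- t)) / (1 - exp (2 * pi * (- t))) < \<eta> \<and> t \<ge> 1) at_top"
        using eventually_ge_at_top[of 1] by eventually_elim auto
      then obtain T where T: "\<And>t. t \<ge> T \<Longrightarrow> M * exp (2 * pi * Re z * (- t)) / (1 - exp (2 * pi * (- t))) < \<eta> \<and> t \<ge> 1"
        unfolding eventually_at_top_linorder by blast
      show ?thesis
      proof (intro exI allI impI ballI)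
        fix t x :: real assume t: "t \<le> -T" and x: "x \<in> {0..1}"
        have t1: "M * exp (2 * pi * Re z * t) / (1 - exp (2 * pi * t)) < \<eta>" "t \<le> -1"
          using T[of "-t"] t by auto
        have "norm (F (of_real x + \<i> * of_real t)) \<le> M * exp (2 * pi * Re z * t) / (1 - exp (2 * pi * t))"
        proof (rule nF[OF x])
          have "norm (exp (2 * of_real pi * (of_real t + \<i> * of_real (b - x)))) = exp (2 * pi * t)" by simp
          then show "1 - exp (2 * pi * t) \<le> norm (1 - exp (2 * of_real pi * (of_real t + \<i> * of_real (b - x))))"
            by (metis norm_one norm_triangle_ineq2)
        qed (use t1 in \<open>auto simp: mult_less_0_iff\<close>)
        then show "norm (F (of_real x + \<i> * of_real t)) \<le> \<eta>" using t1 by simp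
      qed
    qed
  qed (use e in auto)
  have b1: "b - 1 = c + real k" by (simp add: b_def)
  have F1: "F (1 + \<i> * of_real t) = H_integrand z (of_real t + \<i> * of_real (c + real k))"
    and F0: "F (\<i> * of_real t) = H_integrand z (of_real t + \<i> * of_real (c + real (Suc k)))" for t
    using y[of 1 t] y[of 0 t] b1 unfolding F_def b_def[symmetric]
    by (simp_all only: of_real_0 of_real_1 add_0_left diff_0_right)
  note int = H_integrand_shift_integrable[OF c z]
  have "((\<lambda>T. integral {-T..T} (\<lambda>t. F (1 + \<i> * of_real t) - F (\<i> * of_real t)))
     \<longlongrightarrow> (LINT t|lborel. F (1 + \<i> * of_real t) - F (\<i> * of_real t))) at_top"
    unfolding F1 F0 by (intro tendsto_integral_lborel Bochner_Integration.integrable_diff int)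
  also have "(LINT t|lborel. F (1 + \<i> * of_real t) - F (\<i> * of_real t)) = H_int (c + real k) z - H_int (c + real (Suc k)) z"
    unfolding F1 F0 H_int_alt by (intro Bochner_Integration.integral_diff int)
  finally have "((\<lambda>T. \<i> * integral {-T..T} (\<lambda>t. F (1 + \<i> * of_real t) - F (\<i> * of_real t)))
     \<longlongrightarrow> \<i> * (H_int (c + real k) z - H_int (c + real (Suc k)) z)) at_top"
    by (intro tendsto_mult_left)
  from tendsto_unique[OF _ this lim]
  have "\<i> * (H_int (c + real k) z - H_int (c + real (Suc k)) z) = \<i> * (2 * of_real pi * r)" by simp
  then have "H_int (c + real k) z - H_int (c + real (Suc k)) z = 2 * of_real pi * r"
    by (metis complex_i_not_zero mult_left_cancel)
  then show ?thesis by (simp add: r_def del: of_nat_Suc)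
qed

lemma convex_vertical_strip: "convex {z. a < Re z \<and> Re z < b}"
  and open_vertical_strip: "open {z. a < Re z \<and> Re z < b}"
proof -
  have "{z. a < Re z \<and> Re z < b} = Re -` {a<..<b}" by auto
  also have "convex \<dots>" by (intro convex_linear_vimage) (auto simp: linear_iff)
  finally show "convex {z. a < Re z \<and> Re z < b}" .
  show "open {z. a < Re z \<and> Re z < b}"
    by (intro open_Collect_conj open_Collect_less continuous_intros)
qed

text \<open>For Im z > 0, summing the steps over all raised lines leaves the series of ln (1 - ee
  z). The exponentiated identity is single valued and so continues to the whole strip.\<close>

theorem exp_H_int:
  assumes c: "0 < c" "c < 1" and z: "0 < Re z" "Re z < 1"
  shows "exp (H_int c z) = 1 - ee z"
proof -
  have upper: "exp (H_int c z) = 1 - ee z" if z: "0 < Re z" "Re z < 1" "Im z > 0" for z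
  proof -
    have n1: "norm (ee z) < 1" using z by (simp add: norm_ee)
    define N where "N = (LINT t|lborel. norm (H_integrand z (of_real t + \<i> * of_real c)))"
    have "(\<lambda>k. H_int (c + real k) z) \<longlonglongrightarrow> 0"
    proof (rule Lim_null_comparison)
      show "eventually (\<lambda>k. norm (H_int (c + real k) z) \<le> exp (- 2 * pi * Im z * k) * N) sequentially"
        unfolding N_def using H_int_shift_bound[OF c z(1,2)] by (intro always_eventually allI) auto
      show "(\<lambda>k. exp (- 2 * pi * Im z * real k) * N) \<longlonglongrightarrow> 0" using z by real_asymp
    qed
    then have "(\<lambda>k. H_int (c + real (Suc k)) z - H_int (c + real k) z) sums (0 - H_int (c + real 0) z)"
      by (rule telescope_sums)
    then have "(\<lambda>k. - (H_int (c + real (Suc k)) z - H_int (c + real k) z)) sums (- (0 - H_int (c + real 0) z))"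
      by (rule sums_minus)
    moreover have "- (H_int (c + real (Suc k)) z - H_int (c + real k) z) = - (ee z ^ Suc k / of_nat (Suc k))" for k
      using H_int_step[OF c z(1,2), of k] unfolding ee_power by (simp add: algebra_simps)
    ultimately have "(\<lambda>k. - (ee z ^ Suc k / of_nat (Suc k))) sums (H_int c z)" by (simp del: of_nat_Suc power_Suc)
    \<comment> \<open>The added term of index 0 is a division by zero and hence 0.\<close>
    then have "(\<lambda>k. - (ee z ^ k / of_nat k)) sums (H_int c z + - (ee z ^ 0 / of_nat 0))"
      by (subst (asm) sums_Suc_iff[where f = "\<lambda>k. - (ee z ^ k / of_nat k)"]) simp
    moreover have "(\<lambda>k. - (ee z ^ k / of_nat k)) sums ln (1 - ee z)"
      using Ln_series'[of "- ee z"] n1 by simp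
    ultimately have "H_int c z = ln (1 - ee z)" using sums_unique2 by fastforce
    moreover have "1 - ee z \<noteq> 0" using n1 by auto
    ultimately show ?thesis by simp
  qed
  show ?thesis
  proof (rule analytic_continuation_open[where f = "\<lambda>z. exp (H_int c z)" and g = "\<lambda>z. 1 - ee z"])
    show "open ({z. 0 < Re z \<and> Re z < 1} \<inter> {z. Im z > 0})"
      by (intro open_Int open_vertical_strip open_halfspace_Im_gt)
    have "Complex (1/2) 1 \<in> {z. 0 < Re z \<and> Re z < 1} \<inter> {z. Im z > 0}" by simp
    then show "{z. 0 < Re z \<and> Re z < 1} \<inter> {z. Im z > 0} \<noteq> {}" by blast
    show "connected {z. 0 < Re z \<and> Re z < 1}" by (intro convex_connected convex_vertical_strip)
  qed (use upper z in \<open>auto intro!: holomorphic_intros H_int_holomorphic[OF c] open_vertical_strip\<close>)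
qed

lemma I_int_shift_j:
  assumes c: "0 < c" "c < 1" "j > 0" "j * c < 1" and z: "0 < Re z" "Re z < 1"
  shows "I_int j c (z + of_real j) = I_int j c z - H_int c z"
proof -
  define y where "y t = complex_of_real t + \<i> * of_real c" for t
  have ne: "exp (2 * of_real pi * of_real j * y t) \<noteq> 1" for t
  proof -
    obtain K where "K > 0" "norm (1 - exp (2 * of_real pi * of_real j * (of_real t + \<i> * of_real c))) \<ge> K * (1 + exp (2 * pi * j * t))"
      using norm_1_minus_exp_line[of j c] c by auto
    moreover have "K * (1 + exp (2 * pi * j * t)) > 0" using \<open>K > 0\<close> by (simp add: add_pos_pos)
    ultimately show ?thesis by (auto simp: y_def)
  qed
  have "I_int j c z - I_int j c (z + of_real j) = (LINT t|lborel. exp (2 * of_real pi * z * y t) * I_kernel j (y t) -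
      exp (2 * of_real pi * (z + of_real j) * y t) * I_kernel j (y t))"
    unfolding I_int_def y_def[symmetric]
    by (intro Bochner_Integration.integral_diff[symmetric]; unfold y_def; intro I_int_integrable[OF c]; use z c in auto)
  also have "\<dots> = (LINT t|lborel. exp (2 * of_real pi * z * y t) * H_kernel (y t))"
  proof (intro Bochner_Integration.integral_cong refl)
    fix t :: real
    have E: "exp (2 * of_real pi * (z + of_real j) * y t) = exp (2 * of_real pi * z * y t) * exp (2 * of_real pi * of_real j * y t)"
      unfolding exp_add[symmetric] by (rule arg_cong[where f = exp]) (simp add: algebra_simps)
    have K: "I_kernel j (y t) = H_kernel (y t) / (1 - exp (2 * of_real pi * of_real j * y t))"
      by (simp add: I_kernel_def H_kernel_def)
    have "exp (2 * of_real pi * z * y t) * I_kernel j (y t) - exp (2 * of_real pi * (z + of_real j) * y t) * I_kernel j (y t) =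
        exp (2 * of_real pi * z * y t) * ((1 - exp (2 * of_real pi * of_real j * y t)) * I_kernel j (y t))"
      unfolding E by (simp add: algebra_simps)
    also have "(1 - exp (2 * of_real pi * of_real j * y t)) * I_kernel j (y t) = H_kernel (y t)"
      unfolding K using ne[of t] by simp
    finally show "exp (2 * of_real pi * z * y t) * I_kernel j (y t) - exp (2 * of_real pi * (z + of_real j) * y t) * I_kernel j (y t) =
        exp (2 * of_real pi * z * y t) * H_kernel (y t)" .
  qed
  also have "\<dots> = H_int c z" by (simp add: H_int_def y_def)
  finally show ?thesis by (simp add: algebra_simps)
qed

text \<open>Here the factor of period \<open>\<i>\<close> cancels, and rescaling the variable by
  \<open>j\<close> produces \<open>H_kernel\<close> on the line at height
  \<open>j * c\<close>.\<close>

lemma I_int_shift_1: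
  assumes c: "0 < c" "c < 1" "j > 0" "j * c < 1" and z: "0 < Re z" "Re z < j"
  shows "I_int j c (z + 1) = I_int j c z - H_int (j * c) (z / of_real j)"
proof -
  define y where "y t = complex_of_real t + \<i> * of_real c" for t
  note ne = exp_line_neq_1[OF c(1,2), folded y_def]
  have "I_int j c z - I_int j c (z + 1) = (LINT t|lborel. exp (2 * of_real pi * z * y t) * I_kernel j (y t) -
      exp (2 * of_real pi * (z + 1) * y t) * I_kernel j (y t))"
    unfolding I_int_def y_def[symmetric]
    by (intro Bochner_Integration.integral_diff[symmetric]; unfold y_def; intro I_int_integrable[OF c]; use z c in auto)
  also have "\<dots> = (LINT t|lborel. of_real j * H_integrand (z / of_real j) (of_real (0 + j * t) + \<i> * of_real (j * c)))"
  proof (intro Bochner_Integration.integral_cong refl)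
    fix t :: real
    have jz: "2 * of_real pi * (z / of_real j) * (of_real j * y t) = 2 * of_real pi * z * y t"
      using c by simp
    have jy: "of_real (0 + j * t) + \<i> * of_real (j * c) = of_real j * y t" by (simp add: y_def algebra_simps)
    have E: "exp (2 * of_real pi * (z + 1) * y t) = exp (2 * of_real pi * z * y t) * exp (2 * of_real pi * y t)"
      unfolding exp_add[symmetric] by (rule arg_cong[where f = exp]) (simp add: algebra_simps)
    have K: "I_kernel j (y t) = (of_real j * H_kernel (of_real j * y t)) / (1 - exp (2 * of_real pi * y t))"
      using c by (simp add: I_kernel_def H_kernel_def mult_ac)
    have "exp (2 * of_real pi * z * y t) * I_kernel j (y t) - exp (2 * of_real pi * (z + 1) * y t) * I_kernel j (y t) =
        exp (2 * of_real pi * z * y t) * ((1 - exp (2 * of_real pi * y t)) * I_kernel j (y t))"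
      unfolding E by (simp add: algebra_simps)
    also have "(1 - exp (2 * of_real pi * y t)) * I_kernel j (y t) = of_real j * H_kernel (of_real j * y t)"
      unfolding K using ne[of t] by simp
    finally show "exp (2 * of_real pi * z * y t) * I_kernel j (y t) - exp (2 * of_real pi * (z + 1) * y t) * I_kernel j (y t) =
        of_real j * H_integrand (z / of_real j) (of_real (0 + j * t) + \<i> * of_real (j * c))"
      unfolding jy H_integrand_def jz by simp
  qed
  also have "\<dots> = of_real j * (LINT t|lborel. H_integrand (z / of_real j) (of_real (0 + j * t) + \<i> * of_real (j * c)))"
    by simp
  also have "\<dots> = H_int (j * c) (z / of_real j)"
    unfolding H_int_alt using c
    by (subst (2) lborel_integral_real_affine[where c = j and t = 0]) (auto simp: scaleR_conv_of_real)
  finally show ?thesis by (simp add: algebra_simps)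
qed

section \<open>Incommensurable periods on a bounded interval\<close>

lemma countable_Lat: "countable (Lat p)"
proof -
  have "Lat p = (\<lambda>(a, b). of_int a * p + of_int b) ` (UNIV :: (int \<times> int) set)"
    by (auto simp: Lat_def)
  then show ?thesis by (metis countableI_type countable_image)
qed

lemma interval_not_Lat:
  assumes "a < b"
  obtains t where "a < t" "t < b" "t \<notin> Lat p"
proof -
  have "\<not> {a<..<b} \<subseteq> Lat p"
  proof
    assume "{a<..<b} \<subseteq> Lat p"
    then have "countable {a<..<b}" using countable_Lat by (rule countable_subset)
    moreover have "uncountable {a<..<b}" using assms by (simp add: uncountable_open_interval)
    ultimately show False by simp
  qed
  then obtain t where "t \<in> {a<..<b}" "t \<notin> Lat p" by blast
  then show ?thesis by (intro that[of t]) auto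
qed

lemma of_int_in_Lat: "of_int k \<in> Lat p"
  unfolding Lat_def by (force intro: exI[of _ 0])

lemma eq_off_Lat_imp_eq:
  fixes f g :: "real \<Rightarrow> complex"
  assumes "open S" "continuous_on S f" "continuous_on S g"
    and eq: "\<And>x. x \<in> S \<Longrightarrow> x \<notin> Lat p \<Longrightarrow> f x = g x" and x: "x \<in> S"
  shows "f x = g x"
proof (rule ccontr)
  assume "f x \<noteq> g x"
  have cont: "continuous_on S (\<lambda>x. f x - g x)" using assms(2,3) by (intro continuous_intros)
  have "isCont (\<lambda>x. f x - g x) x" using cont assms(1) x by (simp add: continuous_on_eq_continuous_at)
  moreover have "f x - g x \<noteq> 0" using \<open>f x \<noteq> g x\<close> by simp
  ultimately have "eventually (\<lambda>t. f t - g t \<noteq> 0) (at x)"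
    unfolding isCont_def by (rule tendsto_imp_eventually_ne)
  moreover have "eventually (\<lambda>t. t \<in> S) (at x)" using assms(1) x by (rule eventually_at_in_open')
  ultimately have "eventually (\<lambda>t. f t - g t \<noteq> 0 \<and> t \<in> S) (at x)" by eventually_elim auto
  then obtain d where d: "d > 0" "\<And>t. t \<noteq> x \<Longrightarrow> dist t x < d \<Longrightarrow> f t - g t \<noteq> 0 \<and> t \<in> S"
    unfolding eventually_at by blast
  obtain t where "x < t" "t < x + d" "t \<notin> Lat p" using interval_not_Lat[of x "x + d"] d(1) by auto
  then show False using d(2)[of t] eq[of t] by (auto simp: dist_real_def)
qed

text \<open>\<open>h\<close> is known only on an interval longer than \<open>p\<close>, so it is
  replaced by the 1-periodic function \<open>h (frac x)\<close>. That function is continuous off the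
  integers and inherits the period \<open>p\<close> off the lattice, since h (frac x + p) can be
  walked down by unit steps.\<close>

lemma local_periods_imp_const:
  fixes h :: "real \<Rightarrow> complex"
  assumes irr: "p \<notin> \<rat>" and p: "p > 1"
    and cont: "continuous_on {-1<..<p+1} h"
    and per1: "\<And>x. -1 < x \<Longrightarrow> x < p \<Longrightarrow> x \<notin> Lat p \<Longrightarrow> h (x + 1) = h x"
    and perp: "\<And>x. -1 < x \<Longrightarrow> x < 1 \<Longrightarrow> x \<notin> Lat p \<Longrightarrow> h (x + p) = h x"
    and xy: "x \<in> {-1<..<p+1}" "y \<in> {-1<..<p+1}"
  shows "h x = h y"
proof -
  define H where "H x = h (frac x)" for x
  have Lat1: "x + of_int k \<in> Lat p \<longleftrightarrow> x \<in> Lat p" for x k using Lat_add_iff[of x 0 p k] by simp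
  have Latp: "x + p \<in> Lat p \<longleftrightarrow> x \<in> Lat p" for x using Lat_add_iff[of x 1 p 0] by simp
  have frac_notin: "frac x \<notin> Lat p" if "x \<notin> Lat p" for x
    using Lat1[of x "-\<lfloor>x\<rfloor>"] that by (simp add: frac_def)
  have frac_pos: "0 < frac x" "frac x < 1" if "x \<notin> Lat p" for x
  proof -
    have "x \<notin> \<int>" using that of_int_in_Lat[of _ p] by (auto elim!: Ints_cases)
    then show "0 < frac x" "frac x < 1" by (simp_all add: frac_gt_0_iff frac_lt_1)
  qed
  have down: "h (f + real k) = h f" if "0 < f" "f \<notin> Lat p" "f + real k < p + 1" for f k
    using that(3)
  proof (induction k)
    case (Suc k)
    have "f + real k \<notin> Lat p" using Lat1[of f "int k"] that by simp
    then have "h (f + real k + 1) = h (f + real k)" using Suc.prems that by (intro per1) auto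
    then show ?case using Suc by (simp add: add_ac)
  qed simp
  have hfrac: "h x = h (frac x)" if "x \<notin> Lat p" "-1 < x" "x < p + 1" for x
  proof (cases "x \<ge> 0")
    case True
    have "x = frac x + real (nat \<lfloor>x\<rfloor>)" using True by (simp add: frac_def)
    then show ?thesis using down[OF frac_pos(1)[OF that(1)] frac_notin[OF that(1)], of "nat \<lfloor>x\<rfloor>"] that by simp
  next
    case False
    then have "\<lfloor>x\<rfloor> = -1" using that by (intro floor_unique) auto
    then have "frac x = x + 1" by (simp add: frac_def)
    then show ?thesis using per1[of x] that False p by simp
  qed
  have key: "H x = H y" if "x > -1" "x \<notin> Lat p" "y > -1" "y \<notin> Lat p" for x y
  proof (rule dense_periods_imp_const[OF irr _ _ _ _ that])
    show "H (x + 1) = H x" for x by (simp add: H_def frac_1_eq)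
    show "H (x + p) = H x" if x: "x \<notin> Lat p" for x
    proof -
      have f: "frac x + p \<notin> Lat p" using Latp frac_notin[OF x] by simp
      have "frac (x + p) = frac (frac x + p + of_int \<lfloor>x\<rfloor>)" by (simp add: frac_def)
      also have "\<dots> = frac (frac x + p)" unfolding frac_def[of "_ + _"] floor_add_int[symmetric] by simp
      finally have "H (x + p) = h (frac (frac x + p))" by (simp add: H_def)
      also have "\<dots> = h (frac x + p)" using hfrac[OF f] frac_pos[OF x] p by simp
      also have "\<dots> = h (frac x)" using perp[of "frac x"] frac_pos[OF x] frac_notin[OF x] by simp
      finally show ?thesis by (simp add: H_def)
    qed
    show "isCont H x" if x: "x \<notin> Lat p" for x
    proof -
      have x01: "of_int \<lfloor>x\<rfloor> < x" "x < of_int \<lfloor>x\<rfloor> + 1" using frac_pos[OF x] by (auto simp: frac_def)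
      have "continuous_on {of_int \<lfloor>x\<rfloor><..<of_int \<lfloor>x\<rfloor> + 1} (\<lambda>t. h (t - of_int \<lfloor>x\<rfloor>))"
        using p by (intro continuous_on_compose2[OF cont] continuous_intros) auto
      then have "continuous_on {of_int \<lfloor>x\<rfloor><..<of_int \<lfloor>x\<rfloor> + 1} H"
      proof (rule continuous_on_eq)
        fix t :: real assume t: "t \<in> {of_int \<lfloor>x\<rfloor><..<of_int \<lfloor>x\<rfloor> + 1}"
        then have "\<lfloor>t\<rfloor> = \<lfloor>x\<rfloor>" by (intro floor_unique) auto
        then show "h (t - of_int \<lfloor>x\<rfloor>) = H t" by (simp add: H_def frac_def)
      qed
      then show ?thesis using x01 by (auto simp: continuous_on_eq_continuous_at)
    qed
  qed (use p in auto)
  obtain w where w: "0 < w" "w < 1" "w \<notin> Lat p" using interval_not_Lat[of 0 1] by auto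
  have all: "h x = h w" if "x \<in> {-1<..<p+1}" for x
  proof (rule eq_off_Lat_imp_eq[where S = "{-1<..<p+1}" and g = "\<lambda>_. h w" and p = p])
    show "h x = h w" if "x \<in> {-1<..<p+1}" "x \<notin> Lat p" for x
      using hfrac[of x] hfrac[of w] key[of x w] that w p by (simp add: H_def)
  qed (use that cont in auto)
  show ?thesis using all xy by simp
qed

context quadratic_unit
begin

text \<open>A finite q-Pochhammer product, the quotient of \<open>psi (W k z)\<close> by
  \<open>psi (W 0 z)\<close> in the upper half plane. As a finite product it makes sense
  everywhere.\<close>

definition PW :: "nat \<Rightarrow> complex \<Rightarrow> complex" where
  "PW k z = (\<Prod>i=1..k. 1 - W i z)"

lemma PW_0 [simp]: "PW 0 z = 1" by (simp add: PW_def)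

lemma PW_Suc: "PW (Suc k) z = (1 - W (Suc k) z) * PW k z"
  by (simp add: PW_def mult.commute)

lemma PW_holomorphic [holomorphic_intros]: "f holomorphic_on A \<Longrightarrow> (\<lambda>z. PW k (f z)) holomorphic_on A"
  unfolding PW_def by (intro holomorphic_intros)

lemma PW_add: "PW (k + n) z = PW k (z + 1) * PW n z"
proof (induction k)
  case (Suc k)
  have "PW (Suc k + n) z = (1 - W (Suc k + n) z) * PW (k + n) z" using PW_Suc[of "k + n"] by simp
  then show ?case unfolding W_shift_n Suc by (simp add: PW_Suc)
qed simp

lemma norm_W_less_1: "Im z > 0 \<Longrightarrow> norm (W a z) < 1"
  using j_pos by (simp add: norm_W)

lemma norm_ee_less_1: "Im z > 0 \<Longrightarrow> norm (ee z) < 1"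
  by (simp add: norm_ee)

subsection \<open>Continuation across the real axis\<close>

definition Phi_upper :: "complex \<Rightarrow> complex" where
  "Phi_upper z = psi (W 0 z) / psi (ee z)"

lemma Phi_upper_nonzero [simp]: "Phi_upper z \<noteq> 0" by (simp add: Phi_upper_def)

lemma Phi_upper_holomorphic: "Phi_upper holomorphic_on {z. Im z > 0}"
  unfolding Phi_upper_def[abs_def]
  by (intro holomorphic_intros) (auto simp: norm_W_less_1 norm_ee_less_1)

lemma psi_W: "Im z > 0 \<Longrightarrow> psi (W k z) = PW k z * psi (W 0 z)"
proof (induction k)
  case (Suc k)
  have "psi (W (Suc k) z) = (1 - W (Suc k) z) * psi (W k z)"
    using psi_step[OF norm_W_less_1[OF Suc.prems], of "Suc k"] by (simp add: W_Suc)
  then show ?case using Suc by (simp add: PW_Suc)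
qed simp

lemma Phi_upper_shift_1: "Im z > 0 \<Longrightarrow> Phi_upper (z + 1) = PW n z * Phi_upper z"
  using psi_W[of z n] W_shift_n[of 0 z] by (simp add: Phi_upper_def ee_add)

lemma ee_shift_p: "ee (z + of_real p) = q * ee z"
  by (simp add: ee_add q_def)

lemma Phi_upper_shift_p:
  assumes "Im z > 0"
  shows "Phi_upper (z + of_real p) * (1 - W 0 z) = (1 - ee z) * Phi_upper z"
proof -
  have "1 - ee z \<noteq> 0" using norm_ee_less_1[OF assms] by auto
  moreover have "psi (q * ee z) \<noteq> 0" by simp
  ultimately have "psi (q * W 0 z) / psi (q * ee z) * (1 - W 0 z) =
      (1 - ee z) * ((1 - W 0 z) * psi (q * W 0 z) / ((1 - ee z) * psi (q * ee z)))" by (simp add: field_simps)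
  then show ?thesis
    using psi_step[OF norm_W_less_1[OF assms], of 0] psi_step[OF norm_ee_less_1[OF assms]]
    by (simp add: Phi_upper_def ee_shift_p W_shift_p)
qed

lemma Phi_upper_tendsto: "\<And>e. e > 0 \<Longrightarrow> \<exists>Y>0. \<forall>z. Im z \<ge> Y \<longrightarrow> norm (Phi_upper z - 1) < e"
proof -
  fix e :: real assume e: "e > 0"
  obtain K where K: "K > 0" "\<And>u. norm u < 1 \<Longrightarrow> norm (psi_log u) \<le> K * norm u / (1 - norm u)"
    using psi_log_bound by metis
  have "((\<lambda>w. exp w) \<longlongrightarrow> exp 0) (at (0 :: complex))" by (intro tendsto_intros)
  then obtain d where d: "d > 0" "\<And>w :: complex. norm w < d \<Longrightarrow> norm (exp w - 1) < e"
    unfolding LIM_def using e by (metis dist_norm diff_zero exp_zero norm_zero diff_self)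
  have "((\<lambda>y. K * exp (- 2 * pi * (y / j)) / (1 - exp (- 2 * pi * (y / j))) + K * exp (- 2 * pi * y) / (1 - exp (- 2 * pi * y))) \<longlongrightarrow> 0) at_top"
  proof -
    have "((\<lambda>y. exp (- 2 * pi * (y / j))) \<longlongrightarrow> 0) at_top" "((\<lambda>y. exp (- 2 * pi * y)) \<longlongrightarrow> 0) at_top"
      using j_pos by real_asymp+
    then have "((\<lambda>y. K * exp (- 2 * pi * (y / j)) / (1 - exp (- 2 * pi * (y / j))) + K * exp (- 2 * pi * y) / (1 - exp (- 2 * pi * y))) \<longlongrightarrow>
      K * 0 / (1 - 0) + K * 0 / (1 - 0)) at_top"
      by (intro tendsto_intros) auto
    then show ?thesis by simp
  qed
  from order_tendstoD(2)[OF this d(1)] obtain Y where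
    Y: "\<And>y. y \<ge> Y \<Longrightarrow> K * exp (- 2 * pi * (y / j)) / (1 - exp (- 2 * pi * (y / j))) + K * exp (- 2 * pi * y) / (1 - exp (- 2 * pi * y)) < d"
    unfolding eventually_at_top_linorder by blast
  have "norm (Phi_upper z - 1) < e" if z: "Im z \<ge> max Y 1" for z
  proof -
    have z0: "Im z > 0" using z by simp
    have "Phi_upper z = exp (psi_log (ee z) - psi_log (W 0 z))"
      by (simp add: Phi_upper_def psi_def exp_diff exp_minus field_simps)
    moreover have "norm (psi_log (ee z) - psi_log (W 0 z)) \<le>
        K * norm (W 0 z) / (1 - norm (W 0 z)) + K * norm (ee z) / (1 - norm (ee z))"
      using norm_triangle_ineq4[of "psi_log (ee z)" "psi_log (W 0 z)"]
        K(2)[OF norm_W_less_1[OF z0], of 0] K(2)[OF norm_ee_less_1[OF z0]] by linarith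
    moreover have "\<dots> < d" unfolding norm_W norm_ee using Y z by simp
    ultimately show ?thesis using d(2) by simp
  qed
  then show "\<exists>Y>0. \<forall>z. Im z \<ge> Y \<longrightarrow> norm (Phi_upper z - 1) < e"
    by (intro exI[of _ "max Y 1"]) auto
qed

text \<open>Closing the contour, the residues of \<open>I_kernel\<close> at \<open>i k\<close> and \<open>i k / j\<close> give the series of
  \<open>Phi_upper\<close> with \<open>1 - q\<^bsup>n k\<^esup>\<close> in place of \<open>1 - q\<^sup>k\<close>; the sum over \<open>i\<close> corrects this.\<close>

definition Phi_strip :: "complex \<Rightarrow> complex" where
  "Phi_strip z = exp (- (\<Sum>i<n. I_int j (1 / (2 * j)) (z + 1 + of_real (i * p))))"

lemma half_inverse_j: "0 < 1 / (2 * j)" "1 / (2 * j) < 1" "j > 0" "j * (1 / (2 * j)) < 1"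
  using j_gt_1 by auto

lemma Phi_strip_nonzero [simp]: "Phi_strip z \<noteq> 0" by (simp add: Phi_strip_def)

lemma strip_range:
  assumes "i < n" "-1 < x" "x < p + 1"
  shows "0 < x + 1 + i * p" "x + 1 + i * p < 1 + j"
proof -
  show "0 < x + 1 + i * p" using assms p_pos by (smt (verit) mult_nonneg_nonneg of_nat_0_le_iff)
  have "real i \<le> real n - 1" using assms(1) by linarith
  then have "i * p \<le> (real n - 1) * p" using p_pos by (intro mult_right_mono) auto
  then show "x + 1 + i * p < 1 + j" using assms by (simp add: j_def algebra_simps)
qed

lemma Phi_strip_holomorphic: "Phi_strip holomorphic_on {z. -1 < Re z \<and> Re z < p + 1}"
  unfolding Phi_strip_def[abs_def]
proof (intro holomorphic_intros)
  fix i assume i: "i \<in> {..<n}"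
  have "I_int j (1 / (2 * j)) \<circ> (\<lambda>z. z + 1 + of_real (i * p)) holomorphic_on {z. -1 < Re z \<and> Re z < p + 1}"
  proof (rule holomorphic_on_compose_gen[OF _ I_int_holomorphic[OF half_inverse_j]])
    show "(\<lambda>z. z + 1 + of_real (i * p)) ` {z. -1 < Re z \<and> Re z < p + 1} \<subseteq> {z. 0 < Re z \<and> Re z < 1 + j}"
      using strip_range i by auto
  qed (intro holomorphic_intros)
  then show "(\<lambda>z. I_int j (1 / (2 * j)) (z + 1 + of_real (i * p))) holomorphic_on {z. -1 < Re z \<and> Re z < p + 1}"
    by (simp add: comp_def)
qed

text \<open>Each of the \<open>n\<close> summands contributes one factor of \<open>PW n z\<close>:
  as 1 + i p = j - (n - i) p, the exponential of the \<open>H_int\<close> term is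
  \<open>1 - W (n - i) z\<close>.\<close>

lemma Phi_strip_shift_1:
  assumes z: "-1 < Re z" "Re z < p"
  shows "Phi_strip (z + 1) = PW n z * Phi_strip z"
proof -
  define a where "a i = H_int (j * (1 / (2 * j))) ((z + 1 + of_real (i * p)) / of_real j)" for i :: nat
  have r: "0 < Re z + 1 + i * p" "Re z + 1 + i * p < j" if "i < n" for i
  proof -
    show "0 < Re z + 1 + i * p" using strip_range(1)[OF that z(1)] z by simp
    have "real i \<le> real n - 1" using that by linarith
    then have "i * p \<le> (real n - 1) * p" using p_pos by (intro mult_right_mono) auto
    then show "Re z + 1 + i * p < j" using z by (simp add: j_def algebra_simps)
  qed
  have step: "I_int j (1 / (2 * j)) (z + 1 + 1 + of_real (i * p)) = I_int j (1 / (2 * j)) (z + 1 + of_real (i * p)) - a i" if "i < n" for i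
  proof -
    have "I_int j (1 / (2 * j)) ((z + 1 + of_real (i * p)) + 1) = I_int j (1 / (2 * j)) (z + 1 + of_real (i * p)) - a i"
      unfolding a_def by (rule I_int_shift_1[OF half_inverse_j]) (use r[OF that] in auto)
    then show ?thesis by (simp add: add_ac)
  qed
  have ea: "exp (a i) = 1 - W (n - i) z" if "i < n" for i
  proof -
    have "exp (a i) = 1 - ee ((z + 1 + of_real (i * p)) / of_real j)" unfolding a_def
    proof (rule exp_H_int)
      show "0 < Re ((z + 1 + of_real (i * p)) / of_real j)" "Re ((z + 1 + of_real (i * p)) / of_real j) < 1"
        using r[OF that] j_pos by (auto simp: Re_divide_of_real)
    qed (use j_pos in auto)
    also have "ee ((z + 1 + of_real (i * p)) / of_real j) = W 0 ((z + 1) + of_real (i * p))" by (simp add: W_def)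
    also have "W 0 ((z + 1) + of_real (i * p)) = W (n - i) z"
    proof -
      have "W (n - i + i) z = W (n - i) (z + 0) * W i 0" by (simp add: W_add_index[of "n - i" i z 0, simplified])
      then have "W (n - i) z * W i 0 = W n z" using that by simp
      moreover have "W n z = W 0 (z + 1)" using W_shift_n[of 0 z] by simp
      moreover have "W i 0 = inverse (ee (of_real (i * p) / of_real j))"
        unfolding W_def by (simp add: ee_minus[symmetric])
      ultimately show ?thesis unfolding W_add[of 0 "z + 1"] by (simp add: field_simps)
    qed
    finally show ?thesis .
  qed
  have "Phi_strip (z + 1) = exp (- (\<Sum>i<n. I_int j (1 / (2 * j)) (z + 1 + of_real (i * p)) - a i))"
    unfolding Phi_strip_def using step by (intro arg_cong[where f = exp] arg_cong[where f = uminus] sum.cong) auto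
  also have "\<dots> = Phi_strip z * exp (\<Sum>i<n. a i)"
    by (simp add: Phi_strip_def sum_subtractf exp_add[symmetric] algebra_simps)
  also have "exp (\<Sum>i<n. a i) = (\<Prod>i<n. 1 - W (n - i) z)"
    using ea by (simp add: exp_sum)
  also have "\<dots> = PW n z" unfolding PW_def
    by (rule prod.reindex_bij_witness[of _ "\<lambda>i. n - i" "\<lambda>i. n - i"]) auto
  finally show ?thesis by (simp add: mult.commute)
qed

text \<open>The shift by \<open>p\<close> moves the summand i to i + 1, so only the two ends remain.
  Since 1 + n p = j, they are reduced to \<open>I_int\<close> at \<open>z\<close> by the shifts by
  \<open>j\<close> and by 1, where it cancels.\<close>

lemma Phi_strip_shift_p:
  assumes z: "-1 < Re z" "Re z < 1"
  shows "Phi_strip (z + of_real p) * (1 - W 0 z) = (1 - ee z) * Phi_strip z"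
proof -
  let ?c = "1 / (2 * j)"
  \<comment> \<open>The evaluation of \<open>H_int\<close> needs 0 < Re z < 1; the wider strip is
    reached by analytic continuation.\<close>
  have *: "Phi_strip (z + of_real p) * (1 - W 0 z) = (1 - ee z) * Phi_strip z" if z: "0 < Re z" "Re z < 1" for z
  proof -
    define g where "g i = I_int j ?c (z + 1 + of_real (real i * p))" for i
    have sh: "I_int j ?c (z + of_real p + 1 + of_real (i * p)) = g (Suc i)" for i :: nat
      unfolding g_def by (rule arg_cong[where f = "I_int j ?c"]) (simp add: algebra_simps)
    have gn: "g n = I_int j ?c z - H_int ?c z"
    proof -
      have "g n = I_int j ?c (z + of_real j)" unfolding g_def
        by (rule arg_cong[where f = "I_int j ?c"]) (simp add: j_def)
      also have "\<dots> = I_int j ?c z - H_int ?c z" by (rule I_int_shift_j[OF half_inverse_j z])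
      finally show ?thesis .
    qed
    have g0: "g 0 = I_int j ?c z - H_int (j * ?c) (z / of_real j)"
      using I_int_shift_1[OF half_inverse_j, of z] z j_gt_1 by (simp add: g_def)
    have aux: "(a - b) - (a - d) = d - b" for a b d :: complex by simp
    have "(\<Sum>i<n. g (Suc i)) = (\<Sum>i<n. g i) + (g n - g 0)"
      using sum_lessThan_telescope[of g n] by (simp add: sum_subtractf algebra_simps)
    also have "g n - g 0 = H_int (j * ?c) (z / of_real j) - H_int ?c z" unfolding gn g0 by (rule aux)
    finally have sum: "- (\<Sum>i<n. g (Suc i)) = - (\<Sum>i<n. g i) + (H_int ?c z - H_int (j * ?c) (z / of_real j))"
      by (metis add_uminus_conv_diff minus_add_distrib minus_diff_eq)
    have "Phi_strip (z + of_real p) = Phi_strip z * (exp (H_int ?c z) / exp (H_int (j * ?c) (z / of_real j)))"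
      unfolding Phi_strip_def sh g_def[symmetric] sum exp_add exp_diff ..
    also have "exp (H_int ?c z) = 1 - ee z" using z half_inverse_j by (intro exp_H_int) auto
    also have "exp (H_int (j * ?c) (z / of_real j)) = 1 - ee (z / of_real j)"
      using z half_inverse_j j_gt_1 by (intro exp_H_int) (auto simp: Re_divide_of_real)
    finally have eq: "Phi_strip (z + of_real p) = Phi_strip z * ((1 - ee z) / (1 - W 0 z))" by (simp add: W_def)
    have "W 0 z \<noteq> 1"
    proof
      assume "W 0 z = 1"
      then obtain l :: int where "z = of_real (l * j)" unfolding W_eq_1_iff by auto
      then have l: "0 < l * j" "l * j < 1" using z by auto
      then have "real_of_int l > 0" using j_pos by (simp add: zero_less_mult_iff)
      then have "1 \<le> real_of_int l" by simp
      then have "1 * j \<le> l * j" using j_pos by (intro mult_right_mono) auto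
      then show False using l j_gt_1 by linarith
    qed
    then show ?thesis unfolding eq by simp
  qed
  have sub: "(\<lambda>z. z + of_real p) ` {z. -1 < Re z \<and> Re z < 1} \<subseteq> {z. -1 < Re z \<and> Re z < p + 1}"
    using p_pos by auto
  have h1: "(\<lambda>z. Phi_strip (z + of_real p)) holomorphic_on {z. -1 < Re z \<and> Re z < 1}"
  proof -
    have "(\<lambda>z. z + of_real p) holomorphic_on {z. -1 < Re z \<and> Re z < 1}" by (intro holomorphic_intros)
    from holomorphic_on_compose_gen[OF this Phi_strip_holomorphic sub] show ?thesis by (simp add: comp_def)
  qed
  have h2: "Phi_strip holomorphic_on {z. -1 < Re z \<and> Re z < 1}"
    using p_pos by (intro holomorphic_on_subset[OF Phi_strip_holomorphic]) auto
  show ?thesis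
  proof (rule analytic_continuation_open[where f = "\<lambda>z. Phi_strip (z + of_real p) * (1 - W 0 z)"
        and g = "\<lambda>z. (1 - ee z) * Phi_strip z"])
    have "complex_of_real (1/2) \<in> {z. 0 < Re z \<and> Re z < 1}" by simp
    then show "{z. 0 < Re z \<and> Re z < 1} \<noteq> {}" by blast
    show "connected {z. -1 < Re z \<and> Re z < 1}" by (intro convex_connected convex_vertical_strip)
  qed (use z * h1 h2 in \<open>auto intro!: holomorphic_intros open_vertical_strip\<close>)
qed


lemma PW_nonzero_upper: "Im z > 0 \<Longrightarrow> PW k z \<noteq> 0"
  using norm_W_less_1[of z] unfolding PW_def by (auto simp: prod_zero_iff) (metis norm_one order_less_irrefl)

lemma W0_neq_1_upper: "Im z > 0 \<Longrightarrow> W 0 z \<noteq> 1"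
  using norm_W_less_1[of z 0] by auto

lemma ee_neq_1_upper: "Im z > 0 \<Longrightarrow> ee z \<noteq> 1"
  using norm_ee_less_1[of z] by auto

lemma Phi_strip_tendsto: "((\<lambda>y. Phi_strip (Complex 0 y)) \<longlongrightarrow> 1) at_top"
proof -
  have lim: "((\<lambda>y. I_int j (1 / (2 * j)) (Complex 0 y + 1 + of_real (real i * p))) \<longlongrightarrow> 0) at_top" if i: "i < n" for i
  proof -
    have r: "0 < 0 + 1 + i * p" "0 + 1 + i * p < 1 + j" using strip_range[OF i, of 0] p_pos by simp_all
    then obtain M where M: "\<And>y. norm (I_int j (1 / (2 * j)) (Complex (0 + 1 + i * p) y)) \<le> M * exp (- 2 * pi * (1 / (2 * j)) * y)"
      using I_int_bound[OF half_inverse_j r] by blast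
    have eq: "Complex 0 y + 1 + of_real (real i * p) = Complex (0 + 1 + i * p) y" for y
      by (simp add: complex_eq_iff)
    show ?thesis unfolding eq
    proof (rule Lim_null_comparison)
      show "eventually (\<lambda>y. norm (I_int j (1 / (2 * j)) (Complex (0 + 1 + i * p) y)) \<le> M * exp (- 2 * pi * (1 / (2 * j)) * y)) at_top"
        using M by (intro always_eventually allI)
      have "1 / (2 * j) > 0" using j_pos by simp
      then show "((\<lambda>y. M * exp (- 2 * pi * (1 / (2 * j)) * y)) \<longlongrightarrow> 0) at_top"
        by real_asymp
    qed
  qed
  have "((\<lambda>y. exp (- (\<Sum>i<n. I_int j (1 / (2 * j)) (Complex 0 y + 1 + of_real (real i * p))))) \<longlongrightarrow> exp (- (\<Sum>i<n. 0))) at_top"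
    by (intro tendsto_intros lim) auto
  then show ?thesis by (simp add: Phi_strip_def)
qed

text \<open>Both functions obey the same two shift equations, so on a horizontal segment their
  quotient is constant. Being holomorphic it is constant on the half strip, and its limit towards i
  infinity is 1.\<close>

lemma Phi_strip_eq_upper:
  assumes z: "-1 < Re z" "Re z < p + 1" "Im z > 0"
  shows "Phi_strip z = Phi_upper z"
proof -
  define V where "V = {z. -1 < Re z \<and> Re z < p + 1} \<inter> {z. Im z > 0}"
  define r where "r z = Phi_strip z / Phi_upper z" for z
  have V: "open V" "connected V" unfolding V_def
    by (intro open_Int open_vertical_strip open_halfspace_Im_gt,
        intro convex_connected convex_Int convex_vertical_strip convex_halfspace_Im_gt)
  have rhol: "r holomorphic_on V" unfolding r_def V_def
    by (intro holomorphic_intros holomorphic_on_subset[OF Phi_strip_holomorphic] holomorphic_on_subset[OF Phi_upper_holomorphic]) auto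
  have horiz: "r (Complex x y) = r (Complex x' y)" if y: "y > 0" and xx: "x \<in> {-1<..<p+1}" "x' \<in> {-1<..<p+1}" for x x' y
  proof (rule local_periods_imp_const[OF p_irrational p_gt_1 _ _ _ xx, where h = "\<lambda>x. r (Complex x y)"])
    have "continuous_on {-1<..<p+1} (\<lambda>x. r (of_real x + \<i> * of_real y))"
      by (rule continuous_on_compose2[OF holomorphic_on_imp_continuous_on[OF rhol]])
         (use y in \<open>auto intro!: continuous_intros simp: V_def\<close>)
    then show "continuous_on {-1<..<p+1} (\<lambda>x. r (Complex x y))" unfolding Complex_eq .
    show "r (Complex (x + 1) y) = r (Complex x y)" if x: "-1 < x" "x < p" for x
    proof -
      have eq: "Complex (x + 1) y = Complex x y + 1" by (simp add: complex_eq_iff)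
      show ?thesis unfolding r_def eq using Phi_strip_shift_1[of "Complex x y"] Phi_upper_shift_1[of "Complex x y"] x y
          PW_nonzero_upper[of "Complex x y" n] by simp
    qed
    show "r (Complex (x + p) y) = r (Complex x y)" if x: "-1 < x" "x < 1" for x
    proof -
      define w where "w = Complex x y"
      have eq: "Complex (x + p) y = w + of_real p" by (simp add: w_def complex_eq_iff)
      have ne: "1 - W 0 w \<noteq> 0" "1 - ee w \<noteq> 0" using W0_neq_1_upper[of w] ee_neq_1_upper[of w] y by (auto simp: w_def)
      have a: "Phi_strip (w + of_real p) = (1 - ee w) * Phi_strip w / (1 - W 0 w)"
        using Phi_strip_shift_p[of w] x ne by (simp add: w_def field_simps)
      have b: "Phi_upper (w + of_real p) = (1 - ee w) * Phi_upper w / (1 - W 0 w)"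
        using Phi_upper_shift_p[of w] y ne by (simp add: w_def field_simps)
      show ?thesis unfolding eq r_def a b w_def[symmetric] using ne by simp
    qed
  qed
  have const: "r w = r z" if w: "w \<in> V" for w
  proof -
    have "(\<lambda>w. r w - r z) w = 0"
    proof (rule analytic_continuation[where f = "\<lambda>w. r w - r z" and w = w and S = V and U = "{Complex x (Im z) |x. x \<in> {-1<..<p+1}}" and \<xi> = z])
      show "(\<lambda>w. r w - r z) holomorphic_on V" by (intro holomorphic_intros rhol)
      show "{Complex x (Im z) |x. x \<in> {-1<..<p+1}} \<subseteq> V" using z by (auto simp: V_def)
      show "z islimpt {Complex x (Im z) |x. x \<in> {-1<..<p+1}}"
        unfolding islimpt_approachable
      proof (intro allI impI)
        fix e :: real assume "e > 0"
        define d where "d = min (e / 2) ((p + 1 - Re z) / 2)"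
        have d: "d > 0" "d < e" "d < p + 1 - Re z" using \<open>e > 0\<close> z by (auto simp: d_def min_def)
        have "Complex (Re z + d) (Im z) - z = of_real d" by (simp add: complex_eq_iff)
        then have "dist (Complex (Re z + d) (Im z)) z < e" "Complex (Re z + d) (Im z) \<noteq> z"
          using d by (auto simp: dist_norm)
        moreover have "Complex (Re z + d) (Im z) \<in> {Complex x (Im z) |x. x \<in> {-1<..<p+1}}"
          using d z by auto
        ultimately show "\<exists>x'\<in>{Complex x (Im z) |x. x \<in> {-1<..<p+1}}. x' \<noteq> z \<and> dist x' z < e" by blast
      qed
      show "r w - r z = 0" if "w \<in> {Complex x (Im z) |x. x \<in> {-1<..<p+1}}" for w
        using that horiz[of "Im z" _ "Re z"] z by auto
    qed (use V w z in \<open>auto simp: V_def\<close>)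
    then show ?thesis by simp
  qed
  have "((\<lambda>y. Phi_upper (Complex 0 y)) \<longlongrightarrow> 1) at_top"
  proof (rule tendstoI)
    fix e :: real assume "e > 0"
    then obtain Y where "\<forall>z. Im z \<ge> Y \<longrightarrow> norm (Phi_upper z - 1) < e" using Phi_upper_tendsto by blast
    then show "eventually (\<lambda>y. dist (Phi_upper (Complex 0 y)) 1 < e) at_top"
      unfolding eventually_at_top_linorder dist_norm by (intro exI[of _ Y]) auto
  qed
  then have "((\<lambda>y. r (Complex 0 y)) \<longlongrightarrow> 1 / 1) at_top"
    unfolding r_def by (intro tendsto_divide Phi_strip_tendsto) auto
  moreover have "eventually (\<lambda>y. r (Complex 0 y) = r z) at_top"
    using eventually_gt_at_top[of 0] by eventually_elim (use p_pos in \<open>auto simp: V_def intro!: const\<close>)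
  ultimately have "((\<lambda>y::real. r z) \<longlongrightarrow> 1) at_top" by (simp add: tendsto_cong)
  then have "r z = 1" by (simp add: tendsto_const_iff)
  then show ?thesis by (simp add: r_def)
qed

subsection \<open>Reflection\<close>

text \<open>Chosen to have the same multipliers under the shifts by 1 and \<open>p\<close> as the
  product of \<open>Phi_strip z\<close> and \<open>Phi_strip (p - z)\<close>. It equals 1 at 0, so
  \<open>refl_const\<close> is the value of that product there.\<close>

definition gauss :: "complex \<Rightarrow> complex" where
  "gauss z = ee (of_nat n * z * (z - of_real p) / (2 * of_real j))"

lemma gauss_nonzero [simp]: "gauss z \<noteq> 0" by (simp add: gauss_def)

lemma gauss_holomorphic: "gauss holomorphic_on A"
  unfolding gauss_def[abs_def] by (intro holomorphic_intros) (use j_pos in auto)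

lemma ee_half: "ee (1 / 2) = -1"
  by (simp add: ee_def)

lemma prod_minus_W:
  "(\<Prod>i=1..k. - W i z) = ee (of_nat k / 2 + (of_nat k * z - of_nat k * (of_nat k + 1) / 2 * of_real p) / of_real j)"
proof (induction k)
  case (Suc k)
  have "- W (Suc k) z = ee (1 / 2 + (z - of_real (Suc k * p)) / of_real j)"
    by (simp add: ee_add ee_half W_def)
  then have "(\<Prod>i=1..Suc k. - W i z) = ee ((of_nat k / 2 + (of_nat k * z - of_nat k * (of_nat k + 1) / 2 * of_real p) / of_real j) + (1 / 2 + (z - of_real (Suc k * p)) / of_real j))"
    using Suc by (simp add: ee_add)
  also have "(of_nat k / 2 + (of_nat k * z - of_nat k * (of_nat k + 1) / 2 * of_real p) / of_real j) + (1 / 2 + (z - of_real (Suc k * p)) / of_real j) =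
     of_nat (Suc k) / 2 + (of_nat (Suc k) * z - of_nat (Suc k) * (of_nat (Suc k) + 1) / 2 * of_real p) / of_real j"
    using j_pos by (simp add: field_simps)
  finally show ?case .
qed simp

lemma of_nat_n_p: "of_nat n * complex_of_real p = of_real j - 1"
  using np_eq by (metis of_real_1 of_real_diff of_real_mult of_real_of_nat_eq)

lemma gauss_shift_1: "gauss (z + 1) = (\<Prod>i=1..n. - W i z) * gauss z"
proof -
  have jn: "of_real j = of_nat n * complex_of_real p + 1" by (simp add: of_nat_n_p)
  have "(of_nat n / 2 + (of_nat n * z - of_nat n * (of_nat n + 1) / 2 * of_real p) / of_real j) + of_nat n * z * (z - of_real p) / (2 * of_real j)
    = of_nat n * (z + 1) * (z + 1 - of_real p) / (2 * of_real j)"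
  proof -
    have frac: "N / 2 + (N * z - N * (N + 1) / 2 * P) / J + N * z * (z - P) / (2 * J) =
        (N * J + 2 * N * z - N * (N + 1) * P + N * z * (z - P)) / (2 * J)" if "J \<noteq> 0" for N P J :: complex
      using that by (simp add: field_simps)
    have "of_nat n * of_real j + 2 * of_nat n * z - of_nat n * (of_nat n + 1) * of_real p + of_nat n * z * (z - of_real p) =
        of_nat n * (z + 1) * (z + 1 - of_real p)"
      unfolding jn by (simp add: algebra_simps)
    then show ?thesis using frac[of "of_real j" "of_nat n" "of_real p"] j_pos by simp
  qed
  then show ?thesis unfolding gauss_def prod_minus_W ee_add[symmetric] by simp
qed

lemma gauss_shift_p: "gauss (z + of_real p) * W 0 z = gauss z * ee z"
proof -
  have "of_nat n * (z + of_real p) * (z + of_real p - of_real p) / (2 * of_real j) + z / of_real j =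
    of_nat n * z * (z - of_real p) / (2 * of_real j) + z * (of_nat n * of_real p + 1) / of_real j"
    using j_pos by (simp add: field_simps)
  also have "z * (of_nat n * of_real p + 1) / of_real j = z" using j_pos by (simp add: of_nat_n_p)
  finally show ?thesis unfolding gauss_def W_def ee_add[symmetric] by simp
qed

lemma W_reflect: "i \<le> n \<Longrightarrow> W i (of_real p - 1 - z) = inverse (W (n + 1 - i) z)"
proof -
  assume i: "i \<le> n"
  have "(of_real p - 1 - z - of_real (i * p)) + (z - of_real ((n + 1 - i) * p)) = - (of_real j :: complex)"
    using i by (simp add: of_nat_diff algebra_simps of_nat_n_p)
  then have "(of_real p - 1 - z - of_real (i * p)) / of_real j + (z - of_real ((n + 1 - i) * p)) / of_real j = - (of_nat 1 :: complex)"
    using j_pos by (simp add: add_divide_distrib[symmetric])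
  then have "W i (of_real p - 1 - z) * W (n + 1 - i) z = 1"
    unfolding W_def ee_add[symmetric] by (simp add: ee_minus)
  then show ?thesis by (simp add: inverse_eq_divide nonzero_eq_divide_eq)
qed

lemma PW_reflect: "PW n z = PW n (of_real p - 1 - z) * (\<Prod>i=1..n. - W i z)"
proof -
  have "PW n (of_real p - 1 - z) = (\<Prod>i=1..n. 1 - inverse (W (n + 1 - i) z))"
    unfolding PW_def by (intro prod.cong) (auto simp: W_reflect)
  also have "\<dots> = (\<Prod>i=1..n. 1 - inverse (W i z))"
    by (rule prod.reindex_bij_witness[of _ "\<lambda>i. n + 1 - i" "\<lambda>i. n + 1 - i"]) auto
  finally have "PW n (of_real p - 1 - z) * (\<Prod>i=1..n. - W i z) = (\<Prod>i=1..n. (1 - inverse (W i z)) * (- W i z))"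
    by (simp only: prod.distrib)
  also have "\<dots> = PW n z" unfolding PW_def by (intro prod.cong) (auto simp: field_simps)
  finally show ?thesis by simp
qed

lemma W_0_minus: "W 0 (- z) = inverse (W 0 z)"
  by (simp add: W_def ee_minus[symmetric])

definition refl_const :: complex where
  "refl_const = Phi_strip 0 * Phi_strip (of_real p)"

lemma refl_const_nonzero [simp]: "refl_const \<noteq> 0" by (simp add: refl_const_def)

text \<open>The quotient of the two sides has both periods on the real segment, hence is constant
  there and by the identity theorem on the strip. This controls the lower half plane, where the
  series for \<open>psi\<close> diverges.\<close>

lemma Phi_strip_reflect:
  assumes z: "-1 < Re z" "Re z < p + 1"
  shows "Phi_strip z * Phi_strip (of_real p - z) = refl_const * gauss z"
proof -
  define V where "V = {z. -1 < Re z \<and> Re z < p + 1}"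
  define P where "P z = Phi_strip z * Phi_strip (of_real p - z)" for z
  define h where "h z = P z / gauss z" for z
  have V: "open V" "connected V" unfolding V_def
    by (rule open_vertical_strip, intro convex_connected convex_vertical_strip)
  have hhol: "h holomorphic_on V"
  proof -
    have sub: "(\<lambda>z. of_real p - z) ` V \<subseteq> {z. -1 < Re z \<and> Re z < p + 1}" by (auto simp: V_def)
    have "(\<lambda>z. of_real p - z) holomorphic_on V" by (intro holomorphic_intros)
    from holomorphic_on_compose_gen[OF this Phi_strip_holomorphic sub]
    have "(\<lambda>z. Phi_strip (of_real p - z)) holomorphic_on V" by (simp add: comp_def)
    then show ?thesis unfolding h_def[abs_def] P_def using Phi_strip_holomorphic
      by (intro holomorphic_intros gauss_holomorphic) (auto simp: V_def)
  qed
  have real: "h (of_real x) = h (of_real x')" if xx: "x \<in> {-1<..<p+1}" "x' \<in> {-1<..<p+1}" for x x'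
  proof (rule local_periods_imp_const[OF p_irrational p_gt_1 _ _ _ xx, where h = "\<lambda>x. h (of_real x)"])
    show "continuous_on {-1<..<p+1} (\<lambda>x. h (of_real x))"
      by (rule continuous_on_compose2[OF holomorphic_on_imp_continuous_on[OF hhol]])
         (auto intro!: continuous_intros simp: V_def)
    show "h (of_real (x + 1)) = h (of_real x)" if x: "-1 < x" "x < p" for x
    proof -
      define w where "w = complex_of_real x"
      have "Phi_strip (of_real p - 1 - w + 1) = PW n (of_real p - 1 - w) * Phi_strip (of_real p - 1 - w)"
        by (rule Phi_strip_shift_1) (use x in \<open>auto simp: w_def\<close>)
      moreover have "Phi_strip (w + 1) = PW n w * Phi_strip w"
        by (rule Phi_strip_shift_1) (use x in \<open>auto simp: w_def\<close>)
      ultimately have "P (w + 1) = (\<Prod>i=1..n. - W i w) * P w"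
        unfolding P_def PW_reflect[of w] by (simp add: algebra_simps)
      moreover have "(\<Prod>i=1..n. - W i w) \<noteq> 0" by (simp add: prod_minus_W)
      ultimately have "h (w + 1) = h w" unfolding h_def gauss_shift_1 by (simp del: prod_zero_iff)
      then show ?thesis by (simp add: w_def)
    qed
    \<comment> \<open>The shift equation is used at \<open>w\<close> and at \<open>- w\<close>; off
      the lattice the factors \<open>1 - ee w\<close> and \<open>1 - W 0 w\<close> can be
      cancelled.\<close>
    show "h (of_real (x + p)) = h (of_real x)" if x: "-1 < x" "x < 1" "x \<notin> Lat p" for x
    proof -
      define w where "w = complex_of_real x"
      have E: "ee w \<noteq> 1"
      proof
        assume "ee w = 1"
        then obtain l :: int where "complex_of_real x = of_int l" unfolding w_def ee_eq_1_iff by (elim Ints_cases)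
        then have "x = of_int l" by (metis of_real_eq_iff of_real_of_int_eq)
        then show False using x(3) of_int_in_Lat by simp
      qed
      have W0: "W 0 w \<noteq> 1"
      proof
        assume "W 0 w = 1"
        then obtain l :: int where "complex_of_real x = of_real (0 * p + l * j)" unfolding w_def W_eq_1_iff by auto
        then have "x = l * j" by (simp only: of_real_eq_iff)
        then have "x = of_int (l * n) * p + of_int l" by (simp add: j_def algebra_simps)
        then show False using x(3) unfolding Lat_def by blast
      qed
      have a: "Phi_strip (w + of_real p) * (1 - W 0 w) = (1 - ee w) * Phi_strip w"
        by (rule Phi_strip_shift_p) (use x in \<open>auto simp: w_def\<close>)
      have b: "Phi_strip (- w + of_real p) * (1 - W 0 (- w)) = (1 - ee (- w)) * Phi_strip (- w)"
        by (rule Phi_strip_shift_p) (use x in \<open>auto simp: w_def\<close>)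
      have "P (w + of_real p) * W 0 w = P w * ee w"
      proof -
        have "(P (w + of_real p) * W 0 w) * ((1 - W 0 w) * (ee w - 1)) =
          (Phi_strip (w + of_real p) * (1 - W 0 w)) * ((1 - ee (- w)) * Phi_strip (- w)) * (W 0 w * ee w)"
          by (simp add: P_def ee_minus field_simps)
        also have "\<dots> = (P w * ee w) * ((1 - W 0 w) * (ee w - 1))"
          unfolding a b[symmetric] by (simp add: P_def W_0_minus field_simps)
        finally show ?thesis using E W0 by simp
      qed
      then have "P (w + of_real p) * (gauss w * ee w) = P w * (gauss (w + of_real p) * ee w)"
        unfolding gauss_shift_p[symmetric] by (simp add: mult_ac)
      then have "h (w + of_real p) = h w" unfolding h_def by (simp add: field_simps)
      then show ?thesis by (simp add: w_def)
    qed
  qed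
  have "(\<lambda>w. h w - h 0) z = 0"
  proof (rule analytic_continuation[where f = "\<lambda>w. h w - h 0" and w = z and S = V and U = "of_real ` {-1<..<p+1}" and \<xi> = 0])
    show "(\<lambda>w. h w - h 0) holomorphic_on V" by (intro holomorphic_intros hhol)
    show "0 islimpt (complex_of_real ` {-1<..<p+1})" unfolding islimpt_approachable
    proof (intro allI impI)
      fix e :: real assume "e > 0"
      define d where "d = min (e / 2) (1 / 2)"
      have d: "d > 0" "d < e" "d < 1" using \<open>e > 0\<close> by (auto simp: d_def min_def)
      show "\<exists>x'\<in>complex_of_real ` {-1<..<p+1}. x' \<noteq> 0 \<and> dist x' 0 < e"
        by (rule bexI[of _ "of_real d"]) (use d p_pos in auto)
    qed
    show "h w - h 0 = 0" if "w \<in> complex_of_real ` {-1<..<p+1}" for w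
      using that real[of _ 0] p_pos by auto
  qed (use V z p_pos in \<open>auto simp: V_def\<close>)
  then have "h z = h 0" by simp
  also have "h 0 = refl_const" by (simp add: h_def P_def refl_const_def gauss_def)
  finally show ?thesis by (simp add: h_def P_def field_simps)
qed

end

lemma holomorphic_compose:
  assumes "f holomorphic_on B" "g holomorphic_on A" "\<And>z. z \<in> A \<Longrightarrow> g z \<in> B"
  shows "(\<lambda>z. f (g z)) holomorphic_on A"
proof -
  have "g ` A \<subseteq> B" using assms(3) by blast
  from holomorphic_on_compose_gen[OF assms(2,1) this] show ?thesis by (simp add: comp_def)
qed

context quadratic_unit
begin

subsection \<open>Continuation to the slit plane\<close>

text \<open>The reflection formula read as a definition from the values in the upper half
  plane.\<close>

definition Phi_lower :: "complex \<Rightarrow> complex" where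
  "Phi_lower z = refl_const * gauss z / Phi_upper (of_real p - z)"

text \<open>The strip moved \<open>K\<close> units to the right by iterating the shift by 1.\<close>

definition Phi_ext :: "nat \<Rightarrow> complex \<Rightarrow> complex" where
  "Phi_ext K z = PW (K * n) (z - of_nat K) * Phi_strip (z - of_nat K)"

text \<open>The boundary value from above avoids a choice among the overlapping strips. It is
  meaningful to the right of -1 only.\<close>

definition Phi0 :: "complex \<Rightarrow> complex" where
  "Phi0 z = (if Im z > 0 then Phi_upper z else if Im z < 0 then Phi_lower z
     else Lim (at z within {w. Im w > 0}) Phi_upper)"

lemma shift_iterate:
  assumes "\<And>z. z \<in> A \<Longrightarrow> f (z + 1) = PW n z * f z" "\<And>z. z \<in> A \<Longrightarrow> z + 1 \<in> A" "z \<in> A"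
  shows "f (z + of_nat K) = PW (K * n) z * f z"
  using assms(3)
proof (induction K arbitrary: z)
  case (Suc K)
  have "f (z + of_nat (Suc K)) = f ((z + 1) + of_nat K)" by (simp add: add_ac)
  also have "\<dots> = PW (K * n) (z + 1) * f (z + 1)" using Suc assms(2) by blast
  also have "\<dots> = PW (K * n + n) z * f z" using assms(1)[OF Suc.prems] by (simp add: PW_add mult_ac)
  finally show ?case by (simp add: add.commute)
qed simp

lemma Phi_strip_eq_lower:
  assumes z: "-1 < Re z" "Re z < p + 1" "Im z < 0"
  shows "Phi_strip z = Phi_lower z"
proof -
  have "Phi_strip (of_real p - z) = Phi_upper (of_real p - z)"
    by (rule Phi_strip_eq_upper) (use z in auto)
  then show ?thesis using Phi_strip_reflect[OF z(1,2)] by (simp add: Phi_lower_def field_simps)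
qed

lemma Phi_lower_holomorphic: "Phi_lower holomorphic_on {z. Im z < 0}"
proof -
  have "(\<lambda>z. Phi_upper (of_real p - z)) holomorphic_on {z. Im z < 0}"
    by (rule holomorphic_compose[OF Phi_upper_holomorphic]) (auto intro!: holomorphic_intros)
  then show ?thesis unfolding Phi_lower_def[abs_def] by (intro holomorphic_intros gauss_holomorphic) auto
qed

lemma Phi_lower_shift_1:
  assumes "Im z < 0"
  shows "Phi_lower (z + 1) = PW n z * Phi_lower z"
proof (rule analytic_continuation_open[where f = "\<lambda>z. Phi_lower (z + 1)" and g = "\<lambda>z. PW n z * Phi_lower z"
      and s = "{z. -1 < Re z \<and> Re z < p} \<inter> {z. Im z < 0}" and s' = "{z. Im z < 0}"])
  show "open ({z. -1 < Re z \<and> Re z < p} \<inter> {z. Im z < 0})"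
    by (intro open_Int open_vertical_strip open_halfspace_Im_lt)
  have "Complex 0 (-1) \<in> {z. -1 < Re z \<and> Re z < p} \<inter> {z. Im z < 0}" using p_pos by simp
  then show "{z. -1 < Re z \<and> Re z < p} \<inter> {z. Im z < 0} \<noteq> {}" by blast
  show "connected {z. Im z < 0}" by (intro convex_connected convex_halfspace_Im_lt)
  show "(\<lambda>z. Phi_lower (z + 1)) holomorphic_on {z. Im z < 0}"
    by (rule holomorphic_compose[OF Phi_lower_holomorphic]) (auto intro!: holomorphic_intros)
  show "(\<lambda>z. PW n z * Phi_lower z) holomorphic_on {z. Im z < 0}"
    by (intro holomorphic_intros Phi_lower_holomorphic)
  fix z assume z: "z \<in> {z. -1 < Re z \<and> Re z < p} \<inter> {z. Im z < 0}"
  have "Phi_strip (z + 1) = Phi_lower (z + 1)" "Phi_strip z = Phi_lower z"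
    using z by (auto intro!: Phi_strip_eq_lower)
  then show "Phi_lower (z + 1) = PW n z * Phi_lower z" using Phi_strip_shift_1[of z] z by simp
qed (use assms in \<open>auto simp: open_halfspace_Im_lt\<close>)

lemma Phi_ext_upper:
  assumes z: "real K - 1 < Re z" "Re z < K + p + 1" "Im z > 0"
  shows "Phi_ext K z = Phi_upper z"
  using shift_iterate[of "{z. Im z > 0}" Phi_upper "z - of_nat K" K] Phi_upper_shift_1
    Phi_strip_eq_upper[of "z - of_nat K"] z by (simp add: Phi_ext_def)

lemma Phi_ext_lower:
  assumes z: "real K - 1 < Re z" "Re z < K + p + 1" "Im z < 0"
  shows "Phi_ext K z = Phi_lower z"
  using shift_iterate[of "{z. Im z < 0}" Phi_lower "z - of_nat K" K] Phi_lower_shift_1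
    Phi_strip_eq_lower[of "z - of_nat K"] z by (simp add: Phi_ext_def)

lemma Phi_ext_holomorphic: "Phi_ext K holomorphic_on {z. real K - 1 < Re z \<and> Re z < K + p + 1}"
proof -
  have "(\<lambda>z. Phi_strip (z - of_nat K)) holomorphic_on {z. real K - 1 < Re z \<and> Re z < K + p + 1}"
    by (rule holomorphic_compose[OF Phi_strip_holomorphic]) (auto intro!: holomorphic_intros)
  then show ?thesis unfolding Phi_ext_def[abs_def] by (intro holomorphic_intros)
qed

text \<open>On the real axis: \<open>Phi_ext K\<close> is continuous and agrees with
  \<open>Phi_upper\<close> above the axis, so its value is the boundary value.\<close>

lemma Phi0_eq_ext:
  assumes z: "real K - 1 < Re z" "Re z < K + p + 1"
  shows "Phi0 z = Phi_ext K z"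
proof (cases "Im z = 0")
  case False
  then show ?thesis using Phi_ext_upper[OF z] Phi_ext_lower[OF z] by (auto simp: Phi0_def)
next
  case True
  let ?F = "at z within {w. Im w > 0}"
  define V where "V = {w. real K - 1 < Re w \<and> Re w < K + p + 1}"
  have V: "open V" "z \<in> V" using z unfolding V_def by (auto intro: open_vertical_strip)
  have "z islimpt {w. Im w > 0}" unfolding islimpt_approachable
  proof (intro allI impI)
    fix e :: real assume "e > 0"
    then show "\<exists>x'\<in>{w. Im w > 0}. x' \<noteq> z \<and> dist x' z < e"
      using True by (intro bexI[of _ "z + \<i> * of_real (e / 2)"]) (auto simp: dist_norm norm_mult)
  qed
  then have nt: "\<not> trivial_limit ?F" by (simp add: trivial_limit_within)
  have "isCont (Phi_ext K) z"
    using holomorphic_on_imp_continuous_on[OF Phi_ext_holomorphic[of K]] V unfolding V_def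
    by (simp add: continuous_on_eq_continuous_at)
  then have "(Phi_ext K \<longlongrightarrow> Phi_ext K z) ?F"
    using continuous_at_imp_continuous_at_within continuous_within by blast
  moreover have "eventually (\<lambda>w. Phi_ext K w = Phi_upper w) ?F"
    unfolding eventually_at_topological using V Phi_ext_upper[of K] by (intro exI[of _ V]) (auto simp: V_def)
  ultimately have "(Phi_upper \<longlongrightarrow> Phi_ext K z) ?F" by (simp add: tendsto_cong)
  from tendsto_Lim[OF nt this] show ?thesis using True by (simp add: Phi0_def)
qed

text \<open>Continuing further left by the shift by 1 would mean dividing by \<open>PW n z\<close>,
  which vanishes at z = -1.\<close>

definition slit :: "complex set" where
  "slit = {z. Im z \<noteq> 0 \<or> Re z > -1}"

lemma slit_alt: "slit = {z. Im z > 0} \<union> {z. Im z < 0} \<union> {z. Re z > -1}"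
  by (auto simp: slit_def)

lemma open_slit: "open slit"
  unfolding slit_alt by (intro open_Un open_halfspace_Im_gt open_halfspace_Im_lt open_halfspace_Re_gt)

lemma connected_slit: "connected slit"
proof -
  have "starlike slit" unfolding starlike_def
  proof (intro bexI[of _ 0] ballI subsetI)
    fix x y assume x: "x \<in> slit" and "y \<in> closed_segment 0 x"
    then obtain u where u: "0 \<le> u" "u \<le> 1" "y = u *\<^sub>R x" by (auto simp: closed_segment_def)
    show "y \<in> slit"
    proof (cases "u = 0 \<or> Im x \<noteq> 0")
      case True
      then show ?thesis using u by (auto simp: slit_def)
    next
      case False
      then have "Re x > -1" using x by (simp add: slit_def)
      moreover have "u * Re x \<ge> Re x \<or> u * Re x \<ge> 0"
        using u mult_right_mono_neg[of u 1 "Re x"] mult_nonneg_nonneg[of u "Re x"] by (cases "Re x \<ge> 0") auto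
      ultimately have "u * Re x > -1" by linarith
      then show ?thesis using u by (simp add: slit_def)
    qed
  qed (simp add: slit_def)
  then show ?thesis by (rule starlike_imp_connected)
qed

lemma slit_add_nonneg: "z \<in> slit \<Longrightarrow> x \<ge> 0 \<Longrightarrow> z + of_real x \<in> slit"
  by (auto simp: slit_def)

lemma Phi0_holomorphic: "Phi0 holomorphic_on slit"
proof -
  have "Phi0 field_differentiable (at z)" if z: "z \<in> slit" for z
  proof -
    consider "Im z > 0" | "Im z < 0" | "Re z > -1" using z by (cases "Im z" "0 :: real" rule: linorder_cases) (auto simp: slit_def)
    then show ?thesis
    proof cases
      case 1
      have "Phi0 holomorphic_on {z. Im z > 0}"
        using Phi_upper_holomorphic by (rule holomorphic_transform) (auto simp: Phi0_def)
      then show ?thesis using 1 by (intro holomorphic_on_imp_differentiable_at) (auto simp: open_halfspace_Im_gt)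
    next
      case 2
      have "Phi0 holomorphic_on {z. Im z < 0}"
        using Phi_lower_holomorphic by (rule holomorphic_transform) (auto simp: Phi0_def)
      then show ?thesis using 2 by (intro holomorphic_on_imp_differentiable_at) (auto simp: open_halfspace_Im_lt)
    next
      case 3
      \<comment> \<open>For -1 < Re z < 0 the conversion \<open>nat\<close> gives K = 0, whose strip
        begins at -1.\<close>
      define K where "K = nat \<lfloor>Re z\<rfloor>"
      have K: "real K - 1 < Re z" "Re z < K + p + 1" unfolding K_def using 3 p_pos by linarith+
      have "Phi0 holomorphic_on {z. real K - 1 < Re z \<and> Re z < K + p + 1}"
        using Phi_ext_holomorphic by (rule holomorphic_transform) (auto simp: Phi0_eq_ext)
      then show ?thesis by (rule holomorphic_on_imp_differentiable_at) (use K in \<open>auto simp: open_vertical_strip\<close>)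
    qed
  qed
  then show ?thesis unfolding holomorphic_on_def using field_differentiable_at_within by blast
qed

lemma slit_upper_continuation:
  assumes "f holomorphic_on slit" "g holomorphic_on slit" "\<And>z. Im z > 0 \<Longrightarrow> f z = g z" "z \<in> slit"
  shows "f z = g z"
proof (rule analytic_continuation_open[where s = "{z. Im z > 0}" and s' = slit and f = f and g = g])
  have "Complex 0 1 \<in> {z. Im z > 0}" by simp
  then show "{z. Im z > 0} \<noteq> {}" by blast
qed (use assms open_slit connected_slit in \<open>auto simp: slit_def open_halfspace_Im_gt\<close>)

lemma Phi0_shift_holomorphic:
  assumes "x \<ge> 0" shows "(\<lambda>z. Phi0 (z + of_real x)) holomorphic_on slit"
  by (rule holomorphic_compose[OF Phi0_holomorphic])
     (use assms in \<open>auto intro!: holomorphic_intros slit_add_nonneg\<close>)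

lemma Phi0_upper: "Im z > 0 \<Longrightarrow> Phi0 z = Phi_upper z"
  by (simp add: Phi0_def)

lemma Phi0_shift_1: "z \<in> slit \<Longrightarrow> Phi0 (z + 1) = PW n z * Phi0 z"
  by (rule slit_upper_continuation[where f = "\<lambda>z. Phi0 (z + 1)" and g = "\<lambda>z. PW n z * Phi0 z"])
     (use Phi0_shift_holomorphic[of 1] Phi_upper_shift_1 in
       \<open>auto intro!: holomorphic_intros Phi0_holomorphic simp: Phi0_upper\<close>)

lemma Phi0_shift_p: "z \<in> slit \<Longrightarrow> Phi0 (z + of_real p) * (1 - W 0 z) = (1 - ee z) * Phi0 z"
  by (rule slit_upper_continuation[where f = "\<lambda>z. Phi0 (z + of_real p) * (1 - W 0 z)" and g = "\<lambda>z. (1 - ee z) * Phi0 z"])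
     (use Phi0_shift_holomorphic[of p] Phi_upper_shift_p p_pos in
       \<open>auto intro!: holomorphic_intros Phi0_holomorphic simp: Phi0_upper\<close>)

lemma Phi0_eq_strip: "-1 < Re z \<Longrightarrow> Re z < p + 1 \<Longrightarrow> Phi0 z = Phi_strip z"
  using Phi0_eq_ext[of 0 z] by (simp add: Phi_ext_def)

lemma Phi0_reflect:
  "-1 < Re z \<Longrightarrow> Re z < p + 1 \<Longrightarrow> Phi0 z * Phi0 (of_real p - z) = refl_const * gauss z"
  using Phi_strip_reflect[of z] by (simp add: Phi0_eq_strip)

lemma Phi0_lower: "Im z < 0 \<Longrightarrow> Phi0 z = refl_const * gauss z / Phi_upper (of_real p - z)"
  by (simp add: Phi0_def Phi_lower_def)

lemma Phi0_nonzero: "Im z \<noteq> 0 \<or> (-1 < Re z \<and> Re z < p + 1) \<Longrightarrow> Phi0 z \<noteq> 0"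
proof (cases "Im z = 0")
  case False
  then show ?thesis by (auto simp: Phi0_def Phi_lower_def)
next
  case True
  assume "Im z \<noteq> 0 \<or> (-1 < Re z \<and> Re z < p + 1)"
  with True have "Phi0 z = Phi_strip z" by (intro Phi0_eq_strip) auto
  then show ?thesis by simp
qed

lemma W_neq_1: "Im z \<noteq> 0 \<Longrightarrow> W a z \<noteq> 1"
  by (auto simp: W_eq_1_iff)

text \<open>The solutions of W = 1 are a p + l j; those nearest to the interval are a p >= p and a p
  - j <= -1.\<close>

lemma W_neq_1_strip:
  assumes "0 < a" "a \<le> n" "-1 < x" "x < p"
  shows "W a (of_real x) \<noteq> 1"
proof
  assume "W a (of_real x) = 1"
  then obtain l :: int where "complex_of_real x = of_real (a * p + l * j)" unfolding W_eq_1_iff by blast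
  then have x: "x = a * p + l * j" by (simp only: of_real_eq_iff)
  have "1 * p \<le> a * p" using assms p_pos by (intro mult_right_mono) auto
  have "a * p \<le> n * p" using assms p_pos by (intro mult_right_mono) auto
  show False
  proof (cases "l \<ge> 0")
    case True
    then have "0 \<le> l * j" using j_pos by simp
    then show False using x assms \<open>1 * p \<le> a * p\<close> by linarith
  next
    case False
    then have "real_of_int l \<le> -1" by simp
    then have "l * j \<le> -1 * j" using j_pos by (intro mult_right_mono) auto
    then show False using x assms \<open>a * p \<le> n * p\<close> np_eq by linarith
  qed
qed

lemma PW_nonzero: "(\<And>i. 0 < i \<Longrightarrow> i \<le> a \<Longrightarrow> W i z \<noteq> 1) \<Longrightarrow> PW a z \<noteq> 0"
  unfolding PW_def by (auto simp: prod_zero_iff)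

definition Phi :: "nat \<Rightarrow> complex \<Rightarrow> complex" where
  "Phi a z = PW a z * Phi0 z"

lemma Phi_0 [simp]: "Phi 0 z = Phi0 z" by (simp add: Phi_def)

lemma Phi_Suc: "Phi (Suc a) z = (1 - W (Suc a) z) * Phi a z"
  by (simp add: Phi_def PW_Suc)

lemma Phi_holomorphic: "Phi a holomorphic_on slit"
  unfolding Phi_def[abs_def] by (intro holomorphic_intros Phi0_holomorphic)

lemma Phi_shift_n: "z \<in> slit \<Longrightarrow> Phi (a + n) z = Phi a (z + 1)"
  by (simp add: Phi_def PW_add Phi0_shift_1)

lemma PW_Suc_shift_p: "PW (Suc a) (z + of_real p) = (1 - W 0 z) * PW a z"
  by (induction a) (auto simp: PW_Suc W_Suc_shift)

text \<open>Raising the index together with the shift by \<open>p\<close> leaves \<open>W\<close>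
  unchanged, so only the denominator \<open>psi (ee z)\<close> reacts.\<close>

lemma Phi_Suc_shift_p: "z \<in> slit \<Longrightarrow> Phi (Suc a) (z + of_real p) = (1 - ee z) * Phi a z"
  using Phi0_shift_p[of z] by (simp add: Phi_def PW_Suc_shift_p mult_ac)

lemma Phi_shift_p: "z \<in> slit \<Longrightarrow> (1 - W a z) * Phi a (z + of_real p) = (1 - ee z) * Phi a z"
  using Phi_Suc_shift_p[of z a] by (simp add: Phi_Suc W_Suc_shift)

lemma Phi_nonzero:
  assumes "Im z \<noteq> 0 \<or> (-1 < Re z \<and> Re z < p)" "a \<le> n"
  shows "Phi a z \<noteq> 0"
proof -
  have "W i z \<noteq> 1" if "0 < i" "i \<le> a" for i
  proof (cases "Im z = 0")
    case False
    then show ?thesis by (rule W_neq_1)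
  next
    case True
    then have "z = of_real (Re z)" by (simp add: complex_eq_iff)
    then show ?thesis using W_neq_1_strip[of i "Re z"] that assms True by auto
  qed
  then have "PW a z \<noteq> 0" by (rule PW_nonzero)
  moreover have "Phi0 z \<noteq> 0" using assms by (intro Phi0_nonzero) auto
  ultimately show ?thesis by (simp add: Phi_def)
qed

lemma W_eq_1_imp_Lat: "W a (of_real x) = 1 \<Longrightarrow> x \<in> Lat p"
proof -
  assume "W a (of_real x) = 1"
  then obtain l :: int where "complex_of_real x = of_real (a * p + l * j)" unfolding W_eq_1_iff by blast
  then have "x = a * p + l * j" by (simp only: of_real_eq_iff)
  then have "x = of_int (int a + l * int n) * p + of_int l" by (simp add: j_def algebra_simps)
  then show ?thesis unfolding Lat_def by blast
qed

lemma Phi_nonzero_off_Lat: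
  assumes "x > -1" "x \<notin> Lat p"
  shows "Phi a (of_real x) \<noteq> 0"
proof -
  define K where "K = nat \<lfloor>x\<rfloor>"
  have K: "real K - 1 < x" "x < K + p + 1" unfolding K_def using assms p_pos by linarith+
  have "x - real K \<notin> Lat p" using Lat_add_iff[of x 0 p "- int K"] assms by simp
  then have "PW (K * n) (of_real (x - real K)) \<noteq> 0" using W_eq_1_imp_Lat by (intro PW_nonzero) blast
  then have "Phi0 (of_real x) \<noteq> 0" using K Phi0_eq_ext[of K "of_real x"] by (simp add: Phi_ext_def)
  moreover have "PW a (of_real x) \<noteq> 0" using assms W_eq_1_imp_Lat by (intro PW_nonzero) blast
  ultimately show ?thesis by (simp add: Phi_def)
qed

end

subsection \<open>Integrals over tilted lines\<close>

text \<open>In the lower half plane \<open>Phi\<close> behaves like a Gaussian, which decays along lines of slope 1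
  whatever the position of the line; along vertical lines this would constrain the parameters.\<close>

definition line :: "real \<Rightarrow> real \<Rightarrow> complex" where
  "line s t = of_real s + (1 + \<i>) * of_real t"

lemma Re_line [simp]: "Re (line s t) = s + t" and Im_line [simp]: "Im (line s t) = t"
  by (simp_all add: line_def)

lemma line_add: "line (s + d) t = line s t + of_real d"
  by (simp add: line_def)

lemma continuous_on_line: "continuous_on A (\<lambda>t. line s t)"
  unfolding line_def by (intro continuous_intros)

definition LI :: "real \<Rightarrow> (complex \<Rightarrow> complex) \<Rightarrow> complex" where
  "LI s G = (LINT t|lborel. G (line s t))"

text \<open>A tilted line crosses the real axis only at its base point, so real singularities matter
  just between the base points of two lines.\<close>

definition slits :: "real \<Rightarrow> real \<Rightarrow> complex set" where
  "slits lo hi = {z. Im z \<noteq> 0 \<or> (lo < Re z \<and> Re z < hi)}"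

lemma open_slits: "open (slits lo hi)"
proof -
  have "slits lo hi = {z. Im z > 0} \<union> {z. Im z < 0} \<union> {z. lo < Re z \<and> Re z < hi}"
    by (auto simp: slits_def)
  then show ?thesis
    by (simp add: open_Un open_halfspace_Im_gt open_halfspace_Im_lt open_vertical_strip)
qed

lemma line_in_slits: "lo < s \<Longrightarrow> s < hi \<Longrightarrow> line s t \<in> slits lo hi"
  by (cases "t = 0") (auto simp: slits_def)

theorem line_residues:
  fixes G :: "complex \<Rightarrow> complex" and s d lo hi :: real
  assumes d: "d > 0" and s: "lo < s" "s + d < hi" and P: "finite P"
    and hol: "G holomorphic_on slits lo hi - of_real ` P"
    and sub: "\<And>x. x \<in> P \<Longrightarrow> s < x \<and> x < s + d"
    and res: "\<And>x. x \<in> P \<Longrightarrow> ((\<lambda>w. (w - of_real x) * G w) \<longlongrightarrow> r x) (at (of_real x))"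
    and top: "\<And>e. e > 0 \<Longrightarrow> \<exists>T. \<forall>t\<ge>T. \<forall>x\<in>{s..s+d}. norm (G (line x t) - L) \<le> e"
    and bot: "\<And>e. e > 0 \<Longrightarrow> \<exists>T. \<forall>t\<le>-T. \<forall>x\<in>{s..s+d}. norm (G (line x t)) \<le> e"
  shows "((\<lambda>T. (1 + \<i>) * integral {-T..T} (\<lambda>t. G (line (s + d) t) - G (line s t)))
     \<longlongrightarrow> 2 * of_real pi * \<i> * (\<Sum>x\<in>P. r x) + of_real d * L) at_top"
proof -
  define \<mu> where "\<mu> = (1 + \<i>) / of_real d"
  have Re_mu: "Re \<mu> = 1 / d" "Im \<mu> = 1 / d" unfolding \<mu>_def by (simp_all add: Re_divide_of_real Im_divide_of_real)
  have mu: "Im \<mu> > 0" using d by (simp add: Re_mu)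
  have slope: "slope_re \<mu> \<zeta> = Re \<zeta> - Im \<zeta>" for \<zeta> using d by (simp add: slope_re_def Re_mu)
  define F where "F \<zeta> = G (of_real s + of_real d * \<zeta>)" for \<zeta>
  define g where "g x = (complex_of_real x - of_real s) / of_real d" for x
  \<comment> \<open>All rescaled distances from the two lines to the ends of the domain and to the
    poles; half their minimum is the margin \<open>\<epsilon>\<close>.\<close>
  define XX where "XX = insert ((s - lo) / d) (insert ((hi - s - d) / d) (\<Union>x\<in>P. {(x - s) / d, 1 - (x - s) / d}))"
  have "(s - lo) / d > 0" "(hi - s - d) / d > 0" using s d by simp_all
  moreover have "(x - s) / d > 0 \<and> 1 - (x - s) / d > 0" if "x \<in> P" for x
    using sub[OF that] d by simp
  ultimately have XX: "finite XX" "XX \<noteq> {}" "\<And>x. x \<in> XX \<Longrightarrow> x > 0"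
    using P by (auto simp: XX_def)
  define \<epsilon> where "\<epsilon> = Min XX / 2"
  have e0: "\<epsilon> > 0" using XX by (simp add: \<epsilon>_def)
  have eX: "\<epsilon> < x" if "x \<in> XX" for x
  proof -
    have "Min XX \<le> x" "0 < Min XX" using XX that by auto
    then show ?thesis by (simp add: \<epsilon>_def)
  qed
  have e1: "\<epsilon> * d < s - lo" "\<epsilon> * d < hi - s - d"
    using eX[of "(s - lo) / d"] eX[of "(hi - s - d) / d"] d by (auto simp: XX_def field_simps)
  have e2: "\<epsilon> < (x - s) / d" "(x - s) / d < 1 - \<epsilon>" if "x \<in> P" for x
  proof -
    have "(x - s) / d \<in> XX" "1 - (x - s) / d \<in> XX" using that unfolding XX_def by blast+
    from eX[OF this(1)] eX[OF this(2)] show "\<epsilon> < (x - s) / d" "(x - s) / d < 1 - \<epsilon>" by linarith+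
  qed
  have inj: "inj_on g P" using d by (auto simp: g_def inj_on_def)
  have gd: "of_real s + of_real d * g x = of_real x" for x using d by (simp add: g_def)
  have lineF: "F (of_real x + \<mu> * of_real t) = G (line (s + d * x) t)" for x t
  proof -
    have dm: "of_real d * (\<mu> * of_real t) = (1 + \<i>) * of_real t" using d by (simp add: \<mu>_def)
    have "of_real s + of_real d * (of_real x + \<mu> * of_real t) = line (s + d * x) t"
      unfolding distrib_left dm line_def of_real_add of_real_mult add.assoc ..
    then show ?thesis by (simp add: F_def)
  qed
  have "((\<lambda>T. \<mu> * integral {-T..T} (\<lambda>t. F (1 + \<mu> * of_real t) - F (\<mu> * of_real t)))
     \<longlongrightarrow> 2 * of_real pi * \<i> * (\<Sum>z\<in>g ` P. r (s + d * Re z) / of_real d) + L) at_top"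
  proof (rule tendsto_strip_residues[OF mu e0])
    show "finite (g ` P)" using P by simp
    have "(\<lambda>\<zeta>. G (of_real s + of_real d * \<zeta>)) holomorphic_on {z. - \<epsilon> < slope_re \<mu> z \<and> slope_re \<mu> z < 1 + \<epsilon>} - g ` P"
    proof (rule holomorphic_compose[OF hol])
      show "(\<lambda>\<zeta>. of_real s + of_real d * \<zeta>) holomorphic_on {z. - \<epsilon> < slope_re \<mu> z \<and> slope_re \<mu> z < 1 + \<epsilon>} - g ` P"
        by (intro holomorphic_intros)
      fix \<zeta> assume z: "\<zeta> \<in> {z. - \<epsilon> < slope_re \<mu> z \<and> slope_re \<mu> z < 1 + \<epsilon>} - g ` P"
      have "of_real s + of_real d * \<zeta> \<noteq> of_real x" if "x \<in> P" for x
      proof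
        assume "of_real s + of_real d * \<zeta> = of_real x"
        then have "\<zeta> = g x" using d by (simp add: g_def field_simps)
        then show False using z that by blast
      qed
      moreover have "of_real s + of_real d * \<zeta> \<in> slits lo hi"
      proof (cases "Im \<zeta> = 0")
        case False
        then show ?thesis using d by (simp add: slits_def)
      next
        case True
        then have "- \<epsilon> < Re \<zeta>" "Re \<zeta> < 1 + \<epsilon>" using z unfolding slope by auto
        from mult_strict_right_mono[OF this(1) d] mult_strict_right_mono[OF this(2) d]
        show ?thesis using e1 by (simp add: slits_def algebra_simps)
      qed
      ultimately show "of_real s + of_real d * \<zeta> \<in> slits lo hi - of_real ` P" by blast
    qed
    then show "F holomorphic_on {z. - \<epsilon> < slope_re \<mu> z \<and> slope_re \<mu> z < 1 + \<epsilon>} - g ` P"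
      by (simp add: F_def[abs_def])
    show "\<epsilon> < slope_re \<mu> z \<and> slope_re \<mu> z < 1 - \<epsilon>" if "z \<in> g ` P" for z
      using that e2 by (auto simp: g_def slope simp flip: of_real_diff of_real_divide)
    show "((\<lambda>w. (w - z) * F w) \<longlongrightarrow> r (s + d * Re z) / of_real d) (at z)" if z: "z \<in> g ` P" for z
    proof -
      obtain x where x: "x \<in> P" "z = g x" using z by blast
      have lim: "filterlim (\<lambda>w. of_real s + of_real d * w) (at (of_real x)) (at (g x))"
      proof (rule filterlim_atI)
        have "((\<lambda>w. of_real s + of_real d * w) \<longlongrightarrow> of_real s + of_real d * g x) (at (g x))"
          by (intro tendsto_intros)
        then show "((\<lambda>w. of_real s + of_real d * w) \<longlongrightarrow> of_real x) (at (g x))" unfolding gd .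
        show "eventually (\<lambda>w. of_real s + of_real d * w \<noteq> of_real x) (at (g x))"
          unfolding eventually_at_filter using d by (auto simp: g_def field_simps intro!: always_eventually)
      qed
      have "((\<lambda>w. (of_real s + of_real d * w - of_real x) * F w) \<longlongrightarrow> r x) (at (g x))"
        using filterlim_compose[OF res[OF x(1)] lim] by (simp add: F_def)
      then have "((\<lambda>w. (of_real s + of_real d * w - of_real x) * F w / of_real d) \<longlongrightarrow> r x / of_real d) (at (g x))"
        using d by (intro tendsto_divide tendsto_const) auto
      moreover have "(of_real s + of_real d * w - of_real x) * F w / of_real d = (w - g x) * F w" for w
        using d by (simp add: g_def field_simps)
      moreover have "s + d * Re (g x) = x"
        using d by (simp add: g_def flip: of_real_diff of_real_divide)
      ultimately show ?thesis using x by simp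
    qed
    have in01: "s + d * x \<in> {s..s+d}" if "x \<in> {0..1}" for x
      using that d mult_left_mono[of x 1 d] by auto
    show "\<exists>T. \<forall>t\<ge>T. \<forall>x\<in>{0..1}. norm (F (of_real x + \<mu> * of_real t) - L) \<le> e" if "e > 0" for e
      unfolding lineF using top[OF that] in01 by blast
    show "\<exists>T. \<forall>t\<le>-T. \<forall>x\<in>{0..1}. norm (F (of_real x + \<mu> * of_real t)) \<le> e" if "e > 0" for e
      unfolding lineF using bot[OF that] in01 by blast
  qed
  note lim = this
  have "F (1 + \<mu> * of_real t) - F (\<mu> * of_real t) = G (line (s + d) t) - G (line s t)" for t
    using lineF[of 1 t] lineF[of 0 t] by simp
  moreover have "(\<Sum>z\<in>g ` P. r (s + d * Re z) / of_real d) = (\<Sum>x\<in>P. r x) / of_real d"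
    unfolding sum.reindex[OF inj] comp_def sum_divide_distrib using d
    by (intro sum.cong) (auto simp: g_def simp flip: of_real_diff of_real_divide)
  ultimately have lim: "((\<lambda>T. \<mu> * integral {-T..T} (\<lambda>t. G (line (s + d) t) - G (line s t)))
     \<longlongrightarrow> 2 * of_real pi * \<i> * ((\<Sum>x\<in>P. r x) / of_real d) + L) at_top" using lim by simp
  have "((\<lambda>T. of_real d * (\<mu> * integral {-T..T} (\<lambda>t. G (line (s + d) t) - G (line s t))))
     \<longlongrightarrow> of_real d * (2 * of_real pi * \<i> * ((\<Sum>x\<in>P. r x) / of_real d) + L)) at_top"
    by (intro tendsto_mult_left lim)
  moreover have "of_real d * (2 * of_real pi * \<i> * ((\<Sum>x\<in>P. r x) / of_real d) + L) = 2 * of_real pi * \<i> * (\<Sum>x\<in>P. r x) + of_real d * L"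
    using d by (simp add: field_simps)
  moreover have "of_real d * (\<mu> * I) = (1 + \<i>) * I" for I using d by (simp add: \<mu>_def)
  ultimately show ?thesis by (simp only:)
qed

text \<open>Uniformity in the base point allows a line to be moved. The restriction to
  \<open>\<bar>t\<bar> \<ge> 1\<close> leaves out the neighbourhood of the real axis, where poles
  may lie between the lines.\<close>

definition decays :: "real set \<Rightarrow> (complex \<Rightarrow> complex) \<Rightarrow> bool" where
  "decays S G \<longleftrightarrow> (\<exists>K \<delta>. \<delta> > 0 \<and> (\<forall>s\<in>S. \<forall>t. \<bar>t\<bar> \<ge> 1 \<longrightarrow> norm (G (line s t)) \<le> K * exp (- \<delta> * \<bar>t\<bar>)))"

lemma decays_subset: "decays S G \<Longrightarrow> S' \<subseteq> S \<Longrightarrow> decays S' G"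
  unfolding decays_def by blast

lemma decay_bound_everywhere:
  fixes f :: "'a::metric_space \<Rightarrow> real \<Rightarrow> complex"
  assumes A: "compact A" and cont: "continuous_on (A \<times> {-1..1}) (\<lambda>(x, t). f x t)"
    and b: "\<And>x t. x \<in> A \<Longrightarrow> \<bar>t\<bar> \<ge> 1 \<Longrightarrow> norm (f x t) \<le> K * exp (- \<delta> * \<bar>t\<bar>)" and d: "\<delta> > 0"
  obtains K' where "\<And>x t. x \<in> A \<Longrightarrow> norm (f x t) \<le> K' * exp (- \<delta> * \<bar>t\<bar>)"
proof -
  have "compact ((\<lambda>(x, t). f x t) ` (A \<times> {-1..1}))"
    by (intro compact_continuous_image cont compact_Times A) auto
  from compact_imp_bounded[OF this] obtain B where "\<forall>y\<in>(\<lambda>(x, t). f x t) ` (A \<times> {-1..1}). norm y \<le> B"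
    unfolding bounded_iff by blast
  then have B: "norm (f x t) \<le> B" if "x \<in> A" "t \<in> {-1..1}" for x t using that by auto
  have "norm (f x t) \<le> max K (max B 0 * exp \<delta>) * exp (- \<delta> * \<bar>t\<bar>)" if "x \<in> A" for x t
  proof (cases "\<bar>t\<bar> \<ge> 1")
    case True
    then have "norm (f x t) \<le> K * exp (- \<delta> * \<bar>t\<bar>)" using b that by blast
    also have "\<dots> \<le> max K (max B 0 * exp \<delta>) * exp (- \<delta> * \<bar>t\<bar>)" by (intro mult_right_mono) auto
    finally show ?thesis .
  next
    case False
    then have "norm (f x t) \<le> B" using that by (intro B) auto
    then have "norm (f x t) \<le> max B 0 * 1" by simp
    also have "\<dots> \<le> max B 0 * (exp \<delta> * exp (- \<delta> * \<bar>t\<bar>))"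
      using False d by (intro mult_left_mono) (auto simp: exp_add[symmetric])
    also have "\<dots> \<le> max K (max B 0 * exp \<delta>) * exp (- \<delta> * \<bar>t\<bar>)"
      unfolding mult.assoc[symmetric] by (intro mult_right_mono) auto
    finally show ?thesis .
  qed
  then show ?thesis by (rule that)
qed

lemma line_integrable:
  assumes "decays {s} G" "G holomorphic_on slits lo hi" "lo < s" "s < hi"
  shows "integrable lborel (\<lambda>t. G (line s t))"
proof -
  obtain K \<delta> where K: "\<delta> > 0" "\<And>t. \<bar>t\<bar> \<ge> 1 \<Longrightarrow> norm (G (line s t)) \<le> K * exp (- \<delta> * \<bar>t\<bar>)"
    using assms(1) unfolding decays_def by auto
  have cont: "continuous_on UNIV (\<lambda>t. G (line s t))"
    by (rule continuous_on_compose2[OF holomorphic_on_imp_continuous_on[OF assms(2)] continuous_on_line])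
       (use line_in_slits assms in auto)
  obtain K' where "\<And>x t. x \<in> {0::real} \<Longrightarrow> norm (G (line s t)) \<le> K' * exp (- \<delta> * \<bar>t\<bar>)"
  proof (rule decay_bound_everywhere[where A = "{0::real}" and f = "\<lambda>x t. G (line s t)" and K = K and \<delta> = \<delta>])
    have "continuous_on ({0::real} \<times> {-1..1}) (\<lambda>x. G (line s (snd x)))"
      by (rule continuous_on_compose2[OF cont]) (auto intro!: continuous_intros)
    then show "continuous_on ({0::real} \<times> {-1..1}) (\<lambda>(x, t). G (line s t))" by (simp add: case_prod_unfold)
  qed (use K in auto)
  then show ?thesis by (intro exp_decay_integrable[OF cont K(1)]) auto
qed

lemma line_shift:
  assumes dec: "decays {s..s'} G" and hol: "G holomorphic_on slits lo hi" and s: "lo < s" "s \<le> s'" "s' < hi"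
  shows "LI s G = LI s' G"
proof (cases "s = s'")
  case False
  obtain K \<delta> where K: "\<delta> > 0" "\<And>x t. x \<in> {s..s'} \<Longrightarrow> \<bar>t\<bar> \<ge> 1 \<Longrightarrow> norm (G (line x t)) \<le> K * exp (- \<delta> * \<bar>t\<bar>)"
    using dec unfolding decays_def by blast
  have ev: "\<exists>T\<ge>1. \<forall>t\<ge>T. K * exp (- \<delta> * t) \<le> e" if "e > 0" for e
  proof -
    have "((\<lambda>t. K * exp (- \<delta> * t)) \<longlongrightarrow> 0) at_top" using K(1) by real_asymp
    from order_tendstoD(2)[OF this that] obtain T where "\<And>t. t \<ge> T \<Longrightarrow> K * exp (- \<delta> * t) < e"
      unfolding eventually_at_top_linorder by blast
    then show ?thesis by (intro exI[of _ "max T 1"]) (auto intro: less_imp_le)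
  qed
  have lim: "((\<lambda>T. (1 + \<i>) * integral {-T..T} (\<lambda>t. G (line (s + (s' - s)) t) - G (line s t)))
     \<longlongrightarrow> 2 * of_real pi * \<i> * (\<Sum>x\<in>({} :: real set). 0) + of_real (s' - s) * 0) at_top"
  proof (rule line_residues[where lo = lo and hi = hi])
    show "\<exists>T. \<forall>t\<ge>T. \<forall>x\<in>{s..s + (s' - s)}. norm (G (line x t) - 0) \<le> e" if e: "e > 0" for e
    proof -
      obtain T where T: "T \<ge> 1" "\<forall>t\<ge>T. K * exp (- \<delta> * t) \<le> e" using ev[OF e] by blast
      show ?thesis
      proof (intro exI allI impI ballI)
        fix t x assume t: "t \<ge> T" and x: "x \<in> {s..s + (s' - s)}"
        have "norm (G (line x t)) \<le> K * exp (- \<delta> * \<bar>t\<bar>)" using K(2)[of x t] x t T by auto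
        also have "\<dots> \<le> e" using T(2)[rule_format, of t] t T(1) by simp
        finally show "norm (G (line x t) - 0) \<le> e" by simp
      qed
    qed
    show "\<exists>T. \<forall>t\<le>-T. \<forall>x\<in>{s..s + (s' - s)}. norm (G (line x t)) \<le> e" if e: "e > 0" for e
    proof -
      obtain T where T: "T \<ge> 1" "\<forall>t\<ge>T. K * exp (- \<delta> * t) \<le> e" using ev[OF e] by blast
      show ?thesis
      proof (intro exI allI impI ballI)
        fix t x assume t: "t \<le> -T" and x: "x \<in> {s..s + (s' - s)}"
        have "norm (G (line x t)) \<le> K * exp (- \<delta> * \<bar>t\<bar>)" using K(2)[of x t] x t T by auto
        also have "\<dots> \<le> e" using T(2)[rule_format, of "-t"] t T(1) by simp
        finally show "norm (G (line x t)) \<le> e" .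
      qed
    qed
  qed (use False s hol in auto)
  have int: "integrable lborel (\<lambda>t. G (line s t))" "integrable lborel (\<lambda>t. G (line s' t))"
    using s by (auto intro!: line_integrable[OF decays_subset[OF dec] hol])
  have "((\<lambda>T. (1 + \<i>) * integral {-T..T} (\<lambda>t. G (line s' t) - G (line s t))) \<longlongrightarrow> (1 + \<i>) * (LI s' G - LI s G)) at_top"
    unfolding LI_def Bochner_Integration.integral_diff[OF int(2,1), symmetric]
    by (intro tendsto_mult_left tendsto_integral_lborel Bochner_Integration.integrable_diff int)
  moreover have "((\<lambda>T. (1 + \<i>) * integral {-T..T} (\<lambda>t. G (line s' t) - G (line s t))) \<longlongrightarrow> 0) at_top"
    using lim by simp
  ultimately have "(1 + \<i>) * (LI s' G - LI s G) = 0" using tendsto_unique trivial_limit_at_top_linorder by blast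
  then show ?thesis by (simp add: complex_eq_iff)
qed simp

lemma line_integral_continuous:
  fixes G :: "real \<Rightarrow> complex \<Rightarrow> complex"
  assumes A: "compact A" and cont: "continuous_on (A \<times> UNIV) (\<lambda>(x, t). G x (line s t))"
    and b: "\<delta> > 0" "\<And>x t. x \<in> A \<Longrightarrow> \<bar>t\<bar> \<ge> 1 \<Longrightarrow> norm (G x (line s t)) \<le> K * exp (- \<delta> * \<bar>t\<bar>)"
  shows "continuous_on A (\<lambda>x. LI s (G x))"
  unfolding continuous_on_sequentially
proof (intro allI ballI impI, elim conjE)
  fix XX a assume a: "a \<in> A" and XX: "\<forall>n. XX n \<in> A" "XX \<longlonglongrightarrow> a"
  obtain K' where K': "\<And>x t. x \<in> A \<Longrightarrow> norm (G x (line s t)) \<le> K' * exp (- \<delta> * \<bar>t\<bar>)"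
    by (rule decay_bound_everywhere[where A = A and f = "\<lambda>x t. G x (line s t)" and K = K and \<delta> = \<delta>])
       (use A b in \<open>auto intro: continuous_on_subset[OF cont]\<close>)
  have ct: "continuous_on UNIV (\<lambda>t. G x (line s t))" if "x \<in> A" for x
  proof -
    have "continuous_on UNIV (\<lambda>t. (\<lambda>(x, t). G x (line s t)) (x, t))"
      by (rule continuous_on_compose2[OF cont]) (use that in \<open>auto intro!: continuous_intros\<close>)
    then show ?thesis by simp
  qed
  have "(\<lambda>k. LINT t|lborel. G (XX k) (line s t)) \<longlonglongrightarrow> (LINT t|lborel. G a (line s t))"
  proof (rule integral_dominated_convergence[where w = "\<lambda>t. K' * exp (- \<delta> * \<bar>t\<bar>)"])
    show "(\<lambda>t. G a (line s t)) \<in> borel_measurable lborel"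
      using borel_measurable_continuous_onI[OF ct[OF a]] by simp
    show "(\<lambda>t. G (XX k) (line s t)) \<in> borel_measurable lborel" for k
      using borel_measurable_continuous_onI[OF ct] XX(1) by simp
    show "integrable lborel (\<lambda>t. K' * exp (- \<delta> * \<bar>t\<bar>))" by (rule integrable_exp_abs[OF b(1)])
    show "AE t in lborel. norm (G (XX k) (line s t)) \<le> K' * exp (- \<delta> * \<bar>t\<bar>)" for k
      using K' XX(1) by (intro AE_I2) auto
    show "AE t in lborel. (\<lambda>k. G (XX k) (line s t)) \<longlonglongrightarrow> G a (line s t)"
    proof (rule AE_I2)
      fix t :: real
      have "continuous_on A (\<lambda>x. (\<lambda>(x, t). G x (line s t)) (x, t))"
        by (rule continuous_on_compose2[OF cont]) (auto intro!: continuous_intros)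
      then have "continuous_on A (\<lambda>x. G x (line s t))" by simp
      then show "(\<lambda>k. G (XX k) (line s t)) \<longlonglongrightarrow> G a (line s t)"
        using a XX unfolding continuous_on_sequentially by (auto simp: comp_def)
    qed
  qed
  then show "((\<lambda>x. LI s (G x)) \<circ> XX) \<longlonglongrightarrow> LI s (G a)" by (simp add: LI_def comp_def)
qed

context quadratic_unit
begin

section \<open>Growth of the quotients \<open>FF\<close> along tilted lines\<close>

lemma Phi_upper_bounds:
  obtains B where "B \<ge> 1" "\<And>z. Im z \<ge> 1 \<Longrightarrow> norm (Phi_upper z) \<le> B \<and> 1 / B \<le> norm (Phi_upper z)"
proof -
  obtain K where K: "K > 0" "\<And>u. norm u < 1 \<Longrightarrow> norm (psi_log u) \<le> K * norm u / (1 - norm u)"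
    using psi_log_bound by metis
  define r where "r = exp (- 2 * pi * (1 / j))"
  have r: "0 < r" "r < 1" using j_pos by (auto simp: r_def)
  define C where "C = K * r / (1 - r)"
  have C: "C \<ge> 0" using K(1) r by (simp add: C_def)
  have b: "norm (psi_log u) \<le> C" if "norm u \<le> r" for u
  proof -
    have "norm (psi_log u) \<le> K * norm u / (1 - norm u)" using that r by (intro K(2)) auto
    also have "\<dots> \<le> C" unfolding C_def using that r K(1) by (intro frac_le mult_left_mono) auto
    finally show ?thesis .
  qed
  have "norm (Phi_upper z) \<le> exp (2 * C) \<and> 1 / exp (2 * C) \<le> norm (Phi_upper z)" if z: "Im z \<ge> 1" for z
  proof -
    have W: "norm (W 0 z) \<le> r" unfolding norm_W r_def
      using z j_pos by (auto intro!: mult_left_mono divide_right_mono)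
    have "1 / j \<le> 1" using j_gt_1 by simp
    then have "1 / j \<le> Im z" using z by linarith
    from mult_left_mono[OF this, of "2 * pi"] have E: "norm (ee z) \<le> r" unfolding norm_ee r_def by simp
    have eq: "Phi_upper z = exp (psi_log (ee z) - psi_log (W 0 z))"
      by (simp add: Phi_upper_def psi_def exp_diff exp_minus field_simps)
    have "\<bar>Re (psi_log (ee z) - psi_log (W 0 z))\<bar> \<le> norm (psi_log (ee z) - psi_log (W 0 z))"
      by (rule abs_Re_le_cmod)
    also have "\<dots> \<le> C + C" using b[OF W] b[OF E] by (intro norm_triangle_le_diff) auto
    finally have R: "\<bar>Re (psi_log (ee z) - psi_log (W 0 z))\<bar> \<le> 2 * C" by simp
    have n: "norm (Phi_upper z) = exp (Re (psi_log (ee z) - psi_log (W 0 z)))"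
      unfolding eq by (rule norm_exp_eq_Re)
    have "1 / exp (2 * C) = exp (- (2 * C))" by (simp add: exp_minus field_simps)
    then show ?thesis unfolding n using R by auto
  qed
  moreover have "exp (2 * C) \<ge> 1" using C by simp
  ultimately show ?thesis by (intro that[of "exp (2 * C)"]) auto
qed

lemma norm_prod_le_power:
  assumes "\<And>i. i \<in> {1..a} \<Longrightarrow> norm (f i :: complex) \<le> B"
  shows "norm (\<Prod>i=1..a. f i) \<le> B ^ a"
proof -
  have "norm (\<Prod>i=1..a. f i) = (\<Prod>i=1..a. norm (f i))" by (simp add: prod_norm)
  also have "\<dots> \<le> (\<Prod>i=1..a. B)" using assms by (intro prod_mono) auto
  finally show ?thesis by simp
qed

lemma power_le_norm_prod:
  assumes "\<And>i. i \<in> {1..a} \<Longrightarrow> B \<le> norm (f i :: complex)" "B \<ge> 0"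
  shows "B ^ a \<le> norm (\<Prod>i=1..a. f i)"
proof -
  have "(\<Prod>i=1..a. B) \<le> (\<Prod>i=1..a. norm (f i))" using assms by (intro prod_mono) auto
  also have "\<dots> = norm (\<Prod>i=1..a. f i)" by (simp add: prod_norm)
  finally show ?thesis by simp
qed

lemma PW_bounds_upper:
  assumes "Im z \<ge> 1"
  shows "norm (PW a z) \<le> 2 ^ a" "(1 - exp (- 2 * pi * (1 / j))) ^ a \<le> norm (PW a z)"
proof -
  have W: "norm (W i z) \<le> exp (- 2 * pi * (1 / j))" for i unfolding norm_W
    using assms j_pos by (auto intro!: mult_left_mono divide_right_mono)
  have r: "exp (- 2 * pi * (1 / j)) < 1" using j_pos by auto
  have "norm (1 - W i z) \<le> 2" for i
    using norm_triangle_ineq4[of 1 "W i z"] W[of i] r unfolding norm_one by linarith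
  then show "norm (PW a z) \<le> 2 ^ a" unfolding PW_def by (rule norm_prod_le_power)
  have "1 - exp (- 2 * pi * (1 / j)) \<le> norm (1 - W i z)" for i
    using norm_triangle_ineq2[of 1 "W i z"] W[of i] by simp
  then show "(1 - exp (- 2 * pi * (1 / j))) ^ a \<le> norm (PW a z)"
    unfolding PW_def using r by (intro power_le_norm_prod) auto
qed

lemma PW_bounds_lower:
  assumes "Im z \<le> -1"
  shows "norm (PW a z) \<le> 2 ^ a * exp (- (2 * pi * a / j) * Im z)" "(exp (2 * pi * (1 / j)) - 1) ^ a \<le> norm (PW a z)"
proof -
  have W: "norm (W i z) = exp (- 2 * pi * (Im z / j))" for i by (rule norm_W)
  have W1: "1 \<le> exp (- 2 * pi * (Im z / j))" using assms j_pos by (simp add: mult_nonneg_nonpos divide_nonpos_pos)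
  have "norm (1 - W i z) \<le> 2 * exp (- 2 * pi * (Im z / j))" for i
    using norm_triangle_ineq4[of 1 "W i z"] W[of i] W1 unfolding norm_one by linarith
  then have "norm (PW a z) \<le> (2 * exp (- 2 * pi * (Im z / j))) ^ a" unfolding PW_def by (rule norm_prod_le_power)
  also have "\<dots> = 2 ^ a * exp (- (2 * pi * a / j) * Im z)"
    by (simp add: power_mult_distrib exp_of_nat_mult[symmetric] mult_ac)
  finally show "norm (PW a z) \<le> 2 ^ a * exp (- (2 * pi * a / j) * Im z)" .
  have "1 / j \<le> - Im z / j" using assms j_pos by (intro divide_right_mono) auto
  from mult_left_mono[OF this, of "2 * pi"]
  have "exp (2 * pi * (1 / j)) \<le> norm (W i z)" for i unfolding W by simp
  moreover have "norm (W i z) - 1 \<le> norm (1 - W i z)" for i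
    by (metis norm_minus_commute norm_one norm_triangle_ineq2)
  ultimately have "exp (2 * pi * (1 / j)) - 1 \<le> norm (1 - W i z)" for i
    by (meson diff_right_mono order_trans)
  moreover have "exp (2 * pi * (1 / j)) - 1 \<ge> 0" using j_pos by simp
  ultimately show "(exp (2 * pi * (1 / j)) - 1) ^ a \<le> norm (PW a z)"
    unfolding PW_def by (intro power_le_norm_prod)
qed

definition FF :: "nat \<Rightarrow> nat \<Rightarrow> nat \<Rightarrow> real \<Rightarrow> real \<Rightarrow> complex \<Rightarrow> complex" where
  "FF a b c \<xi> \<eta> z = Phi a (z + of_real \<xi>) * Phi b (z + of_real \<eta>) / Phi c z"

lemma FF_bound_upper: obtains K where "\<And>\<xi> \<eta> z. Im z \<ge> 1 \<Longrightarrow> norm (FF a b c \<xi> \<eta> z) \<le> K"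
proof -
  obtain B where B: "B \<ge> 1" "\<And>z. Im z \<ge> 1 \<Longrightarrow> norm (Phi_upper z) \<le> B \<and> 1 / B \<le> norm (Phi_upper z)"
    using Phi_upper_bounds by metis
  define r where "r = 1 - exp (- 2 * pi * (1 / j))"
  have r: "r > 0" using j_pos by (auto simp: r_def)
  have up: "norm (Phi a z) \<le> 2 ^ a * B" if "Im z \<ge> 1" for a z
  proof -
    have "norm (Phi0 z) \<le> B" using B(2)[OF that] that by (simp add: Phi0_upper)
    then show ?thesis unfolding Phi_def norm_mult using PW_bounds_upper(1)[OF that] by (intro mult_mono) auto
  qed
  have lo: "r ^ a * (1 / B) \<le> norm (Phi a z)" if "Im z \<ge> 1" for a z
  proof -
    have "1 / B \<le> norm (Phi0 z)" using B(2)[OF that] that by (simp add: Phi0_upper)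
    then show ?thesis unfolding Phi_def norm_mult
      using PW_bounds_upper(2)[OF that, of a] r B(1) by (intro mult_mono) (auto simp: r_def)
  qed
  have "norm (FF a b c \<xi> \<eta> z) \<le> (2 ^ a * B) * (2 ^ b * B) / (r ^ c * (1 / B))" if "Im z \<ge> 1" for \<xi> \<eta> z
    unfolding FF_def norm_mult norm_divide using up lo that B(1) r
    by (intro frac_le mult_mono) (auto intro!: mult_pos_pos)
  then show ?thesis by (rule that)
qed

lemma norm_gauss: "norm (gauss z) = exp (- (pi * n / j) * (Im z * (2 * Re z - p)))"
proof -
  have "Im (of_nat n * z * (z - of_real p) / (2 * of_real j)) = Im (of_real (n / (2 * j)) * (z * (z - of_real p)))"
    by (simp add: mult.assoc)
  also have "\<dots> = n / (2 * j) * Im (z * (z - of_real p))" by simp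
  also have "Im (z * (z - of_real p)) = Im z * (2 * Re z - p)" by (simp add: algebra_simps)
  finally show ?thesis unfolding gauss_def norm_ee using j_pos by (simp add: field_simps)
qed

text \<open>Two Gaussians in the numerator against one in the denominator leave a single one. On a
  tilted line Re z = Im z + O(1), so it decays like exp (-2 \<kappa> y^2) and beats every
  exponential, uniformly for bounded parameters.\<close>

lemma FF_bound_lower:
  obtains K where "\<And>\<xi> \<eta> z. \<bar>\<xi>\<bar> \<le> R \<Longrightarrow> \<bar>\<eta>\<bar> \<le> R \<Longrightarrow> \<bar>Re z - Im z\<bar> \<le> R \<Longrightarrow> Im z \<le> -1 \<Longrightarrow>
    norm (FF a b c \<xi> \<eta> z) \<le> K * exp (M * Im z)"
proof -
  obtain B where B: "B \<ge> 1" "\<And>z. Im z \<ge> 1 \<Longrightarrow> norm (Phi_upper z) \<le> B \<and> 1 / B \<le> norm (Phi_upper z)"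
    using Phi_upper_bounds by metis
  define C where "C = norm refl_const"
  have C: "C > 0" by (simp add: C_def)
  define r where "r = exp (2 * pi * (1 / j)) - 1"
  have r: "r > 0" using j_pos by (simp add: r_def)
  define \<kappa> where "\<kappa> = pi * n / j"
  have k: "\<kappa> > 0" using n_pos j_pos by (simp add: \<kappa>_def)
  have n0: "norm (Phi0 z) = C * norm (gauss z) / norm (Phi_upper (of_real p - z))" if "Im z \<le> -1" for z
    using that by (simp add: Phi0_lower norm_mult norm_divide C_def)
  have up: "norm (Phi a z) \<le> (2 ^ a * (C * B)) * (exp (- (2 * pi * a / j) * Im z) * norm (gauss z))" if z: "Im z \<le> -1" for a z
  proof -
    have "1 / B \<le> norm (Phi_upper (of_real p - z))" using B(2)[of "of_real p - z"] z by simp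
    then have "norm (Phi0 z) \<le> C * norm (gauss z) / (1 / B)" unfolding n0[OF z]
      using C B(1) by (intro frac_le) auto
    then have "norm (Phi a z) \<le> (2 ^ a * exp (- (2 * pi * a / j) * Im z)) * (C * norm (gauss z) / (1 / B))"
      unfolding Phi_def norm_mult using PW_bounds_lower(1)[OF z] by (intro mult_mono) auto
    then show ?thesis by (simp add: mult_ac)
  qed
  have lo: "r ^ a * (C / B) * norm (gauss z) \<le> norm (Phi a z)" if z: "Im z \<le> -1" for a z
  proof -
    have "norm (Phi_upper (of_real p - z)) \<le> B" using B(2)[of "of_real p - z"] z by simp
    then have "C * norm (gauss z) / B \<le> norm (Phi0 z)" unfolding n0[OF z]
      using C B(1) by (intro divide_left_mono) auto
    then have "r ^ a * (C * norm (gauss z) / B) \<le> norm (Phi a z)"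
      unfolding Phi_def norm_mult using PW_bounds_lower(2)[OF z, of a] r C B(1) by (intro mult_mono) (auto simp: r_def)
    then show ?thesis by simp
  qed
  define D where "D = (2 ^ a * (C * B)) * (2 ^ b * (C * B)) / (r ^ c * (C / B))"
  have D: "D \<ge> 0" using C B(1) r by (simp add: D_def)
  \<comment> \<open>Collects the linear terms of the exponent: \<open>2 R\<close> from each of the
    base point, \<open>\<xi>\<close> and \<open>\<eta>\<close>, then \<open>p\<close>, and the
    growth of the two products \<open>PW\<close>.\<close>
  define A where "A = \<kappa> * (6 * R + p) + 2 * pi * (a + b) / j"
  have "norm (FF a b c \<xi> \<eta> z) \<le> (D * exp ((A + M)\<^sup>2 / (8 * \<kappa>))) * exp (M * Im z)"
    if R: "\<bar>\<xi>\<bar> \<le> R" "\<bar>\<eta>\<bar> \<le> R" "\<bar>Re z - Im z\<bar> \<le> R" and z: "Im z \<le> -1" for \<xi> \<eta> z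
  proof -
    define y where "y = Im z"
    have y: "y \<le> -1" using z by (simp add: y_def)
    define e1 where "e1 = - (2 * pi * a / j) * y"
    define e2 where "e2 = - (2 * pi * b / j) * y"
    have "norm (FF a b c \<xi> \<eta> z) \<le> ((2 ^ a * (C * B)) * (exp e1 * norm (gauss (z + of_real \<xi>)))) *
      ((2 ^ b * (C * B)) * (exp e2 * norm (gauss (z + of_real \<eta>)))) / (r ^ c * (C / B) * norm (gauss z))"
      unfolding FF_def norm_mult norm_divide
      using up[of "z + of_real \<xi>" a] up[of "z + of_real \<eta>" b] lo[of z c] z C B(1) r
      by (intro frac_le mult_mono) (auto simp: e1_def e2_def y_def)
    also have "\<dots> = D * (exp e1 * exp e2 * (norm (gauss (z + of_real \<xi>)) * norm (gauss (z + of_real \<eta>)) / norm (gauss z)))"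
      by (simp add: D_def)
    also have "norm (gauss (z + of_real \<xi>)) * norm (gauss (z + of_real \<eta>)) / norm (gauss z) =
       exp (- \<kappa> * (y * (2 * Re z + 2 * \<xi> + 2 * \<eta> - p)))"
      unfolding norm_gauss exp_add[symmetric] exp_diff[symmetric]
      by (rule arg_cong[where f = exp]) (simp add: \<kappa>_def[symmetric] y_def algebra_simps)
    also have "exp e1 * exp e2 * exp (- \<kappa> * (y * (2 * Re z + 2 * \<xi> + 2 * \<eta> - p))) \<le> exp ((A + M)\<^sup>2 / (8 * \<kappa>) + M * y)"
    proof -
      define v where "v = Re z - y"
      have v: "\<bar>v\<bar> \<le> R" using R(3) by (simp add: v_def y_def)
      have "2 * v + 2 * \<xi> + 2 * \<eta> - p \<le> 6 * R + p" using v R p_pos by linarith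
      from mult_left_mono[OF this, of "- y"]
      have "- y * (2 * v + 2 * \<xi> + 2 * \<eta> - p) \<le> - y * (6 * R + p)" using y by linarith
      then have h: "\<kappa> * (- y * (2 * v + 2 * \<xi> + 2 * \<eta> - p)) \<le> \<kappa> * (- y * (6 * R + p))"
        by (rule mult_left_mono) (use k in simp)
      have "e1 + e2 + (- \<kappa> * (y * (2 * Re z + 2 * \<xi> + 2 * \<eta> - p))) =
          - (2 * \<kappa> * y\<^sup>2) + \<kappa> * (- y * (2 * v + 2 * \<xi> + 2 * \<eta> - p)) - (2 * pi * (a + b) / j) * y"
        by (simp add: e1_def e2_def v_def power2_eq_square algebra_simps add_divide_distrib)
      also have "\<dots> \<le> - (2 * \<kappa> * y\<^sup>2) - A * y" using h by (simp add: A_def algebra_simps)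
      \<comment> \<open>Completing the square; this is the source of the constant (A + M)^2 / (8
        \<kappa>).\<close>
      also have "\<dots> = (A + M)\<^sup>2 / (8 * \<kappa>) + M * y - 2 * \<kappa> * (y + (A + M) / (4 * \<kappa>))\<^sup>2"
        using k by (simp add: power2_eq_square field_simps)
      also have "\<dots> \<le> (A + M)\<^sup>2 / (8 * \<kappa>) + M * y" using k by simp
      finally show ?thesis unfolding exp_add[symmetric] by simp
    qed
    finally show ?thesis using D by (simp add: exp_add y_def mult_left_mono mult.assoc)
  qed
  then show ?thesis by (rule that)
qed

text \<open>Im z tends to infinity with no condition on Re z, so limits along it are uniform in the
  base point of a line.\<close>

definition top_filter :: "complex filter" where "top_filter = filtercomap Im at_top"

lemma eventually_top_filter: "eventually P top_filter \<longleftrightarrow> (\<exists>Y. \<forall>z. Im z \<ge> Y \<longrightarrow> P z)"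
  unfolding top_filter_def eventually_filtercomap_at_top_linorder by simp

lemma top_filter_shift: "(f \<longlongrightarrow> L) top_filter \<Longrightarrow> ((\<lambda>z. f (z + of_real x)) \<longlongrightarrow> L) top_filter"
proof -
  have "filterlim (\<lambda>z. z + of_real x) top_filter top_filter"
    unfolding filterlim_iff eventually_top_filter
  proof (intro allI impI, elim exE)
    fix P :: "complex \<Rightarrow> bool" and Y assume "\<forall>z. Y \<le> Im z \<longrightarrow> P z"
    then show "\<exists>Y. \<forall>z. Y \<le> Im z \<longrightarrow> P (z + of_real x)" by (intro exI[of _ Y]) simp
  qed
  then show "(f \<longlongrightarrow> L) top_filter \<Longrightarrow> ((\<lambda>z. f (z + of_real x)) \<longlongrightarrow> L) top_filter"
    by (rule filterlim_compose[rotated])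
qed

lemma ee_top: "(ee \<longlongrightarrow> 0) top_filter" and W_top: "(W a \<longlongrightarrow> 0) top_filter"
proof -
  have Im: "filterlim Im at_top top_filter" unfolding top_filter_def by (rule filterlim_filtercomap)
  have lim: "((\<lambda>y. exp (- 2 * pi * y)) \<longlongrightarrow> 0) at_top" "((\<lambda>y. exp (- 2 * pi * (y / j))) \<longlongrightarrow> 0) at_top"
    using j_pos by real_asymp+
  from filterlim_compose[OF lim(1) Im] filterlim_compose[OF lim(2) Im] show "(ee \<longlongrightarrow> 0) top_filter" "(W a \<longlongrightarrow> 0) top_filter"
    by (simp_all add: norm_ee norm_W tendsto_norm_zero_iff[of ee, symmetric] tendsto_norm_zero_iff[of "W a", symmetric])
qed

lemma Phi_top: "(Phi a \<longlongrightarrow> 1) top_filter"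
proof -
  have "(Phi0 \<longlongrightarrow> 1) top_filter"
  proof (rule tendstoI)
    fix e :: real assume "e > 0"
    then obtain Y where "Y > 0" "\<forall>z. Im z \<ge> Y \<longrightarrow> norm (Phi_upper z - 1) < e" using Phi_upper_tendsto by blast
    then show "eventually (\<lambda>z. dist (Phi0 z) 1 < e) top_filter"
      unfolding eventually_top_filter dist_norm by (intro exI[of _ Y]) (auto simp: Phi0_upper)
  qed
  then have "((\<lambda>z. (\<Prod>i=1..a. 1 - W i z) * Phi0 z) \<longlongrightarrow> (\<Prod>i=1..a. 1 - 0) * 1) top_filter"
    by (intro tendsto_intros W_top)
  then show ?thesis by (simp add: Phi_def[abs_def] PW_def)
qed

lemma FF_top: "(FF a b c \<xi> \<eta> \<longlongrightarrow> 1) top_filter"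
proof -
  have "((\<lambda>z. Phi a (z + of_real \<xi>) * Phi b (z + of_real \<eta>) / Phi c z) \<longlongrightarrow> 1 * 1 / 1) top_filter"
    by (intro tendsto_divide tendsto_mult top_filter_shift Phi_top) auto
  then show ?thesis by (simp add: FF_def[abs_def])
qed

text \<open>Only the rate above the real axis is recorded: below it any exponential growth is
  absorbed by the Gaussian decay of \<open>FF\<close>.\<close>

definition weight :: "real \<Rightarrow> (complex \<Rightarrow> complex) \<Rightarrow> bool" where
  "weight \<delta> f \<longleftrightarrow> (\<exists>K M. (\<forall>z. Im z \<ge> 1 \<longrightarrow> norm (f z) \<le> K * exp (- \<delta> * Im z)) \<and>
     (\<forall>z. Im z \<le> -1 \<longrightarrow> norm (f z) \<le> K * exp (- M * Im z)))"

lemma weight_mult: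
  assumes "weight \<delta> f" "weight \<delta>' g" shows "weight (\<delta> + \<delta>') (\<lambda>z. f z * g z)"
proof -
  obtain K M where 1: "\<And>z. Im z \<ge> 1 \<Longrightarrow> norm (f z) \<le> K * exp (- \<delta> * Im z)" "\<And>z. Im z \<le> -1 \<Longrightarrow> norm (f z) \<le> K * exp (- M * Im z)"
    using assms(1) unfolding weight_def by blast
  obtain K' M' where 2: "\<And>z. Im z \<ge> 1 \<Longrightarrow> norm (g z) \<le> K' * exp (- \<delta>' * Im z)" "\<And>z. Im z \<le> -1 \<Longrightarrow> norm (g z) \<le> K' * exp (- M' * Im z)"
    using assms(2) unfolding weight_def by blast
  have mul: "norm (f z * g z) \<le> (K * K') * exp (- (x + x') * Im z)"
    if "norm (f z) \<le> K * exp (- x * Im z)" "norm (g z) \<le> K' * exp (- x' * Im z)" for z x x'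
  proof -
    have "norm (f z * g z) \<le> (K * exp (- x * Im z)) * (K' * exp (- x' * Im z))"
      unfolding norm_mult using that by (intro mult_mono) (auto intro: order_trans[OF norm_ge_zero])
    also have "\<dots> = (K * K') * (exp (- x * Im z) * exp (- x' * Im z))" by simp
    also have "exp (- x * Im z) * exp (- x' * Im z) = exp (- (x + x') * Im z)"
      unfolding exp_add[symmetric] by (rule arg_cong[where f = exp]) (simp add: algebra_simps)
    finally show ?thesis .
  qed
  show ?thesis unfolding weight_def
    by (intro exI[of _ "K * K'"] exI[of _ "M + M'"] conjI allI impI mul 1 2)
qed

lemma weight_ee: "weight (2 * pi) ee" and weight_W: "weight (2 * pi / j) (W a)"
  unfolding weight_def norm_ee norm_W
  by (intro exI[of _ 1] exI[of _ "2 * pi"], simp, intro exI[of _ 1] exI[of _ "2 * pi / j"], simp)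

lemma weight_ee_affine_fraction:
  assumes c: "c > 0"
  shows "weight 0 (\<lambda>z. 1 / (1 - ee (of_real c * z + of_real d)))"
proof -
  have n: "norm (ee (of_real c * z + of_real d)) = exp (- (2 * pi * c) * Im z)" for z by (simp add: norm_ee)
  have pc: "2 * pi * c > 0" using c by simp
  then have e: "exp (- (2 * pi * c)) < 1" "exp (2 * pi * c) > 1" by (simp_all del: mult_pos_pos)
  have "norm (1 / (1 - ee (of_real c * z + of_real d))) \<le> 1 / (1 - exp (- (2 * pi * c)))" if z: "Im z \<ge> 1" for z
  proof -
    have "norm (ee (of_real c * z + of_real d)) \<le> exp (- (2 * pi * c))"
      unfolding n using mult_left_mono[OF z, of "2 * pi * c"] pc by simp
    then have "1 - exp (- (2 * pi * c)) \<le> norm (1 - ee (of_real c * z + of_real d))"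
      using norm_triangle_ineq2[of 1 "ee (of_real c * z + of_real d)"] by simp
    then show ?thesis using e(1) by (simp add: norm_divide frac_le)
  qed
  moreover have "norm (1 / (1 - ee (of_real c * z + of_real d))) \<le> 1 / (exp (2 * pi * c) - 1)" if z: "Im z \<le> -1" for z
  proof -
    have "exp (2 * pi * c) \<le> norm (ee (of_real c * z + of_real d))"
      unfolding n using mult_left_mono[of 1 "- Im z" "2 * pi * c"] z pc by simp
    then have "exp (2 * pi * c) - 1 \<le> norm (1 - ee (of_real c * z + of_real d))"
      using norm_triangle_ineq2[of "ee (of_real c * z + of_real d)" 1] by (simp add: norm_minus_commute)
    then show ?thesis using e(2) by (simp add: norm_divide frac_le)
  qed
  ultimately show ?thesis unfolding weight_def
    by (intro exI[of _ "max (1 / (1 - exp (- (2 * pi * c)))) (1 / (exp (2 * pi * c) - 1))"] exI[of _ 0])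
       (auto simp del: norm_divide simp: le_max_iff_disj)
qed

lemma weight_ee_fraction: "weight 0 (\<lambda>z. 1 / (1 - ee z))"
  using weight_ee_affine_fraction[of 1 0] by simp

lemma weighted_FF_bound:
  assumes w: "weight \<delta> f" and d: "\<delta> > 0"
  obtains K where "\<And>\<xi> \<eta> s t. \<bar>\<xi>\<bar> \<le> R \<Longrightarrow> \<bar>\<eta>\<bar> \<le> R \<Longrightarrow> \<bar>s\<bar> \<le> R \<Longrightarrow> \<bar>t\<bar> \<ge> 1 \<Longrightarrow>
     norm (f (line s t) * FF a b c \<xi> \<eta> (line s t)) \<le> K * exp (- \<delta> * \<bar>t\<bar>)"
proof -
  obtain K1 M where 1: "\<And>z. Im z \<ge> 1 \<Longrightarrow> norm (f z) \<le> K1 * exp (- \<delta> * Im z)" "\<And>z. Im z \<le> -1 \<Longrightarrow> norm (f z) \<le> K1 * exp (- M * Im z)"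
    using w unfolding weight_def by blast
  have K1: "K1 \<ge> 0"
  proof -
    have "norm (f \<i>) \<le> K1 * exp (- \<delta> * Im \<i>)" by (rule 1(1)) simp
    then have "0 \<le> K1 * exp (- \<delta> * Im \<i>)" by (rule order_trans[OF norm_ge_zero])
    then show ?thesis by (simp add: zero_le_mult_iff)
  qed
  obtain K2 where 2: "\<And>\<xi> \<eta> z. Im z \<ge> 1 \<Longrightarrow> norm (FF a b c \<xi> \<eta> z) \<le> K2" using FF_bound_upper by metis
  \<comment> \<open>The freely chosen exponent of the lower bound pays for the growth
    \<open>M\<close> of \<open>f\<close> and for the desired rate \<open>\<delta>\<close>.\<close>
  obtain K3 where 3: "\<And>\<xi> \<eta> z. \<bar>\<xi>\<bar> \<le> R \<Longrightarrow> \<bar>\<eta>\<bar> \<le> R \<Longrightarrow> \<bar>Re z - Im z\<bar> \<le> R \<Longrightarrow> Im z \<le> -1 \<Longrightarrow>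
    norm (FF a b c \<xi> \<eta> z) \<le> K3 * exp ((M + \<delta>) * Im z)" using FF_bound_lower by metis
  have "norm (f (line s t) * FF a b c \<xi> \<eta> (line s t)) \<le> (K1 * max K2 K3) * exp (- \<delta> * \<bar>t\<bar>)"
    if R: "\<bar>\<xi>\<bar> \<le> R" "\<bar>\<eta>\<bar> \<le> R" "\<bar>s\<bar> \<le> R" and t: "\<bar>t\<bar> \<ge> 1" for \<xi> \<eta> s t
  proof (cases "t \<ge> 0")
    case True
    then have "norm (f (line s t) * FF a b c \<xi> \<eta> (line s t)) \<le> (K1 * exp (- \<delta> * t)) * K2"
      unfolding norm_mult using 1(1)[of "line s t"] 2[of "line s t" \<xi> \<eta>] t K1 by (intro mult_mono) auto
    also have "\<dots> \<le> (K1 * exp (- \<delta> * t)) * max K2 K3" using K1 by (intro mult_left_mono) auto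
    finally show ?thesis using True by (simp add: mult_ac)
  next
    case False
    then have "norm (f (line s t) * FF a b c \<xi> \<eta> (line s t)) \<le> (K1 * exp (- M * t)) * (K3 * exp ((M + \<delta>) * t))"
      unfolding norm_mult using 1(2)[of "line s t"] 3[of \<xi> \<eta> "line s t"] t K1 R by (intro mult_mono) auto
    also have "\<dots> = (K1 * (exp (- M * t) * exp ((M + \<delta>) * t))) * K3" by simp
    also have "exp (- M * t) * exp ((M + \<delta>) * t) = exp (\<delta> * t)"
      unfolding exp_add[symmetric] by (rule arg_cong[where f = exp]) (simp add: algebra_simps)
    also have "(K1 * exp (\<delta> * t)) * K3 \<le> (K1 * exp (\<delta> * t)) * max K2 K3" using K1 by (intro mult_left_mono) auto
    finally show ?thesis using False by (simp add: mult_ac)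
  qed
  then show ?thesis by (rule that)
qed

lemma weighted_FF_decays:
  assumes "weight \<delta> f" "\<delta> > 0"
  shows "decays {s..s'} (\<lambda>z. f z * FF a b c \<xi> \<eta> z)"
proof -
  define R where "R = \<bar>\<xi>\<bar> + \<bar>\<eta>\<bar> + \<bar>s\<bar> + \<bar>s'\<bar>"
  obtain K where K: "\<And>\<xi> \<eta> s t. \<bar>\<xi>\<bar> \<le> R \<Longrightarrow> \<bar>\<eta>\<bar> \<le> R \<Longrightarrow> \<bar>s\<bar> \<le> R \<Longrightarrow> \<bar>t\<bar> \<ge> 1 \<Longrightarrow>
     norm (f (line s t) * FF a b c \<xi> \<eta> (line s t)) \<le> K * exp (- \<delta> * \<bar>t\<bar>)"
    using weighted_FF_bound[OF assms, of R a b c] by metis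
  show ?thesis unfolding decays_def
    by (rule exI[of _ K], rule exI[of _ \<delta>], intro conjI ballI allI impI K assms) (auto simp: R_def)
qed

end

lemma decays_cong:
  assumes "\<And>z. \<bar>Im z\<bar> \<ge> 1 \<Longrightarrow> f z = g z" "decays S f"
  shows "decays S g"
  using assms unfolding decays_def by (metis Im_line)

lemma LI_shift: "LI s (\<lambda>z. f (z + of_real d)) = LI (s + d) f"
  by (simp add: LI_def line_add)

lemma LI_cong: "(\<And>t. f (line s t) = g (line s t)) \<Longrightarrow> LI s f = LI s g"
  by (simp add: LI_def)

lemma LI_add: "integrable lborel (\<lambda>t. f (line s t)) \<Longrightarrow> integrable lborel (\<lambda>t. g (line s t)) \<Longrightarrow>
    LI s (\<lambda>z. f z + g z) = LI s f + LI s g"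
  and LI_diff: "integrable lborel (\<lambda>t. f (line s t)) \<Longrightarrow> integrable lborel (\<lambda>t. g (line s t)) \<Longrightarrow>
    LI s (\<lambda>z. f z - g z) = LI s f - LI s g"
  by (simp_all add: LI_def)

lemma LI_mult: "LI s (\<lambda>z. c * f z) = c * LI s f"
  by (simp add: LI_def)

context quadratic_unit
begin

lemma in_slit:
  assumes "z \<in> slits lo hi" "lo \<ge> -1 - x"
  shows "z + of_real x \<in> slit"
  using assms by (auto simp: slits_def slit_def)

text \<open>The bound on \<open>hi\<close> reflects the zeros of the denominator:
  \<open>Phi c\<close> is known to be nonzero on the real axis up to \<open>p\<close>, and
  \<open>Phi 0\<close> up to \<open>p + 1\<close>.\<close>

lemma FF_holomorphic:
  assumes "lo \<ge> -1" "lo \<ge> -1 - \<xi>" "lo \<ge> -1 - \<eta>" "c \<le> n" "hi \<le> p \<or> (c = 0 \<and> hi \<le> p + 1)"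
  shows "FF a b c \<xi> \<eta> holomorphic_on slits lo hi"
  unfolding FF_def[abs_def]
proof (intro holomorphic_intros)
  show "(\<lambda>z. Phi a (z + of_real \<xi>)) holomorphic_on slits lo hi"
    by (rule holomorphic_compose[OF Phi_holomorphic]) (use assms in_slit in \<open>auto intro!: holomorphic_intros\<close>)
  show "(\<lambda>z. Phi b (z + of_real \<eta>)) holomorphic_on slits lo hi"
    by (rule holomorphic_compose[OF Phi_holomorphic]) (use assms in_slit in \<open>auto intro!: holomorphic_intros\<close>)
  show "Phi c holomorphic_on slits lo hi"
    by (rule holomorphic_on_subset[OF Phi_holomorphic]) (use assms in \<open>auto simp: slits_def slit_def\<close>)
  show "Phi c z \<noteq> 0" if "z \<in> slits lo hi" for z
    using assms(5)
  proof
    assume "hi \<le> p"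
    then show ?thesis using that assms by (intro Phi_nonzero) (auto simp: slits_def)
  next
    assume "c = 0 \<and> hi \<le> p + 1"
    then show ?thesis using that assms Phi0_nonzero[of z] by (auto simp: slits_def)
  qed
qed

lemma weighted_integrable:
  assumes "f holomorphic_on slits lo hi" "weight \<delta> f" "\<delta> > 0" "lo < s" "s < hi"
    "lo \<ge> -1" "lo \<ge> -1 - \<xi>" "lo \<ge> -1 - \<eta>" "c \<le> n" "hi \<le> p"
  shows "integrable lborel (\<lambda>t. f (line s t) * FF a b c \<xi> \<eta> (line s t))"
proof (rule line_integrable[where G = "\<lambda>z. f z * FF a b c \<xi> \<eta> z" and lo = lo and hi = hi])
  show "decays {s} (\<lambda>z. f z * FF a b c \<xi> \<eta> z)"
    using weighted_FF_decays[OF assms(2,3), of s s] by simp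
  show "(\<lambda>z. f z * FF a b c \<xi> \<eta> z) holomorphic_on slits lo hi"
    using assms by (intro holomorphic_intros FF_holomorphic) auto
qed (use assms in auto)

lemma ee_neq_1_slits: "z \<in> slits (-1) 0 \<Longrightarrow> ee z \<noteq> 1"
proof
  assume z: "z \<in> slits (-1) 0" and "ee z = 1"
  then obtain k :: int where "z = of_int k" unfolding ee_eq_1_iff by (elim Ints_cases)
  then show False using z by (auto simp: slits_def)
qed

lemma W_neq_1_line:
  assumes s: "-1 < s" "s < 0" and a: "a \<le> n"
  shows "W a (line s t) \<noteq> 1"
proof (cases "t = 0")
  case False
  then show ?thesis by (intro W_neq_1) simp
next
  case True
  then have ls: "line s t = of_real s" by (simp add: line_def)
  show ?thesis
  proof (cases "a = 0")
    case False
    then show ?thesis unfolding ls using a s p_pos by (intro W_neq_1_strip) auto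
  next
    case True
    show ?thesis unfolding ls True
    proof
      assume "W 0 (of_real s) = 1"
      then obtain i :: int where "complex_of_real s = of_real (0 * p + i * j)" unfolding W_eq_1_iff by auto
      then have i: "s = i * j" by (simp only: of_real_eq_iff)
      then have "real_of_int i < 0" using s j_pos by (simp add: mult_less_0_iff)
      then have "real_of_int i \<le> -1" by simp
      then have "i * j \<le> -1 * j" using j_pos by (intro mult_right_mono) auto
      then show False using i s j_gt_1 by linarith
    qed
  qed
qed

text \<open>The weight that survives the telescoping in \<open>difference_identity\<close>. Its
  poles are the integers, so lines are kept between -1 and 0.\<close>

definition wt :: "nat \<Rightarrow> complex \<Rightarrow> complex" where
  "wt a z = ee z * W a z * (1 / (1 - ee z))"

lemma weight_wt: "weight (2 * pi + 2 * pi / j + 0) (wt a)"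
  unfolding wt_def[abs_def] by (intro weight_mult weight_ee weight_W weight_ee_fraction)

lemma wt_pos: "2 * pi + 2 * pi / j + 0 > 0" using j_pos by (simp add: add_pos_pos)

lemma wt_holomorphic: "lo \<ge> -1 \<Longrightarrow> hi \<le> 0 \<Longrightarrow> wt a holomorphic_on slits lo hi"
  unfolding wt_def[abs_def]
  by (intro holomorphic_intros) (use ee_neq_1_slits in \<open>force simp: slits_def\<close>)

subsection \<open>A Barnes integral\<close>

text \<open>The \<open>n\<close> integrals belong together: differences between consecutive indices
  telescope over \<open>a\<close>, and by \<open>FF_shift_n\<close> the two ends differ by the shift
  of \<open>z\<close> by 1.\<close>

definition barnes :: "real \<Rightarrow> nat \<Rightarrow> nat \<Rightarrow> real \<Rightarrow> real \<Rightarrow> complex" where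
  "barnes s k l \<xi> \<eta> = (\<Sum>a<n. LI s (\<lambda>z. wt a z * FF (a + k) (a + l) a \<xi> \<eta> z))"

lemma wt_FF_integrable:
  assumes s: "-1 < s" "s < 0" "-1 < s + \<xi>" "-1 < s + \<eta>" and a: "a \<le> n"
  shows "integrable lborel (\<lambda>t. wt a (line s t) * FF b c a \<xi> \<eta> (line s t))"
    and "integrable lborel (\<lambda>t. wt a (line s t) * W a (line s t) * FF b c a \<xi> \<eta> (line s t))"
    and "integrable lborel (\<lambda>t. wt a (line s t) * ee (line s t) * FF b c a \<xi> \<eta> (line s t))"
proof -
  define lo where "lo = max (-1) (max (-1 - \<xi>) (-1 - \<eta>))"
  have lo: "lo \<ge> -1" "lo \<ge> -1 - \<xi>" "lo \<ge> -1 - \<eta>" "lo < s" using s by (auto simp: lo_def)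
  have p: "0 \<le> p" using p_pos by simp
  show "integrable lborel (\<lambda>t. wt a (line s t) * FF b c a \<xi> \<eta> (line s t))"
    by (rule weighted_integrable[OF wt_holomorphic weight_wt wt_pos lo(4) s(2) lo(1-3) a p]) (use lo in auto)
  show "integrable lborel (\<lambda>t. wt a (line s t) * W a (line s t) * FF b c a \<xi> \<eta> (line s t))"
    by (rule weighted_integrable[OF _ weight_mult[OF weight_wt weight_W] _ lo(4) s(2) lo(1-3) a p])
       (use lo wt_pos j_pos in \<open>auto intro!: holomorphic_intros wt_holomorphic add_pos_pos\<close>)
  show "integrable lborel (\<lambda>t. wt a (line s t) * ee (line s t) * FF b c a \<xi> \<eta> (line s t))"
    by (rule weighted_integrable[OF _ weight_mult[OF weight_wt weight_ee] _ lo(4) s(2) lo(1-3) a p])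
       (use lo wt_pos j_pos in \<open>auto intro!: holomorphic_intros wt_holomorphic add_pos_pos\<close>)
qed

lemma weight_one_minus_W: "weight 0 (\<lambda>z. 1 - W a z)"
proof -
  have "norm (1 - W a z) \<le> 2 * exp (- 0 * Im z)" if "Im z \<ge> 1" for z
  proof -
    have "norm (W a z) \<le> 1" using that j_pos by (simp add: norm_W)
    then show ?thesis using norm_triangle_ineq4[of 1 "W a z"] by simp
  qed
  moreover have "norm (1 - W a z) \<le> 2 * exp (- (2 * pi / j) * Im z)" if "Im z \<le> -1" for z
  proof -
    have "norm (W a z) = exp (- (2 * pi / j) * Im z)" by (simp add: norm_W)
    moreover have "1 \<le> exp (- (2 * pi / j) * Im z)" using that j_pos by (simp add: mult_nonneg_nonpos divide_nonpos_pos)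
    ultimately show ?thesis using norm_triangle_ineq4[of 1 "W a z"] unfolding norm_one by linarith
  qed
  ultimately show ?thesis unfolding weight_def by blast
qed

lemma FF_Suc_first: "FF (a + Suc k) b c \<xi> \<eta> z = (1 - W a z * W (Suc k) (of_real \<xi>)) * FF (a + k) b c \<xi> \<eta> z"
proof -
  have "Phi (a + Suc k) (z + of_real \<xi>) = (1 - W (a + Suc k) (z + of_real \<xi>)) * Phi (a + k) (z + of_real \<xi>)"
    using Phi_Suc[of "a + k"] by simp
  then show ?thesis unfolding FF_def W_add_index by simp
qed

lemma FF_Suc_all:
  assumes "W (Suc a) z \<noteq> 1"
  shows "(1 - W (Suc a) z) * FF (Suc a + k) (Suc a + l) (Suc a) \<xi> \<eta> z =
    (1 - W a z * W (Suc k) (of_real \<xi>)) * (1 - W a z * W (Suc l) (of_real \<eta>)) * FF (a + k) (a + l) a \<xi> \<eta> z"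
proof -
  have 1: "Phi (Suc a + k) (z + of_real \<xi>) = (1 - W a z * W (Suc k) (of_real \<xi>)) * Phi (a + k) (z + of_real \<xi>)"
    unfolding W_add_index[symmetric] using Phi_Suc[of "a + k"] by simp
  have 2: "Phi (Suc a + l) (z + of_real \<eta>) = (1 - W a z * W (Suc l) (of_real \<eta>)) * Phi (a + l) (z + of_real \<eta>)"
    unfolding W_add_index[symmetric] using Phi_Suc[of "a + l"] by simp
  show ?thesis unfolding FF_def 1 2 Phi_Suc[of a z] using assms by simp
qed

lemma FF_shift_n:
  assumes "z \<in> slits lo hi" "lo \<ge> -1" "lo \<ge> -1 - \<xi>" "lo \<ge> -1 - \<eta>"
  shows "FF (a + n) (b + n) (c + n) \<xi> \<eta> z = FF a b c \<xi> \<eta> (z + 1)"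
proof -
  have "z \<in> slit" using assms(1,2) by (auto simp: slits_def slit_def)
  moreover have e: "z + 1 + of_real \<xi> = z + of_real \<xi> + 1" "z + 1 + of_real \<eta> = z + of_real \<eta> + 1" by simp_all
  ultimately show ?thesis unfolding FF_def e
    using in_slit[OF assms(1,3)] in_slit[OF assms(1,4)] by (simp add: Phi_shift_n)
qed

text \<open>Contiguity by eliminating a moment. With M2 the analogue of M1 containing one more
  factor \<open>W a z\<close>, the left side uses M1 - x M2. A telescoping sum, whose ends give
  integrals over lines one unit apart and thus cancel, yields (1 - x - y) M1 + x y M2 = 0.\<close>

lemma barnes_Suc:
  assumes s: "-1 < s" "s < 0" "-1 < s + \<xi>" "-1 < s + \<eta>"
  shows "W (Suc l) (of_real \<eta>) * barnes s (Suc k) l \<xi> \<eta> = (1 - W (Suc k) (of_real \<xi>)) * barnes s k l \<xi> \<eta>"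
proof -
  define lo where "lo = max (-1) (max (-1 - \<xi>) (-1 - \<eta>))"
  have lo: "lo \<ge> -1" "lo \<ge> -1 - \<xi>" "lo \<ge> -1 - \<eta>" "lo < s" using s by (auto simp: lo_def)
  define x where "x = W (Suc k) (of_real \<xi>)"
  define y where "y = W (Suc l) (of_real \<eta>)"
  define F where "F a = FF (a + k) (a + l) a \<xi> \<eta>" for a
  define M1 where "M1 = (\<Sum>a<n. LI s (\<lambda>z. wt a z * F a z))"
  define M2 where "M2 = (\<Sum>a<n. LI s (\<lambda>z. wt a z * W a z * F a z))"
  note int = wt_FF_integrable[OF s]
  have barnes: "barnes s (Suc k) l \<xi> \<eta> = M1 - x * M2"
  proof -
    have "LI s (\<lambda>z. wt a z * FF (a + Suc k) (a + l) a \<xi> \<eta> z) = LI s (\<lambda>z. wt a z * F a z) - x * LI s (\<lambda>z. wt a z * W a z * F a z)"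
      if "a < n" for a
    proof -
      have "LI s (\<lambda>z. wt a z * FF (a + Suc k) (a + l) a \<xi> \<eta> z) = LI s (\<lambda>z. wt a z * F a z - x * (wt a z * W a z * F a z))"
        unfolding FF_Suc_first F_def x_def by (intro LI_cong) (simp add: algebra_simps)
      also have "\<dots> = LI s (\<lambda>z. wt a z * F a z) - LI s (\<lambda>z. x * (wt a z * W a z * F a z))"
        unfolding F_def using that int by (intro LI_diff integrable_mult_right) auto
      finally show ?thesis by (simp add: LI_mult)
    qed
    then show ?thesis unfolding barnes_def M1_def M2_def by (simp add: sum_subtractf sum_distrib_left)
  qed
  define G where "G a z = ee z * (1 - W a z) * (1 / (1 - ee z)) * F a z" for a z
  \<comment> \<open>\<open>G 0\<close> rewritten through the shift by \<open>p\<close>: this removes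
    the apparent pole at 0, so the line can be moved from \<open>s\<close> to
    \<open>s + 1\<close>.\<close>
  define H where "H z = ee z * Phi k (z + of_real \<xi>) * Phi l (z + of_real \<eta>) / Phi0 (z + of_real p)" for z
  have GH: "G 0 z = H z" if z: "z \<in> slit" "ee z \<noteq> 1" "W 0 z \<noteq> 1" for z
  proof -
    have "Phi0 (z + of_real p) = (1 - ee z) * Phi0 z / (1 - W 0 z)"
      using Phi0_shift_p[OF z(1)] z(3) by (simp add: field_simps)
    then show ?thesis using z by (simp add: G_def H_def F_def FF_def)
  qed
  have line_ok: "line s t \<in> slits lo 0" "line s t \<in> slits (-1) 0" "line s t \<in> slit" for t
    using line_in_slits[of lo s 0 t] line_in_slits[of "-1" s 0 t] lo s by (auto simp: slits_def slit_def)
  note W_ok = W_neq_1_line[OF s(1,2)]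
  have G_step: "G (Suc a) (line s t) - G a (line s t) =
      (1 - x - y) * (wt a (line s t) * F a (line s t)) + x * y * (wt a (line s t) * W a (line s t) * F a (line s t))"
    if "a < n" for a t
  proof -
    have *: "(1 - W (Suc a) (line s t)) * F (Suc a) (line s t) = (1 - W a (line s t) * x) * (1 - W a (line s t) * y) * F a (line s t)"
      unfolding F_def x_def y_def by (rule FF_Suc_all) (use W_ok that in auto)
    have "G (Suc a) (line s t) = ee (line s t) * (1 / (1 - ee (line s t))) * ((1 - W (Suc a) (line s t)) * F (Suc a) (line s t))"
      by (simp add: G_def)
    moreover have "e * r * ((1 - w * x) * (1 - w * y) * f) - e * (1 - w) * r * f =
        (1 - x - y) * (e * w * r * f) + x * y * (e * w * r * w * f)" for e r w f
      by (simp add: algebra_simps)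
    ultimately show ?thesis unfolding * by (simp only: G_def wt_def)
  qed
  have G_tel: "(\<Sum>a<n. G (Suc a) (line s t) - G a (line s t)) = H (line s t + of_real 1) - H (line s t)" for t
  proof -
    have "(\<Sum>a<n. G (Suc a) (line s t) - G a (line s t)) = G n (line s t) - G 0 (line s t)"
      by (rule sum_lessThan_telescope)
    also have "G 0 (line s t) = H (line s t)"
      using line_ok[of t] ee_neq_1_slits[OF line_ok(2)] W_ok[of 0 t] by (intro GH) auto
    also have "G n (line s t) = G 0 (line s t + 1)"
    proof -
      have "F n (line s t) = F 0 (line s t + 1)"
        using FF_shift_n[OF line_ok(1)[of t] lo(1-3), of k l 0] by (simp add: F_def add.commute)
      moreover have "W n (line s t) = W 0 (line s t + 1)" using W_shift_n[of 0] by simp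
      ultimately show ?thesis by (simp add: G_def ee_add)
    qed
    also have "G 0 (line s t + 1) = H (line s t + 1)"
    proof (rule GH)
      show "line s t + 1 \<in> slit" using slit_add_nonneg[OF line_ok(3), of 1] by simp
      show "ee (line s t + 1) \<noteq> 1" using ee_neq_1_slits[OF line_ok(2)] by (simp add: ee_add)
      show "W 0 (line s t + 1) \<noteq> 1" using W_ok[of n t] W_shift_n[of 0 "line s t"] by simp
    qed
    finally show ?thesis by simp
  qed
  have Hhol: "H holomorphic_on slits lo 1" unfolding H_def[abs_def]
  proof (intro holomorphic_intros)
    show "(\<lambda>z. Phi k (z + of_real \<xi>)) holomorphic_on slits lo 1"
      by (rule holomorphic_compose[OF Phi_holomorphic]) (use lo in_slit in \<open>auto intro!: holomorphic_intros\<close>)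
    show "(\<lambda>z. Phi l (z + of_real \<eta>)) holomorphic_on slits lo 1"
      by (rule holomorphic_compose[OF Phi_holomorphic]) (use lo in_slit in \<open>auto intro!: holomorphic_intros\<close>)
    show "(\<lambda>z. Phi0 (z + of_real p)) holomorphic_on slits lo 1"
      by (rule holomorphic_compose[OF Phi0_holomorphic])
         (use lo in_slit[of _ lo 1 p] p_pos in \<open>auto intro!: holomorphic_intros\<close>)
    show "Phi0 (z + of_real p) \<noteq> 0" if "z \<in> slits lo 1" for z
      using that lo p_pos by (intro Phi0_nonzero) (auto simp: slits_def)
  qed
  have Hdec: "decays {s..s + 1} H"
  proof (rule decays_cong)
    show "decays {s..s+1} (\<lambda>z. (ee z * (1 - W 0 z) * (1 / (1 - ee z))) * FF k l 0 \<xi> \<eta> z)"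
      by (rule weighted_FF_decays[OF weight_mult[OF weight_mult[OF weight_ee weight_one_minus_W] weight_ee_fraction]]) simp
    show "(ee z * (1 - W 0 z) * (1 / (1 - ee z))) * FF k l 0 \<xi> \<eta> z = H z" if z: "\<bar>Im z\<bar> \<ge> 1" for z
    proof -
      have "Im z \<noteq> 0" using z by auto
      then have "z \<in> slit" "W 0 z \<noteq> 1" "z \<in> slits (-1) 0" by (auto simp: slit_def slits_def W_neq_1)
      then show ?thesis using GH[of z] ee_neq_1_slits by (simp add: G_def F_def)
    qed
  qed
  have "(1 - x - y) * M1 + x * y * M2 = (\<Sum>a<n. (1 - x - y) * LI s (\<lambda>z. wt a z * F a z) + x * y * LI s (\<lambda>z. wt a z * W a z * F a z))"
    unfolding M1_def M2_def by (simp add: sum.distrib sum_distrib_left)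
  also have "\<dots> = (\<Sum>a<n. LI s (\<lambda>z. (1 - x - y) * (wt a z * F a z) + x * y * (wt a z * W a z * F a z)))"
  proof (rule sum.cong[OF refl])
    fix a assume "a \<in> {..<n}"
    then show "(1 - x - y) * LI s (\<lambda>z. wt a z * F a z) + x * y * LI s (\<lambda>z. wt a z * W a z * F a z) =
      LI s (\<lambda>z. (1 - x - y) * (wt a z * F a z) + x * y * (wt a z * W a z * F a z))"
      unfolding F_def LI_mult[symmetric] using int by (intro LI_add[symmetric] integrable_mult_right) auto
  qed
  also have "\<dots> = LI s (\<lambda>z. \<Sum>a<n. (1 - x - y) * (wt a z * F a z) + x * y * (wt a z * W a z * F a z))"
    unfolding LI_def F_def using int
    by (intro Bochner_Integration.integral_sum[symmetric] Bochner_Integration.integrable_add integrable_mult_right) auto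
  also have "\<dots> = LI s (\<lambda>z. H (z + of_real 1) - H z)"
    using G_step G_tel by (intro LI_cong) (metis (mono_tags, lifting) lessThan_iff sum.cong)
  also have "\<dots> = LI s (\<lambda>z. H (z + of_real 1)) - LI s H"
  proof (rule LI_diff)
    show "integrable lborel (\<lambda>t. H (line s t + of_real 1))" unfolding line_add[symmetric]
      by (rule line_integrable[OF decays_subset[OF Hdec] Hhol]) (use lo s in auto)
    show "integrable lborel (\<lambda>t. H (line s t))"
      by (rule line_integrable[OF decays_subset[OF Hdec] Hhol]) (use lo s in auto)
  qed
  also have "\<dots> = 0" unfolding LI_shift using line_shift[OF Hdec Hhol lo(4)] s by simp
  finally have "x * y * M2 = - ((1 - x - y) * M1)" by (simp add: add_eq_0_iff)
  then have "y * (M1 - x * M2) = (1 - x) * M1" by (simp add: algebra_simps)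
  then show ?thesis unfolding barnes x_def[symmetric] y_def[symmetric] by (simp add: barnes_def M1_def F_def)
qed


lemma FF_p_first:
  assumes "z + of_real \<xi> \<in> slit"
  shows "FF (a + Suc k) b c (\<xi> + p) \<eta> z = (1 - ee z * ee (of_real \<xi>)) * FF (a + k) b c \<xi> \<eta> z"
proof -
  have "Phi (a + Suc k) (z + of_real (\<xi> + p)) = (1 - ee z * ee (of_real \<xi>)) * Phi (a + k) (z + of_real \<xi>)"
    unfolding ee_add[symmetric] using Phi_Suc_shift_p[OF assms, of "a + k"] by (simp add: add.assoc)
  then show ?thesis by (simp add: FF_def)
qed

lemma FF_p_all:
  assumes "z \<in> slit" "z + of_real \<xi> \<in> slit" "z + of_real \<eta> \<in> slit" "ee z \<noteq> 1"
  shows "(1 - ee z) * FF (Suc a + k) (Suc a + l) (Suc a) \<xi> \<eta> (z + of_real p) =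
    (1 - ee z * ee (of_real \<xi>)) * (1 - ee z * ee (of_real \<eta>)) * FF (a + k) (a + l) a \<xi> \<eta> z"
proof -
  have e: "z + of_real p + of_real x = z + of_real x + of_real p" for x by simp
  have 1: "Phi (Suc a + i) (z + of_real p + of_real x) = (1 - ee z * ee (of_real x)) * Phi (a + i) (z + of_real x)"
    if "z + of_real x \<in> slit" for x i
    unfolding e ee_add[symmetric] using Phi_Suc_shift_p[OF that, of "a + i"] by simp
  show ?thesis unfolding FF_def 1[OF assms(2)] 1[OF assms(3)] Phi_Suc_shift_p[OF assms(1)]
    using assms(4) by simp
qed

text \<open>The same elimination with \<open>ee\<close> in place of \<open>W\<close>. Now index
  \<open>a + 1\<close> on the line moved by \<open>p\<close> is compared with index
  \<open>a\<close>; the functions \<open>G a\<close> lack the factor 1 / (1 - ee z), so moving the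
  lines meets no poles.\<close>

lemma barnes_Suc_shift_p:
  assumes s: "-1 < s" "s < 0" "-1 < s + \<xi>" "-1 < s + \<eta>"
  shows "ee (of_real \<eta>) * barnes s (Suc k) l (\<xi> + p) \<eta> = (1 - ee (of_real \<xi>)) * barnes s k l \<xi> \<eta>"
proof -
  define lo where "lo = max (-1) (max (-1 - \<xi>) (-1 - \<eta>))"
  have lo: "lo \<ge> -1" "lo \<ge> -1 - \<xi>" "lo \<ge> -1 - \<eta>" "lo < s" using s by (auto simp: lo_def)
  define x where "x = ee (of_real \<xi>)"
  define y where "y = ee (of_real \<eta>)"
  define F where "F a = FF (a + k) (a + l) a \<xi> \<eta>" for a
  define M1 where "M1 = (\<Sum>a<n. LI s (\<lambda>z. wt a z * F a z))"
  define M2 where "M2 = (\<Sum>a<n. LI s (\<lambda>z. wt a z * ee z * F a z))"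
  note int = wt_FF_integrable[OF s]
  have line_ok: "line s t \<in> slits lo 0" "line s t \<in> slits (-1) 0" "line s t \<in> slit" for t
    using line_in_slits[of lo s 0 t] line_in_slits[of "-1" s 0 t] lo s by (auto simp: slits_def slit_def)
  have xi_ok: "line s t + of_real \<xi> \<in> slit" "line s t + of_real \<eta> \<in> slit" for t
    using in_slit[OF line_ok(1) lo(2)] in_slit[OF line_ok(1) lo(3)] by auto
  have barnes: "barnes s (Suc k) l (\<xi> + p) \<eta> = M1 - x * M2"
  proof -
    have "LI s (\<lambda>z. wt a z * FF (a + Suc k) (a + l) a (\<xi> + p) \<eta> z) = LI s (\<lambda>z. wt a z * F a z) - x * LI s (\<lambda>z. wt a z * ee z * F a z)"
      if "a < n" for a
    proof -
      have "LI s (\<lambda>z. wt a z * FF (a + Suc k) (a + l) a (\<xi> + p) \<eta> z) = LI s (\<lambda>z. wt a z * F a z - x * (wt a z * ee z * F a z))"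
      proof (rule LI_cong)
        fix t
        show "wt a (line s t) * FF (a + Suc k) (a + l) a (\<xi> + p) \<eta> (line s t) =
          wt a (line s t) * F a (line s t) - x * (wt a (line s t) * ee (line s t) * F a (line s t))"
          unfolding FF_p_first[OF xi_ok(1)] F_def x_def by (simp add: algebra_simps)
      qed
      also have "\<dots> = LI s (\<lambda>z. wt a z * F a z) - LI s (\<lambda>z. x * (wt a z * ee z * F a z))"
        unfolding F_def using that int by (intro LI_diff integrable_mult_right) auto
      finally show ?thesis by (simp add: LI_mult)
    qed
    then show ?thesis unfolding barnes_def M1_def M2_def by (simp add: sum_subtractf sum_distrib_left)
  qed
  define G where "G a z = W a z * F a z" for a z
  have hol: "G a holomorphic_on slits lo hi" if "a \<le> n" "hi \<le> p \<or> (a = 0 \<and> hi \<le> p + 1)" for a hi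
    unfolding G_def[abs_def] F_def using that lo by (intro holomorphic_intros FF_holomorphic) auto
  have dec: "decays {a'..b'} (G a)" for a a' b'
    unfolding G_def[abs_def] F_def using j_pos by (intro weighted_FF_decays[OF weight_W]) simp
  have int_G: "integrable lborel (\<lambda>t. G a (line s' t))" if "a \<le> n" "lo < s'" "s' < p" for a s'
    by (rule line_integrable[OF _ hol[of a p]]) (use dec[of s' s' a] that in auto)
  have step: "G (Suc a) (line s t + of_real p) - G a (line s t) =
      (1 - x - y) * (wt a (line s t) * F a (line s t)) + x * y * (wt a (line s t) * ee (line s t) * F a (line s t))" for a t
  proof -
    define z where "z = line s t"
    have E: "1 - ee z \<noteq> 0" using ee_neq_1_slits[OF line_ok(2)] by (simp add: z_def)
    have "(1 - ee z) * F (Suc a) (z + of_real p) = (1 - ee z * x) * (1 - ee z * y) * F a z"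
      unfolding F_def x_def y_def using E line_ok(3) xi_ok by (intro FF_p_all) (auto simp: z_def)
    then have F': "F (Suc a) (z + of_real p) = (1 - ee z * x) * (1 - ee z * y) * F a z * (1 / (1 - ee z))"
      using E by (simp add: field_simps)
    have f: "F a z = (1 - ee z) * F a z * (1 / (1 - ee z))" using E by simp
    have aux: "w * ((1 - e * x) * (1 - e * y) * f * r) - w * ((1 - e) * f * r) =
        (1 - x - y) * (e * w * r * f) + x * y * (e * w * r * e * f)" for e r w f
      by (simp add: algebra_simps)
    have "G (Suc a) (z + of_real p) - G a z =
        W a z * ((1 - ee z * x) * (1 - ee z * y) * F a z * (1 / (1 - ee z))) - W a z * ((1 - ee z) * F a z * (1 / (1 - ee z)))"
      unfolding G_def W_Suc_shift F' f[symmetric] ..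
    then show ?thesis unfolding aux wt_def z_def[symmetric] .
  qed
  have "(1 - x - y) * M1 + x * y * M2 = (\<Sum>a<n. (1 - x - y) * LI s (\<lambda>z. wt a z * F a z) + x * y * LI s (\<lambda>z. wt a z * ee z * F a z))"
    unfolding M1_def M2_def by (simp add: sum.distrib sum_distrib_left)
  also have "\<dots> = (\<Sum>a<n. LI s (G (Suc a)) - LI s (G a))"
  proof (rule sum.cong[OF refl])
    fix a assume a: "a \<in> {..<n}"
    have "(1 - x - y) * LI s (\<lambda>z. wt a z * F a z) + x * y * LI s (\<lambda>z. wt a z * ee z * F a z) =
      LI s (\<lambda>z. (1 - x - y) * (wt a z * F a z) + x * y * (wt a z * ee z * F a z))"
      unfolding F_def LI_mult[symmetric] using int a by (intro LI_add[symmetric] integrable_mult_right) auto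
    also have "\<dots> = LI s (\<lambda>z. G (Suc a) (z + of_real p) - G a z)"
      by (rule LI_cong) (rule step[symmetric])
    also have "\<dots> = LI s (\<lambda>z. G (Suc a) (z + of_real p)) - LI s (G a)"
    proof (rule LI_diff)
      show "integrable lborel (\<lambda>t. G (Suc a) (line s t + of_real p))"
        unfolding line_add[symmetric] using a s lo p_pos by (intro int_G) auto
      show "integrable lborel (\<lambda>t. G a (line s t))" using a s lo p_pos by (intro int_G) auto
    qed
    also have "LI s (\<lambda>z. G (Suc a) (z + of_real p)) = LI s (G (Suc a))"
      unfolding LI_shift using a s lo p_pos by (intro line_shift[symmetric, OF dec hol[of "Suc a" p]]) auto
    finally show "(1 - x - y) * LI s (\<lambda>z. wt a z * F a z) + x * y * LI s (\<lambda>z. wt a z * ee z * F a z) = LI s (G (Suc a)) - LI s (G a)" .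
  qed
  also have "\<dots> = LI s (G n) - LI s (G 0)" by (rule sum_lessThan_telescope)
  also have "LI s (G n) = LI s (\<lambda>z. G 0 (z + of_real 1))"
  proof (rule LI_cong)
    fix t
    have "F n (line s t) = F 0 (line s t + 1)"
      using FF_shift_n[OF line_ok(1)[of t] lo(1-3), of k l 0] by (simp add: F_def add.commute)
    moreover have "W n (line s t) = W 0 (line s t + 1)" using W_shift_n[of 0] by simp
    ultimately show "G n (line s t) = G 0 (line s t + of_real 1)" by (simp add: G_def)
  qed
  also have "\<dots> = LI s (G 0)"
    unfolding LI_shift using s lo p_pos by (intro line_shift[symmetric, OF dec hol[of 0 "p + 1"]]) auto
  finally have "x * y * M2 = - ((1 - x - y) * M1)" by (simp add: add_eq_0_iff)
  then have "y * (M1 - x * M2) = (1 - x) * M1" by (simp add: algebra_simps)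
  then show ?thesis unfolding barnes x_def[symmetric] y_def[symmetric] by (simp add: barnes_def M1_def F_def)
qed

lemma barnes_shift_n:
  assumes s: "-1 < s" "-1 < s + \<xi>"
  shows "barnes s (k + n) l \<xi> \<eta> = barnes s k l (\<xi> + 1) \<eta>"
proof -
  have "FF (a + (k + n)) b c \<xi> \<eta> (line s t) = FF (a + k) b c (\<xi> + 1) \<eta> (line s t)" for a b c t
  proof -
    have "line s t + of_real \<xi> \<in> slit" using s by (cases "t = 0") (auto simp: slit_def)
    from Phi_shift_n[OF this, of "a + k"] show ?thesis by (simp add: FF_def add.assoc)
  qed
  then show ?thesis unfolding barnes_def by (intro sum.cong LI_cong refl) simp
qed

lemma barnes_commute: "barnes s k l \<xi> \<eta> = barnes s l k \<eta> \<xi>"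
  unfolding barnes_def FF_def by (simp add: mult_ac)

lemma barnes_indep:
  assumes "-1 < s" "s \<le> s'" "s' < 0" "-1 < s + \<xi>" "-1 < s + \<eta>"
  shows "barnes s k l \<xi> \<eta> = barnes s' k l \<xi> \<eta>"
  unfolding barnes_def
proof (rule sum.cong[OF refl])
  fix a assume a: "a \<in> {..<n}"
  define lo where "lo = max (-1) (max (-1 - \<xi>) (-1 - \<eta>))"
  have lo: "lo \<ge> -1" "lo \<ge> -1 - \<xi>" "lo \<ge> -1 - \<eta>" "lo < s" using assms by (auto simp: lo_def)
  show "LI s (\<lambda>z. wt a z * FF (a + k) (a + l) a \<xi> \<eta> z) = LI s' (\<lambda>z. wt a z * FF (a + k) (a + l) a \<xi> \<eta> z)"
  proof (rule line_shift[where lo = lo and hi = 0])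
    show "decays {s..s'} (\<lambda>z. wt a z * FF (a + k) (a + l) a \<xi> \<eta> z)"
      by (rule weighted_FF_decays[OF weight_wt wt_pos])
    show "(\<lambda>z. wt a z * FF (a + k) (a + l) a \<xi> \<eta> z) holomorphic_on slits lo 0"
      using lo a p_pos by (intro holomorphic_intros wt_holomorphic FF_holomorphic) auto
  qed (use assms lo in auto)
qed

lemma LI_FF_continuous:
  assumes A: "compact A" "\<And>x. x \<in> A \<Longrightarrow> -1 < s + x" and s: "-1 < s" "s < p" "-1 < s + \<eta>" and c: "c \<le> n"
    and f: "continuous_on UNIV (\<lambda>t. f (line s t))" "weight \<delta> f" "\<delta> > 0"
  shows "continuous_on A (\<lambda>x. LI s (\<lambda>z. f z * FF a b c x \<eta> z))"
proof -
  obtain R0 where R0: "\<And>x. x \<in> A \<Longrightarrow> \<bar>x\<bar> \<le> R0"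
    using compact_imp_bounded[OF A(1)] unfolding bounded_iff by (auto simp: real_norm_def)
  define R where "R = max R0 (max \<bar>\<eta>\<bar> \<bar>s\<bar>)"
  obtain K where K: "\<And>\<xi> \<eta> s t. \<bar>\<xi>\<bar> \<le> R \<Longrightarrow> \<bar>\<eta>\<bar> \<le> R \<Longrightarrow> \<bar>s\<bar> \<le> R \<Longrightarrow> \<bar>t\<bar> \<ge> 1 \<Longrightarrow>
     norm (f (line s t) * FF a b c \<xi> \<eta> (line s t)) \<le> K * exp (- \<delta> * \<bar>t\<bar>)"
    using weighted_FF_bound[OF f(2,3), of R a b c] by metis
  have snd: "continuous_on B (\<lambda>x. line s (snd x))" for B :: "(real \<times> real) set"
    unfolding line_def by (intro continuous_intros)
  have ins: "line s t + of_real x \<in> slit" if "-1 < s + x" for t x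
    using that by (cases "t = 0") (auto simp: slit_def)
  have cont: "continuous_on (A \<times> UNIV) (\<lambda>x. f (line s (snd x)) * FF a b c (fst x) \<eta> (line s (snd x)))"
    unfolding FF_def
  proof (intro continuous_intros)
    show "continuous_on (A \<times> UNIV) (\<lambda>x. f (line s (snd x)))"
      by (rule continuous_on_compose2[OF f(1)]) (auto intro!: continuous_intros)
    show "continuous_on (A \<times> UNIV) (\<lambda>x. Phi a (line s (snd x) + of_real (fst x)))"
      by (rule continuous_on_compose2[OF holomorphic_on_imp_continuous_on[OF Phi_holomorphic]])
         (use A ins in \<open>auto intro!: continuous_intros snd\<close>)
    show "continuous_on (A \<times> UNIV) (\<lambda>x. Phi b (line s (snd x) + of_real \<eta>))"
      by (rule continuous_on_compose2[OF holomorphic_on_imp_continuous_on[OF Phi_holomorphic]])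
         (use s ins in \<open>auto intro!: continuous_intros snd\<close>)
    show "continuous_on (A \<times> UNIV) (\<lambda>x. Phi c (line s (snd x)))"
      by (rule continuous_on_compose2[OF holomorphic_on_imp_continuous_on[OF Phi_holomorphic]])
         (use s ins[of 0] in \<open>auto intro!: continuous_intros snd\<close>)
    show "\<forall>x\<in>A \<times> UNIV. Phi c (line s (snd x)) \<noteq> 0"
    proof
      fix x assume "x \<in> A \<times> (UNIV :: real set)"
      show "Phi c (line s (snd x)) \<noteq> 0"
        by (rule Phi_nonzero[OF _ c]) (use s in \<open>cases "snd x = 0"; simp\<close>)
    qed
  qed
  show ?thesis
    by (rule line_integral_continuous[OF A(1), where \<delta> = \<delta> and K = K])
       (use cont f K R0 in \<open>auto simp: case_prod_unfold R_def le_max_iff_disj\<close>)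
qed

lemma barnes_continuous: "-1 < s \<Longrightarrow> s < 0 \<Longrightarrow> -1 < s + \<eta> \<Longrightarrow> continuous_on {-1 - s<..} (\<lambda>\<xi>. barnes s k l \<xi> \<eta>)"
proof -
  assume s: "-1 < s" "s < 0" "-1 < s + \<eta>"
  have c: "continuous_on {a..b} (\<lambda>\<xi>. barnes s k l \<xi> \<eta>)" if "-1 - s < a" for a b
    unfolding barnes_def
  proof (intro continuous_on_sum)
    fix i assume i: "i \<in> {..<n}"
    show "continuous_on {a..b} (\<lambda>\<xi>. LI s (\<lambda>z. wt i z * FF (i + k) (i + l) i \<xi> \<eta> z))"
    proof (rule LI_FF_continuous[OF _ _ s(1) _ s(3) _ _ weight_wt wt_pos])
      show "continuous_on UNIV (\<lambda>t. wt i (line s t))"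
        by (rule continuous_on_compose2[OF holomorphic_on_imp_continuous_on[OF wt_holomorphic[of "-1" 0]] continuous_on_line])
           (use s line_in_slits in auto)
    qed (use that s i p_pos in auto)
  qed
  have "isCont (\<lambda>\<xi>. barnes s k l \<xi> \<eta>) x" if x: "x \<in> {-1 - s<..}" for x
  proof -
    have "continuous_on {(-1 - s + x) / 2<..<x + 1} (\<lambda>\<xi>. barnes s k l \<xi> \<eta>)"
      by (rule continuous_on_subset[OF c[of "(-1 - s + x) / 2" "x + 1"]]) (use x in auto)
    then show ?thesis using x by (simp add: continuous_on_eq_continuous_at)
  qed
  then show ?thesis by (intro continuous_at_imp_continuous_on ballI)
qed

text \<open>The bilinear exponential that solves the multipliers \<open>W (Suc l)\<close> and
  \<open>ee\<close> of the two contiguity relations; at pole points it becomes the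
  bicharacter.\<close>

definition barnes_factor :: "nat \<Rightarrow> nat \<Rightarrow> real \<Rightarrow> real \<Rightarrow> complex" where
  "barnes_factor k l \<xi> \<eta> = ee (of_real
     (- (real n * \<xi> * \<eta> + (real k + 1) * \<eta> + (real l + 1) * \<xi> - (real k + 1) * (real l + 1) * p) / j))"

lemma barnes_factor_nonzero [simp]: "barnes_factor k l \<xi> \<eta> \<noteq> 0" by (simp add: barnes_factor_def)

lemma barnes_factor_commute: "barnes_factor k l \<xi> \<eta> = barnes_factor l k \<eta> \<xi>"
  unfolding barnes_factor_def by (simp add: algebra_simps)

lemma barnes_factor_Suc: "barnes_factor (Suc k) l \<xi> \<eta> * W (Suc l) (of_real \<eta>) = barnes_factor k l \<xi> \<eta>"
proof -
  have "W (Suc l) (of_real \<eta>) = ee (of_real ((\<eta> - (real l + 1) * p) / j))" by (simp add: W_def algebra_simps)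
  moreover have "- (real n * \<xi> * \<eta> + (real (Suc k) + 1) * \<eta> + (real l + 1) * \<xi> - (real (Suc k) + 1) * (real l + 1) * p) / j + (\<eta> - (real l + 1) * p) / j =
    - (real n * \<xi> * \<eta> + (real k + 1) * \<eta> + (real l + 1) * \<xi> - (real k + 1) * (real l + 1) * p) / j"
    unfolding add_divide_distrib[symmetric] by (simp add: algebra_simps)
  ultimately show ?thesis unfolding barnes_factor_def by (simp only: ee_add[symmetric] of_real_add[symmetric])
qed

lemma barnes_factor_Suc_shift_p: "barnes_factor (Suc k) l (\<xi> + p) \<eta> * ee (of_real \<eta>) = barnes_factor k l \<xi> \<eta>"
proof -
  have "- (real n * (\<xi> + p) * \<eta> + (real (Suc k) + 1) * \<eta> + (real l + 1) * (\<xi> + p) - (real (Suc k) + 1) * (real l + 1) * p) / j + \<eta> =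
    (- (real n * \<xi> * \<eta> + (real k + 1) * \<eta> + (real l + 1) * \<xi> - (real k + 1) * (real l + 1) * p) - (real n * p + 1) * \<eta> + j * \<eta>) / j"
    using j_pos by (simp add: field_simps)
  also have "\<dots> = - (real n * \<xi> * \<eta> + (real k + 1) * \<eta> + (real l + 1) * \<xi> - (real k + 1) * (real l + 1) * p) / j"
    by (simp add: j_def)
  finally show ?thesis unfolding barnes_factor_def ee_add[symmetric] of_real_add[symmetric] by simp
qed

lemma barnes_factor_shift_n: "barnes_factor (k + n) l \<xi> \<eta> = barnes_factor k l (\<xi> + 1) \<eta>"
proof -
  have "- (real n * \<xi> * \<eta> + (real (k + n) + 1) * \<eta> + (real l + 1) * \<xi> - (real (k + n) + 1) * (real l + 1) * p) / j =
     (- (real n * (\<xi> + 1) * \<eta> + (real k + 1) * \<eta> + (real l + 1) * (\<xi> + 1) - (real k + 1) * (real l + 1) * p) + (real l + 1) * (real n * p + 1)) / j"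
    by (simp add: algebra_simps)
  also have "\<dots> = - (real n * (\<xi> + 1) * \<eta> + (real k + 1) * \<eta> + (real l + 1) * (\<xi> + 1) - (real k + 1) * (real l + 1) * p) / j + real (Suc l)"
    unfolding j_def[symmetric] add_divide_distrib using j_pos by simp
  finally have "barnes_factor (k + n) l \<xi> \<eta> = barnes_factor k l (\<xi> + 1) \<eta> * ee (of_nat (Suc l))"
    unfolding barnes_factor_def by (simp only: of_real_add ee_add of_real_of_nat_eq)
  then show ?thesis unfolding ee_of_nat by simp
qed

lemma barnes_factor_continuous: "continuous_on A (\<lambda>\<xi>. barnes_factor k l \<xi> \<eta>)"
  unfolding barnes_factor_def by (intro continuous_intros) (use j_pos in auto)

lemma ee_neq_1_off_Lat: "x \<notin> Lat p \<Longrightarrow> ee (of_real x) \<noteq> 1"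
proof
  assume x: "x \<notin> Lat p" and "ee (of_real x) = 1"
  then obtain l :: int where "complex_of_real x = of_int l" unfolding ee_eq_1_iff by (elim Ints_cases)
  then have "x = of_int l" by (metis of_real_eq_iff of_real_of_int_eq)
  then show False using x of_int_in_Lat by simp
qed

end

lemma decays_top_bot:
  assumes "decays S G" "e > 0"
  shows "\<exists>T. \<forall>t\<ge>T. \<forall>x\<in>S. norm (G (line x t)) \<le> e" "\<exists>T. \<forall>t\<le>-T. \<forall>x\<in>S. norm (G (line x t)) \<le> e"
proof -
  obtain K \<delta> where K: "\<delta> > 0" "\<And>x t. x \<in> S \<Longrightarrow> \<bar>t\<bar> \<ge> 1 \<Longrightarrow> norm (G (line x t)) \<le> K * exp (- \<delta> * \<bar>t\<bar>)"
    using assms(1) unfolding decays_def by blast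
  have "((\<lambda>t. K * exp (- \<delta> * t)) \<longlongrightarrow> 0) at_top" using K(1) by real_asymp
  from order_tendstoD(2)[OF this assms(2)] obtain T where T: "\<And>t. t \<ge> T \<Longrightarrow> K * exp (- \<delta> * t) < e"
    unfolding eventually_at_top_linorder by blast
  have *: "norm (G (line x t)) \<le> e" if "x \<in> S" "\<bar>t\<bar> \<ge> max T 1" for x t
    using K(2)[OF that(1), of t] T[of "\<bar>t\<bar>"] that(2) by simp
  show "\<exists>T. \<forall>t\<ge>T. \<forall>x\<in>S. norm (G (line x t)) \<le> e" by (rule exI[of _ "max T 1"]) (auto intro: *)
  show "\<exists>T. \<forall>t\<le>-T. \<forall>x\<in>S. norm (G (line x t)) \<le> e" by (rule exI[of _ "max T 1"]) (auto intro!: *)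
qed

lemma line_residue:
  assumes dec: "decays {s..s'} G" and hol: "G holomorphic_on slits lo hi - {of_real x0}"
    and s: "lo < s" "s < x0" "x0 < s'" "s' < hi"
    and res: "((\<lambda>w. (w - of_real x0) * G w) \<longlongrightarrow> r) (at (of_real x0))"
  shows "(1 + \<i>) * (LI s' G - LI s G) = 2 * of_real pi * \<i> * r"
proof -
  have lim: "((\<lambda>T. (1 + \<i>) * integral {-T..T} (\<lambda>t. G (line (s + (s' - s)) t) - G (line s t)))
     \<longlongrightarrow> 2 * of_real pi * \<i> * (\<Sum>x\<in>{x0}. r) + of_real (s' - s) * 0) at_top"
  proof (rule line_residues[where lo = lo and hi = hi])
    show "\<exists>T. \<forall>t\<ge>T. \<forall>x\<in>{s..s + (s' - s)}. norm (G (line x t) - 0) \<le> e" if "e > 0" for e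
      using decays_top_bot(1)[OF dec that] by simp
    show "\<exists>T. \<forall>t\<le>-T. \<forall>x\<in>{s..s + (s' - s)}. norm (G (line x t)) \<le> e" if "e > 0" for e
      using decays_top_bot(2)[OF dec that] by simp
  qed (use hol s res in auto)
  have "slits lo x0 \<subseteq> slits lo hi - {of_real x0}" "slits x0 hi \<subseteq> slits lo hi - {of_real x0}"
    using s by (auto simp: slits_def)
  then have hol': "G holomorphic_on slits lo x0" "G holomorphic_on slits x0 hi"
    using holomorphic_on_subset[OF hol] by auto
  have int: "integrable lborel (\<lambda>t. G (line s t))" "integrable lborel (\<lambda>t. G (line s' t))"
    using s line_integrable[OF decays_subset[OF dec] hol'(1), of s] line_integrable[OF decays_subset[OF dec] hol'(2), of s'] by auto
  have "((\<lambda>T. (1 + \<i>) * integral {-T..T} (\<lambda>t. G (line s' t) - G (line s t))) \<longlongrightarrow> (1 + \<i>) * (LI s' G - LI s G)) at_top"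
    unfolding LI_def Bochner_Integration.integral_diff[OF int(2,1), symmetric]
    by (intro tendsto_mult_left tendsto_integral_lborel Bochner_Integration.integrable_diff int)
  moreover have "((\<lambda>T. (1 + \<i>) * integral {-T..T} (\<lambda>t. G (line s' t) - G (line s t))) \<longlongrightarrow> 2 * of_real pi * \<i> * r) at_top"
    using lim by simp
  ultimately show ?thesis using tendsto_unique trivial_limit_at_top_linorder by blast
qed

context quadratic_unit
begin

lemma Lat_shift [simp]: "x + 1 \<in> Lat p \<longleftrightarrow> x \<in> Lat p" "x + p \<in> Lat p \<longleftrightarrow> x \<in> Lat p"
  using Lat_add_iff[of x 0 p 1] Lat_add_iff[of x 1 p 0] by simp_all

lemma Phi_real_continuous: "A \<subseteq> {-1<..} \<Longrightarrow> continuous_on A (\<lambda>x. Phi k (of_real x))"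
  by (rule continuous_on_compose2[OF holomorphic_on_imp_continuous_on[OF Phi_holomorphic]])
     (auto intro!: continuous_intros simp: slit_def)

text \<open>Off the lattice the quotient \<open>r k \<xi>\<close> does not depend on
  \<open>k\<close>. Hence \<open>k + n\<close> against \<open>k\<close> gives the period 1 in
  \<open>\<xi>\<close>, and \<open>k + 1\<close> against \<open>k\<close> gives the period
  \<open>p\<close>.\<close>

lemma barnes_const:
  assumes s: "-1 < s" "s < 0" "-1 < s + \<eta>"
  obtains \<kappa> where "\<And>k \<xi>. -1 < s + \<xi> \<Longrightarrow> barnes s k l \<xi> \<eta> = \<kappa> * barnes_factor k l \<xi> \<eta> * Phi k (of_real \<xi>)"
proof -
  define r where "r k \<xi> = barnes s k l \<xi> \<eta> / (barnes_factor k l \<xi> \<eta> * Phi k (of_real \<xi>))" for k \<xi>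
  define S where "S = {-1 - s<..}"
  have S: "open S" "x \<in> S \<longleftrightarrow> -1 < s + x" "x \<in> S \<Longrightarrow> x > -1" "x \<in> S \<Longrightarrow> of_real x \<in> slit" for x
    using s by (auto simp: S_def slit_def)
  have nz: "Phi k (of_real x) \<noteq> 0" if "x \<in> S" "x \<notin> Lat p" for x k
    using Phi_nonzero_off_Lat S(3) that by blast
  have frac: "B' / (c' * P') = B / (c * P)"
    if "y * B' = t * B" "c' * y = c" "P' = t * P" "t \<noteq> 0" "y \<noteq> 0" for y t B B' c c' P P' :: complex
  proof -
    have "B' / (c' * P') = (y * B') / ((c' * y) * P')" using that(5) by simp
    then show ?thesis unfolding that(1-3) using that(4) by simp
  qed
  have r_Suc: "r (Suc k) x = r k x" if x: "x \<in> S" "x \<notin> Lat p" for k x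
  proof -
    have "W (Suc k) (of_real x) \<noteq> 1" using x W_eq_1_imp_Lat by blast
    then show ?thesis unfolding r_def
      using barnes_Suc[OF s(1,2) _ s(3), of x l k] x S(2) by (intro frac[OF _ barnes_factor_Suc Phi_Suc]) auto
  qed
  have r_0: "r k x = r 0 x" if "x \<in> S" "x \<notin> Lat p" for k x
    by (induction k) (simp_all add: r_Suc[OF that])
  have r_p: "r 1 (x + p) = r 0 x" if x: "x \<in> S" "x \<notin> Lat p" for x
  proof -
    have "Phi (Suc 0) (of_real (x + p)) = (1 - ee (of_real x)) * Phi 0 (of_real x)"
      using Phi_Suc_shift_p[OF S(4)[OF x(1)], of 0] by (simp only: of_real_add)
    then show ?thesis unfolding r_def One_nat_def
      using barnes_Suc_shift_p[OF s(1,2) _ s(3), of x 0 l] x S(2) ee_neq_1_off_Lat[OF x(2)]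
      by (intro frac[OF _ barnes_factor_Suc_shift_p]) auto
  qed
  have per1: "r 0 (x + 1) = r 0 x" if x: "x \<in> S" "x \<notin> Lat p" for x
  proof -
    have "r (0 + n) x = r 0 (x + 1)" unfolding r_def
      using barnes_shift_n[of s x 0 l \<eta>] Phi_shift_n[OF S(4)[OF x(1)], of 0] barnes_factor_shift_n[of 0 l x \<eta>] s(1) x S(2)
      by simp
    then show ?thesis using r_0[OF x, of n] by simp
  qed
  have perp: "r 0 (x + p) = r 0 x" if x: "x \<in> S" "x \<notin> Lat p" for x
  proof -
    have "x + p \<in> S" using x p_pos by (simp add: S_def)
    then have "r 0 (x + p) = r 1 (x + p)" using r_0[of "x + p" 1] x by simp
    then show ?thesis using r_p[OF x] by simp
  qed
  have contB: "continuous_on S (\<lambda>x. barnes s k l x \<eta>)" for k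
    unfolding S_def by (rule barnes_continuous[OF s])
  have contP: "continuous_on S (\<lambda>x. Phi k (of_real x))" for k
    using S(3) by (intro Phi_real_continuous) auto
  have cont: "isCont (r 0) x" if x: "x \<in> S" "x \<notin> Lat p" for x
    unfolding r_def
  proof (intro continuous_intros)
    show "isCont (\<lambda>x. barnes s 0 l x \<eta>) x" using contB[of 0] S(1) x by (simp add: continuous_on_eq_continuous_at)
    have "continuous_on UNIV (\<lambda>x. barnes_factor 0 l x \<eta>)" by (rule barnes_factor_continuous)
    then show "isCont (\<lambda>x. barnes_factor 0 l x \<eta>) x" by (simp add: continuous_on_eq_continuous_at)
    show "isCont (\<lambda>x. Phi 0 (of_real x)) x" using contP[of 0] S(1) x by (simp add: continuous_on_eq_continuous_at)
    show "barnes_factor 0 l x \<eta> * Phi 0 (of_real x) \<noteq> 0" using nz[OF x, of 0] by simp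
  qed
  obtain x0 where x0: "x0 \<in> S" "x0 \<notin> Lat p"
    using interval_not_Lat[of "-1 - s" 0 p] s unfolding S_def by auto
  have const: "r k x = r 0 x0" if x: "x \<in> S" "x \<notin> Lat p" for k x
  proof -
    have "r 0 x = r 0 x0"
      by (rule dense_periods_imp_const[where p = p and ?x0.0 = "-1 - s"])
         (use per1 perp cont x x0 p_irrational p_pos in \<open>auto simp: S_def\<close>)
    then show ?thesis using r_0[OF x] by simp
  qed
  have "barnes s k l x \<eta> = r 0 x0 * barnes_factor k l x \<eta> * Phi k (of_real x)" if "-1 < s + x" for k x
  proof (rule eq_off_Lat_imp_eq[where S = S and f = "\<lambda>x. barnes s k l x \<eta>" and g = "\<lambda>x. r 0 x0 * barnes_factor k l x \<eta> * Phi k (of_real x)"])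
    show "continuous_on S (\<lambda>x. r 0 x0 * barnes_factor k l x \<eta> * Phi k (of_real x))"
      by (intro continuous_intros barnes_factor_continuous contP)
    show "barnes s k l x \<eta> = r 0 x0 * barnes_factor k l x \<eta> * Phi k (of_real x)" if "x \<in> S" "x \<notin> Lat p" for x
      using const[OF that, of k, symmetric] nz[OF that, of k] by (simp add: r_def)
  qed (use S contB that in auto)
  then show ?thesis by (rule that)
qed

text \<open>The factorisation in \<open>\<xi>\<close> and, by symmetry, the one in
  \<open>\<eta>\<close> are compared at a point \<open>x0\<close> off the lattice, where
  \<open>Phi\<close> does not vanish. The constant does not depend on \<open>s\<close>, as the line
  may be moved.\<close>

lemma barnes_const2:
  obtains \<kappa> where "\<And>s k l \<xi> \<eta>. -1 < s \<Longrightarrow> s < 0 \<Longrightarrow> -1 < s + \<xi> \<Longrightarrow> -1 < s + \<eta> \<Longrightarrow>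
    barnes s k l \<xi> \<eta> = \<kappa> * barnes_factor k l \<xi> \<eta> * Phi k (of_real \<xi>) * Phi l (of_real \<eta>)"
proof -
  obtain x0 where x0: "x0 > 0" "x0 \<notin> Lat p"
    using interval_not_Lat[of 0 1 p] by auto
  have nz: "Phi k (of_real x0) \<noteq> 0" for k using x0 by (intro Phi_nonzero_off_Lat) auto
  define \<kappa> where "\<kappa> s = barnes s 0 0 x0 x0 / (barnes_factor 0 0 x0 x0 * Phi 0 (of_real x0) * Phi 0 (of_real x0))" for s
  have main: "barnes s k l \<xi> \<eta> = \<kappa> s * barnes_factor k l \<xi> \<eta> * Phi k (of_real \<xi>) * Phi l (of_real \<eta>)"
    if s: "-1 < s" "s < 0" "-1 < s + \<xi>" "-1 < s + \<eta>" for s k l \<xi> \<eta>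
  proof -
    have sx: "-1 < s + x0" using s x0 by simp
    obtain K where K: "\<And>k \<xi>. -1 < s + \<xi> \<Longrightarrow> barnes s k l \<xi> \<eta> = K * barnes_factor k l \<xi> \<eta> * Phi k (of_real \<xi>)"
      using barnes_const[OF s(1,2,4), of l] by metis
    obtain K' where K': "\<And>l \<eta>. -1 < s + \<eta> \<Longrightarrow> barnes s l 0 \<eta> x0 = K' * barnes_factor l 0 \<eta> x0 * Phi l (of_real \<eta>)"
      using barnes_const[OF s(1,2) sx, of 0] by metis
    have 1: "K * barnes_factor 0 l x0 \<eta> * Phi 0 (of_real x0) = K' * barnes_factor 0 l x0 \<eta> * Phi l (of_real \<eta>)"
      using K[OF sx, of 0] K'[OF s(4), of l] barnes_commute[of s 0 l x0 \<eta>] barnes_factor_commute[of 0 l x0 \<eta>] by simp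
    have 2: "\<kappa> s * Phi 0 (of_real x0) = K'"
      unfolding \<kappa>_def K'[OF sx] using nz[of 0] by simp
    have "barnes_factor 0 l x0 \<eta> * (K * Phi 0 (of_real x0)) = barnes_factor 0 l x0 \<eta> * (K' * Phi l (of_real \<eta>))"
      using 1 by (simp only: mult.assoc mult.left_commute)
    then have "K * Phi 0 (of_real x0) = K' * Phi l (of_real \<eta>)" by simp
    then have "K = \<kappa> s * Phi l (of_real \<eta>)" using nz[of 0] unfolding 2[symmetric] by simp
    then show ?thesis using K[OF s(3)] by simp
  qed
  have indep: "\<kappa> s = \<kappa> (- 1 / 2)" if s: "-1 < s" "s < 0" for s
  proof -
    have "barnes s 0 0 x0 x0 = barnes (- 1 / 2) 0 0 x0 x0"
    proof (cases "s \<le> - 1 / 2")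
      case True
      then show ?thesis using s x0 by (intro barnes_indep) auto
    next
      case False
      then show ?thesis using s x0 by (intro barnes_indep[symmetric]) auto
    qed
    then show ?thesis by (simp add: \<kappa>_def)
  qed
  show ?thesis
  proof (rule that[of "\<kappa> (- 1 / 2)"])
    fix s \<xi> \<eta> :: real and k l assume s: "-1 < s" "s < 0" "-1 < s + \<xi>" "-1 < s + \<eta>"
    show "barnes s k l \<xi> \<eta> = \<kappa> (- 1 / 2) * barnes_factor k l \<xi> \<eta> * Phi k (of_real \<xi>) * Phi l (of_real \<eta>)"
      unfolding indep[OF s(1,2), symmetric] by (rule main[OF s])
  qed
qed

text \<open>As \<open>x\<close> tends to \<open>-1\<close> the line at \<open>s\<close> is pinched between \<open>-1 - x\<close> and the pole at \<open>0\<close>;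
  the line at \<open>1 / 2\<close> is not.\<close>

lemma wt_FF_residue:
  assumes x: "-1 < x" "x < 0" and a: "a < n" and s: "-1 - x < s" "s < 0"
  shows "(1 + \<i>) * LI s (\<lambda>z. wt a z * FF b a a x 0 z) =
    (1 + \<i>) * LI (1/2) (\<lambda>z. wt a z * FF b a a x 0 z) + W a 0 * Phi b (of_real x)"
proof -
  define F where "F = FF b a a x 0"
  define r where "r = - (1 / (2 * of_real pi * \<i>)) * 1 * (ee 0 * W a 0 * F 0)"
  have F: "F holomorphic_on slits (-1 - x) 1"
    unfolding F_def using x a p_gt_1 by (intro FF_holomorphic) auto
  have in0: "0 \<in> slits (-1 - x) 1" using x by (simp add: slits_def)
  have "F 0 = Phi b (of_real x)"
    using Phi_nonzero[of 0 a] a p_pos by (simp add: F_def FF_def)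
  then have r: "r = - (W a 0 * Phi b (of_real x)) / (2 * of_real pi * \<i>)" by (simp add: r_def)
  have "(1 + \<i>) * (LI (1/2) (\<lambda>z. wt a z * F z) - LI s (\<lambda>z. wt a z * F z)) = 2 * of_real pi * \<i> * r"
  proof (rule line_residue[where lo = "-1 - x" and hi = 1 and ?x0.0 = 0])
    show "decays {s..1 / 2} (\<lambda>z. wt a z * F z)"
      unfolding F_def by (rule weighted_FF_decays[OF weight_wt wt_pos])
    have e1: "ee z \<noteq> 1" if "z \<in> slits (-1 - x) 1 - {of_real 0}" for z
    proof
      assume "ee z = 1"
      then obtain k :: int where k: "z = of_int k" unfolding ee_eq_1_iff by (elim Ints_cases)
      then have "-1 < k" "k < 1" "k \<noteq> 0" using that x by (auto simp: slits_def)
      then show False by linarith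
    qed
    show "(\<lambda>z. wt a z * F z) holomorphic_on slits (-1 - x) 1 - {of_real 0}"
      unfolding wt_def by (intro holomorphic_intros holomorphic_on_subset[OF F]) (use e1 in auto)
    show "((\<lambda>w. (w - of_real 0) * (wt a w * F w)) \<longlongrightarrow> r) (at (of_real 0))"
    proof -
      have "isCont F 0"
        using holomorphic_on_imp_continuous_on[OF F] open_slits in0 by (simp add: continuous_on_eq_continuous_at)
      then have F0: "(F \<longlongrightarrow> F 0) (at 0)" by (simp add: isCont_def)
      have "continuous_on UNIV (\<lambda>z. ee z * W a z)" by (intro continuous_intros)
      then have "isCont (\<lambda>z. ee z * W a z) 0" by (simp add: continuous_on_eq_continuous_at)
      then have E0: "((\<lambda>z. ee z * W a z) \<longlongrightarrow> ee 0 * W a 0) (at 0)" by (simp add: isCont_def)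
      have "((\<lambda>w. - (1 / (2 * of_real pi * \<i>)) * ((w - 0) * (2 * of_real pi * \<i> / (ee (w - 0) - 1))) * (ee w * W a w * F w)) \<longlongrightarrow> r) (at 0)"
        unfolding r_def by (intro tendsto_mult tendsto_const ee_quotient_limit E0 F0)
      moreover have "- (1 / (2 * of_real pi * \<i>)) * ((w - 0) * (2 * of_real pi * \<i> / (ee (w - 0) - 1))) * (ee w * W a w * F w) =
          (w - of_real 0) * (wt a w * F w)" for w
      proof -
        have "1 / (1 - ee w) = - (1 / (ee w - 1))" by (metis minus_diff_eq minus_divide_right)
        then show ?thesis unfolding wt_def by simp
      qed
      ultimately show ?thesis by (simp only: of_real_0)
    qed
  qed (use x s in auto)
  then show ?thesis unfolding r F_def by (simp add: algebra_simps)
qed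

text \<open>The constant is found with l = 0, \<eta> = 0 and k = n - 1. For this index,
  multiplication by \<open>1 - W n x\<close> turns \<open>Phi k0 x\<close> into
  \<open>Phi 0 (x + 1)\<close>. As x tends to -1 this residue term, of index a = 0, is the only one
  to survive: the others are regular functions times a vanishing factor.\<close>

theorem barnes_eq:
  assumes s: "-1 < s" "s < 0" "-1 < s + \<xi>" "-1 < s + \<eta>"
  shows "(1 + \<i>) * barnes s k l \<xi> \<eta> = barnes_factor k l \<xi> \<eta> * Phi k (of_real \<xi>) * Phi l (of_real \<eta>) / Phi0 0"
proof -
  obtain \<kappa> where \<kappa>: "\<And>s k l \<xi> \<eta>. -1 < s \<Longrightarrow> s < 0 \<Longrightarrow> -1 < s + \<xi> \<Longrightarrow> -1 < s + \<eta> \<Longrightarrow>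
    barnes s k l \<xi> \<eta> = \<kappa> * barnes_factor k l \<xi> \<eta> * Phi k (of_real \<xi>) * Phi l (of_real \<eta>)"
    by (rule barnes_const2) metis
  obtain k0 where k0: "n = Suc k0" using n_pos by (cases n) auto
  define R where "R x = (\<Sum>a<n. LI (1/2) (\<lambda>z. wt a z * FF (a + k0) a a x 0 z))" for x
  define lhs where "lhs x = (1 + \<i>) * \<kappa> * barnes_factor k0 0 x 0 * Phi 0 (of_real (x + 1)) * Phi0 0" for x
  define rhs where "rhs x = (1 - W n (of_real x)) * ((1 + \<i>) * R x) +
    (W 0 0 * Phi 0 (of_real (x + 1)) + (\<Sum>b<k0. W (Suc b) 0 * ((1 - W n (of_real x)) * Phi b (of_real (x + 1)))))" for x
  have eq: "lhs x = rhs x" if x: "-1 < x" "x < 0" for x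
  proof -
    \<comment> \<open>The midpoint of (-1 - x, 0), the interval that shrinks as x tends to
      -1.\<close>
    define s where "s = (-1 - x) / 2"
    have s: "-1 < s" "s < 0" "-1 - x < s" "-1 < s + x" using x by (auto simp: s_def field_simps)
    have in_slit': "complex_of_real x \<in> slit" using x by (simp add: slit_def)
    have P: "Phi (b + n) (of_real x) = Phi b (of_real (x + 1))" for b
      using Phi_shift_n[OF in_slit'] by simp
    have Pn: "(1 - W n (of_real x)) * Phi k0 (of_real x) = Phi 0 (of_real (x + 1))"
      using Phi_Suc[of k0 "of_real x"] P[of 0] by (simp add: k0)
    have "(1 + \<i>) * barnes s k0 0 x 0 = (\<Sum>a<n. (1 + \<i>) * LI s (\<lambda>z. wt a z * FF (a + k0) a a x 0 z))"
      by (simp add: barnes_def sum_distrib_left)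
    also have "\<dots> = (\<Sum>a<n. (1 + \<i>) * LI (1/2) (\<lambda>z. wt a z * FF (a + k0) a a x 0 z) + W a 0 * Phi (a + k0) (of_real x))"
      using x s by (intro sum.cong refl wt_FF_residue) auto
    also have "\<dots> = (1 + \<i>) * R x + (\<Sum>a<n. W a 0 * Phi (a + k0) (of_real x))"
      by (simp add: R_def sum.distrib sum_distrib_left)
    finally have B: "(1 + \<i>) * barnes s k0 0 x 0 = (1 + \<i>) * R x + (\<Sum>a<n. W a 0 * Phi (a + k0) (of_real x))" .
    have "lhs x = (1 - W n (of_real x)) * ((1 + \<i>) * barnes s k0 0 x 0)"
      unfolding lhs_def Pn[symmetric] using \<kappa>[of s x 0 k0 0] s by simp
    also have "\<dots> = (1 - W n (of_real x)) * ((1 + \<i>) * R x) + (\<Sum>a<n. W a 0 * ((1 - W n (of_real x)) * Phi (a + k0) (of_real x)))"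
      unfolding B by (simp add: distrib_left sum_distrib_left mult_ac)
    also have "(\<Sum>a<n. W a 0 * ((1 - W n (of_real x)) * Phi (a + k0) (of_real x))) =
      W 0 0 * ((1 - W n (of_real x)) * Phi k0 (of_real x)) +
      (\<Sum>b<k0. W (Suc b) 0 * ((1 - W n (of_real x)) * Phi (b + n) (of_real x)))"
      unfolding k0 sum.lessThan_Suc_shift by simp
    finally show ?thesis unfolding Pn P rhs_def .
  qed
  have Wc: "continuous_on UNIV (\<lambda>x. W n (complex_of_real x))" by (intro continuous_intros)
  have W1: "W n (of_real (- 1)) = 1"
  proof -
    have "W n (of_real (- 1)) = ee (of_real ((- 1 - n * p) / j))" by (simp add: W_def)
    also have "(- 1 - n * p) / j = - 1" using j_pos by (simp add: np_eq)
    finally show ?thesis by (simp add: ee_minus)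
  qed
  have W: "((\<lambda>x. W n (complex_of_real x)) \<longlongrightarrow> 1) (at_right (-1))"
    using continuous_on_tendsto_compose[OF Wc, of "\<lambda>x. x" "-1" "at_right (-1)"] W1 by simp
  have b1: "barnes_factor k0 0 (-1) 0 = 1"
  proof -
    have "- (real n * (- 1) * 0 + (real k0 + 1) * 0 + (real 0 + 1) * (- 1) - (real k0 + 1) * (real 0 + 1) * p) / j = 1"
      using j_pos k0 np_eq by (simp add: field_simps)
    then show ?thesis unfolding barnes_factor_def by (simp only: of_real_1) (simp add: ee_of_nat[of 1, simplified])
  qed
  have "continuous_on UNIV (\<lambda>x. barnes_factor k0 0 x 0)" by (rule barnes_factor_continuous)
  from continuous_on_tendsto_compose[OF this, of "\<lambda>x. x" "-1" "at_right (-1)"] b1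
  have b: "((\<lambda>x. barnes_factor k0 0 x 0) \<longlongrightarrow> 1) (at_right (-1))" by simp
  have P: "((\<lambda>x. Phi b (of_real (x + 1))) \<longlongrightarrow> Phi b 0) (at_right (-1))" for b
  proof -
    have "continuous_on {-1<..} (\<lambda>x. Phi b (of_real x))" by (rule Phi_real_continuous) simp
    then have "isCont (\<lambda>x. Phi b (of_real x)) (-1 + 1)" by (simp add: continuous_on_eq_continuous_at)
    moreover have "((\<lambda>x. x + 1) \<longlongrightarrow> -1 + (1::real)) (at_right (-1))" by (intro tendsto_intros)
    ultimately have "((\<lambda>x. Phi b (of_real (x + 1))) \<longlongrightarrow> Phi b (of_real (-1 + 1))) (at_right (-1))"
      by (rule isCont_tendsto_compose)
    then show ?thesis by simp
  qed
  \<comment> \<open>On the line at 1/2 the parameter -1 is still admissible, so \<open>R\<close>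
    stays finite while its factor \<open>1 - W n x\<close> tends to 0.\<close>
  have R: "(R \<longlongrightarrow> R (-1)) (at_right (-1))"
  proof -
    have "continuous_on {-1..0} R" unfolding R_def[abs_def]
    proof (intro continuous_on_sum)
      fix a assume a: "a \<in> {..<n}"
      show "continuous_on {-1..0} (\<lambda>x. LI (1/2) (\<lambda>z. wt a z * FF (a + k0) a a x 0 z))"
      proof (rule LI_FF_continuous[OF _ _ _ _ _ _ _ weight_wt wt_pos])
        have ne: "ee (line (1/2) t) \<noteq> 1" for t
        proof
          assume "ee (line (1/2) t) = 1"
          then obtain i :: int where i: "line (1/2) t = of_int i" unfolding ee_eq_1_iff by (elim Ints_cases)
          then have "t = 0" using Im_line[of "1/2" t] by simp
          then have "real_of_int i = 1 / 2" using i Re_line[of "1/2" t] by simp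
          then have "real_of_int (2 * i) = real_of_int 1" by simp
          then have "2 * i = 1" by (simp only: of_int_eq_iff)
          then show False by presburger
        qed
        show "continuous_on UNIV (\<lambda>t. wt a (line (1/2) t))"
          unfolding wt_def by (intro continuous_intros continuous_on_line) (use ne in auto)
      qed (use a p_gt_1 in auto)
    qed
    then have "(R \<longlongrightarrow> R (-1)) (at (-1) within {-1..0})" by (simp add: continuous_on_def)
    moreover have "at (-1) within {-1..0::real} = at_right (-1)" by (rule at_within_Icc_at_right) simp
    ultimately show ?thesis by simp
  qed
  have L: "(lhs \<longlongrightarrow> (1 + \<i>) * \<kappa> * 1 * Phi 0 0 * Phi0 0) (at_right (-1))"
    unfolding lhs_def[abs_def] by (intro tendsto_intros b P)
  have Rl: "(rhs \<longlongrightarrow> (1 - 1) * ((1 + \<i>) * R (-1)) + (W 0 0 * Phi 0 0 + (\<Sum>b<k0. W (Suc b) 0 * ((1 - 1) * Phi b 0)))) (at_right (-1))"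
    unfolding rhs_def[abs_def] by (intro tendsto_intros W P R)
  have "eventually (\<lambda>x. lhs x = rhs x) (at_right (-1))"
    by (rule eventually_mono[OF eventually_at_right_real[of "-1" 0]]) (use eq in auto)
  from Lim_transform_eventually[OF L this]
  have "(1 + \<i>) * \<kappa> * 1 * Phi 0 0 * Phi0 0 = (1 - 1) * ((1 + \<i>) * R (-1)) + (W 0 0 * Phi 0 0 + (\<Sum>b<k0. W (Suc b) 0 * ((1 - 1) * Phi b 0)))"
    using Rl by (intro tendsto_unique[of "at_right (-1::real)" rhs]) auto
  moreover have nz: "Phi0 0 \<noteq> 0" using p_pos by (intro Phi0_nonzero) auto
  moreover have "W 0 0 = 1" by (simp add: W_def)
  ultimately have "((1 + \<i>) * \<kappa> * Phi0 0) * Phi0 0 = 1 * Phi0 0" by simp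
  then have "(1 + \<i>) * \<kappa> * Phi0 0 = 1" using nz by (simp only: mult_cancel_right) simp
  then have "(1 + \<i>) * \<kappa> = 1 / Phi0 0" by (rule nonzero_eq_divide_eq[OF nz, THEN iffD2])
  then have "(1 + \<i>) * (\<kappa> * b * P * Q) = b * P * Q / Phi0 0" for b P Q
    unfolding mult.assoc[symmetric] by simp
  then show ?thesis unfolding \<kappa>[OF s] .
qed

end

lemma continuous_on_line_hol:
  assumes "f holomorphic_on slits lo hi - of_real ` P" "lo < s" "s < hi" "s \<notin> P"
  shows "continuous_on A (\<lambda>t. f (line s t))"
proof (rule continuous_on_compose2[OF holomorphic_on_imp_continuous_on[OF assms(1)] continuous_on_line])
  have "line s t \<in> slits lo hi - of_real ` P" for t
  proof (cases "t = 0")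
    case True
    then have "line s t = of_real s" by (simp add: line_def)
    then show ?thesis using assms(2-4) by (auto simp: slits_def)
  next
    case False
    then have "Im (line s t) \<noteq> 0" by simp
    moreover from this have "line s t \<notin> of_real ` P" by (metis Im_complex_of_real imageE)
    ultimately show ?thesis by (simp add: slits_def)
  qed
  then show "(\<lambda>t. line s t) ` A \<subseteq> slits lo hi - of_real ` P" by auto
qed

lemma ee_quotient_limit_scaled:
  fixes c z :: complex
  assumes "c \<noteq> 0"
  shows "((\<lambda>w. (w - z) * (c * (2 * of_real pi * \<i>) / (ee (c * (w - z)) - 1))) \<longlongrightarrow> 1) (at z)"
proof -
  have "filterlim (\<lambda>w. c * w) (at (c * z)) (at z)"
    unfolding filterlim_at using assms
    by (auto intro!: tendsto_intros simp: eventually_at_filter)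
  from filterlim_compose[OF ee_quotient_limit this] show ?thesis
    by (simp only: right_diff_distrib[symmetric] mult.assoc mult.left_commute times_divide_eq_right)
qed

context quadratic_unit
begin

lemma top_filter_line:
  assumes "(g \<longlongrightarrow> L) top_filter" "e > 0"
  shows "\<exists>T. \<forall>t\<ge>T. \<forall>x\<in>S. norm (g (line x t) - L) \<le> e"
proof -
  have "eventually (\<lambda>z. dist (g z) L < e) top_filter" using tendstoD[OF assms] .
  then obtain Y where "\<forall>z. Im z \<ge> Y \<longrightarrow> dist (g z) L < e" unfolding eventually_top_filter by blast
  then show ?thesis by (intro exI[of _ Y]) (auto simp: dist_norm intro: less_imp_le)
qed

lemma weighted_FF_bot:
  assumes w: "weight 0 f" and e: "e > 0"
  shows "\<exists>T. \<forall>t\<le>-T. \<forall>x\<in>{s..s'}. norm (f (line x t) * FF a b c \<xi> \<eta> (line x t)) \<le> e"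
proof -
  have "decays {s..s'} (\<lambda>z. (W 0 z * f z) * FF a b c \<xi> \<eta> z)"
    using j_pos by (intro weighted_FF_decays[OF weight_mult[OF weight_W w]]) simp
  from decays_top_bot(2)[OF this e] obtain T
    where T: "\<And>t x. t \<le> -T \<Longrightarrow> x \<in> {s..s'} \<Longrightarrow> norm (W 0 (line x t) * f (line x t) * FF a b c \<xi> \<eta> (line x t)) \<le> e"
    by blast
  have "norm (f (line x t) * FF a b c \<xi> \<eta> (line x t)) \<le> e" if t: "t \<le> - max T 0" and x: "x \<in> {s..s'}" for t x
  proof -
    have "1 \<le> norm (W 0 (line x t))" using t j_pos by (simp add: norm_W mult_nonneg_nonpos divide_nonpos_pos)
    then have "1 * norm (f (line x t) * FF a b c \<xi> \<eta> (line x t)) \<le> norm (W 0 (line x t)) * norm (f (line x t) * FF a b c \<xi> \<eta> (line x t))"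
      by (rule mult_right_mono) simp
    also have "\<dots> \<le> e" using T[of t x] t x by (simp add: norm_mult mult.assoc)
    finally show ?thesis by simp
  qed
  then show ?thesis by (intro exI[of _ "max T 0"]) blast
qed

lemma m_div_p: "real m / p = 1 - 1 / j" and p_div_j': "p / j = m / (n * p)"
proof -
  have "m * j = n * p * p" using p_square_j by (simp add: power2_eq_square)
  then show 1: "p / j = m / (n * p)" using j_pos p_pos n_pos by (simp add: field_simps)
  have "m / p = n * (p / j)" unfolding 1 using n_pos p_pos by simp
  also have "\<dots> = n * p / j" by simp
  also have "\<dots> = 1 - 1 / j" unfolding np_eq using j_pos by (simp add: field_simps)
  finally show "real m / p = 1 - 1 / j" .
qed

subsection \<open>The sum as a sum of residues\<close>

definition pole_pt :: "nat \<Rightarrow> nat \<Rightarrow> real" where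
  "pole_pt a b = real b * p / m - real a / n"

text \<open>This is \<open>ee z / W a z\<close>, rewritten with m / p = 1 - 1 / j so that the period
  \<open>p\<close> is visible. Thus \<open>pole_kernel\<close> is the periodic function W / (W - ee)
  of the overview.\<close>

definition V :: "nat \<Rightarrow> complex \<Rightarrow> complex" where
  "V a z = ee (of_real (real m / p) * z + of_real (real a * p / j))"

lemma pole_pt_phase: "real m / p * (x * p / m - real a / n) + real a * p / j = x"
proof -
  have "real a * p / j = real m * real a / (p * n)"
    unfolding times_divide_eq_right[symmetric] p_div_j' by (simp add: mult_ac)
  moreover have "real m / p * (x * p / m - real a / n) = x - real m * real a / (p * n)"
    using p_pos m_pos n_pos by (simp add: field_simps)
  ultimately show ?thesis by simp
qed

lemma W_mult_V: "W a z * V a z = ee z"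
proof -
  have "(z - of_real (a * p)) / of_real j + (of_real (real m / p) * z + of_real (real a * p / j)) = z"
    unfolding m_div_p using j_pos by (simp add: field_simps)
  then show ?thesis unfolding W_def V_def ee_add[symmetric] by simp
qed

lemma V_shift_p: "V a (z + of_real p) = V a z"
proof -
  have "of_real (real m / p) * (z + of_real p) + of_real (real a * p / j) =
    (of_real (real m / p) * z + of_real (real a * p / j)) + of_nat m"
    using p_pos by (simp add: field_simps)
  then show ?thesis unfolding V_def by (simp only: ee_add ee_of_nat mult_1_right)
qed

lemma norm_V: "norm (V a z) = exp (- 2 * pi * (m / p * Im z))"
  by (simp add: V_def norm_ee)

lemma V_top: "(V a \<longlongrightarrow> 0) top_filter"
proof -
  have Im: "filterlim Im at_top top_filter" unfolding top_filter_def by (rule filterlim_filtercomap)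
  have "((\<lambda>y. exp (- 2 * pi * (m / p * y))) \<longlongrightarrow> 0) at_top"
    using m_pos p_pos by real_asymp
  from filterlim_compose[OF this Im] show ?thesis
    unfolding norm_V[of a, symmetric] by (rule tendsto_norm_zero_cancel)
qed

lemma V_at_pole_pt: "V a (of_real (pole_pt a b) + w) = ee (of_real (real m / p) * w)"
proof -
  have "real m / p * pole_pt a b + real a * p / j = real b"
    unfolding pole_pt_def by (rule pole_pt_phase)
  then have *: "of_real (real m / p) * of_real (pole_pt a b) + of_real (real a * p / j) = (of_nat b :: complex)"
    by (metis of_real_add of_real_mult of_real_of_nat_eq)
  have "of_real (real m / p) * (of_real (pole_pt a b) + w) + of_real (real a * p / j) =
    (of_real (real m / p) * of_real (pole_pt a b) + of_real (real a * p / j)) + of_real (real m / p) * w"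
    by (simp add: algebra_simps)
  then show ?thesis unfolding V_def * by (simp only: ee_add ee_of_nat mult_1_left)
qed

lemma ee_eq_W_pole_pt: "ee (of_real (pole_pt a b)) = W a (of_real (pole_pt a b))"
  using W_mult_V[of a "of_real (pole_pt a b)"] V_at_pole_pt[of a b 0] by simp

lemma V_eq_1_iff: "V a z = 1 \<longleftrightarrow> (\<exists>b::int. z = of_real (of_int b * p / m - real a / n))"
proof -
  have c: "of_real (real m / p) \<noteq> (0::complex)" using m_pos p_pos by simp
  have "V a z = 1 \<longleftrightarrow> (\<exists>b::int. of_real (real m / p) * z + of_real (real a * p / j) = of_int b)"
    unfolding V_def ee_eq_1_iff by (auto elim: Ints_cases)
  also have "\<dots> \<longleftrightarrow> (\<exists>b::int. z = of_real (of_int b * p / m - real a / n))"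
  proof (rule ex_cong1)
    fix b :: int
    have "real m / p * (of_int b * p / m - real a / n) + real a * p / j = of_int b"
      by (rule pole_pt_phase)
    then have *: "of_real (real m / p) * of_real (of_int b * p / m - real a / n) + of_real (real a * p / j) = (of_int b :: complex)"
      by (metis of_real_add of_real_mult of_real_of_int_eq)
    show "of_real (real m / p) * z + of_real (real a * p / j) = of_int b \<longleftrightarrow> z = of_real (of_int b * p / m - real a / n)"
      unfolding *[symmetric] using c by simp
  qed
  finally show ?thesis .
qed

definition pole_kernel :: "nat \<Rightarrow> complex \<Rightarrow> complex" where
  "pole_kernel a z = 1 / (1 - V a z)"

lemma weight_pole_kernel: "weight 0 (pole_kernel a)"
  unfolding pole_kernel_def[abs_def] V_def using m_pos p_pos by (intro weight_ee_affine_fraction) simp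

lemma pole_kernel_top: "(pole_kernel a \<longlongrightarrow> 1) top_filter"
proof -
  have "((\<lambda>z. 1 / (1 - V a z)) \<longlongrightarrow> 1 / (1 - 0)) top_filter"
    by (intro tendsto_intros V_top) simp
  then show ?thesis by (simp add: pole_kernel_def[abs_def])
qed

text \<open>The right end p - 1 + 1/n is the smallest pole with b = m, reached for a = n - 1. On the
  left a negative b gives at most -p/m, which is below -1.\<close>

lemma V_neq_1:
  assumes z: "z \<in> slits (-1) (p - 1 + 1 / n)" "z \<notin> of_real ` pole_pt a ` {..<m}" and a: "a < n"
  shows "V a z \<noteq> 1"
proof
  assume "V a z = 1"
  then obtain b :: int where b: "z = of_real (of_int b * p / m - real a / n)" unfolding V_eq_1_iff by blast
  have an: "0 \<le> real a / n" "real a / n \<le> 1 - 1 / n"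
    using a by (auto simp: field_simps)
  have lo: "-1 < of_int b * p / m - real a / n" and hi: "of_int b * p / m - real a / n < p - 1 + 1 / n"
    using z(1) by (auto simp: b slits_def)
  have "b \<ge> 0"
  proof (rule ccontr)
    assume "\<not> b \<ge> 0"
    then have "of_int b * (p / m) \<le> -1 * (p / m)" using p_pos m_pos by (intro mult_right_mono) auto
    moreover have "p / m > 1" using p_gt m_pos by simp
    ultimately show False using lo an by simp
  qed
  moreover have "b < m"
  proof (rule ccontr)
    assume "\<not> b < m"
    then have "real m * (p / m) \<le> of_int b * (p / m)" using p_pos m_pos by (intro mult_right_mono) auto
    then show False using hi an m_pos by simp
  qed
  ultimately have "z = of_real (pole_pt a (nat b))" "nat b < m" by (auto simp: b pole_pt_def)
  then show False using z(2) by auto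
qed

lemma pole_pt_bounds:
  assumes "a < n" "b < m"
  shows "-1 + 1 / n \<le> pole_pt a b" "pole_pt a b < p - 1"
proof -
  have an: "0 \<le> real a / n" "real a / n \<le> 1 - 1 / n" using assms by (auto simp: field_simps)
  have "0 \<le> real b * p / m" using p_pos by simp
  then show "-1 + 1 / n \<le> pole_pt a b" using an by (simp add: pole_pt_def)
  have "(real b + 1) * (p / m) \<le> real m * (p / m)" using assms p_pos by (intro mult_right_mono) auto
  moreover have "(real b + 1) * (p / m) = real b * p / m + p / m" by (simp add: distrib_right add_divide_distrib)
  moreover have "real m * (p / m) = p" using m_pos by simp
  moreover have "p / m > 1" using p_gt m_pos by simp
  ultimately have "real b * p / m < p - 1" by linarith
  then show "pole_pt a b < p - 1" unfolding pole_pt_def using an(1) by linarith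
qed

lemma inj_pole_pt: "inj (pole_pt a)"
  using p_pos m_pos by (auto simp: inj_def pole_pt_def)


text \<open>The leftmost possible pole is -1 + 1/n, so this \<open>s\<close> lies to the left of all
  poles, and the strip of width \<open>p\<close> holds exactly the \<open>m\<close> poles of index
  \<open>a\<close>. The limit 1 at the top contributes the summand \<open>p\<close>.\<close>

lemma FF_pole_kernel_residues:
  fixes a k l :: nat and \<xi> \<eta> s :: real
  assumes a: "a < n" and xi: "\<xi> > 0" "\<eta> > 0" and s: "s = -1 + 1 / (2 * real n)"
  defines "F \<equiv> FF (a + k) (a + l) a \<xi> \<eta>"
  shows "((\<lambda>T. (1 + \<i>) * integral {-T..T} (\<lambda>t. F (line (s + p) t) * pole_kernel a (line (s + p) t) - F (line s t) * pole_kernel a (line s t)))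
    \<longlongrightarrow> of_real p - of_real (p / m) * (\<Sum>b<m. F (of_real (pole_pt a b)))) at_top"
    and "continuous_on A (\<lambda>t. F (line s t) * pole_kernel a (line s t))"
    and "continuous_on A (\<lambda>t. F (line (s + p) t) * pole_kernel a (line (s + p) t))"
proof -
  define P where "P = pole_pt a ` {..<m}"
  define hi where "hi = p - 1 + 1 / n"
  \<comment> \<open>The kernel is 1 / (1 - ee (c (w - x))) near a pole, with c = m / p, hence the
    residue -1 / (2 pi i c).\<close>
  define r where "r x = - of_real (p / m) * 1 * F (of_real x) / (2 * of_real pi * \<i>)" for x
  have n2: "0 < 1 / (2 * real n)" "1 / (2 * real n) < 1 / n" "1 / real n \<le> 1" using n_pos by (auto simp: field_simps)
  have s': "-1 < s" "s + p < hi" "s < hi" "-1 < s + p" "hi \<le> p" unfolding s hi_def using n2 p_pos by linarith+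
  have P: "s < x" "x < s + p" if "x \<in> P" for x
    using that pole_pt_bounds[OF a] n2 unfolding P_def s by fastforce+
  have notP: "s \<notin> P" "s + p \<notin> P" using P by fastforce+
  have F: "F holomorphic_on slits (-1) hi"
    unfolding F_def using xi a s' by (intro FF_holomorphic) auto
  have hol: "(\<lambda>z. F z * pole_kernel a z) holomorphic_on slits (-1) hi - of_real ` P"
    unfolding pole_kernel_def
  proof (intro holomorphic_intros holomorphic_on_subset[OF F])
    show "V a holomorphic_on slits (-1) hi - of_real ` P" unfolding V_def[abs_def] by (intro holomorphic_intros)
    show "1 - V a z \<noteq> 0" if "z \<in> slits (-1) hi - of_real ` P" for z
      using V_neq_1[of z a] that a unfolding P_def hi_def image_image by auto
  qed auto
  show "continuous_on A (\<lambda>t. F (line s t) * pole_kernel a (line s t))"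
    using continuous_on_line_hol[OF hol s'(1,3) notP(1)] .
  show "continuous_on A (\<lambda>t. F (line (s + p) t) * pole_kernel a (line (s + p) t))"
    using continuous_on_line_hol[OF hol s'(4,2) notP(2)] .
  have "((\<lambda>T. (1 + \<i>) * integral {-T..T} (\<lambda>t. F (line (s + p) t) * pole_kernel a (line (s + p) t) - F (line s t) * pole_kernel a (line s t)))
    \<longlongrightarrow> 2 * of_real pi * \<i> * (\<Sum>x\<in>P. r x) + of_real p * 1) at_top"
  proof (rule line_residues[OF p_pos s'(1,2) _ hol])
    show "finite P" by (simp add: P_def)
    show "s < x \<and> x < s + p" if "x \<in> P" for x using P[OF that] by simp
    show "\<exists>T. \<forall>t\<ge>T. \<forall>x\<in>{s..s + p}. norm (F (line x t) * pole_kernel a (line x t) - 1) \<le> e" if "e > 0" for e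
    proof (rule top_filter_line[OF _ that])
      have "((\<lambda>z. F z * pole_kernel a z) \<longlongrightarrow> 1 * 1) top_filter" unfolding F_def by (intro tendsto_mult FF_top pole_kernel_top)
      then show "((\<lambda>z. F z * pole_kernel a z) \<longlongrightarrow> 1) top_filter" by simp
    qed
    show "\<exists>T. \<forall>t\<le>-T. \<forall>x\<in>{s..s + p}. norm (F (line x t) * pole_kernel a (line x t)) \<le> e" if "e > 0" for e
      using weighted_FF_bot[OF weight_pole_kernel that, of s "s + p" a "a + k" "a + l" a \<xi> \<eta>] by (simp add: F_def mult.commute)
    show "((\<lambda>w. (w - of_real x) * (F w * pole_kernel a w)) \<longlongrightarrow> r x) (at (of_real x))" if x: "x \<in> P" for x
    proof -
      obtain b where b: "x = pole_pt a b" using x by (auto simp: P_def)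
      define c :: complex where "c = of_real (real m / p)"
      have c: "c \<noteq> 0" using m_pos p_pos by (simp add: c_def)
      have "of_real x \<in> slits (-1) hi" using P[OF x] s' by (simp add: slits_def)
      then have "isCont F (of_real x)"
        using holomorphic_on_imp_continuous_on[OF F] open_slits by (simp add: continuous_on_eq_continuous_at)
      then have F0: "(F \<longlongrightarrow> F (of_real x)) (at (of_real x))" by (simp add: isCont_def)
      have "((\<lambda>w. - of_real (p / m) * ((w - of_real x) * (c * (2 * of_real pi * \<i>) / (ee (c * (w - of_real x)) - 1))) * F w / (2 * of_real pi * \<i>)) \<longlongrightarrow> r x) (at (of_real x))"
        unfolding r_def by (intro tendsto_mult tendsto_divide tendsto_const ee_quotient_limit_scaled F0 c) simp
      moreover have "- of_real (p / m) * ((w - of_real x) * (c * (2 * of_real pi * \<i>) / (ee (c * (w - of_real x)) - 1))) * F w / (2 * of_real pi * \<i>) =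
        (w - of_real x) * (F w * pole_kernel a w)" for w
      proof -
        have V: "V a w = ee (c * (w - of_real x))" using V_at_pole_pt[of a b "w - of_real x"] by (simp add: c_def b)
        have pc: "of_real (p / m) * c = 1" using m_pos p_pos by (simp add: c_def)
        have d: "2 * of_real pi * \<i> \<noteq> 0" by simp
        have aux: "- of_real (p / m) * (y * (c * d / u)) * f / d = y * (f * (1 / (- u)))" if "d \<noteq> 0" for y d u f :: complex
        proof -
          have "- of_real (p / m) * (y * (c * d / u)) * f / d = - (of_real (p / m) * c) * (y * (f * (1 / u)))"
            using that by simp
          then show ?thesis unfolding pc by simp
        qed
        show ?thesis unfolding aux[OF d] pole_kernel_def V minus_diff_eq ..
      qed
      ultimately show ?thesis by simp
    qed
  qed
  moreover have "2 * of_real pi * \<i> * (\<Sum>x\<in>P. r x) = - of_real (p / m) * (\<Sum>b<m. F (of_real (pole_pt a b)))"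
    unfolding P_def sum.reindex[OF inj_on_subset[OF inj_pole_pt subset_UNIV]] sum_distrib_left
    by (intro sum.cong refl) (simp add: r_def)
  ultimately show "((\<lambda>T. (1 + \<i>) * integral {-T..T} (\<lambda>t. F (line (s + p) t) * pole_kernel a (line (s + p) t) - F (line s t) * pole_kernel a (line s t)))
    \<longlongrightarrow> of_real p - of_real (p / m) * (\<Sum>b<m. F (of_real (pole_pt a b)))) at_top"
    by (simp add: algebra_simps)
qed

lemma FF_shift_p_all:
  assumes "z \<in> slit" "z + of_real \<xi> \<in> slit" "z + of_real \<eta> \<in> slit" "ee z \<noteq> 1" "W a z \<noteq> 1"
  shows "(1 - ee z) * FF (a + Suc k) (a + Suc l) a \<xi> \<eta> (z + of_real p) =
    (1 - ee z * ee (of_real \<xi>)) * (1 - ee z * ee (of_real \<eta>)) * (1 - W a z) * FF (a + k) (a + l) a \<xi> \<eta> z"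
proof -
  have e: "z + of_real p + of_real x = z + of_real x + of_real p" for x by simp
  have 1: "Phi (a + Suc i) (z + of_real p + of_real x) = (1 - ee z * ee (of_real x)) * Phi (a + i) (z + of_real x)"
    if "z + of_real x \<in> slit" for x i
    unfolding e ee_add[symmetric] using Phi_Suc_shift_p[OF that, of "a + i"] by simp
  have 2: "Phi a (z + of_real p) = (1 - ee z) * Phi a z / (1 - W a z)"
    using Phi_shift_p[OF assms(1), of a] assms(5) by (simp add: field_simps)
  show ?thesis unfolding FF_def 1[OF assms(2)] 1[OF assms(3)] 2
    using assms(4,5) by simp
qed

lemma FF_Suc_both:
  "FF (a + Suc k) (a + Suc l) c \<xi> \<eta> z = (1 - W a z * W (Suc k) (of_real \<xi>)) * (1 - W a z * W (Suc l) (of_real \<eta>)) * FF (a + k) (a + l) c \<xi> \<eta> z"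
proof -
  have "Phi (a + Suc i) (z + of_real x) = (1 - W a z * W (Suc i) (of_real x)) * Phi (a + i) (z + of_real x)" for i x
    unfolding W_add_index[symmetric] using Phi_Suc[of "a + i"] by simp
  then show ?thesis by (simp add: FF_def)
qed

text \<open>The assumptions on \<open>\<xi>\<close> and \<open>\<eta>\<close>, valid at pole points,
  make the factors from the shift by \<open>p\<close> and from the index step share the same x and
  y. The difference then vanishes at v = 1, cancelling the pole of the kernel; what remains is a
  rational identity in w, v, x, y.\<close>

lemma difference_identity:
  assumes z: "z \<in> slit" "z + of_real \<xi> \<in> slit" "z + of_real \<eta> \<in> slit" "ee z \<noteq> 1" "W a z \<noteq> 1" "W (Suc a) z \<noteq> 1" "V a z \<noteq> 1"
    and xi: "ee (of_real \<xi>) = W (Suc k) (of_real \<xi>)" "ee (of_real \<eta>) = W (Suc l) (of_real \<eta>)"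
  shows "(FF (a + Suc k) (a + Suc l) a \<xi> \<eta> (z + of_real p) - FF (a + Suc k) (a + Suc l) a \<xi> \<eta> z) * pole_kernel a z =
    FF (a + k) (a + l) a \<xi> \<eta> z * (1 - W a z) - FF (Suc a + k) (Suc a + l) (Suc a) \<xi> \<eta> z * (1 - W (Suc a) z)
    - (1 - ee (of_real \<xi>)) * (1 - ee (of_real \<eta>)) * (wt a z * FF (a + k) (a + l) a \<xi> \<eta> z)"
proof -
  define w where "w = W a z"
  define v where "v = V a z"
  define x where "x = ee (of_real \<xi>)"
  define y where "y = ee (of_real \<eta>)"
  define f where "f = FF (a + k) (a + l) a \<xi> \<eta> z"
  have u: "ee z = w * v" by (simp add: w_def v_def W_mult_V)
  have E: "1 - w * v \<noteq> 0" using z(4) u by simp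
  have v1: "1 - v \<noteq> 0" using z(7) by (simp add: v_def)
  have A: "FF (a + Suc k) (a + Suc l) a \<xi> \<eta> (z + of_real p) = (1 - w * v * x) * (1 - w * v * y) * (1 - w) * f / (1 - w * v)"
    using FF_shift_p_all[OF z(1-5), of k l] E unfolding u w_def[symmetric] x_def[symmetric] y_def[symmetric] f_def[symmetric]
    by (simp add: field_simps)
  have B: "FF (a + Suc k) (a + Suc l) a \<xi> \<eta> z = (1 - w * x) * (1 - w * y) * f"
    unfolding FF_Suc_both xi[symmetric] w_def x_def y_def f_def ..
  have C: "FF (Suc a + k) (Suc a + l) (Suc a) \<xi> \<eta> z * (1 - W (Suc a) z) = (1 - w * x) * (1 - w * y) * f"
    using FF_Suc_all[OF z(6), of k l \<xi> \<eta>] unfolding xi[symmetric] w_def x_def y_def f_def by (simp add: mult.commute)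
  have "((1 - w * v * x) * (1 - w * v * y) * (1 - w) * f / (1 - w * v) - (1 - w * x) * (1 - w * y) * f) * (1 / (1 - v)) =
    f * (1 - w) - (1 - w * x) * (1 - w * y) * f - (1 - x) * (1 - y) * (w * v * w * (1 / (1 - w * v)) * f)"
    using E v1 by (simp add: divide_simps) (simp add: algebra_simps)
  then show ?thesis
    unfolding A B C pole_kernel_def wt_def u f_def[symmetric] x_def[symmetric] y_def[symmetric] w_def[symmetric] v_def[symmetric] by simp
qed

text \<open>The \<open>n\<close> strips contribute n p from the limit at the top. The telescoping
  part closes into a shift by 1 and contributes 1, so the sum is \<open>j\<close>; the rest is the
  Barnes integral, whose factor (1 - ee \<xi>) (1 - ee \<eta>) raises both indices.\<close>

theorem FF_sum:
  assumes pos: "\<xi> > 0" "\<eta> > 0"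
    and xi: "ee (of_real \<xi>) = W (Suc k) (of_real \<xi>)" "ee (of_real \<eta>) = W (Suc l) (of_real \<eta>)"
  shows "of_real (p / m) * (\<Sum>a<n. \<Sum>b<m. FF (a + Suc k) (a + Suc l) a \<xi> \<eta> (of_real (pole_pt a b))) =
    of_real j + barnes_factor k l \<xi> \<eta> * Phi (Suc k) (of_real \<xi>) * Phi (Suc l) (of_real \<eta>) / Phi0 0"
proof -
  define s where "s = -1 + 1 / (2 * real n)"
  have n2: "0 < 1 / (2 * real n)" "1 / (2 * real n) < 1 / n" "1 / real n \<le> 1" using n_pos by (auto simp: field_simps)
  have s: "-1 < s" "s < 0" "s < -1 + 1 / n" "-1 < s + \<xi>" "-1 < s + \<eta>" unfolding s_def using n2 pos by linarith+
  define F where "F a = FF (a + Suc k) (a + Suc l) a \<xi> \<eta>" for a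
  define f where "f a t = F a (line (s + p) t) * pole_kernel a (line (s + p) t) - F a (line s t) * pole_kernel a (line s t)" for a t
  define g where "g a z = FF (a + k) (a + l) a \<xi> \<eta> z * (1 - W a z)" for a z
  define B where "B t = (\<Sum>a<n. wt a (line s t) * FF (a + k) (a + l) a \<xi> \<eta> (line s t))" for t
  define c where "c = (1 - ee (of_real \<xi>)) * (1 - ee (of_real \<eta>))"
  note res = FF_pole_kernel_residues[where k = "Suc k" and l = "Suc l", OF _ pos s_def, folded F_def]
  have lim_f: "((\<lambda>T. (1 + \<i>) * integral {-T..T} (f a)) \<longlongrightarrow> of_real p - of_real (p / m) * (\<Sum>b<m. F a (of_real (pole_pt a b)))) at_top"
    and cont_f: "continuous_on A (f a)" if "a < n" for a A
    unfolding f_def[abs_def] using res(1)[OF that] continuous_on_diff[OF res(3)[OF that] res(2)[OF that]] by auto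
  have D: "g 0 holomorphic_on slits (-1) (p + 1)"
    unfolding g_def using pos by (intro holomorphic_intros FF_holomorphic) auto
  have lim_D: "((\<lambda>T. (1 + \<i>) * integral {-T..T} (\<lambda>t. g 0 (line (s + 1) t) - g 0 (line s t)))
    \<longlongrightarrow> 2 * of_real pi * \<i> * (\<Sum>x\<in>({} :: real set). 0) + of_real 1 * 1) at_top"
  proof (rule line_residues[where lo = "-1" and hi = "p + 1"])
    show "\<exists>T. \<forall>t\<ge>T. \<forall>x\<in>{s..s + 1}. norm (g 0 (line x t) - 1) \<le> e" if "e > 0" for e
    proof (rule top_filter_line[OF _ that])
      have "(g 0 \<longlongrightarrow> 1 * (1 - 0)) top_filter" unfolding g_def[abs_def] by (intro tendsto_intros FF_top W_top)
      then show "(g 0 \<longlongrightarrow> 1) top_filter" by simp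
    qed
    show "\<exists>T. \<forall>t\<le>-T. \<forall>x\<in>{s..s + 1}. norm (g 0 (line x t)) \<le> e" if "e > 0" for e
      using weighted_FF_bot[OF weight_one_minus_W that, of s "s + 1" 0 k l 0 \<xi> \<eta>] by (simp add: g_def mult.commute)
  qed (use D s p_pos in auto)
  have cont_D: "continuous_on A (\<lambda>t. g 0 (line (s + 1) t) - g 0 (line s t))" for A
    using s p_pos by (intro continuous_on_diff continuous_on_line_hol[where lo = "-1" and hi = "p + 1" and P = "{}"])
      (use D in auto)
  have int_B: "integrable lborel (\<lambda>t. wt a (line s t) * FF (a + k) (a + l) a \<xi> \<eta> (line s t))" if "a < n" for a
    using that by (intro wt_FF_integrable(1) s) auto
  have lim_B: "((\<lambda>T. integral {-T..T} B) \<longlongrightarrow> barnes s k l \<xi> \<eta>) at_top"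
  proof -
    have "integrable lborel B" unfolding B_def[abs_def] using int_B by (intro Bochner_Integration.integrable_sum) auto
    from tendsto_integral_lborel[OF this] show ?thesis
      unfolding B_def[abs_def] barnes_def LI_def using int_B by (subst (asm) Bochner_Integration.integral_sum) auto
  qed
  have cont_B: "continuous_on A B" for A
    unfolding B_def[abs_def]
  proof (intro continuous_on_sum continuous_on_mult)
    fix a assume a: "a \<in> {..<n}"
    show "continuous_on A (\<lambda>t. wt a (line s t))"
      by (rule continuous_on_line_hol[where lo = "-1" and hi = 0 and P = "{}"]) (use s wt_holomorphic in auto)
    show "continuous_on A (\<lambda>t. FF (a + k) (a + l) a \<xi> \<eta> (line s t))"
      by (rule continuous_on_line_hol[where lo = "-1" and hi = 0 and P = "{}"])
         (use s pos a p_pos FF_holomorphic[of "-1" \<xi> \<eta> a 0] in auto)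
  qed
  \<comment> \<open>Since \<open>V\<close> has period \<open>p\<close>, both lines carry the same
    kernel value; this puts \<open>f\<close> in the form of
    \<open>difference_identity\<close>.\<close>
  have sum_f: "(\<Sum>a<n. f a t) = - (g 0 (line (s + 1) t) - g 0 (line s t)) - c * B t" for t
  proof -
    define z where "z = line s t"
    have z: "z \<in> slits (-1) 0" "z \<in> slits (-1) (p - 1 + 1 / n)"
      unfolding z_def using s(1-3) p_pos by (intro line_in_slits; linarith)+
    have sl: "z \<in> slit" "z + of_real \<xi> \<in> slit" "z + of_real \<eta> \<in> slit"
      using in_slit[OF z(1), of 0] in_slit[OF z(1), of \<xi>] in_slit[OF z(1), of \<eta>] pos by auto
    have ne: "ee z \<noteq> 1" "W a z \<noteq> 1" if "a \<le> n" for a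
      using ee_neq_1_slits[OF z(1)] W_neq_1_line[OF s(1,2) that] by (auto simp: z_def)
    have Vne: "V a z \<noteq> 1" if "a < n" for a
    proof (rule V_neq_1[OF z(2) _ that])
      show "z \<notin> of_real ` pole_pt a ` {..<m}"
      proof
        assume "z \<in> of_real ` pole_pt a ` {..<m}"
        then obtain b where b: "b < m" "z = of_real (pole_pt a b)" by auto
        have "Im z = 0" "Re z = pole_pt a b" by (simp_all add: b(2))
        then have "t = 0" "s + t = pole_pt a b" by (simp_all add: z_def)
        then show False using pole_pt_bounds(1)[OF that b(1)] s(3) by linarith
      qed
    qed
    have "f a t = (g a z - g (Suc a) z) - c * (wt a z * FF (a + k) (a + l) a \<xi> \<eta> z)" if a: "a < n" for a
    proof -
      have "f a t = (F a (z + of_real p) - F a z) * pole_kernel a z"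
        unfolding f_def line_add z_def[symmetric] pole_kernel_def V_shift_p by (simp add: diff_divide_distrib)
      also have "\<dots> = (g a z - g (Suc a) z) - c * (wt a z * FF (a + k) (a + l) a \<xi> \<eta> z)"
        unfolding F_def g_def c_def using a by (intro difference_identity sl ne[of a] ne(2)[of "Suc a"] Vne xi) auto
      finally show ?thesis .
    qed
    then have "(\<Sum>a<n. f a t) = (\<Sum>a<n. g a z - g (Suc a) z) - c * B t"
      by (simp add: sum_subtractf B_def sum_distrib_left z_def[symmetric])
    also have "(\<Sum>a<n. g a z - g (Suc a) z) = g 0 z - g n z" by (rule sum_lessThan_telescope')
    also have "g n z = g 0 (z + 1)"
      using FF_shift_n[OF z(1), of \<xi> \<eta> k l 0] W_shift_n[of 0 z] pos by (simp add: g_def add.commute)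
    finally show ?thesis by (simp add: z_def line_add)
  qed
  have eq: "(\<Sum>a<n. (1 + \<i>) * integral {-T..T} (f a)) =
     - ((1 + \<i>) * integral {-T..T} (\<lambda>t. g 0 (line (s + 1) t) - g 0 (line s t))) - c * ((1 + \<i>) * integral {-T..T} B)" for T
  proof -
    have "(\<Sum>a<n. integral {-T..T} (f a)) = integral {-T..T} (\<lambda>t. \<Sum>a<n. f a t)"
      by (rule integral_sum[symmetric]) (use cont_f in \<open>auto intro: integrable_continuous_interval simp: box_real\<close>)
    also have "\<dots> = integral {-T..T} (\<lambda>t. - (g 0 (line (s + 1) t) - g 0 (line s t)) - c * B t)"
      unfolding sum_f ..
    also have "\<dots> = integral {-T..T} (\<lambda>t. - (g 0 (line (s + 1) t) - g 0 (line s t))) - integral {-T..T} (\<lambda>t. c * B t)"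
      by (intro Henstock_Kurzweil_Integration.integral_diff integrable_continuous_interval
          continuous_on_minus continuous_on_mult continuous_on_const cont_D cont_B)
    finally have E: "(\<Sum>a<n. integral {-T..T} (f a)) = - integral {-T..T} (\<lambda>t. g 0 (line (s + 1) t) - g 0 (line s t)) - c * integral {-T..T} B"
      by (simp only: Henstock_Kurzweil_Integration.integral_neg Henstock_Kurzweil_Integration.integral_mult_right)
    show ?thesis unfolding sum_distrib_left[symmetric] E by (simp add: algebra_simps)
  qed
  have "((\<lambda>T. \<Sum>a<n. (1 + \<i>) * integral {-T..T} (f a)) \<longlongrightarrow> (\<Sum>a<n. of_real p - of_real (p / m) * (\<Sum>b<m. F a (of_real (pole_pt a b))))) at_top"
    by (intro tendsto_sum lim_f) auto
  moreover have "((\<lambda>T. \<Sum>a<n. (1 + \<i>) * integral {-T..T} (f a)) \<longlongrightarrow>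
     - (2 * of_real pi * \<i> * (\<Sum>x\<in>({} :: real set). 0) + of_real 1 * 1) - c * ((1 + \<i>) * barnes s k l \<xi> \<eta>)) at_top"
    unfolding eq by (intro tendsto_diff tendsto_minus lim_D tendsto_mult lim_B tendsto_const)
  ultimately have "(\<Sum>a<n. of_real p - of_real (p / m) * (\<Sum>b<m. F a (of_real (pole_pt a b)))) =
     - (2 * of_real pi * \<i> * (\<Sum>x\<in>({} :: real set). 0) + of_real 1 * 1) - c * ((1 + \<i>) * barnes s k l \<xi> \<eta>)"
    by (rule tendsto_unique[OF trivial_limit_at_top_linorder])
  then have E: "of_nat n * of_real p - of_real (p / m) * (\<Sum>a<n. \<Sum>b<m. F a (of_real (pole_pt a b))) = -1 - c * ((1 + \<i>) * barnes s k l \<xi> \<eta>)"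
    by (simp add: sum_subtractf sum_distrib_left)
  have aux: "S = N + 1 + t" if "N - S = -1 - t" for S N t :: complex
    using arg_cong[OF that, of "\<lambda>x. N - x"] by simp
  have "of_real (p / m) * (\<Sum>a<n. \<Sum>b<m. F a (of_real (pole_pt a b))) =
      of_nat n * of_real p + 1 + c * ((1 + \<i>) * barnes s k l \<xi> \<eta>)" by (rule aux[OF E])
  moreover have "of_nat n * of_real p = (of_real (n * p) :: complex)" by simp
  moreover have "of_real (n * p) + 1 = (of_real j :: complex)" by (simp add: np_eq)
  moreover have "c * ((1 + \<i>) * barnes s k l \<xi> \<eta>) = barnes_factor k l \<xi> \<eta> * Phi (Suc k) (of_real \<xi>) * Phi (Suc l) (of_real \<eta>) / Phi0 0"
    unfolding barnes_eq[OF s(1,2,4,5)] Phi_Suc xi[symmetric] c_def by simp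
  ultimately show ?thesis by (simp only: F_def)
qed


section \<open>Special values and reflection at the pole points\<close>

lemma Phi0_0_nonzero [simp]: "Phi0 0 \<noteq> 0"
  using p_pos by (intro Phi0_nonzero) auto

text \<open>Both sides of the shift equation vanish at 0. Comparing derivatives there gives the
  ratio of those of \<open>1 - ee z\<close> and \<open>1 - W 0 z\<close>, which is
  \<open>j\<close>.\<close>

lemma Phi0_p: "Phi0 (of_real p) = of_real j * Phi0 0"
proof -
  have "0 \<in> slit" "of_real p \<in> slit" using p_pos by (auto simp: slit_def)
  then have d: "Phi0 field_differentiable at 0" "Phi0 field_differentiable at (0 + of_real p)"
    using holomorphic_on_imp_differentiable_at[OF Phi0_holomorphic open_slit] by simp_all
  obtain A where A: "(Phi0 has_field_derivative A) (at 0)" using d(1) by (auto simp: field_differentiable_def)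
  obtain B where B: "(Phi0 has_field_derivative B) (at (0 + of_real p))" using d(2) by (auto simp: field_differentiable_def)
  have Bs: "((\<lambda>z. Phi0 (z + of_real p)) has_field_derivative B) (at 0)" using B by (simp only: DERIV_shift)
  have W: "((\<lambda>z. 1 - W 0 z) has_field_derivative - (2 * of_real pi * \<i> / of_real j)) (at 0)"
  proof -
    have "((\<lambda>z. ee (z / of_real j)) has_field_derivative 2 * of_real pi * \<i> * ee (0 / of_real j) * (1 / of_real j)) (at 0)"
      by (rule DERIV_chain2[OF ee_has_field_derivative]) (intro DERIV_cdivide DERIV_ident)
    then have "((\<lambda>z. 1 - ee (z / of_real j)) has_field_derivative 0 - 2 * of_real pi * \<i> * ee (0 / of_real j) * (1 / of_real j)) (at 0)"
      by (intro DERIV_diff DERIV_const)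
    then show ?thesis by (simp add: W_def)
  qed
  have E: "((\<lambda>z. 1 - ee z) has_field_derivative 0 - 2 * of_real pi * \<i> * ee 0) (at 0)"
    by (intro DERIV_diff DERIV_const ee_has_field_derivative)
  have "((\<lambda>z. (1 - W 0 z) * Phi0 (z + of_real p)) has_field_derivative
      - (2 * of_real pi * \<i> / of_real j) * Phi0 (0 + of_real p) + B * (1 - W 0 0)) (at 0)"
    by (rule DERIV_mult[OF W Bs])
  then have "((\<lambda>z. (1 - ee z) * Phi0 z) has_field_derivative
      - (2 * of_real pi * \<i> / of_real j) * Phi0 (0 + of_real p) + B * (1 - W 0 0)) (at 0)"
    by (rule has_field_derivative_transform_within_open[OF _ open_slit \<open>0 \<in> slit\<close>]) (use Phi_shift_p[of _ 0] in simp)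
  moreover have "((\<lambda>z. (1 - ee z) * Phi0 z) has_field_derivative (0 - 2 * of_real pi * \<i> * ee 0) * Phi0 0 + A * (1 - ee 0)) (at 0)"
    by (rule DERIV_mult[OF E A])
  ultimately have "- (2 * of_real pi * \<i> / of_real j) * Phi0 (0 + of_real p) + B * (1 - W 0 0) =
    (0 - 2 * of_real pi * \<i> * ee 0) * Phi0 0 + A * (1 - ee 0)" by (rule DERIV_unique)
  then have "2 * of_real pi * \<i> / of_real j * Phi0 (of_real p) = 2 * of_real pi * \<i> * Phi0 0" by (simp add: W_def)
  then show ?thesis using j_pos by (simp add: field_simps)
qed

lemma refl_const_eq: "refl_const = of_real j * Phi0 0 ^ 2"
  using Phi0_reflect[of 0] p_pos Phi0_p by (simp add: gauss_def power2_eq_square mult_ac)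

text \<open>Induction on \<open>a\<close> from the formula for \<open>Phi0\<close>. Raising
  \<open>a\<close> brings in 1 - w and drops 1 - 1/w from the other factor, with the quotient
  -w.\<close>

lemma Phi_reflect:
  assumes x: "-1 < x" "x < p" and a: "a \<le> n"
  shows "Phi a (of_real x) * Phi (n - a) (of_real (p - 1 - x)) = refl_const * gauss (of_real x) * (\<Prod>i=1..a. - W i (of_real x))"
  using a
proof (induction a)
  case 0
  have "of_real (p - 1 - x) \<in> slit" using x by (simp add: slit_def)
  from Phi_shift_n[OF this, of 0] have "Phi n (of_real (p - 1 - x)) = Phi0 (of_real p - of_real x)" by simp
  then show ?case using Phi0_reflect[of "of_real x"] x by simp
next
  case (Suc a)
  define w where "w = W (Suc a) (complex_of_real x)"
  have w: "w \<noteq> 1" "w \<noteq> 0" unfolding w_def using W_neq_1_strip[of "Suc a" x] Suc.prems x by auto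
  have nS: "n - a = Suc (n - Suc a)" using Suc.prems by simp
  have "W (n - a) (of_real p - 1 - of_real x) = inverse w"
    using W_reflect[of "n - a" "of_real x"] Suc.prems by (simp add: w_def)
  then have 1: "Phi (n - a) (of_real (p - 1 - x)) = (1 - inverse w) * Phi (n - Suc a) (of_real (p - 1 - x))"
    using Phi_Suc[of "n - Suc a" "of_real (p - 1 - x)"] nS by simp
  have "Phi (Suc a) (of_real x) * Phi (n - Suc a) (of_real (p - 1 - x)) =
    (- w) * (Phi a (of_real x) * ((1 - inverse w) * Phi (n - Suc a) (of_real (p - 1 - x))))"
    unfolding Phi_Suc w_def[symmetric] using w by (simp add: field_simps)
  also have "\<dots> = (- w) * (refl_const * gauss (of_real x) * (\<Prod>i=1..a. - W i (of_real x)))"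
    using Suc.IH Suc.prems unfolding 1 by simp
  finally show ?case by (simp add: w_def)
qed

text \<open>Half of a quadratic form is not periodic in general; the linear terms repair this
  because n s^2 + n s and m t^2 + m t are even. They do not affect the polarization, and evenness
  survives since the change is by an integer.\<close>

definition quad_form :: "int \<Rightarrow> int \<Rightarrow> complex" where
  "quad_form x y = ee (of_real ((of_int x ^ 2 / n + of_int x - of_int y ^ 2 / m - of_int y) / 2))"

lemma quad_form_nonzero [simp]: "quad_form x y \<noteq> 0" by (simp add: quad_form_def)

text \<open>With n p^2 = m j and n p = j - 1 all irrational contributions to the exponent cancel,
  and the integer a - b remains.\<close>

lemma gauss_at_pole_pt: "gauss (of_real (pole_pt a b)) * (\<Prod>i=1..a. - W i (of_real (pole_pt a b))) * quad_form (int a) (int b) = 1"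
proof -
  define x where "x = pole_pt a b"
  define A where "A = real a"
  define B where "B = real b"
  have x: "x = B * p / m - A / n" by (simp add: x_def pole_pt_def A_def B_def)
  have jj: "real n * p\<^sup>2 = m * j" by (rule p_square_j)
  have np: "real n * p = j - 1" by (rule np_eq)
  have pos: "real n > 0" "real m > 0" "j > 0" using n_pos m_pos j_pos by auto
  have "real n * x * (x - p) / (2 * j) + (A / 2 + (A * x - A * (A + 1) / 2 * p) / j) + (A\<^sup>2 / n + A - B\<^sup>2 / m - B) / 2 = A - B"
  proof -
    have 1: "real n * x * x / (2 * j) = B\<^sup>2 / m / 2 - A * B * p / (m * j) + A\<^sup>2 / (n * j) / 2"
    proof -
      have "real n * x * x = B\<^sup>2 * (n * p\<^sup>2) / m\<^sup>2 - 2 * A * B * p / m + A\<^sup>2 / n"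
        unfolding x using pos by (simp add: field_simps power2_eq_square)
      also have "\<dots> = B\<^sup>2 * j / m - 2 * A * B * p / m + A\<^sup>2 / n"
        unfolding jj using pos by (simp add: field_simps power2_eq_square)
      finally show ?thesis using pos by (simp add: field_simps)
    qed
    have 2: "real n * x * p / (2 * j) = B / 2 - A * p / (2 * j)"
    proof -
      have "real n * x * p = B * (n * p\<^sup>2) / m - A * p" unfolding x using pos by (simp add: field_simps power2_eq_square)
      also have "\<dots> = B * j - A * p" unfolding jj using pos by simp
      finally show ?thesis using pos by (simp add: field_simps)
    qed
    have 3: "A * x / j = A * B * p / (m * j) - A\<^sup>2 / (n * j)" unfolding x using pos by (simp add: field_simps power2_eq_square)
    have 4: "A\<^sup>2 / (n * j) + A\<^sup>2 * p / j = A\<^sup>2 / n"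
    proof -
      have "A\<^sup>2 / (n * j) + A\<^sup>2 * p / j = A\<^sup>2 * (1 + n * p) / (n * j)" using pos by (simp add: field_simps)
      then show ?thesis unfolding np using pos by simp
    qed
    have e: "real n * x * (x - p) / (2 * j) = real n * x * x / (2 * j) - real n * x * p / (2 * j)"
      "(A * x - A * (A + 1) / 2 * p) / j = A * x / j - A\<^sup>2 * p / j / 2 - A * p / (2 * j)"
      "(A\<^sup>2 / n + A - B\<^sup>2 / m - B) / 2 = A\<^sup>2 / n / 2 + A / 2 - B\<^sup>2 / m / 2 - B / 2"
      using pos by (simp_all add: field_simps power2_eq_square)
    \<comment> \<open>Naming the nonlinear terms leaves a purely linear consequence of the four
      evaluations.\<close>
    have "t1 - t2 + (A / 2 + (t3 - t4 / 2 - t5)) + (t6 / 2 + A / 2 - t7 / 2 - B / 2) = A - B"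
      if "t1 = t7 / 2 - t8 + t9 / 2" "t2 = B / 2 - t5" "t3 = t8 - t9" "t9 + t4 = t6" for t1 t2 t3 t4 t5 t6 t7 t8 t9 :: real
      using that by linarith
    from this[OF 1 2 3 4] show ?thesis unfolding e .
  qed
  then have eq: "complex_of_real (real n * x * (x - p) / (2 * j) + (A / 2 + (A * x - A * (A + 1) / 2 * p) / j) + (A\<^sup>2 / n + A - B\<^sup>2 / m - B) / 2) = of_int (int a - int b)"
    by (simp add: A_def B_def)
  have g: "gauss (of_real x) = ee (of_real (real n * x * (x - p) / (2 * j)))" by (simp add: gauss_def)
  have w: "(\<Prod>i=1..a. - W i (of_real x)) = ee (of_real (A / 2 + (A * x - A * (A + 1) / 2 * p) / j))"
    unfolding prod_minus_W by (simp add: A_def)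
  have q: "quad_form (int a) (int b) = ee (of_real ((A\<^sup>2 / n + A - B\<^sup>2 / m - B) / 2))" by (simp add: quad_form_def A_def B_def)
  show ?thesis unfolding x_def[symmetric] g w q ee_add[symmetric] of_real_add[symmetric] eq ee_of_int ..
qed

lemma pole_pt_add: "pole_pt (a + a') (b + b') = pole_pt a b + pole_pt a' b'"
  by (simp add: pole_pt_def add_divide_distrib distrib_right)

lemma pole_pt_pos: assumes "a \<le> n" "b > 0" shows "pole_pt a b > 0"
proof -
  have "1 * (p / m) \<le> real b * (p / m)" using assms p_pos by (intro mult_right_mono) auto
  moreover have "p / m > 1" using p_gt m_pos by simp
  moreover have "real a / n \<le> 1" using assms n_pos by simp
  ultimately show ?thesis by (simp add: pole_pt_def)
qed

lemma Phi_pole_pt_add_n: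
  assumes "pole_pt a b > 0" shows "Phi (a + n) (of_real (pole_pt (a + n) b)) = Phi a (of_real (pole_pt a b))"
proof -
  have "pole_pt (a + n) b = pole_pt a b - 1" using n_pos by (simp add: pole_pt_def add_divide_distrib)
  moreover have "of_real (pole_pt a b - 1) \<in> slit" using assms by (simp add: slit_def)
  ultimately show ?thesis using Phi_shift_n[of "of_real (pole_pt a b - 1)" a] by simp
qed

text \<open>The increment \<open>m\<close> in b shifts the point by \<open>p\<close>. There
  \<open>W a\<close> and \<open>ee\<close> agree, so the two factors of the shift equation cancel;
  they are nonzero because b > 0 makes the point irrational.\<close>

lemma Phi_pole_pt_add_m:
  assumes "pole_pt a b > -1" "b > 0" shows "Phi a (of_real (pole_pt a (b + m))) = Phi a (of_real (pole_pt a b))"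
proof -
  have "W a (of_real (pole_pt a b)) \<noteq> 1"
  proof
    assume "W a (of_real (pole_pt a b)) = 1"
    then have "of_real (pole_pt a b) \<in> (\<int> :: complex set)" unfolding ee_eq_W_pole_pt[symmetric] ee_eq_1_iff .
    then obtain i :: int where "complex_of_real (pole_pt a b) = of_int i" by (elim Ints_cases)
    then have "pole_pt a b = of_int i" by (metis of_real_eq_iff of_real_of_int_eq)
    then have "p = (of_int i + real a / n) * m / b"
      using assms(2) m_pos by (simp add: pole_pt_def field_simps)
    then have "p \<in> \<rat>" by simp
    then show False using p_irrational by simp
  qed
  moreover have "of_real (pole_pt a b) \<in> slit" using assms by (simp add: slit_def)
  moreover have "pole_pt a (b + m) = pole_pt a b + p" using m_pos by (simp add: pole_pt_def add_divide_distrib distrib_right)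
  ultimately show ?thesis using Phi_shift_p[of "of_real (pole_pt a b)" a] by (simp add: ee_eq_W_pole_pt)
qed

text \<open>Representatives are taken in \<open>{1..N}\<close>: \<open>Phi a\<close> at \<open>pole_pt a b\<close> depends only on the residue
  classes of \<open>a\<close> and \<open>b\<close> as long as \<open>b > 0\<close>, while at the pole \<open>0\<close> itself it differs from
  the value at \<open>p\<close> by the factor \<open>j\<close>.\<close>

definition rep :: "nat \<Rightarrow> int \<Rightarrow> nat" where
  "rep N x = nat ((x - 1) mod int N) + 1"

lemma rep_mod [simp]: "rep N (x mod int N) = rep N x"
  by (simp add: rep_def mod_diff_left_eq)

lemma rep_bounds: "N > 0 \<Longrightarrow> rep N x \<in> {1..N}"
  unfolding rep_def by (auto simp: Suc_le_eq nat_less_iff)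

lemma rep_mod_eq:
  assumes "N > 0" shows "int (rep N x) mod int N = x mod int N"
proof -
  have "int (rep N x) = (x - 1) mod int N + 1" using assms by (simp add: rep_def)
  then show ?thesis using mod_add_left_eq[of "x - 1" "int N" 1] by simp
qed

lemma rep_eq: "0 < c \<Longrightarrow> c \<le> N \<Longrightarrow> rep N (int c) = c"
  by (simp add: rep_def)

text \<open>Normalised by mu^2 \<open>refl_const\<close> = 1. This absorbs the reflection constant
  and makes the value at 0 equal to sqrt j.\<close>

definition mu :: complex where "mu = 1 / (of_real (sqrt j) * Phi0 0)"

definition dilog :: "int \<Rightarrow> int \<Rightarrow> complex" where
  "dilog x y = mu * Phi (rep n x) (of_real (pole_pt (rep n x) (rep m y)))"

lemma dilog_mod [simp]: "dilog (x mod int n) y = dilog x y" "dilog x (y mod int m) = dilog x y"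
  by (simp_all add: dilog_def)

text \<open>The range up to \<open>2 * n\<close> and \<open>2 * m\<close> admits the sums of a
  representative and a summation index without reducing them.\<close>

lemma dilog_eq:
  assumes "0 < c" "c \<le> 2 * n" "0 < d" "d \<le> 2 * m"
  shows "dilog (int c) (int d) = mu * Phi c (of_real (pole_pt c d))"
proof -
  have base: "dilog (int c) (int d) = mu * Phi c (of_real (pole_pt c d))"
    if "0 < c" "c \<le> n" "0 < d" "d \<le> m" for c d
    using that by (simp add: dilog_def rep_eq)
  have 1: "dilog (int c) (int d) = mu * Phi c (of_real (pole_pt c d))" if c: "0 < c" "c \<le> n" for c
  proof (cases "d \<le> m")
    case False
    then obtain d' where d': "d = d' + m" "0 < d'" "d' \<le> m" using assms by (intro that[of "d - m"]) auto
    have "dilog (int c) (int d) = dilog (int c) (int d')"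
      using dilog_mod(2)[of "int c" "int d"] dilog_mod(2)[of "int c" "int d'"] by (simp add: d'(1) del: dilog_mod)
    then show ?thesis using base[OF c d'(2,3)] Phi_pole_pt_add_m[of c d'] pole_pt_pos[of c d'] c d' by simp
  qed (use base c assms in auto)
  show ?thesis
  proof (cases "c \<le> n")
    case False
    then obtain c' where c': "c = c' + n" "0 < c'" "c' \<le> n" using assms by (intro that[of "c - n"]) auto
    have "dilog (int c) (int d) = dilog (int c') (int d)"
      using dilog_mod(1)[of "int c" "int d"] dilog_mod(1)[of "int c'" "int d"] by (simp add: c'(1) del: dilog_mod)
    then show ?thesis using 1[OF c'(2,3)] Phi_pole_pt_add_n[of c' d] pole_pt_pos[of c' d] assms c' by simp
  qed (use 1 assms in auto)
qed

text \<open>Replaces the denominator of \<open>FF\<close> by two factors of the defining equation,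
  taken at the negated summation variable.\<close>

lemma dilog_reflect:
  assumes a: "a < n" and b: "b < m"
  shows "dilog (- int a) (- int b) * quad_form (int a) (int b) = mu * refl_const / Phi a (of_real (pole_pt a b))"
proof -
  have x: "-1 < pole_pt a b" "pole_pt a b < p" using pole_pt_bounds[OF a b] n_pos by (auto intro: less_le_trans[rotated])
  have "rep n (- int a) = rep n (int (n - a))" using rep_mod[of n "- int a"] rep_mod[of n "int (n - a)"] a by (simp add: of_nat_diff del: rep_mod)
  then have ra: "rep n (- int a) = n - a" using rep_eq[of "n - a" n] a by simp
  have "rep m (- int b) = rep m (int (m - b))" using rep_mod[of m "- int b"] rep_mod[of m "int (m - b)"] b by (simp add: of_nat_diff del: rep_mod)
  then have rb: "rep m (- int b) = m - b" using rep_eq[of "m - b" m] b by simp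
  have "pole_pt (n - a) (m - b) = p - 1 - pole_pt a b"
    using a b n_pos m_pos by (simp add: pole_pt_def of_nat_diff left_diff_distrib diff_divide_distrib)
  then have E: "dilog (- int a) (- int b) = mu * Phi (n - a) (of_real (p - 1 - pole_pt a b))"
    by (simp add: dilog_def ra rb)
  have nz: "Phi a (of_real (pole_pt a b)) \<noteq> 0" using x a by (intro Phi_nonzero) auto
  have "Phi a (of_real (pole_pt a b)) * (dilog (- int a) (- int b) * quad_form (int a) (int b)) =
    mu * (Phi a (of_real (pole_pt a b)) * Phi (n - a) (of_real (p - 1 - pole_pt a b))) * quad_form (int a) (int b)"
    unfolding E by simp
  also have "\<dots> = mu * refl_const * (gauss (of_real (pole_pt a b)) * (\<Prod>i=1..a. - W i (of_real (pole_pt a b))) * quad_form (int a) (int b))"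
    unfolding Phi_reflect[OF x less_imp_le[OF a]] by simp
  also have "\<dots> = mu * refl_const" unfolding gauss_at_pole_pt by simp
  finally show ?thesis using nz by (simp add: field_simps)
qed

end

subsection \<open>The metric group\<close>

definition pairing :: "nat \<Rightarrow> int \<Rightarrow> int \<Rightarrow> complex" where
  "pairing N x y = ee (of_real (of_int (x * y) / real N))"

lemma pairing_nonzero [simp]: "pairing N x y \<noteq> 0" by (simp add: pairing_def)

lemma pairing_commute: "pairing N x y = pairing N y x" by (simp add: pairing_def mult.commute)

lemma pairing_add_left: "pairing N (x + x') y = pairing N x y * pairing N x' y"
  by (simp add: pairing_def ee_add[symmetric] distrib_right add_divide_distrib)

lemma pairing_mod_left:
  assumes "N > 0" shows "pairing N (x mod int N) y = pairing N x y"
proof -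
  have "pairing N (int N * (x div int N)) y = ee (of_int (x div int N * y))"
    using assms by (simp add: pairing_def)
  then have "pairing N (int N * (x div int N) + x mod int N) y = pairing N (x mod int N) y"
    unfolding pairing_add_left ee_of_int by simp
  then show ?thesis by simp
qed

lemma pairing_0 [simp]: "pairing N 0 y = 1" by (simp add: pairing_def)

lemma pairing_1_eq_1:
  assumes "pairing N x 1 = 1" "0 \<le> x" "x < int N"
  shows "x = 0"
proof -
  have "of_real (of_int x / real N) \<in> (\<int> :: complex set)" using assms(1) by (simp add: pairing_def ee_eq_1_iff)
  then obtain i :: int where "complex_of_real (of_int x / real N) = of_int i" by (elim Ints_cases)
  then have "of_int x / real N = of_int i" by (metis of_real_eq_iff of_real_of_int_eq)
  then have "real_of_int x = of_int (i * int N)" using assms by (simp add: field_simps)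
  then have x: "x = i * int N" by (simp only: of_int_eq_iff)
  then have "i * int N < 1 * int N" "0 \<le> i * int N" using assms by simp_all
  then have "i < 1" "0 \<le> i" using assms by (simp_all add: mult_less_cancel_right zero_le_mult_iff)
  then show ?thesis using x by simp
qed

context quadratic_unit
begin

lemma quad_form_add: "quad_form (x + x') (y + y') = quad_form x y * quad_form x' y' * (pairing n x x' / pairing m y y')"
proof -
  have "(of_int (x + x') ^ 2 / real n + of_int (x + x') - of_int (y + y') ^ 2 / m - of_int (y + y')) / 2 =
    (of_int x ^ 2 / real n + of_int x - of_int y ^ 2 / m - of_int y) / 2 +
    (of_int x' ^ 2 / real n + of_int x' - of_int y' ^ 2 / m - of_int y') / 2 +
    (of_int (x * x') / real n - of_int (y * y') / m)"
    using n_pos m_pos by (simp add: power2_eq_square field_simps)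
  then show ?thesis unfolding quad_form_def pairing_def ee_diff[symmetric] ee_add[symmetric] by (simp only: of_real_add of_real_diff)
qed

lemma quad_form_multiple: "quad_form (int n * s) (int m * t) = 1"
proof -
  have ev: "even (k * i\<^sup>2 + k * i)" for k i :: int
    by (cases "even i"; cases "even k") (auto simp: power2_eq_square)
  obtain u where u: "int n * s\<^sup>2 + int n * s = 2 * u" using ev[of "int n" s] by (elim evenE)
  obtain v where v: "int m * t\<^sup>2 + int m * t = 2 * v" using ev[of "int m" t] by (elim evenE)
  have "of_int (int n * s) ^ 2 / real n + of_int (int n * s) = of_int (int n * s\<^sup>2 + int n * s)"
    "of_int (int m * t) ^ 2 / real m + of_int (int m * t) = of_int (int m * t\<^sup>2 + int m * t)"
    using n_pos m_pos by (simp_all add: power2_eq_square)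
  then have "(of_int (int n * s) ^ 2 / real n + of_int (int n * s) - of_int (int m * t) ^ 2 / real m - of_int (int m * t)) / 2 = of_int (u - v)"
    unfolding u v by simp
  then show ?thesis unfolding quad_form_def by (simp only: of_real_of_int_eq ee_of_int)
qed

lemma quad_form_mod: "quad_form (x mod int n) (y mod int m) = quad_form x y"
proof -
  have "quad_form x y = quad_form (int n * (x div int n) + x mod int n) (int m * (y div int m) + y mod int m)" by simp
  also have "\<dots> = quad_form (x mod int n) (y mod int m) * (pairing n (int n * (x div int n)) (x mod int n) / pairing m (int m * (y div int m)) (y mod int m))"
    unfolding quad_form_add quad_form_multiple by simp
  also have "pairing n (int n * (x div int n)) (x mod int n) = 1"
    using pairing_mod_left[OF n_pos, of "int n * (x div int n)"] by simp
  also have "pairing m (int m * (y div int m)) (y mod int m) = 1"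
    using pairing_mod_left[OF m_pos, of "int m * (y div int m)"] by simp
  finally show ?thesis by simp
qed

lemma quad_form_minus: "quad_form (- x) (- y) = quad_form x y"
proof -
  have "(of_int (- x) ^ 2 / real n + of_int (- x) - of_int (- y) ^ 2 / m - of_int (- y)) / 2 =
    (of_int x ^ 2 / real n + of_int x - of_int y ^ 2 / m - of_int y) / 2 + of_int (y - x)"
    by (simp add: field_simps)
  then show ?thesis unfolding quad_form_def by (simp only: of_real_add ee_add of_real_of_int_eq ee_of_int mult_1_right)
qed

text \<open>Again n p^2 = m j removes the irrational part of the exponent. This is how the
  bicharacter enters the final identity.\<close>

lemma barnes_factor_at_pole_pt: "barnes_factor k l (pole_pt (Suc k) b) (pole_pt (Suc l) b') = pairing n (int (Suc k)) (int (Suc l)) / pairing m (int b) (int b')"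
proof -
  define A where "A = real k + 1"
  define A' where "A' = real l + 1"
  define B where "B = real b"
  define B' where "B' = real b'"
  have pos: "real n > 0" "real m > 0" "j > 0" using n_pos m_pos j_pos by auto
  have jj: "real n * p\<^sup>2 = m * j" by (rule p_square_j)
  define x where "x = B * p / m - A / n"
  define y where "y = B' * p / m - A' / n"
  have "real n * x * y + A * y + A' * x - A * A' * p = (B * B' / m - A * A' / n) * j"
  proof -
    have "real n * x * y = B * B' * (n * p\<^sup>2) / m\<^sup>2 - (A * B' + A' * B) * p / m + A * A' / n"
      unfolding x_def y_def using pos by (simp add: field_simps power2_eq_square)
    also have "\<dots> = B * B' * j / m - (A * B' + A' * B) * p / m + A * A' / n"
      unfolding jj using pos by (simp add: field_simps power2_eq_square)
    finally have "real n * x * y = B * B' * j / m - (A * B' + A' * B) * p / m + A * A' / n" .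
    moreover have "A * y + A' * x = (A * B' + A' * B) * p / m - 2 * (A * A' / n)"
      unfolding x_def y_def using pos by (simp add: field_simps)
    moreover have "(B * B' / m - A * A' / n) * j = B * B' * j / m - A * A' / n - A * A' * p"
    proof -
      have "A * A' / n * j = A * A' / n + A * A' * p" unfolding j_def using pos by (simp add: field_simps)
      then show ?thesis by (simp add: left_diff_distrib)
    qed
    ultimately show ?thesis by simp
  qed
  then have "- (real n * x * y + A * y + A' * x - A * A' * p) / j = A * A' / n - B * B' / m"
    using pos by (simp add: field_simps)
  moreover have "pole_pt (Suc k) b = x" "pole_pt (Suc l) b' = y" by (simp_all add: pole_pt_def x_def y_def A_def A'_def B_def B'_def)
  ultimately have "barnes_factor k l (pole_pt (Suc k) b) (pole_pt (Suc l) b') = ee (of_real (A * A' / n - B * B' / m))"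
    unfolding barnes_factor_def A_def A'_def by simp
  then show ?thesis by (simp add: pairing_def ee_diff[symmetric] A_def A'_def B_def B'_def add.commute)
qed

lemma dilog_cong: "x mod int n = x' mod int n \<Longrightarrow> y mod int m = y' mod int m \<Longrightarrow> dilog x y = dilog x' y'"
  by (metis dilog_mod)

lemma mu_square: "mu * mu * refl_const = 1" "mu * mu = mu / of_real (sqrt j) / Phi0 0"
  and mu_nonzero: "mu \<noteq> 0"
proof -
  have s: "of_real (sqrt j) * of_real (sqrt j) = (of_real j :: complex)"
    using j_pos unfolding of_real_mult[symmetric] by simp
  have "sqrt j \<noteq> 0" using j_pos by simp
  then show "mu \<noteq> 0" "mu * mu = mu / of_real (sqrt j) / Phi0 0" by (simp_all add: mu_def)
  have "mu * mu * refl_const = (1 / (of_real (sqrt j) * of_real (sqrt j) * Phi0 0 ^ 2)) * (of_real j * Phi0 0 ^ 2)"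
    unfolding refl_const_eq by (simp add: mu_def power2_eq_square)
  then show "mu * mu * refl_const = 1" unfolding s using j_pos by simp
qed

text \<open>From n p^2 = m j; it matches the prefactor p / m of the residue sum with 1 / sqrt
  N.\<close>

lemma sqrt_nm: "1 / sqrt (real (n * m)) = p / m / sqrt j"
proof -
  have "real (n * m) * (p / m)\<^sup>2 = n * p\<^sup>2 / m" using m_pos by (simp add: power2_eq_square)
  also have "\<dots> = j" unfolding p_square_j using m_pos by simp
  finally have "sqrt (real (n * m) * (p / m)\<^sup>2) = sqrt j" by simp
  then have "sqrt (real (n * m)) * (p / m) = sqrt j" using p_pos by (simp add: real_sqrt_mult del: of_nat_mult)
  moreover have "sqrt (real (n * m)) > 0" using n_pos m_pos by simp
  ultimately show ?thesis using j_pos p_pos m_pos by (simp add: field_simps del: of_nat_mult)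
qed

text \<open>\<open>FF_sum\<close> at two pole points, multiplied by \<open>mu / sqrt j\<close>. Its
  term \<open>j\<close> becomes the negative of the constant C, so C = -1 / Phi0 0; reflection
  supplies the factor at the negated variable.\<close>

theorem dilog_convolution:
  "pairing n x y / pairing m x' y' * dilog x x' * dilog y y' = - (mu * of_real (sqrt j)) +
     1 / of_real (sqrt (real (n * m))) *
     (\<Sum>a<n. \<Sum>b<m. dilog (y + int a) (y' + int b) * dilog (- int a) (- int b) * quad_form (int a) (int b) * dilog (x + int a) (x' + int b))"
proof -
  define k where "k = rep n x - 1"
  define l where "l = rep n y - 1"
  define b0 where "b0 = rep m x'"
  define c0 where "c0 = rep m y'"
  have rk: "rep n x = Suc k" "rep n y = Suc l" "k < n" "l < n"
    using rep_bounds[OF n_pos, of x] rep_bounds[OF n_pos, of y] by (auto simp: k_def l_def)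
  have rb: "0 < b0" "b0 \<le> m" "0 < c0" "c0 \<le> m"
    using rep_bounds[OF m_pos, of x'] rep_bounds[OF m_pos, of y'] by (auto simp: b0_def c0_def)
  define \<xi> where "\<xi> = pole_pt (Suc k) b0"
  define \<eta> where "\<eta> = pole_pt (Suc l) c0"
  have pos: "\<xi> > 0" "\<eta> > 0" unfolding \<xi>_def \<eta>_def using rk rb by (auto intro!: pole_pt_pos)
  have Ex: "dilog x x' = mu * Phi (Suc k) (of_real \<xi>)" "dilog y y' = mu * Phi (Suc l) (of_real \<eta>)"
    unfolding dilog_def rk b0_def[symmetric] c0_def[symmetric] \<xi>_def \<eta>_def by simp_all
  have mods: "int (Suc k) mod int n = x mod int n" "int (Suc l) mod int n = y mod int n"
    "int b0 mod int m = x' mod int m" "int c0 mod int m = y' mod int m"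
    using rep_mod_eq[OF n_pos, of x] rep_mod_eq[OF n_pos, of y] rep_mod_eq[OF m_pos, of x'] rep_mod_eq[OF m_pos, of y']
    unfolding rk b0_def c0_def .
  \<comment> \<open>Adding pole points adds their indices, and the unreduced sums stay within the
    range of \<open>dilog_eq\<close>.\<close>
  have shift: "dilog (z + int a) (z' + int b) = mu * Phi (a + Suc i) (of_real (pole_pt a b) + of_real (pole_pt (Suc i) d))"
    if "int (Suc i) mod int n = z mod int n" "int d mod int m = z' mod int m" "i < n" "0 < d" "d \<le> m" "a < n" "b < m" for z z' i d a b
  proof -
    have "dilog (z + int a) (z' + int b) = dilog (int (a + Suc i)) (int (b + d))"
      using mod_add_cong[OF that(1) refl, of "int a"] mod_add_cong[OF that(2) refl, of "int b"]
      by (intro dilog_cong) (simp_all add: add_ac)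
    also have "\<dots> = mu * Phi (a + Suc i) (of_real (pole_pt (a + Suc i) (b + d)))"
      using that by (intro dilog_eq) auto
    finally show ?thesis unfolding pole_pt_add by simp
  qed
  define S where "S = (\<Sum>a<n. \<Sum>b<m. FF (a + Suc k) (a + Suc l) a \<xi> \<eta> (of_real (pole_pt a b)))"
  define b where "b = barnes_factor k l \<xi> \<eta>"
  have "dilog (y + int a) (y' + int b) * dilog (- int a) (- int b) * quad_form (int a) (int b) * dilog (x + int a) (x' + int b) =
      mu * FF (a + Suc k) (a + Suc l) a \<xi> \<eta> (of_real (pole_pt a b))" if ab: "a < n" "b < m" for a b
  proof -
    have "dilog (y + int a) (y' + int b) * dilog (- int a) (- int b) * quad_form (int a) (int b) * dilog (x + int a) (x' + int b) =
      dilog (y + int a) (y' + int b) * (dilog (- int a) (- int b) * quad_form (int a) (int b)) * dilog (x + int a) (x' + int b)" by simp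
    also have "\<dots> = mu * (mu * mu * refl_const) * FF (a + Suc k) (a + Suc l) a \<xi> \<eta> (of_real (pole_pt a b))"
      unfolding dilog_reflect[OF ab] shift[OF mods(1,3) rk(3) rb(1,2) ab] shift[OF mods(2,4) rk(4) rb(3,4) ab] FF_def \<xi>_def \<eta>_def
      by simp
    finally show ?thesis unfolding mu_square(1) by simp
  qed
  then have sum: "(\<Sum>a<n. \<Sum>b<m. dilog (y + int a) (y' + int b) * dilog (- int a) (- int b) * quad_form (int a) (int b) * dilog (x + int a) (x' + int b)) = mu * S"
    unfolding S_def sum_distrib_left by (intro sum.cong refl) auto
  have FS: "of_real (p / m) * S = of_real j + b * Phi (Suc k) (of_real \<xi>) * Phi (Suc l) (of_real \<eta>) / Phi0 0"
    unfolding S_def b_def by (rule FF_sum[OF pos]) (simp_all only: \<xi>_def \<eta>_def ee_eq_W_pole_pt)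
  have N: "1 / of_real (sqrt (real (n * m))) = of_real (p / m) / (of_real (sqrt j) :: complex)"
    using sqrt_nm by (metis of_real_1 of_real_divide)
  have jj: "of_real j / of_real (sqrt j) = (of_real (sqrt j) :: complex)"
    unfolding of_real_divide[symmetric] using j_pos by (simp add: real_div_sqrt)
  have "1 / of_real (sqrt (real (n * m))) * (mu * S) = mu * (of_real (p / m) * S) / of_real (sqrt j)"
    unfolding N by simp
  also have "\<dots> = mu * (of_real j / of_real (sqrt j)) + b * (mu / of_real (sqrt j) / Phi0 0) * Phi (Suc k) (of_real \<xi>) * Phi (Suc l) (of_real \<eta>)"
    unfolding FS by (simp add: distrib_left add_divide_distrib mult_ac)
  also have "\<dots> = mu * of_real (sqrt j) + b * dilog x x' * dilog y y'"
    unfolding jj mu_square(2)[symmetric] Ex by simp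
  finally have main: "1 / of_real (sqrt (real (n * m))) * (mu * S) = mu * of_real (sqrt j) + b * dilog x x' * dilog y y'" .
  have "pairing n (int (Suc k)) (int (Suc l)) = pairing n x y"
    using pairing_mod_left[OF n_pos] pairing_commute mods(1,2) by metis
  moreover have "pairing m (int b0) (int c0) = pairing m x' y'"
    using pairing_mod_left[OF m_pos] pairing_commute mods(3,4) by metis
  ultimately have "b = pairing n x y / pairing m x' y'" unfolding b_def \<xi>_def \<eta>_def barnes_factor_at_pole_pt by simp
  then show ?thesis unfolding sum main by simp
qed

text \<open>The class of 0 has the representative (n, m), with pole point p - 1, and
  \<open>Phi n\<close> at p - 1 is \<open>Phi0\<close> at p.\<close>

lemma dilog_0: "dilog 0 0 = of_real (sqrt j)"
proof -
  have "dilog 0 0 = dilog (int n) (int m)" by (rule dilog_cong) simp_all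
  also have "\<dots> = mu * Phi n (of_real (pole_pt n m))" using n_pos m_pos by (intro dilog_eq) auto
  also have "pole_pt n m = p - 1" using n_pos m_pos by (simp add: pole_pt_def)
  also have "Phi n (of_real (p - 1)) = of_real j * Phi0 0"
    using Phi_shift_n[of "of_real (p - 1)" 0] p_pos Phi0_p by (simp add: slit_def)
  also have "mu * (of_real j * Phi0 0) = of_real j / of_real (sqrt j)" by (simp add: mu_def)
  also have "\<dots> = of_real (sqrt j)" unfolding of_real_divide[symmetric] using j_pos by (simp add: real_div_sqrt)
  finally show ?thesis .
qed

text \<open>sqrt (n m) sqrt j = m j / p = n p = j - 1. The normalisation thus holds for groups of
  every order.\<close>

lemma dilog_0_quadratic: "dilog 0 0 ^ 2 = of_real (sqrt (real (n * m))) * dilog 0 0 + 1"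
proof -
  have s: "sqrt (real (n * m)) > 0" using n_pos m_pos by simp
  have "sqrt (real (n * m)) = m * sqrt j / p"
    using sqrt_nm s j_pos p_pos m_pos by (simp add: field_simps del: of_nat_mult)
  then have "sqrt (real (n * m)) * sqrt j = m * (sqrt j * sqrt j) / p" by simp
  also have "\<dots> = m * j / p" using j_pos by simp
  also have "\<dots> = n * p" unfolding p_square_j[symmetric] using p_pos by (simp add: power2_eq_square)
  finally have "(sqrt j)\<^sup>2 = sqrt (real (n * m)) * sqrt j + 1" using j_pos by (simp add: np_eq)
  then have "complex_of_real ((sqrt j)\<^sup>2) = of_real (sqrt (real (n * m)) * sqrt j + 1)" by (simp only:)
  then show ?thesis unfolding dilog_0 by (simp only: of_real_power of_real_mult of_real_add of_real_1)
qed


section \<open>The metric group on Z/n x Z/m and its dilogarithm\<close>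

definition Zn_Zm :: "(int \<times> int) monoid" where
  "Zn_Zm = integer_mod_group n \<times>\<times> integer_mod_group m"

definition quad_form_pair :: "int \<times> int \<Rightarrow> complex" where "quad_form_pair = (\<lambda>(x, y). quad_form x y)"

definition dilog_pair :: "int \<times> int \<Rightarrow> complex" where "dilog_pair = (\<lambda>(x, y). dilog x y)"

lemma carrier_Zn_Zm: "carrier Zn_Zm = {0..<int n} \<times> {0..<int m}"
  using n_pos m_pos by (simp add: Zn_Zm_def carrier_integer_mod_group)

lemma mult_Zn_Zm: "(x, x') \<otimes>\<^bsub>Zn_Zm\<^esub> (y, y') = ((x + y) mod int n, (x' + y') mod int m)"
  by (simp add: Zn_Zm_def)

lemma one_Zn_Zm: "\<one>\<^bsub>Zn_Zm\<^esub> = (0, 0)" by (simp add: Zn_Zm_def)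

lemma inv_Zn_Zm:
  assumes "(x, y) \<in> carrier Zn_Zm"
  shows "inv\<^bsub>Zn_Zm\<^esub> (x, y) = (- x mod int n, - y mod int m)"
proof -
  have "x \<in> carrier (integer_mod_group n)" "y \<in> carrier (integer_mod_group m)"
    using assms by (simp_all add: Zn_Zm_def)
  then show ?thesis unfolding Zn_Zm_def by simp
qed

lemma order_Zn_Zm: "Coset.order Zn_Zm = n * m"
  by (simp add: Coset.order_def carrier_Zn_Zm card_cartesian_product)

lemma comm_group_Zn_Zm: "comm_group Zn_Zm"
proof (rule group.group_comm_groupI)
  show "group Zn_Zm" unfolding Zn_Zm_def by (intro DirProd_group group_integer_mod_group)
  show "x \<otimes>\<^bsub>Zn_Zm\<^esub> y = y \<otimes>\<^bsub>Zn_Zm\<^esub> x" for x y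
    by (cases x, cases y) (simp add: mult_Zn_Zm add.commute)
qed

lemma polarization_Zn_Zm: "polarization Zn_Zm quad_form_pair (x, x') (y, y') = pairing n x y / pairing m x' y'"
proof -
  have "quad_form_pair ((x, x') \<otimes>\<^bsub>Zn_Zm\<^esub> (y, y')) = quad_form x x' * quad_form y y' * (pairing n x y / pairing m x' y')"
    unfolding mult_Zn_Zm quad_form_pair_def by (simp add: quad_form_mod quad_form_add)
  then show ?thesis by (simp add: polarization_def quad_form_pair_def)
qed

lemma polarization_Zn_Zm_commute: "polarization Zn_Zm quad_form_pair x y = polarization Zn_Zm quad_form_pair y x"
  by (cases x, cases y) (simp add: polarization_Zn_Zm pairing_commute)

lemma polarization_Zn_Zm_add: "polarization Zn_Zm quad_form_pair (x \<otimes>\<^bsub>Zn_Zm\<^esub> y) z = polarization Zn_Zm quad_form_pair x z * polarization Zn_Zm quad_form_pair y z"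
  by (cases x, cases y, cases z)
     (simp add: mult_Zn_Zm polarization_Zn_Zm pairing_mod_left n_pos m_pos pairing_add_left)

lemma polarization_Zn_Zm_kernel:
  assumes x: "x \<in> carrier Zn_Zm" and ker: "\<And>y. y \<in> carrier Zn_Zm \<Longrightarrow> polarization Zn_Zm quad_form_pair x y = 1"
  shows "x = \<one>\<^bsub>Zn_Zm\<^esub>"
proof -
  obtain a b where ab: "x = (a, b)" "0 \<le> a" "a < int n" "0 \<le> b" "b < int m"
    using x by (auto simp: carrier_Zn_Zm)
  have mod: "pairing N y (1 mod int N) = pairing N y 1" if "N > 0" for N y
    using pairing_mod_left[OF that, of 1 y] by (simp add: pairing_commute)
  \<comment> \<open>The two generators suffice as test elements; \<open>1 mod int n\<close> instead
    of 1 also covers n = 1, where the carrier is {0}.\<close>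
  have "(1 mod int n, 0) \<in> carrier Zn_Zm" "(0, 1 mod int m) \<in> carrier Zn_Zm"
    using n_pos m_pos by (auto simp: carrier_Zn_Zm)
  from this[THEN ker] have "pairing n a 1 = 1" "pairing m b 1 = 1"
    unfolding ab(1) polarization_Zn_Zm by (simp_all add: mod n_pos m_pos pairing_commute[of _ _ 0])
  then show ?thesis using pairing_1_eq_1 ab by (simp add: one_Zn_Zm)
qed

lemma metric_group_Zn_Zm: "metric_group Zn_Zm quad_form_pair"
proof (rule metric_group.intro[OF comm_group_Zn_Zm], rule metric_group_axioms.intro)
  show "finite (carrier Zn_Zm)" by (simp add: carrier_Zn_Zm)
  show "quad_form_pair x \<noteq> 0" for x by (cases x) (simp add: quad_form_pair_def)
  show "quad_form_pair (inv\<^bsub>Zn_Zm\<^esub> x) = quad_form_pair x" if "x \<in> carrier Zn_Zm" for x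
    using that by (cases x) (simp add: inv_Zn_Zm quad_form_pair_def quad_form_mod quad_form_minus)
  show "bicharacter Zn_Zm (polarization Zn_Zm quad_form_pair)"
    unfolding bicharacter_def
  proof (intro conjI ballI)
    show "polarization Zn_Zm quad_form_pair x y \<noteq> 0" for x y by (cases x, cases y) (simp add: polarization_Zn_Zm)
    show "polarization Zn_Zm quad_form_pair (x \<otimes>\<^bsub>Zn_Zm\<^esub> y) z = polarization Zn_Zm quad_form_pair x z * polarization Zn_Zm quad_form_pair y z" for x y z
      by (rule polarization_Zn_Zm_add)
    show "polarization Zn_Zm quad_form_pair x (y \<otimes>\<^bsub>Zn_Zm\<^esub> z) = polarization Zn_Zm quad_form_pair x y * polarization Zn_Zm quad_form_pair x z" for x y z
      unfolding polarization_Zn_Zm_commute[of x] by (rule polarization_Zn_Zm_add)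
  qed
  show "nondegenerate Zn_Zm (polarization Zn_Zm quad_form_pair)"
    unfolding nondegenerate_def
  proof (intro conjI ballI impI)
    fix x assume x: "x \<in> carrier Zn_Zm"
    show "x = \<one>\<^bsub>Zn_Zm\<^esub>" if "\<forall>y\<in>carrier Zn_Zm. polarization Zn_Zm quad_form_pair x y = 1"
      by (rule polarization_Zn_Zm_kernel[OF x]) (use that in blast)
    show "x = \<one>\<^bsub>Zn_Zm\<^esub>" if "\<forall>y\<in>carrier Zn_Zm. polarization Zn_Zm quad_form_pair y x = 1"
      by (rule polarization_Zn_Zm_kernel[OF x]) (use that polarization_Zn_Zm_commute[of x] in simp)
  qed
qed

text \<open>Negates the summation variable, as the residue sum runs over the inverses of the
  elements in the defining equation.\<close>

lemma sum_Zn_Zm_inv: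
  fixes f :: "int \<Rightarrow> int \<Rightarrow> complex"
  assumes f: "\<And>x x' y y'. x mod int n = x' mod int n \<Longrightarrow> y mod int m = y' mod int m \<Longrightarrow> f x y = f x' y'"
  shows "(\<Sum>(x, y)\<in>carrier Zn_Zm. f x y) = (\<Sum>a<n. \<Sum>b<m. f (- int a) (- int b))"
proof -
  have neg: "- (- u mod int N) mod int N = u" if "0 \<le> u" "u < int N" for u N
    using that by (simp add: mod_minus_eq)
  have "(\<Sum>(x, y)\<in>carrier Zn_Zm. f x y) = (\<Sum>(a, b)\<in>{..<n} \<times> {..<m}. f (- int a) (- int b))"
  proof (rule sum.reindex_bij_witness[where
        i = "\<lambda>(a, b). (- int a mod int n, - int b mod int m)" and
        j = "\<lambda>(x, y). (nat (- x mod int n), nat (- y mod int m))"])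
    fix z assume "z \<in> carrier Zn_Zm"
    then obtain x y where z: "z = (x, y)" "0 \<le> x" "x < int n" "0 \<le> y" "y < int m" by (auto simp: carrier_Zn_Zm)
    show "(case case z of (x, y) \<Rightarrow> (nat (- x mod int n), nat (- y mod int m)) of
        (a, b) \<Rightarrow> (- int a mod int n, - int b mod int m)) = z"
      using z n_pos m_pos by (simp add: neg)
    show "(case z of (x, y) \<Rightarrow> (nat (- x mod int n), nat (- y mod int m))) \<in> {..<n} \<times> {..<m}"
      using z n_pos m_pos by (simp add: nat_less_iff)
    show "(case case z of (x, y) \<Rightarrow> (nat (- x mod int n), nat (- y mod int m)) of (a, b) \<Rightarrow> f (- int a) (- int b)) =
        (case z of (x, y) \<Rightarrow> f x y)"
      unfolding z(1) using n_pos m_pos by (auto intro!: f simp: mod_minus_eq)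
  next
    fix c assume "c \<in> {..<n} \<times> {..<m}"
    then obtain a b where c: "c = (a, b)" "a < n" "b < m" by auto
    show "(case case c of (a, b) \<Rightarrow> (- int a mod int n, - int b mod int m) of
        (x, y) \<Rightarrow> (nat (- x mod int n), nat (- y mod int m))) = c"
      using c by (simp add: neg)
    show "(case c of (a, b) \<Rightarrow> (- int a mod int n, - int b mod int m)) \<in> carrier Zn_Zm"
      using c n_pos m_pos by (simp add: carrier_Zn_Zm)
  qed
  then show ?thesis by (simp add: sum.cartesian_product)
qed

lemma finite_quantum_dilogarithm_Zn_Zm: "finite_quantum_dilogarithm Zn_Zm quad_form_pair dilog_pair"
  unfolding finite_quantum_dilogarithm_def
proof (intro conjI exI[of _ "- (mu * of_real (sqrt j))"] ballI)
  show "- (mu * of_real (sqrt j)) \<noteq> 0" using mu_nonzero j_pos by simp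
  show "Coset.order Zn_Zm \<le> 4 \<longrightarrow> (dilog_pair \<one>\<^bsub>Zn_Zm\<^esub>)\<^sup>2 = complex_of_real (sqrt (real (Coset.order Zn_Zm))) * dilog_pair \<one>\<^bsub>Zn_Zm\<^esub> + 1"
    unfolding order_Zn_Zm one_Zn_Zm dilog_pair_def using dilog_0_quadratic by simp
  fix u v assume uv: "u \<in> carrier Zn_Zm" "v \<in> carrier Zn_Zm"
  obtain x x' where u: "u = (x, x')" by (cases u)
  obtain y y' where v: "v = (y, y')" by (cases v)
  define f where "f c d = dilog (y - c) (y' - d) * dilog c d * quad_form c d * dilog (x - c) (x' - d)" for c d
  have f_cong: "f c d = f c' d'" if "c mod int n = c' mod int n" "d mod int m = d' mod int m" for c c' d d'
  proof -
    have "dilog (z - c) (z' - d) = dilog (z - c') (z' - d')" for z z'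
      using that by (intro dilog_cong mod_diff_cong) auto
    moreover have "dilog c d = dilog c' d'" using that by (intro dilog_cong)
    moreover have "quad_form c d = quad_form c' d'" using that quad_form_mod by metis
    ultimately show ?thesis by (simp add: f_def)
  qed
  have dilog_pair_diff: "dilog_pair ((z, z') \<otimes>\<^bsub>Zn_Zm\<^esub> inv\<^bsub>Zn_Zm\<^esub> (c, d)) = dilog (z - c) (z' - d)" if "(c, d) \<in> carrier Zn_Zm" for z z' c d
    unfolding inv_Zn_Zm[OF that] mult_Zn_Zm dilog_pair_def by (auto intro!: dilog_cong simp: mod_add_right_eq)
  have "(\<Sum>z\<in>carrier Zn_Zm. dilog_pair (v \<otimes>\<^bsub>Zn_Zm\<^esub> inv\<^bsub>Zn_Zm\<^esub> z) * dilog_pair z * quad_form_pair z * dilog_pair (u \<otimes>\<^bsub>Zn_Zm\<^esub> inv\<^bsub>Zn_Zm\<^esub> z)) = (\<Sum>(c, d)\<in>carrier Zn_Zm. f c d)"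
  proof (rule sum.cong[OF refl])
    fix z assume z: "z \<in> carrier Zn_Zm"
    obtain c d where cd: "z = (c, d)" by (cases z)
    show "dilog_pair (v \<otimes>\<^bsub>Zn_Zm\<^esub> inv\<^bsub>Zn_Zm\<^esub> z) * dilog_pair z * quad_form_pair z * dilog_pair (u \<otimes>\<^bsub>Zn_Zm\<^esub> inv\<^bsub>Zn_Zm\<^esub> z) = (case z of (c, d) \<Rightarrow> f c d)"
      using z unfolding cd u v by (simp add: dilog_pair_diff f_def) (simp add: dilog_pair_def quad_form_pair_def)
  qed
  also have "\<dots> = (\<Sum>a<n. \<Sum>b<m. f (- int a) (- int b))" using f_cong by (rule sum_Zn_Zm_inv)
  also have "\<dots> = (\<Sum>a<n. \<Sum>b<m. dilog (y + int a) (y' + int b) * dilog (- int a) (- int b) * quad_form (int a) (int b) * dilog (x + int a) (x' + int b))"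
    unfolding f_def quad_form_minus by simp
  finally have sum: "(\<Sum>z\<in>carrier Zn_Zm. dilog_pair (v \<otimes>\<^bsub>Zn_Zm\<^esub> inv\<^bsub>Zn_Zm\<^esub> z) * dilog_pair z * quad_form_pair z * dilog_pair (u \<otimes>\<^bsub>Zn_Zm\<^esub> inv\<^bsub>Zn_Zm\<^esub> z)) =
    (\<Sum>a<n. \<Sum>b<m. dilog (y + int a) (y' + int b) * dilog (- int a) (- int b) * quad_form (int a) (int b) * dilog (x + int a) (x' + int b))" .
  show "polarization Zn_Zm quad_form_pair u v * dilog_pair u * dilog_pair v = - (mu * of_real (sqrt j)) + 1 / complex_of_real (sqrt (real (Coset.order Zn_Zm))) *
      (\<Sum>z\<in>carrier Zn_Zm. dilog_pair (v \<otimes>\<^bsub>Zn_Zm\<^esub> inv\<^bsub>Zn_Zm\<^esub> z) * dilog_pair z * quad_form_pair z * dilog_pair (u \<otimes>\<^bsub>Zn_Zm\<^esub> inv\<^bsub>Zn_Zm\<^esub> z))"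
    unfolding sum order_Zn_Zm dilog_convolution[symmetric] unfolding u v polarization_Zn_Zm dilog_pair_def by simp
qed

end

theorem corollary3:
  fixes n m :: nat
  assumes "n \<ge> 1" and "m \<ge> 1"
  defines "G \<equiv> integer_mod_group n \<times>\<times> integer_mod_group m"
  shows "\<exists>q. metric_group G q \<and> (\<exists>E. finite_quantum_dilogarithm G q E)"
proof -
  interpret quadratic_unit n m using assms by unfold_locales auto
  have "G = Zn_Zm" by (simp add: G_def Zn_Zm_def)
  then show ?thesis using metric_group_Zn_Zm finite_quantum_dilogarithm_Zn_Zm by blast
qed

end
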